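(* The set $\mathcal S$ of minimal connected symplectic plumbing trees equals $\mathcal G\cup\mathcal W\cup\mathcal N\cup\mathcal M\cup\mathcal A\cup\mathcal B\cup\mathcal C$.
   Context: A plumbing tree is a finite tree $\Gamma$ each of whose vertices $v$ carries an integer decoration $d(v)$; $|\Gamma|$ denotes its number of vertices, a leaf is a vertex of valency one. $\Gamma$ is minimal if no vertex has decoration $-1$. For $n\ge 1$ let $(\mathbb Z^n,Q_n)$ be the lattice with basis $E_1,\dots,E_n$ and $Q_n(E_i,E_j)=-\delta_{ij}$, and let $K=\sum_{i=1}^n E_i$. A plumbing tree $\Gamma$ on $n$ vertices is a symplectic plumbing tree if there is a map $\varphi$ (an embedding) from its vertex set to $\mathbb Z^n$ such that: for distinct vertices $v_1,v_2$, $Q_n(\varphi(v_1),\varphi(v_2))$ is $1$ if they are adjacent and $0$ otherwise; $Q_n(\varphi(v),\varphi(v))=d(v)$ for every $v$; and $Q_n(\varphi(v),K)+Q_n(\varphi(v),\varphi(v))=-2$ for every $v$. $\mathcal S$ is the set of minimal, connected symplectic plumbing trees. Families. (G) For coprime integers $p>q>0$ write $p^2/(pq-1)=a_1-\cfrac{1}{a_2-\cfrac{1}{\ddots-\cfrac{1}{a_k}}}$ with all $a_i\ge 2$ integers; $\Gamma_{p/q}$ is the linear chain with decorations $-a_1,\dots,-a_k$ in order, and $\mathcal G$ is the set of all $\Gamma_{p/q}$. (W) For $p,q,r\ge 0$, $\Gamma_{p,q,r}$ is the tree with a central vertex of decoration $-4$ and three legs (chains starting at a vertex adjacent to the center): $q$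 vertices of decoration $-2$ followed by an end vertex $-(p+3)$; $r$ vertices $-2$ followed by an end vertex $-(q+3)$; $p$ vertices $-2$ followed by an end vertex $-(r+3)$. $\mathcal W=\{\Gamma_{p,q,r}:p,q,r\ge0\}$. (N) For $p\ge1$, $q,r\ge 0$, $\Delta_{p,q,r}$ has a central vertex $-3$ with three legs: a single vertex $-(p+2)$; $r$ vertices $-2$ followed by an end vertex $-(q+4)$; and (from the center) $q$ vertices $-2$, one vertex $-3$, $p-1$ vertices $-2$, and an end vertex $-(r+3)$. For $q,r\ge0$, $\Delta_{0,q,r}$ has a central vertex $-3$ with legs: a single vertex $-2$; $q$ vertices $-2$ followed by an end vertex $-(r+4)$; $r$ vertices $-2$ followed by an end vertex $-(q+4)$. $\mathcal N=\{\Delta_{p,q,r}:p,q,r\ge 0\}$. (M) For $p,r\ge1$, $q\ge0$, $\Lambda_{p,q,r}$ has a central vertex $-2$ with legs: a single vertex $-(p+2)$; a single vertex $-(r+3)$; and (from the center) $q$ vertices $-2$, one vertex $-3$, $r-1$ vertices $-2$, one vertex $-3$, $p-1$ vertices $-2$, and an end vertex $-(q+4)$. For $q\ge0,r\ge1$, $\Lambda_{0,q,r}$ has a central vertex $-2$ with legs: a single vertex $-2$; a single vertex $-(r+3)$; and $q$ vertices $-2$, one vertex $-3$, $r-1$ vertices $-2$, an end vertex $-(q+5)$. For $p\ge1,q\ge0$, $\Lambda_{p,q,0}$ has a central vertex $-2$ with legs: a single vertex $-(p+2)$; a single vertex $-3$; and $q$ vertices $-2$, one vertex $-4$, $p-1$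 vertices $-2$, an end vertex $-(q+4)$. $\mathcal M=\{\Lambda_{p,q,r}: p,q,r\ge0,\ (p,r)\neq(0,0)\}$. (A,B,C) If $u$ is a vertex of decoration $-1$, blowing up $u$ means adding a new vertex of decoration $-1$ adjacent only to $u$ and decreasing $d(u)$ by $1$; blowing up an edge $uw$ means deleting that edge, adding a new vertex of decoration $-1$ adjacent exactly to $u$ and $w$, and decreasing $d(u)$ and $d(w)$ by $1$. Let $T_a,T_b,T_c$ be the trees with a central vertex of decoration $-1$ and three leaves of decorations $(-3,-3,-3)$, $(-4,-4,-2)$, $(-2,-6,-3)$ respectively. $\mathcal A$ is the set of trees obtained from $T_a$ by a finite (possibly empty) sequence of blow-ups, each of which blows up the current unique $(-1)$-vertex or an edge emanating from it, followed by changing the decoration of the unique $(-1)$-vertex to $-4$; $\mathcal B$ and $\mathcal C$ are defined in the same way starting from $T_b$, resp. $T_c$, with final decoration $-3$, resp. $-2$. *)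

theory Defs
  imports Complex_Main
begin

text \<open>A decorated graph on the vertex set {0..<nv}. Adjacency and decorations
  outside this range are irrelevant (isomorphism only looks inside the range).\<close>
record ptree =
  nv  :: nat
  adj :: "nat \<Rightarrow> nat \<Rightarrow> bool"
  dec :: "nat \<Rightarrow> int"

definition is_tree :: "ptree \<Rightarrow> bool" where
  "is_tree T \<longleftrightarrow>
     nv T \<ge> 1 \<and>
     (\<forall>i j. adj T i j \<longrightarrow> i < nv T \<and> j < nv T) \<and>
     (\<forall>i j. adj T i j \<longleftrightarrow> adj T j i) \<and>
     (\<forall>i. \<not> adj T i i) \<and>
     (\<forall>i<nv T. (0, i) \<in> {(a, b). adj T a b}\<^sup>*) \<and>
     card {(i, j). i < j \<and> j < nv T \<and> adj T i j} = nv T - 1"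

text \<open>Isomorphism of decorated graphs.\<close>
definition ptree_iso :: "ptree \<Rightarrow> ptree \<Rightarrow> bool" where
  "ptree_iso T1 T2 \<longleftrightarrow> nv T1 = nv T2 \<and>
     (\<exists>f. bij_betw f {..<nv T1} {..<nv T2} \<and>
          (\<forall>i<nv T1. \<forall>j<nv T1. adj T2 (f i) (f j) = adj T1 i j) \<and>
          (\<forall>i<nv T1. dec T2 (f i) = dec T1 i))"

text \<open>The lattice (Z^n, Q_n), vectors represented as functions on {0..<n}.\<close>
definition Qn :: "nat \<Rightarrow> (nat \<Rightarrow> int) \<Rightarrow> (nat \<Rightarrow> int) \<Rightarrow> int" where
  "Qn n x y = - (\<Sum>k<n. x k * y k)"

definition Kn :: "nat \<Rightarrow> int" where
  "Kn = (\<lambda>_. 1)"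

definition symplectic_embedding :: "ptree \<Rightarrow> (nat \<Rightarrow> nat \<Rightarrow> int) \<Rightarrow> bool" where
  "symplectic_embedding T \<phi> \<longleftrightarrow>
     (\<forall>u<nv T. \<forall>v<nv T. u \<noteq> v \<longrightarrow>
         Qn (nv T) (\<phi> u) (\<phi> v) = (if adj T u v then 1 else 0)) \<and>
     (\<forall>v<nv T. Qn (nv T) (\<phi> v) (\<phi> v) = dec T v) \<and>
     (\<forall>v<nv T. Qn (nv T) (\<phi> v) Kn + Qn (nv T) (\<phi> v) (\<phi> v) = -2)"

definition symplectic_tree :: "ptree \<Rightarrow> bool" where
  "symplectic_tree T \<longleftrightarrow> is_tree T \<and> (\<exists>\<phi>. symplectic_embedding T \<phi>)"

definition minimal :: "ptree \<Rightarrow> bool" where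
  "minimal T \<longleftrightarrow> (\<forall>v<nv T. dec T v \<noteq> -1)"

text \<open>The set S (trees are connected by definition).\<close>
definition S_set :: "ptree set" where
  "S_set = {T. symplectic_tree T \<and> minimal T}"

section \<open>Constructions of concrete trees\<close>

definition mk_tree :: "int list \<Rightarrow> (nat \<times> nat) list \<Rightarrow> ptree" where
  "mk_tree ds es = \<lparr> nv = length ds,
                     adj = (\<lambda>i j. (i, j) \<in> set es \<or> (j, i) \<in> set es),
                     dec = (\<lambda>i. ds ! i) \<rparr>"

text \<open>Linear chain with decorations ds in order.\<close>
definition chain :: "int list \<Rightarrow> ptree" where
  "chain ds = mk_tree ds (map (\<lambda>i. (i, Suc i)) [0..<length ds - 1])"

text \<open>Edges of a leg of length m whose first vertex is s, attached to the centre 0.\<close>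
definition leg_edges :: "nat \<Rightarrow> nat \<Rightarrow> (nat \<times> nat) list" where
  "leg_edges s m = (if m = 0 then [] else (0, s) # map (\<lambda>i. (s + i, s + i + 1)) [0..<m - 1])"

text \<open>Star-shaped tree: centre (vertex 0) with decoration c and three legs A, B, C,
  each listed starting from the vertex adjacent to the centre.\<close>
definition star3 :: "int \<Rightarrow> int list \<Rightarrow> int list \<Rightarrow> int list \<Rightarrow> ptree" where
  "star3 c A B C = mk_tree (c # A @ B @ C)
     (leg_edges 1 (length A) @ leg_edges (1 + length A) (length B)
      @ leg_edges (1 + length A + length B) (length C))"

section \<open>Family G\<close>

text \<open>Value of the Hirzebruch--Jung continued fraction a1 - 1/(a2 - 1/(... - 1/ak)).\<close>
fun hj :: "int list \<Rightarrow> rat" where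
  "hj [] = 0"
| "hj [a] = of_int a"
| "hj (a # b # rest) = of_int a - 1 / hj (b # rest)"

definition G_set :: "ptree set" where
  "G_set = {chain (map uminus as) | p q as. (p::int) > q \<and> q > 0 \<and> coprime p q \<and>
              as \<noteq> [] \<and> (\<forall>a\<in>set as. a \<ge> 2) \<and>
              hj as = of_int (p^2) / of_int (p * q - 1)}"

section \<open>Family W\<close>

definition Gamma :: "nat \<Rightarrow> nat \<Rightarrow> nat \<Rightarrow> ptree" where
  "Gamma p q r = star3 (-4)
     (replicate q (-2) @ [- (int p + 3)])
     (replicate r (-2) @ [- (int q + 3)])
     (replicate p (-2) @ [- (int r + 3)])"

definition W_set :: "ptree set" where
  "W_set = {Gamma p q r | p q r. True}"

section \<open>Family N\<close>

definition Delta :: "nat \<Rightarrow> nat \<Rightarrow> nat \<Rightarrow> ptree" where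
  "Delta p q r = (if p \<ge> 1 then
      star3 (-3) [- (int p + 2)]
        (replicate r (-2) @ [- (int q + 4)])
        (replicate q (-2) @ [-3] @ replicate (p - 1) (-2) @ [- (int r + 3)])
    else
      star3 (-3) [-2]
        (replicate q (-2) @ [- (int r + 4)])
        (replicate r (-2) @ [- (int q + 4)]))"

definition N_set :: "ptree set" where
  "N_set = {Delta p q r | p q r. True}"

section \<open>Family M\<close>

definition Lambda :: "nat \<Rightarrow> nat \<Rightarrow> nat \<Rightarrow> ptree" where
  "Lambda p q r = (if p \<ge> 1 \<and> r \<ge> 1 then
      star3 (-2) [- (int p + 2)] [- (int r + 3)]
        (replicate q (-2) @ [-3] @ replicate (r - 1) (-2) @ [-3] @ replicate (p - 1) (-2)
         @ [- (int q + 4)])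
    else if p = 0 then
      star3 (-2) [-2] [- (int r + 3)]
        (replicate q (-2) @ [-3] @ replicate (r - 1) (-2) @ [- (int q + 5)])
    else
      star3 (-2) [- (int p + 2)] [-3]
        (replicate q (-2) @ [-4] @ replicate (p - 1) (-2) @ [- (int q + 4)]))"

definition M_set :: "ptree set" where
  "M_set = {Lambda p q r | p q r. (p, r) \<noteq> (0, 0)}"

section \<open>Families A, B, C via blow-ups\<close>

text \<open>Blow up the vertex u: new vertex (index nv T) of decoration -1 adjacent only to u.\<close>
definition blowup_vertex :: "ptree \<Rightarrow> nat \<Rightarrow> ptree" where
  "blowup_vertex T u = \<lparr> nv = Suc (nv T),
      adj = (\<lambda>i j. adj T i j \<or> (i = u \<and> j = nv T) \<or> (i = nv T \<and> j = u)),
      dec = (dec T)(u := dec T u - 1, nv T := -1) \<rparr>"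

text \<open>Blow up the edge uw: delete it, add new vertex (index nv T) of decoration -1
  adjacent exactly to u and w.\<close>
definition blowup_edge :: "ptree \<Rightarrow> nat \<Rightarrow> nat \<Rightarrow> ptree" where
  "blowup_edge T u w = \<lparr> nv = Suc (nv T),
      adj = (\<lambda>i j. (adj T i j \<and> \<not> ((i = u \<and> j = w) \<or> (i = w \<and> j = u)))
                 \<or> (i = u \<and> j = nv T) \<or> (i = nv T \<and> j = u)
                 \<or> (i = w \<and> j = nv T) \<or> (i = nv T \<and> j = w)),
      dec = (dec T)(u := dec T u - 1, w := dec T w - 1, nv T := -1) \<rparr>"

text \<open>Pairs (tree, its unique (-1)-vertex) reachable from (T0, u0) by blow-ups of the
  current (-1)-vertex or an edge emanating from it.\<close>
inductive blowup_reach :: "ptree \<Rightarrow> nat \<Rightarrow> ptree \<Rightarrow> nat \<Rightarrow> bool"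
  for T0 :: ptree and u0 :: nat where
  refl: "blowup_reach T0 u0 T0 u0"
| vert: "blowup_reach T0 u0 T u \<Longrightarrow> blowup_reach T0 u0 (blowup_vertex T u) (nv T)"
| edge: "blowup_reach T0 u0 T u \<Longrightarrow> w < nv T \<Longrightarrow> adj T u w \<Longrightarrow>
         blowup_reach T0 u0 (blowup_edge T u w) (nv T)"

definition set_dec :: "ptree \<Rightarrow> nat \<Rightarrow> int \<Rightarrow> ptree" where
  "set_dec T u c = T\<lparr> dec := (dec T)(u := c) \<rparr>"

definition T_a :: ptree where "T_a = star3 (-1) [-3] [-3] [-3]"
definition T_b :: ptree where "T_b = star3 (-1) [-4] [-4] [-2]"
definition T_c :: ptree where "T_c = star3 (-1) [-2] [-6] [-3]"

definition A_set :: "ptree set" where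
  "A_set = {set_dec T u (-4) | T u. blowup_reach T_a 0 T u}"
definition B_set :: "ptree set" where
  "B_set = {set_dec T u (-3) | T u. blowup_reach T_b 0 T u}"
definition C_set :: "ptree set" where
  "C_set = {set_dec T u (-2) | T u. blowup_reach T_c 0 T u}"

end

(* By adjunction every embedded vertex has one entry 1 or -2 and otherwise entries 0 and -1.
   The tree condition turns the sum of all vertices into a vector satisfying the same equation, so
   all columns but one sum to 0 or -1 and the exceptional one sums to 1 or -2. A Perron-type
   argument (more vectors than dimensions, nonpositive off-diagonal products, connectedness)
   excludes all other configurations. If some column has no entry 1, it either sums to -2 and
   peeling off one end vertex after the other exhibits a chain of the family G, or some vertex
   E_c - E_g meets exactly the vertices with entry -1 in column c. Such a hub E_c + f is made into
   a (-1)-vertex E_c by dropping f, and blowing down leads to T_a, T_b or T_c. If every column has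
   an entry 1, rows and columns correspond bijectively; a vertex of norm 2 can be merged into its
   partner unless the configuration is one of a few small ones, and undoing the merges only leads
   to hubs and to the members of W, N and M. Conversely, blow-ups and unmergings carry embeddings
   along, which embeds every member of the families. *)

theory Submission imports Defs begin

section \<open>Linear dependence in the lattice\<close>

text \<open>The Perron-type argument needs a linear relation, and there are two sources for one:
  deleting a column leaves more vectors than dimensions, and after deleting a hub together with its
  column all remaining vectors are orthogonal to the nonzero f. Nonpositive off-diagonal products
  give the relation full support and, up to sign, positive coefficients; summed over the columns it
  forces all row sums to vanish as soon as none is positive. That leaves so little freedom that the
  last blow-down is \<open>T_a\<close>, \<open>T_b\<close> or \<open>T_c\<close>. The final
  decorations -4, -3, -2 are minus (1 plus the number of nonzero entries of f). If every column has
  an entry 1, the obstacle is that undoing a merge next to a hub may destroy the hub. This happens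
  only when hub and neighbour lie in each other's column, and then the configuration already belongs
  to the structured families, which are stable under undoing merges up to new hubs. Configurations
  without a merge are few because a double count of the entries -1 ties the norms to the sizes of
  the columns.\<close>

definition ip :: "'b set \<Rightarrow> ('b \<Rightarrow> int) \<Rightarrow> ('b \<Rightarrow> int) \<Rightarrow> int" where
  "ip C x y = (\<Sum>k\<in>C. x k * y k)"

lemma ip_commute: "ip C x y = ip C y x"
  by (simp add: ip_def mult.commute)

text \<open>Gaussian elimination over the integers without division: with a pivot entry
  \<open>?c\<close> in column \<open>k\<close>, every other row \<open>v\<close> is replaced by
  \<open>?c\<close> times itself minus \<open>\<phi> v k\<close> times the pivot row. One column and
  one vector disappear.\<close>

lemma linear_dependence:
  fixes \<phi> :: "'a \<Rightarrow> 'b \<Rightarrow> int"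
  assumes "finite C" "finite V" "card C < card V"
  shows "\<exists>m. (\<exists>v\<in>V. m v \<noteq> 0) \<and> (\<forall>k\<in>C. (\<Sum>v\<in>V. m v * \<phi> v k) = 0)"
  using assms
proof (induction C arbitrary: V \<phi> rule: finite_induct)
  case empty
  then have "V \<noteq> {}" by auto
  then show ?case by (intro exI[of _ "\<lambda>_. 1"]) auto
next
  case (insert k C)
  show ?case
  proof (cases "\<forall>v\<in>V. \<phi> v k = 0")
    case True
    obtain m where "\<exists>v\<in>V. m v \<noteq> 0" "\<forall>j\<in>C. (\<Sum>v\<in>V. m v * \<phi> v j) = 0"
      using insert.IH[of V \<phi>] insert.prems insert.hyps by auto
    then show ?thesis using True by (intro exI[of _ m]) auto
  next
    case False
    then obtain v0 where v0: "v0 \<in> V" "\<phi> v0 k \<noteq> 0" by auto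
    let ?V = "V - {v0}" and ?c = "\<phi> v0 k"
    have "card C < card ?V" using insert v0 by simp
    then obtain m where m: "\<exists>v\<in>?V. m v \<noteq> 0"
      "\<forall>j\<in>C. (\<Sum>v\<in>?V. m v * (?c * \<phi> v j - \<phi> v k * \<phi> v0 j)) = 0"
      using insert.IH[of ?V "\<lambda>v j. ?c * \<phi> v j - \<phi> v k * \<phi> v0 j"] insert.prems by auto
    define S where "S = (\<Sum>v\<in>?V. m v * \<phi> v k)"
    \<comment> \<open>Undoes the elimination: the other coefficients get the factor
      \<open>?c\<close>, and the coefficient \<open>- S\<close> of the pivot row cancels column
      \<open>k\<close>.\<close>
    define m' where "m' v = (if v = v0 then - S else ?c * m v)" for v
    have sum: "(\<Sum>v\<in>V. m' v * \<phi> v j) = ?c * (\<Sum>v\<in>?V. m v * \<phi> v j) - S * \<phi> v0 j" for j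
    proof -
      have "(\<Sum>v\<in>V. m' v * \<phi> v j) = m' v0 * \<phi> v0 j + (\<Sum>v\<in>?V. m' v * \<phi> v j)"
        using insert.prems v0 by (simp add: sum.remove)
      also have "(\<Sum>v\<in>?V. m' v * \<phi> v j) = (\<Sum>v\<in>?V. ?c * (m v * \<phi> v j))"
        by (rule sum.cong) (auto simp: m'_def)
      finally show ?thesis by (simp add: m'_def sum_distrib_left)
    qed
    have "(\<Sum>v\<in>V. m' v * \<phi> v j) = 0" if "j \<in> C" for j
    proof -
      have "0 = (\<Sum>v\<in>?V. m v * (?c * \<phi> v j - \<phi> v k * \<phi> v0 j))" using m(2) that by simp
      also have "\<dots> = (\<Sum>v\<in>?V. ?c * (m v * \<phi> v j) - (m v * \<phi> v k) * \<phi> v0 j)"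
        by (rule sum.cong) (auto simp: algebra_simps)
      also have "\<dots> = ?c * (\<Sum>v\<in>?V. m v * \<phi> v j) - S * \<phi> v0 j"
        by (simp add: sum_subtractf sum_distrib_left[symmetric] sum_distrib_right[symmetric] S_def)
      finally show ?thesis using sum by simp
    qed
    moreover have "(\<Sum>v\<in>V. m' v * \<phi> v k) = 0" using sum[of k] by (simp add: S_def)
    moreover have "\<exists>v\<in>V. m' v \<noteq> 0" using m(1) v0 by (auto simp: m'_def)
    ultimately show ?thesis by (intro exI[of _ m']) auto
  qed
qed

text \<open>Connectedness by cuts. It is applied to adjacency as well as to the relation of having
  negative product, and in both uses the arguments ask for an edge that leaves a given set.\<close>

definition conn :: "'a set \<Rightarrow> ('a \<Rightarrow> 'a \<Rightarrow> bool) \<Rightarrow> bool" where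
  "conn V R \<longleftrightarrow> (\<forall>S. S \<subseteq> V \<longrightarrow> S \<noteq> {} \<longrightarrow> S \<noteq> V \<longrightarrow> (\<exists>u\<in>S. \<exists>v\<in>V - S. R u v))"

lemma connD: "conn V R \<Longrightarrow> S \<subseteq> V \<Longrightarrow> S \<noteq> {} \<Longrightarrow> S \<noteq> V \<Longrightarrow> \<exists>u\<in>S. \<exists>v\<in>V - S. R u v"
  by (auto simp: conn_def)

lemma conn_mono: "conn V R \<Longrightarrow> (\<And>u v. u \<in> V \<Longrightarrow> v \<in> V \<Longrightarrow> R u v \<Longrightarrow> R' u v) \<Longrightarrow> conn V R'"
  unfolding conn_def by (meson DiffD1 subsetD)

section \<open>Null combinations of vectors with nonpositive products\<close>

lemma ip_combination:
  assumes "finite V"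
  shows "(\<Sum>k\<in>C. (\<Sum>u\<in>V. a u * \<phi> u k) * (\<Sum>v\<in>V. b v * \<phi> v k))
       = (\<Sum>u\<in>V. \<Sum>v\<in>V. a u * b v * ip C (\<phi> u) (\<phi> v))"
proof -
  have "(\<Sum>k\<in>C. (\<Sum>u\<in>V. a u * \<phi> u k) * (\<Sum>v\<in>V. b v * \<phi> v k))
      = (\<Sum>k\<in>C. \<Sum>u\<in>V. \<Sum>v\<in>V. a u * b v * (\<phi> u k * \<phi> v k))"
    by (simp add: sum_product algebra_simps)
  also have "\<dots> = (\<Sum>u\<in>V. \<Sum>k\<in>C. \<Sum>v\<in>V. a u * b v * (\<phi> u k * \<phi> v k))" by (rule sum.swap)
  also have "\<dots> = (\<Sum>u\<in>V. \<Sum>v\<in>V. \<Sum>k\<in>C. a u * b v * (\<phi> u k * \<phi> v k))"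
    by (rule sum.cong[OF HOL.refl sum.swap])
  finally show ?thesis by (simp add: ip_def sum_distrib_left)
qed

text \<open>Passing from the coefficients to their absolute values can only lower the square of the
  combination, because off-diagonal products are nonpositive; a square equal to \<open>0\<close>
  stays \<open>0\<close>.\<close>

lemma null_abs:
  assumes "finite V" "finite C"
    and off: "\<And>u v. u \<in> V \<Longrightarrow> v \<in> V \<Longrightarrow> u \<noteq> v \<Longrightarrow> ip C (\<phi> u) (\<phi> v) \<le> 0"
    and null: "\<And>k. k \<in> C \<Longrightarrow> (\<Sum>v\<in>V. m v * \<phi> v k) = 0" and "k \<in> C"
  shows "(\<Sum>v\<in>V. \<bar>m v\<bar> * \<phi> v k) = 0"
proof -
  let ?F = "\<lambda>k. (\<Sum>v\<in>V. \<bar>m v\<bar> * \<phi> v k)"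
  have "(\<Sum>k\<in>C. ?F k * ?F k) = (\<Sum>u\<in>V. \<Sum>v\<in>V. \<bar>m u\<bar> * \<bar>m v\<bar> * ip C (\<phi> u) (\<phi> v))"
    by (rule ip_combination[OF assms(1)])
  also have "\<dots> \<le> (\<Sum>u\<in>V. \<Sum>v\<in>V. m u * m v * ip C (\<phi> u) (\<phi> v))"
  proof (intro sum_mono)
    fix u v assume uv: "u \<in> V" "v \<in> V"
    show "\<bar>m u\<bar> * \<bar>m v\<bar> * ip C (\<phi> u) (\<phi> v) \<le> m u * m v * ip C (\<phi> u) (\<phi> v)"
    proof (cases "u = v")
      case False
      have "m u * m v \<le> \<bar>m u\<bar> * \<bar>m v\<bar>" by (metis abs_ge_self abs_mult)
      then show ?thesis using off[OF uv False] by (simp add: mult_right_mono_neg)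
    qed (simp add: abs_mult_self_eq)
  qed
  also have "\<dots> = (\<Sum>k\<in>C. (\<Sum>v\<in>V. m v * \<phi> v k) * (\<Sum>v\<in>V. m v * \<phi> v k))"
    by (rule ip_combination[OF assms(1), symmetric])
  also have "\<dots> = 0" using null by simp
  finally have "(\<Sum>k\<in>C. ?F k * ?F k) \<le> 0" .
  then have "(\<Sum>k\<in>C. ?F k * ?F k) = 0" by (simp add: sum_nonneg order_antisym)
  then show ?thesis using assms(2,5) by (simp add: sum_nonneg_eq_0_iff)
qed

text \<open>Pair the relation with coefficients \<open>\<bar>m v\<bar>\<close> with
  \<open>\<phi> u\<close>. Since \<open>m u = 0\<close>, the diagonal term, the only one that could
  be positive, drops out; so every term is nonpositive and hence zero.\<close>

lemma null_closed:
  assumes "finite V" "finite C"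
    and off: "\<And>u v. u \<in> V \<Longrightarrow> v \<in> V \<Longrightarrow> u \<noteq> v \<Longrightarrow> ip C (\<phi> u) (\<phi> v) \<le> 0"
    and null: "\<And>k. k \<in> C \<Longrightarrow> (\<Sum>v\<in>V. m v * \<phi> v k) = 0"
    and u: "u \<in> V" "m u = 0" and v: "v \<in> V" "ip C (\<phi> u) (\<phi> v) < 0"
  shows "m v = 0"
proof -
  have "0 = (\<Sum>k\<in>C. \<phi> u k * (\<Sum>v\<in>V. \<bar>m v\<bar> * \<phi> v k))"
    using null_abs[OF assms(1,2) off null] by simp
  also have "\<dots> = (\<Sum>k\<in>C. \<Sum>v\<in>V. \<bar>m v\<bar> * (\<phi> u k * \<phi> v k))"
    by (simp add: sum_distrib_left algebra_simps)
  also have "\<dots> = (\<Sum>v\<in>V. \<bar>m v\<bar> * ip C (\<phi> u) (\<phi> v))"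
    by (subst sum.swap) (simp add: ip_def sum_distrib_left)
  finally have "(\<Sum>v\<in>V. - (\<bar>m v\<bar> * ip C (\<phi> u) (\<phi> v))) = 0" by (simp add: sum_negf)
  moreover have "\<forall>w\<in>V. 0 \<le> - (\<bar>m w\<bar> * ip C (\<phi> u) (\<phi> w))"
  proof
    fix w assume w: "w \<in> V"
    show "0 \<le> - (\<bar>m w\<bar> * ip C (\<phi> u) (\<phi> w))"
      using off[of u w] u w by (cases "w = u") (auto simp: mult_nonneg_nonpos)
  qed
  ultimately have "\<bar>m v\<bar> * ip C (\<phi> u) (\<phi> v) = 0"
    using v(1) assms(1) by (simp add: sum_nonneg_eq_0_iff)
  then show ?thesis using v(2) by auto
qed

text \<open>Irreducibility: by \<open>null_closed\<close> no edge leaves the zero set of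
  \<open>m\<close>, so this set is empty once \<open>m\<close> is not identically zero.\<close>

lemma null_full:
  assumes "finite V" "finite C"
    and off: "\<And>u v. u \<in> V \<Longrightarrow> v \<in> V \<Longrightarrow> u \<noteq> v \<Longrightarrow> ip C (\<phi> u) (\<phi> v) \<le> 0"
    and con: "conn V (\<lambda>u v. ip C (\<phi> u) (\<phi> v) < 0)"
    and null: "\<And>k. k \<in> C \<Longrightarrow> (\<Sum>v\<in>V. m v * \<phi> v k) = 0"
    and nz: "\<exists>v\<in>V. m v \<noteq> 0" and "v \<in> V"
  shows "m v \<noteq> 0"
proof
  assume "m v = 0"
  let ?S = "{v\<in>V. m v = 0}"
  have "?S \<noteq> {}" "?S \<noteq> V" using nz \<open>m v = 0\<close> \<open>v \<in> V\<close> by auto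
  then obtain a b where "a \<in> ?S" "b \<in> V - ?S" "ip C (\<phi> a) (\<phi> b) < 0"
    using connD[OF con, of ?S] by auto
  then show False using null_closed[OF assms(1,2) off null, of a b] by auto
qed

text \<open>Summed over the columns, the relation becomes a vanishing sum of nonpositive row sums
  with weights \<open>\<bar>m v\<bar>\<close>. Through adjunction a row sum is a norm in disguise,
  so this pins down norms.\<close>

lemma null_row_sums:
  assumes "finite V" "finite C"
    and off: "\<And>u v. u \<in> V \<Longrightarrow> v \<in> V \<Longrightarrow> u \<noteq> v \<Longrightarrow> ip C (\<phi> u) (\<phi> v) \<le> 0"
    and null: "\<And>k. k \<in> C \<Longrightarrow> (\<Sum>v\<in>V. m v * \<phi> v k) = 0"
    and le: "\<And>v. v \<in> V \<Longrightarrow> (\<Sum>k\<in>C. \<phi> v k) \<le> 0" and v: "v \<in> V" "m v \<noteq> 0"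
  shows "(\<Sum>k\<in>C. \<phi> v k) = 0"
proof -
  have "0 = (\<Sum>k\<in>C. \<Sum>v\<in>V. \<bar>m v\<bar> * \<phi> v k)" using null_abs[OF assms(1,2) off null] by simp
  also have "\<dots> = (\<Sum>v\<in>V. \<bar>m v\<bar> * (\<Sum>k\<in>C. \<phi> v k))"
    by (subst sum.swap) (simp add: sum_distrib_left)
  finally have "(\<Sum>v\<in>V. - (\<bar>m v\<bar> * (\<Sum>k\<in>C. \<phi> v k))) = 0" by (simp add: sum_negf)
  moreover have "\<forall>w\<in>V. 0 \<le> - (\<bar>m w\<bar> * (\<Sum>k\<in>C. \<phi> w k))"
    using le by (simp add: mult_nonneg_nonpos)
  ultimately have "\<bar>m v\<bar> * (\<Sum>k\<in>C. \<phi> v k) = 0" using v(1) assms(1) by (simp add: sum_nonneg_eq_0_iff)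
  then show ?thesis using v(2) by auto
qed

section \<open>Trees\<close>

text \<open>The number of edges is given as a degree sum, which needs no order on the vertices and
  is easy to follow when a vertex is contracted into a neighbour.\<close>

definition tree :: "'a set \<Rightarrow> ('a \<Rightarrow> 'a \<Rightarrow> bool) \<Rightarrow> bool" where
  "tree V E \<longleftrightarrow> finite V \<and> V \<noteq> {} \<and> (\<forall>u v. E u v \<longrightarrow> E v u) \<and> (\<forall>u. \<not> E u u) \<and> conn V E \<and>
     (\<Sum>u\<in>V. card {v\<in>V. E u v}) + 2 = 2 * card V"

text \<open>A connected set is exhausted by adding one vertex at a time along an edge that leaves
  the current subset; each such vertex raises the degree sum by at least \<open>2\<close>.\<close>

lemma conn_edges:
  assumes "finite V" "V \<noteq> {}" "conn V E" "\<forall>u v. E u v \<longrightarrow> E v u"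
  shows "2 * card V \<le> (\<Sum>u\<in>V. card {v\<in>V. E u v}) + 2"
proof -
  have "\<exists>S\<subseteq>V. card S = j \<and> 2 * card S \<le> (\<Sum>u\<in>S. card {v\<in>S. E u v}) + 2"
    if "1 \<le> j" "j \<le> card V" for j
    using that
  proof (induction j rule: dec_induct)
    case base
    obtain r where "r \<in> V" using assms by auto
    then show ?case by (intro exI[of _ "{r}"]) auto
  next
    case (step j)
    then obtain S where S: "S \<subseteq> V" "card S = j" "2 * card S \<le> (\<Sum>u\<in>S. card {v\<in>S. E u v}) + 2"
      by auto
    have fS: "finite S" using S(1) assms(1) finite_subset by auto
    have "S \<noteq> {}" "S \<noteq> V" using S step by auto
    then obtain a b where ab: "a \<in> S" "b \<in> V - S" "E a b" using connD[OF assms(3) S(1)] by auto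
    let ?T = "insert b S"
    have "(\<Sum>u\<in>?T. card {v\<in>?T. E u v}) = card {v\<in>?T. E b v} + (\<Sum>u\<in>S. card {v\<in>?T. E u v})"
      using fS ab by simp
    moreover have "card {v\<in>?T. E b v} \<ge> 1"
    proof -
      have "a \<in> {v\<in>?T. E b v}" using ab assms(4) by auto
      then have "card {v\<in>?T. E b v} > 0" using fS by (subst card_gt_0_iff) auto
      then show ?thesis by simp
    qed
    moreover have "(\<Sum>u\<in>S. card {v\<in>S. E u v}) < (\<Sum>u\<in>S. card {v\<in>?T. E u v})"
    proof (rule sum_strict_mono_ex1[OF fS])
      show "\<forall>u\<in>S. card {v\<in>S. E u v} \<le> card {v\<in>?T. E u v}" using fS by (auto intro!: card_mono)
      have "{v\<in>S. E a v} \<subset> {v\<in>?T. E a v}" using ab by auto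
      then show "\<exists>u\<in>S. card {v\<in>S. E u v} < card {v\<in>?T. E u v}"
        using fS ab(1) by (intro bexI[of _ a]) (auto intro!: psubset_card_mono)
    qed
    ultimately have "2 * card ?T \<le> (\<Sum>u\<in>?T. card {v\<in>?T. E u v}) + 2"
      using S ab fS by simp
    then show ?case using S ab fS by (intro exI[of _ ?T]) auto
  qed
  moreover have "1 \<le> card V" using assms by (simp add: Suc_leI card_gt_0_iff)
  ultimately obtain S where "S \<subseteq> V" "card S = card V" "2 * card S \<le> (\<Sum>u\<in>S. card {v\<in>S. E u v}) + 2"
    by blast
  then show ?thesis using card_subset_eq[OF assms(1)] by auto
qed

text \<open>Deleting the edge \<open>a b\<close> of a triangle leaves every cut crossed, since
  \<open>c\<close> lies on one side and is joined to the endpoint on the other. The remaining graph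
  has too few edges for \<open>conn_edges\<close>.\<close>

lemma tree_no_triangle:
  assumes t: "tree V E" and "a \<in> V" "b \<in> V" "c \<in> V" and e: "E a b" "E b c" shows "\<not> E a c"
proof
  assume ac: "E a c"
  let ?E = "\<lambda>u v. E u v \<and> \<not> (u = a \<and> v = b) \<and> \<not> (u = b \<and> v = a)"
  have fV: "finite V" and sym: "\<And>u v. E u v \<Longrightarrow> E v u" and irr: "\<And>u. \<not> E u u"
    using t by (auto simp: tree_def)
  have "conn V ?E"
    unfolding conn_def
  proof (intro allI impI)
    fix S assume S: "S \<subseteq> V" "S \<noteq> {}" "S \<noteq> V"
    then obtain u v where uv: "u \<in> S" "v \<in> V - S" "E u v"
      using t connD[of V E S] by (auto simp: tree_def)
    show "\<exists>u\<in>S. \<exists>v\<in>V - S. ?E u v"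
    proof (cases "?E u v")
      case False
      then have "(u = a \<and> v = b) \<or> (u = b \<and> v = a)" using uv by auto
      then show ?thesis
        using uv e ac sym[OF e(1)] sym[OF e(2)] sym[OF ac] irr assms(2-4)
        by (cases "c \<in> S") (elim disjE; fastforce)+
    qed (use uv in auto)
  qed
  then have "2 * card V \<le> (\<Sum>u\<in>V. card {v\<in>V. ?E u v}) + 2"
    using t sym by (intro conn_edges) (auto simp: tree_def)
  moreover have "(\<Sum>u\<in>V. card {v\<in>V. ?E u v}) < (\<Sum>u\<in>V. card {v\<in>V. E u v})"
  proof (rule sum_strict_mono_ex1[OF fV])
    show "\<forall>u\<in>V. card {v\<in>V. ?E u v} \<le> card {v\<in>V. E u v}" using fV by (auto intro!: card_mono)
    have "{v\<in>V. ?E a v} \<subset> {v\<in>V. E a v}" using e assms by auto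
    then show "\<exists>u\<in>V. card {v\<in>V. ?E u v} < card {v\<in>V. E u v}"
      using fV assms(2) by (intro bexI[of _ a]) (auto intro!: psubset_card_mono)
  qed
  ultimately show False using t by (simp add: tree_def)
qed

text \<open>Contraction of the edge \<open>u a\<close>: the other neighbours of \<open>u\<close> are
  handed to \<open>a\<close>. In the absence of triangles these are new neighbours of
  \<open>a\<close>, so exactly one edge is lost. If \<open>u\<close> is a leaf, this is
  deletion.\<close>

lemma tree_contract:
  assumes t: "tree V E" and ua: "u \<in> V" "a \<in> V" "E u a"
    and E': "\<And>z w. z \<in> V - {u} \<Longrightarrow> w \<in> V - {u} \<Longrightarrow>
       E' z w = (E z w \<or> (z = a \<and> E u w \<and> w \<noteq> a) \<or> (w = a \<and> E u z \<and> z \<noteq> a))"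
    and symE': "\<And>z w. E' z w \<Longrightarrow> E' w z" and irrE': "\<And>z. \<not> E' z z"
  shows "tree (V - {u}) E'"
proof -
  have fV: "finite V" and sym: "\<And>u v. E u v \<Longrightarrow> E v u" and irr: "\<And>u. \<not> E u u"
    and con: "conn V E" and cnt: "(\<Sum>u\<in>V. card {v\<in>V. E u v}) + 2 = 2 * card V"
    using t by (auto simp: tree_def)
  let ?V = "V - {u}"
  have au: "a \<noteq> u" using ua irr by auto
  have "conn ?V E'"
    unfolding conn_def
  proof (intro allI impI)
    fix S assume S: "S \<subseteq> ?V" "S \<noteq> {}" "S \<noteq> ?V"
    let ?S = "if a \<in> S then insert u S else S"
    have "?S \<subseteq> V" "?S \<noteq> {}" "?S \<noteq> V" using S ua au by (auto split: if_splits)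
    then obtain z w where zw: "z \<in> ?S" "w \<in> V - ?S" "E z w" using connD[OF con] by blast
    show "\<exists>z\<in>S. \<exists>w\<in>?V - S. E' z w"
    proof (cases "a \<in> S")
      case True
      then have w: "w \<in> ?V - S" using zw by auto
      show ?thesis
      proof (cases "z = u")
        case True
        then have "E' a w" using E'[of a w] w zw ua au \<open>a \<in> S\<close> by auto
        then show ?thesis using w \<open>a \<in> S\<close> by auto
      next
        case False
        then have "E' z w" using E'[of z w] w zw S True by auto
        then show ?thesis using w zw False True by auto
      qed
    next
      case False
      then have z: "z \<in> S" "z \<in> ?V" "z \<noteq> a" using zw S by auto
      show ?thesis
      proof (cases "w = u")
        case True
        then have "E' z a" using E'[of z a] z zw ua au sym by auto
        then show ?thesis using z ua au False by auto
      next
        case False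
        then have "E' z w" using E'[of z w] z zw \<open>a \<notin> S\<close> by auto
        then show ?thesis using z zw False \<open>a \<notin> S\<close> by auto
      qed
    qed
  qed
  moreover have "(\<Sum>z\<in>?V. card {w\<in>?V. E' z w}) + 2 = 2 * card ?V"
  proof -
    let ?B = "{b \<in> V. E u b} - {a}"
    have finB: "finite ?B" and B: "?B \<subseteq> ?V - {a}" using fV irr by auto
    have noadj: "\<not> E a b" "\<not> E b a" if "b \<in> ?B" for b
      using that tree_no_triangle[OF t, of a u b] ua sym by auto
    have ca: "card {w\<in>?V. E' a w} + 1 = card {w\<in>V. E a w} + card ?B"
    proof -
      have "{w\<in>?V. E' a w} = ({w\<in>V. E a w} - {u}) \<union> ?B"
        using E'[of a] ua au irr by auto
      moreover have "({w\<in>V. E a w} - {u}) \<inter> ?B = {}" using noadj by auto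
      moreover have "card ({w\<in>V. E a w} - {u}) + 1 = card {w\<in>V. E a w}"
        using fV ua sym card.remove[of "{w\<in>V. E a w}" u] by simp
      ultimately show ?thesis using fV finB by (simp add: card_Un_disjoint)
    qed
    have cz: "card {w\<in>?V. E' z w} = card {w\<in>V. E z w}" if "z \<in> ?V - {a}" for z
    proof (cases "z \<in> ?B")
      case True
      then have "{w\<in>?V. E' z w} = insert a ({w\<in>V. E z w} - {u})"
        using E'[of z] that ua au sym by auto
      moreover have "u \<in> {w\<in>V. E z w}" "a \<notin> {w\<in>V. E z w}" using True sym noadj ua by auto
      moreover have "card (insert a ({w\<in>V. E z w} - {u})) = Suc (card ({w\<in>V. E z w} - {u}))"
        using calculation fV by (intro card_insert_disjoint) auto
      ultimately show ?thesis using fV card_Suc_Diff1[of "{w\<in>V. E z w}" u] by simp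
    next
      case False
      then have "{w\<in>?V. E' z w} = {w\<in>V. E z w}" using E'[of z] that ua au sym by auto
      then show ?thesis by simp
    qed
    have "(\<Sum>z\<in>V. card {w\<in>V. E z w}) = card {w\<in>V. E u w} + (card {w\<in>V. E a w} + (\<Sum>z\<in>?V - {a}. card {w\<in>V. E z w}))"
      using fV ua au by (simp add: sum.remove[of V u "\<lambda>z. card {w\<in>V. E z w}"] sum.remove[of ?V a "\<lambda>z. card {w\<in>V. E z w}"])
    moreover have "(\<Sum>z\<in>?V. card {w\<in>?V. E' z w}) = card {w\<in>?V. E' a w} + (\<Sum>z\<in>?V - {a}. card {w\<in>V. E z w})"
      using sum.remove[of ?V a "\<lambda>z. card {w\<in>?V. E' z w}"] sum.cong[OF HOL.refl, of "?V - {a}", OF cz] fV ua au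
      by simp
    moreover have "card {w\<in>V. E u w} = card ?B + 1"
      using fV ua card.remove[of "{w\<in>V. E u w}" a] by simp
    moreover have "card V = card ?V + 1" using fV ua card.remove[of V u] by simp
    ultimately show ?thesis using ca cnt by linarith
  qed
  ultimately show ?thesis unfolding tree_def using fV ua au symE' irrE' by auto
qed

section \<open>Embeddings and their columns\<close>

lemma even_prod_nonneg: "(0::int) \<le> t * (t + 1)"
  by (cases "t \<ge> 0") (auto simp: mult_nonneg_nonneg mult_nonpos_nonpos)

text \<open>The product of consecutive integers is even and nonnegative; adjunction, with right-hand
  side \<open>2\<close>, leaves room for exactly one nonzero term.\<close>

lemma even_prod_ge: "(t::int) * (t + 1) \<noteq> 0 \<Longrightarrow> 2 \<le> t * (t + 1)"
  using even_prod_nonneg[of t] even_mult_iff[of t "t+1"] by (metis add.commute dvd_imp_le_int even_add even_plus_one_iff abs_of_nonneg order_less_le zdvd_imp_le)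

lemma row_lead:
  fixes x :: "'b \<Rightarrow> int"
  assumes "finite C" "(\<Sum>k\<in>C. x k * (x k + 1)) = 2"
  obtains i where "i \<in> C" "x i = 1 \<or> x i = -2" "\<And>k. k \<in> C \<Longrightarrow> k \<noteq> i \<Longrightarrow> x k = 0 \<or> x k = -1"
proof -
  have "\<exists>i\<in>C. x i * (x i + 1) \<noteq> 0"
    using assms(2) by (metis (no_types, lifting) sum.neutral zero_neq_numeral)
  then obtain i where i: "i \<in> C" "x i * (x i + 1) \<noteq> 0" by auto
  have split: "x i * (x i + 1) + (\<Sum>k\<in>C - {i}. x k * (x k + 1)) = 2"
    using assms i by (simp add: sum.remove)
  have nn: "0 \<le> (\<Sum>k\<in>C - {i}. x k * (x k + 1))" by (simp add: sum_nonneg even_prod_nonneg)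
  have two: "x i * (x i + 1) = 2" using even_prod_ge[OF i(2)] split nn by linarith
  have "(x i - 1) * (x i + 2) = 0" using two by (simp add: algebra_simps)
  then have "x i = 1 \<or> x i = -2" by auto
  moreover have "x k = 0 \<or> x k = -1" if "k \<in> C" "k \<noteq> i" for k
  proof -
    have "(\<Sum>k\<in>C - {i}. x k * (x k + 1)) = 0" using split two by simp
    then have "x k * (x k + 1) = 0"
      using that assms(1) even_prod_nonneg by (subst (asm) sum_nonneg_eq_0_iff) auto
    then show ?thesis by auto
  qed
  ultimately show thesis using that i(1) by blast
qed

lemma row_count:
  fixes x :: "'b \<Rightarrow> int"
  assumes "finite C" "i \<in> C" "\<And>k. k \<in> C \<Longrightarrow> k \<noteq> i \<Longrightarrow> x k = 0 \<or> x k = -1"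
  shows "(\<Sum>k\<in>C. x k) = x i - int (card {k\<in>C - {i}. x k = -1})"
    and "ip C x x = x i * x i + int (card {k\<in>C - {i}. x k = -1})"
proof -
  let ?J = "{k\<in>C - {i}. x k = -1}"
  have "(\<Sum>k\<in>C - {i}. x k) = (\<Sum>k\<in>?J. -1)"
    using assms by (intro sum.mono_neutral_cong_right) auto
  then show "(\<Sum>k\<in>C. x k) = x i - int (card ?J)" using assms by (simp add: sum.remove)
  have "(\<Sum>k\<in>C - {i}. x k * x k) = (\<Sum>k\<in>?J. 1)"
    using assms by (intro sum.mono_neutral_cong_right) auto
  then show "ip C x x = x i * x i + int (card ?J)" using assms by (simp add: ip_def sum.remove)
qed

text \<open>Here \<open>ip\<close> is the positive form \<open>- Q\<close>, and \<open>row\<close> is adjunction: it forces every vector to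
  have one entry \<open>1\<close> or \<open>-2\<close> and all other entries in \<open>{0, -1}\<close>.\<close>
locale emb =
  fixes V :: "nat set" and C :: "nat set" and E :: "nat \<Rightarrow> nat \<Rightarrow> bool" and \<phi> :: "nat \<Rightarrow> nat \<Rightarrow> int"
  assumes tree: "tree V E" and finC: "finite C" and cardC: "card C = card V"
    and pair: "\<And>u v. u \<in> V \<Longrightarrow> v \<in> V \<Longrightarrow> u \<noteq> v \<Longrightarrow> ip C (\<phi> u) (\<phi> v) = - of_bool (E u v)"
    and row: "\<And>v. v \<in> V \<Longrightarrow> (\<Sum>k\<in>C. \<phi> v k * (\<phi> v k + 1)) = 2"
    and norm_ne_1: "\<And>v. v \<in> V \<Longrightarrow> ip C (\<phi> v) (\<phi> v) \<noteq> 1"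
begin

lemma finV: "finite V" and V_ne: "V \<noteq> {}" and E_sym: "E u v \<Longrightarrow> E v u" and E_irr: "\<not> E u u"
  and connE: "conn V E"
  using tree by (auto simp: tree_def)

lemma lead:
  assumes "v \<in> V"
  obtains i where "i \<in> C" "\<phi> v i = 1 \<or> \<phi> v i = -2" "\<And>k. k \<in> C \<Longrightarrow> k \<noteq> i \<Longrightarrow> \<phi> v k = 0 \<or> \<phi> v k = -1"
  using row_lead[OF finC row[OF assms]] by blast

lemma entries: "v \<in> V \<Longrightarrow> k \<in> C \<Longrightarrow> \<phi> v k \<in> {1, 0, -1, -2}"
  by (metis insertCI lead)

lemma other_entries:
  assumes "v \<in> V" "i \<in> C" "\<phi> v i = 1 \<or> \<phi> v i = -2" "k \<in> C" "k \<noteq> i"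
  shows "\<phi> v k = 0 \<or> \<phi> v k = -1"
  using lead[OF assms(1)] assms(2-5) by (metis (full_types) zero_neq_one neg_0_equal_iff_equal
      neg_equal_iff_equal numeral_eq_one_iff semiring_norm(85) one_neq_neg_one neg_numeral_neq_numeral one_neq_neg_numeral zero_neq_neg_numeral)

lemma norm_sum: "v \<in> V \<Longrightarrow> ip C (\<phi> v) (\<phi> v) = 2 - (\<Sum>k\<in>C. \<phi> v k)"
  using row[of v] by (simp add: ip_def algebra_simps sum.distrib)

lemma norm_ge_2: assumes "v \<in> V" shows "2 \<le> ip C (\<phi> v) (\<phi> v)"
proof -
  obtain i where i: "i \<in> C" "\<phi> v i = 1 \<or> \<phi> v i = -2" "\<And>k. k \<in> C \<Longrightarrow> k \<noteq> i \<Longrightarrow> \<phi> v k = 0 \<or> \<phi> v k = -1"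
    using lead[OF assms] by blast
  show ?thesis using row_count(2)[OF finC i(1,3)] i(2) norm_ne_1[OF assms] by auto
qed

lemma sum_le_0: "v \<in> V \<Longrightarrow> (\<Sum>k\<in>C. \<phi> v k) \<le> 0"
  using norm_ge_2 norm_sum by fastforce

text \<open>Norm \<open>2\<close> excludes a leading entry \<open>-2\<close>, which alone
  contributes \<open>4\<close>, and leaves one entry \<open>-1\<close> next to the leading
  \<open>1\<close>: the vector is \<open>E_c - E_g\<close>.\<close>

lemma norm_2:
  assumes v: "v \<in> V" "ip C (\<phi> v) (\<phi> v) = 2" and g: "g \<in> C" "\<phi> v g = -1"
  obtains c where "c \<in> C" "c \<noteq> g" "\<phi> v c = 1" "\<And>k. k \<in> C \<Longrightarrow> k \<noteq> c \<Longrightarrow> k \<noteq> g \<Longrightarrow> \<phi> v k = 0"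
proof -
  obtain i where i: "i \<in> C" "\<phi> v i = 1 \<or> \<phi> v i = -2" "\<And>k. k \<in> C \<Longrightarrow> k \<noteq> i \<Longrightarrow> \<phi> v k = 0 \<or> \<phi> v k = -1"
    using lead[OF v(1)] by blast
  let ?J = "{k\<in>C - {i}. \<phi> v k = -1}"
  have i1: "\<phi> v i = 1" "card ?J = 1" using row_count(2)[OF finC i(1,3)] i(2) v by auto
  then have "g \<in> ?J" using g by auto
  then have "?J = {g}" using i1 by (metis card_1_singletonE singletonD)
  then show thesis using that[of i] i i1 \<open>g \<in> ?J\<close> by blast
qed

text \<open>Two entries \<open>1\<close> in a common column contribute \<open>1\<close>, and all
  other products of entries are nonnegative, whereas distinct vertices have product \<open>0\<close>
  or \<open>-1\<close>.\<close>

lemma P_unique: assumes "u \<in> V" "v \<in> V" "k \<in> C" "\<phi> u k = 1" "\<phi> v k = 1" shows "u = v"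
proof (rule ccontr)
  assume "u \<noteq> v"
  have "0 \<le> (\<Sum>j\<in>C - {k}. \<phi> u j * \<phi> v j)"
    using other_entries[of u k] other_entries[of v k] assms by (intro sum_nonneg) fastforce
  then have "ip C (\<phi> u) (\<phi> v) \<ge> 1" using assms finC by (simp add: ip_def sum.remove[of C k])
  then show False using pair[OF assms(1,2) \<open>u \<noteq> v\<close>] by (simp add: of_bool_def split: if_splits)
qed

section \<open>Column sums and columns without an entry 1\<close>

definition colsum :: "nat \<Rightarrow> int" where "colsum k = (\<Sum>v\<in>V. \<phi> v k)"

text \<open>Adjunction is additive up to the mixed products: each vertex contributes
  \<open>2\<close>, the edges subtract the degree sum, and for a tree the difference is again
  \<open>2\<close>.\<close>

lemma colsum_adj: "(\<Sum>k\<in>C. colsum k * (colsum k + 1)) = 2"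
proof -
  have eq: "(\<Sum>v\<in>V. ip C (\<phi> u) (\<phi> v)) = ip C (\<phi> u) (\<phi> u) - int (card {v\<in>V. E u v})" if "u \<in> V" for u
  proof -
    have "(\<Sum>v\<in>V. ip C (\<phi> u) (\<phi> v)) = ip C (\<phi> u) (\<phi> u) + (\<Sum>v\<in>V - {u}. ip C (\<phi> u) (\<phi> v))"
      using finV that by (simp add: sum.remove)
    also have "(\<Sum>v\<in>V - {u}. ip C (\<phi> u) (\<phi> v)) = (\<Sum>v\<in>V - {u}. - of_bool (E u v))"
      using pair that by (intro sum.cong) auto
    also have "\<dots> = (\<Sum>v\<in>{v\<in>V. E u v}. - 1)"
      using finV E_irr by (intro sum.mono_neutral_cong_right) auto
    finally show ?thesis by simp
  qed
  have "(\<Sum>k\<in>C. colsum k * colsum k) = (\<Sum>u\<in>V. \<Sum>v\<in>V. ip C (\<phi> u) (\<phi> v))"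
    using ip_combination[OF finV, where a = "\<lambda>_. 1" and b = "\<lambda>_. 1" and \<phi> = \<phi> and C = C]
    by (simp add: colsum_def)
  also have "\<dots> = (\<Sum>u\<in>V. ip C (\<phi> u) (\<phi> u)) - int (\<Sum>u\<in>V. card {v\<in>V. E u v})"
    using eq by (simp add: sum_subtractf)
  finally have 1: "(\<Sum>k\<in>C. colsum k * colsum k) = (\<Sum>u\<in>V. ip C (\<phi> u) (\<phi> u)) - int (\<Sum>u\<in>V. card {v\<in>V. E u v})" .
  have "(\<Sum>k\<in>C. colsum k) = (\<Sum>u\<in>V. \<Sum>k\<in>C. \<phi> u k)" unfolding colsum_def by (rule sum.swap)
  also have "\<dots> = (\<Sum>u\<in>V. 2 - ip C (\<phi> u) (\<phi> u))" using norm_sum by (intro sum.cong) auto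
  finally have 2: "(\<Sum>k\<in>C. colsum k) = 2 * int (card V) - (\<Sum>u\<in>V. ip C (\<phi> u) (\<phi> u))"
    by (simp add: sum_subtractf)
  have "(\<Sum>u\<in>V. card {v\<in>V. E u v}) + 2 = 2 * card V" using tree by (simp add: tree_def)
  then have "int (\<Sum>u\<in>V. card {v\<in>V. E u v}) + 2 = 2 * int (card V)" by linarith
  then show ?thesis using 1 2 by (simp add: algebra_simps sum.distrib)
qed

lemma exceptional:
  obtains e where "e \<in> C" "colsum e = 1 \<or> colsum e = -2"
    "\<And>k. k \<in> C \<Longrightarrow> k \<noteq> e \<Longrightarrow> colsum k = 0 \<or> colsum k = -1"
  using row_lead[OF finC colsum_adj] by blast

lemma colsum_ge: assumes "k \<in> C" shows "colsum k \<ge> -2"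
proof -
  obtain e where "colsum e = 1 \<or> colsum e = -2"
    "\<And>k. k \<in> C \<Longrightarrow> k \<noteq> e \<Longrightarrow> colsum k = 0 \<or> colsum k = -1"
    using exceptional by blast
  then show ?thesis using assms by (cases "k = e") force+
qed

text \<open>Without column \<open>g\<close> there are more vectors than dimensions. By hypothesis
  \<open>R\<close> the deletion only lowers off-diagonal products, so signs and connectedness
  survive and the relation has full support.\<close>

lemma drop_column:
  assumes g: "g \<in> C" and R: "\<And>u v. u \<in> V \<Longrightarrow> v \<in> V \<Longrightarrow> u \<noteq> v \<Longrightarrow> \<phi> u g * \<phi> v g \<ge> 0"
    and le: "\<And>v. v \<in> V \<Longrightarrow> (\<Sum>k\<in>C - {g}. \<phi> v k) \<le> 0" and "v \<in> V"
  shows "(\<Sum>k\<in>C - {g}. \<phi> v k) = 0"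
proof -
  have off: "ip (C - {g}) (\<phi> u) (\<phi> v) \<le> - of_bool (E u v)" if "u \<in> V" "v \<in> V" "u \<noteq> v" for u v
  proof -
    have "ip C (\<phi> u) (\<phi> v) = \<phi> u g * \<phi> v g + ip (C - {g}) (\<phi> u) (\<phi> v)"
      using g finC by (simp add: ip_def sum.remove)
    then show ?thesis using pair[OF that] R[OF that] by linarith
  qed
  have off0: "ip (C - {g}) (\<phi> u) (\<phi> v) \<le> 0" if "u \<in> V" "v \<in> V" "u \<noteq> v" for u v
    using off[OF that] by (simp add: order_trans)
  have con: "conn V (\<lambda>u v. ip (C - {g}) (\<phi> u) (\<phi> v) < 0)"
  proof (rule conn_mono[OF connE])
    fix u v assume uv: "u \<in> V" "v \<in> V" "E u v"
    then have "u \<noteq> v" using E_irr by auto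
    then show "ip (C - {g}) (\<phi> u) (\<phi> v) < 0" using off[OF uv(1,2)] uv(3) by simp
  qed
  have "card (C - {g}) < card V" using g finC cardC card_Diff1_less[of C g] by simp
  then obtain m where m: "\<exists>v\<in>V. m v \<noteq> 0" "\<forall>k\<in>C - {g}. (\<Sum>v\<in>V. m v * \<phi> v k) = 0"
    using linear_dependence[of "C - {g}" V \<phi>] finC finV by auto
  have "m v \<noteq> 0" using null_full[OF finV _ off0 con _ m(1) \<open>v \<in> V\<close>] m(2) finC by auto
  then show ?thesis
    by (intro null_row_sums[where m = m and V = V and C = "C - {g}" and \<phi> = \<phi>])
      (use finV finC off0 le m(2) \<open>v \<in> V\<close> in auto)
qed

text \<open>Pigeonhole: if every row had a leading \<open>1\<close>, these would occupy distinct
  columns, all different from \<open>g\<close>, although there are as many rows as columns.\<close>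

lemma D_exists:
  assumes "g \<in> C" "\<And>v. v \<in> V \<Longrightarrow> \<phi> v g \<noteq> 1"
  obtains z i where "z \<in> V" "i \<in> C" "\<phi> z i = -2"
proof (rule ccontr)
  assume "\<not> thesis"
  then have noD: "\<forall>z\<in>V. \<forall>i\<in>C. \<phi> z i \<noteq> -2" using that by blast
  have ex: "\<exists>i\<in>C. \<phi> v i = 1" if "v \<in> V" for v using lead[OF that] noD that by metis
  define l where "l v = (SOME i. i \<in> C \<and> \<phi> v i = 1)" for v
  have l: "l v \<in> C" "\<phi> v (l v) = 1" if "v \<in> V" for v
    using ex[OF that] someI_ex[of "\<lambda>i. i \<in> C \<and> \<phi> v i = 1"] unfolding l_def by blast+
  have "inj_on l V" using l P_unique by (intro inj_onI) metis
  then have "card (l ` V) = card C" using cardC by (simp add: card_image)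
  moreover have "l ` V \<subseteq> C - {g}" using l assms by fastforce
  ultimately have "card C \<le> card (C - {g})" using finC card_mono[of "C - {g}" "l ` V"] by simp
  then show False using finC assms(1) card_Diff1_less[of C g] by simp
qed

text \<open>Either deleting column \<open>g\<close> makes some row sum positive, and this row is
  \<open>E_c - E_g\<close>; or \<open>drop_column\<close> makes all row sums off \<open>g\<close>
  vanish, and then the row with entry \<open>-2\<close> has it in column \<open>g\<close> and has no
  other entries.\<close>

lemma Pless_cases:
  assumes g: "g \<in> C" and P: "\<And>v. v \<in> V \<Longrightarrow> \<phi> v g \<noteq> 1"
  obtains (single) z where "V = {z}" "ip C (\<phi> z) (\<phi> z) = 4"
  | (root) y c where "y \<in> V" "c \<in> C" "c \<noteq> g" "\<phi> y c = 1" "\<phi> y g = -1"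
      "\<And>k. k \<in> C \<Longrightarrow> k \<noteq> c \<Longrightarrow> k \<noteq> g \<Longrightarrow> \<phi> y k = 0"
proof -
  have le: "\<phi> v g \<le> 0" if "v \<in> V" for v using P[OF that] entries[OF that g] by auto
  have drop: "(\<Sum>k\<in>C. \<phi> v k) = \<phi> v g + (\<Sum>k\<in>C - {g}. \<phi> v k)" for v
    using g finC by (simp add: sum.remove)
  show thesis
  proof (cases "\<exists>y\<in>V. (\<Sum>k\<in>C - {g}. \<phi> y k) > 0")
    case True
    then obtain y where y: "y \<in> V" "(\<Sum>k\<in>C - {g}. \<phi> y k) > 0" by auto
    obtain i where i: "i \<in> C" "\<phi> y i = 1 \<or> \<phi> y i = -2" "\<And>k. k \<in> C \<Longrightarrow> k \<noteq> i \<Longrightarrow> \<phi> y k = 0 \<or> \<phi> y k = -1"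
      using lead[OF y(1)] by blast
    have sm: "(\<Sum>k\<in>C. \<phi> y k) \<le> -2" if "\<phi> y i = -2" using row_count(1)[OF finC i(1,3)] that by simp
    have yg: "\<phi> y g = -1"
      using y drop[of y] sum_le_0[OF y(1)] entries[OF y(1) g] le[OF y(1)] i(3)[OF g] i(2) sm by (cases "g = i") auto
    have yg0: "(\<Sum>k\<in>C. \<phi> y k) = 0"
      using y drop[of y] sum_le_0[OF y(1)] yg by simp
    have "ip C (\<phi> y) (\<phi> y) = 2" using norm_sum[OF y(1)] yg0 by simp
    then show thesis using norm_2[OF y(1) _ g yg] root y(1) yg by metis
  next
    case False
    then have z: "(\<Sum>k\<in>C - {g}. \<phi> v k) = 0" if "v \<in> V" for v
      using drop_column[OF g _ _ that] le by (simp add: mult_nonpos_nonpos not_less)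
    obtain z i where zi: "z \<in> V" "i \<in> C" "\<phi> z i = -2" using D_exists[OF g P] by metis
    have oth: "\<phi> z k = 0 \<or> \<phi> z k = -1" if "k \<in> C" "k \<noteq> i" for k
      using other_entries zi that by blast
    let ?J = "{k\<in>C - {i}. \<phi> z k = -1}"
    have s: "(\<Sum>k\<in>C. \<phi> z k) = -2 - int (card ?J)" using row_count(1)[OF finC zi(2) oth] zi by simp
    have "\<phi> z g = -2 - int (card ?J)" using s drop[of z] z[OF zi(1)] by simp
    then have "\<phi> z g = -2" "card ?J = 0" using entries[OF zi(1) g] by auto
    then have gi: "g = i" using oth[OF g] by auto
    have J: "?J = {}" using \<open>card ?J = 0\<close> finC by simp
    have "ip C (\<phi> z) (\<phi> z) = 4" using norm_sum[OF zi(1)] s \<open>card ?J = 0\<close> by simp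
    moreover have "\<not> E z v" if "v \<in> V" for v
    proof
      assume "E z v"
      then have "z \<noteq> v" using E_irr by auto
      \<comment> \<open>The only nonzero entry of \<open>\<phi> z\<close> is \<open>-2\<close>, so
        all its products are even and none equals \<open>-1\<close>.\<close>
      have "ip C (\<phi> z) (\<phi> v) = (\<Sum>k\<in>{i}. \<phi> z k * \<phi> v k)"
        unfolding ip_def using finC zi J oth by (intro sum.mono_neutral_right) auto
      then show False using pair[OF zi(1) that \<open>z \<noteq> v\<close>] \<open>E z v\<close> zi by simp presburger
    qed
    then have "V = {z}" using connD[OF connE, of "{z}"] zi(1) by auto
    ultimately show thesis using single by blast
  qed
qed

end

section \<open>Chains\<close>

text \<open>Deleting a leaf together with a column is harmless if, among the remaining rows, the
  column contributes to no product, has entries with vanishing adjunction term, and lowers no norm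
  to \<open>1\<close>.\<close>

lemma emb_remove_leaf:
  assumes e: "emb V C E \<phi>" and y: "y \<in> V" "z \<in> V" "E y z" "\<And>w. w \<in> V \<Longrightarrow> E y w \<Longrightarrow> w = z"
    and g: "g \<in> C" "\<And>u v. u \<in> V - {y} \<Longrightarrow> v \<in> V - {y} \<Longrightarrow> u \<noteq> v \<Longrightarrow> \<phi> u g * \<phi> v g = 0"
      "\<And>v. v \<in> V - {y} \<Longrightarrow> \<phi> v g = 0 \<or> \<phi> v g = -1"
      "\<And>v. v \<in> V - {y} \<Longrightarrow> \<phi> v g = -1 \<Longrightarrow> ip C (\<phi> v) (\<phi> v) \<noteq> 2"
  shows "emb (V - {y}) (C - {g}) E \<phi>"
proof -
  interpret emb V C E \<phi> by fact
  have split: "ip C x x' = x g * x' g + ip (C - {g}) x x'" for x x'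
    using g(1) finC by (simp add: ip_def sum.remove)
  show ?thesis
  proof
    show "tree (V - {y}) E"
      using tree_contract[OF tree y(1-3)] y(4) E_sym E_irr by blast
    show "finite (C - {g})" using finC by simp
    show "card (C - {g}) = card (V - {y})" using cardC finC finV g(1) y(1) by simp
    fix u assume u: "u \<in> V - {y}"
    then have uV: "u \<in> V" by simp
    show "ip (C - {g}) (\<phi> u) (\<phi> u) \<noteq> 1"
      using split[of "\<phi> u" "\<phi> u"] g(3,4)[OF u] norm_ne_1[OF uV] by auto
    show "(\<Sum>k\<in>C - {g}. \<phi> u k * (\<phi> u k + 1)) = 2"
      using row[OF uV] g(3)[OF u] g(1) finC by (auto simp: sum.remove)
    fix v assume v: "v \<in> V - {y}" "u \<noteq> v"
    then show "ip (C - {g}) (\<phi> u) (\<phi> v) = - of_bool (E u v)"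
      using split[of "\<phi> u" "\<phi> v"] g(2)[OF u v] pair[of u v] u by simp
  qed
qed

text \<open>The norms of the chains in \<open>\<G>\<close>; the two rules act on the parameters as
  \<open>(p, q) \<mapsto> (2 p - q, p)\<close> and \<open>(p, q) \<mapsto> (p + q, q)\<close>.\<close>
inductive Gl :: "int list \<Rightarrow> bool" where
  Gl_base: "Gl [4]"
| Gl_left: "Gl (as @ [a]) \<Longrightarrow> Gl (2 # as @ [a + 1])"
| Gl_right: "Gl (a # as) \<Longrightarrow> Gl ((a + 1) # as @ [2])"

definition chain_on :: "(nat \<Rightarrow> nat \<Rightarrow> bool) \<Rightarrow> nat list \<Rightarrow> bool" where
  "chain_on E L \<longleftrightarrow> (\<forall>i<length L. \<forall>j<length L. E (L ! i) (L ! j) = (j = Suc i \<or> i = Suc j))"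

lemma chain_on_Cons:
  assumes "chain_on E L" "distinct L" "\<And>u v. E u v \<Longrightarrow> E v u" "\<not> E y y"
    "\<And>z. z \<in> set L \<Longrightarrow> E y z \<longleftrightarrow> z = hd L"
  shows "chain_on E (y # L)"
proof -
  have 1: "E y (L ! j) \<longleftrightarrow> j = 0" if "j < length L" for j
  proof -
    have "L \<noteq> []" using that by auto
    then show ?thesis using assms(5)[of "L ! j"] that assms(2) nth_eq_iff_index_eq[of L j 0] by (auto simp: hd_conv_nth)
  qed
  have 2: "E (L ! j) y \<longleftrightarrow> j = 0" if "j < length L" for j using 1[OF that] assms(3) by blast
  show ?thesis
    using assms(1,4) 1 2 by (auto simp: chain_on_def nth_Cons split: nat.splits)
qed

lemma chain_on_snoc:
  assumes "chain_on E L" "distinct L" "\<And>u v. E u v \<Longrightarrow> E v u" "\<not> E y y"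
    "\<And>z. z \<in> set L \<Longrightarrow> E y z \<longleftrightarrow> z = last L"
  shows "chain_on E (L @ [y])"
proof -
  have 1: "E y (L ! j) \<longleftrightarrow> Suc j = length L" if "j < length L" for j
  proof -
    have "L \<noteq> []" using that by auto
    then show ?thesis
      using assms(5)[of "L ! j"] that assms(2) nth_eq_iff_index_eq[of L j "length L - 1"]
      by (auto simp: last_conv_nth)
  qed
  have 2: "E (L ! j) y \<longleftrightarrow> Suc j = length L" if "j < length L" for j using 1[OF that] assms(3) by blast
  show ?thesis
    using assms(1,4) 1 2 by (auto simp: chain_on_def nth_append less_Suc_eq)
qed

text \<open>Induction by removing the row \<open>y = E_c - E_g\<close>. The columns \<open>c\<close>
  and \<open>g\<close> determine the valency of \<open>y\<close>, and the bound on column sums makes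
  it \<open>1\<close>. The remaining tree has no entry \<open>1\<close> in column \<open>c\<close>
  and column sum \<open>-2\<close> there, so \<open>c\<close> takes over the role of
  \<open>g\<close>. The last conjunct places the two rows with entry \<open>-1\<close> at the ends
  of the chain; this decides whether the list of norms grows by \<open>Gl_left\<close> or by
  \<open>Gl_right\<close>.\<close>

lemma G_chain:
  assumes "emb V C E \<phi>" "g \<in> C" "\<And>v. v \<in> V \<Longrightarrow> \<phi> v g \<noteq> 1" "(\<Sum>v\<in>V. \<phi> v g) = -2"
  shows "\<exists>L. distinct L \<and> set L = V \<and> chain_on E L \<and> Gl (map (\<lambda>v. ip C (\<phi> v) (\<phi> v)) L) \<and>
    (length L \<ge> 2 \<longrightarrow> {v\<in>V. \<phi> v g = -1} = {hd L, last L})"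
  using assms
proof (induction "card V" arbitrary: V C g rule: less_induct)
  case less
  interpret emb V C E \<phi> by fact
  note g = less.prems(2) and Pless = less.prems(3) and sg = less.prems(4)
  consider (single) z where "V = {z}" "ip C (\<phi> z) (\<phi> z) = 4"
    | (root) y c where "y \<in> V" "c \<in> C" "c \<noteq> g" "\<phi> y c = 1" "\<phi> y g = -1"
        "\<And>k. k \<in> C \<Longrightarrow> k \<noteq> c \<Longrightarrow> k \<noteq> g \<Longrightarrow> \<phi> y k = 0"
    by (rule Pless_cases[OF g Pless]) blast+
  then show ?case
  proof cases
    case (single z)
    have "Gl (map (\<lambda>v. ip C (\<phi> v) (\<phi> v)) [z])" using Gl_base single(2) by simp
    moreover have "chain_on E [z]" using E_irr by (auto simp: chain_on_def)
    moreover have "distinct [z]" "set [z] = V" "\<not> 2 \<le> length [z]" using single(1) by auto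
    ultimately show ?thesis by blast
  next
    case (root y c)
    have le: "\<phi> v g \<le> 0" if "v \<in> V" for v using Pless[OF that] entries[OF that g] by auto
    have s': "(\<Sum>v\<in>V - {y}. \<phi> v g) = -1" using sg root finV by (simp add: sum.remove)
    then have "\<exists>v\<in>V - {y}. \<phi> v g \<noteq> 0" by (metis sum.neutral zero_neq_neg_one)
    then obtain y2 where y2: "y2 \<in> V - {y}" "\<phi> y2 g \<noteq> 0" by auto
    have s2: "\<phi> y2 g + (\<Sum>v\<in>V - {y} - {y2}. \<phi> v g) = -1" using s' y2 finV by (simp add: sum.remove)
    have npos: "(\<Sum>v\<in>V - {y} - {y2}. \<phi> v g) \<le> 0" using le by (intro sum_nonpos) auto
    have y2g: "\<phi> y2 g = -1" using s2 npos le[of y2] y2 by auto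
    then have "(\<Sum>v\<in>V - {y} - {y2}. - \<phi> v g) = 0" using s2 by (simp add: sum_negf)
    then have zg: "\<phi> v g = 0" if "v \<in> V - {y} - {y2}" for v
      using that le finV by (subst (asm) sum_nonneg_eq_0_iff) auto
    have ipy: "ip C (\<phi> y) x = x c - x g" for x
    proof -
      have "ip C (\<phi> y) x = (\<Sum>k\<in>{c,g}. \<phi> y k * x k)"
        unfolding ip_def using root g finC by (intro sum.mono_neutral_right) auto
      then show ?thesis using root by simp
    qed
    have Ey: "of_bool (E y v) = \<phi> v g - \<phi> v c" if "v \<in> V - {y}" for v
      using pair[of y v] that root ipy[of "\<phi> v"] by auto
    have y2c: "\<phi> y2 c = -1 \<or> \<phi> y2 c = -2" using Ey[OF y2(1)] y2g by (cases "E y y2") auto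
    have cz: "\<phi> v c = - of_bool (E y v)" if "v \<in> V - {y} - {y2}" for v
      using Ey[of v] zg[OF that] that by auto
    obtain e where e: "e \<in> C" "\<And>k. k \<in> C \<Longrightarrow> k \<noteq> e \<Longrightarrow> colsum k = 0 \<or> colsum k = -1"
      using exceptional by metis
    \<comment> \<open>The exceptional column is already \<open>g\<close>, whose sum is
      \<open>-2\<close>; for column \<open>c\<close> only the sums \<open>0\<close> and
      \<open>-1\<close> are left.\<close>
    have "e = g" using e(2)[OF g] sg by (auto simp: colsum_def)
    then have "colsum c = 0 \<or> colsum c = -1" using e(2)[OF root(2)] root by auto
    moreover have csplit: "colsum c = 1 + (\<Sum>v\<in>V - {y}. \<phi> v c)"
      using root finV by (simp add: colsum_def sum.remove)
    ultimately have sc: "(\<Sum>v\<in>V - {y}. \<phi> v c) \<in> {-1, -2}" by auto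
    have sc2: "(\<Sum>v\<in>V - {y}. \<phi> v c) = \<phi> y2 c + (\<Sum>v\<in>V - {y} - {y2}. \<phi> v c)"
      using y2 finV by (simp add: sum.remove)
    have sc3: "(\<Sum>v\<in>V - {y} - {y2}. \<phi> v c) = - int (card {v\<in>V - {y} - {y2}. E y v})"
    proof -
      have "(\<Sum>v\<in>V - {y} - {y2}. \<phi> v c) = (\<Sum>v\<in>{v\<in>V - {y} - {y2}. E y v}. -1)"
        using cz finV by (intro sum.mono_neutral_cong_right) auto
      then show ?thesis by simp
    qed
    obtain z where z: "z \<in> V - {y}" "E y z" using connD[OF connE, of "{y}"] root y2 by auto
    \<comment> \<open>Without \<open>y\<close> the sum of column \<open>c\<close> is
      \<open>-1\<close>, contributed by \<open>y2\<close>, minus the valency of \<open>y\<close>.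
      Connectedness makes the valency positive, so it equals \<open>1\<close>.\<close>
    have zc: "(\<Sum>v\<in>V - {y}. \<phi> v c) = -2 \<and> (\<forall>w\<in>V. E y w \<longrightarrow> w = z)"
    proof (cases "z = y2")
      case True
      then have "\<phi> y2 c = -2" using Ey[OF y2(1)] y2g z by auto
      then have c0: "card {v\<in>V - {y} - {y2}. E y v} = 0" using sc sc2 sc3 by auto
      then have none: "{v\<in>V - {y} - {y2}. E y v} = {}" using finV by simp
      have "(\<Sum>v\<in>V - {y}. \<phi> v c) = -2" using sc2 sc3 \<open>\<phi> y2 c = -2\<close> c0 by linarith
      then show ?thesis using none True E_irr by auto
    next
      case False
      let ?A = "{v\<in>V - {y} - {y2}. E y v}"
      have "z \<in> ?A" using z False by auto
      moreover have fA: "finite ?A" using finV by simp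
      ultimately have "card ?A > 0" by (subst card_gt_0_iff) blast
      then have A1: "card ?A = 1" "\<phi> y2 c = -1" using sc sc2 sc3 y2c by auto
      then have "?A = {z}" using \<open>z \<in> ?A\<close> by (metis card_1_singletonE singletonD)
      moreover have "\<not> E y y2" using Ey[OF y2(1)] A1 y2g by auto
      ultimately show ?thesis using sc2 sc3 A1 E_irr by auto
    qed
    have emb': "emb (V - {y}) (C - {g}) E \<phi>"
    proof (rule emb_remove_leaf[OF less.prems(1) root(1) _ z(2) _ g])
      show "z \<in> V" using z by simp
      show "w = z" if "w \<in> V" "E y w" for w using zc that by auto
      show "\<phi> u g * \<phi> v g = 0" if "u \<in> V - {y}" "v \<in> V - {y}" "u \<noteq> v" for u v
        using that zg[of u] zg[of v] by (cases "u = y2") auto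
      show "\<phi> v g = 0 \<or> \<phi> v g = -1" if "v \<in> V - {y}" for v using that zg[of v] y2g by (cases "v = y2") auto
      show "ip C (\<phi> v) (\<phi> v) \<noteq> 2" if v: "v \<in> V - {y}" "\<phi> v g = -1" for v
      proof
        assume n2: "ip C (\<phi> v) (\<phi> v) = 2"
        have "v = y2" using zg[of v] v by auto
        obtain c' where "c' \<in> C" "c' \<noteq> g" "\<phi> v c' = 1" "\<And>k. k \<in> C \<Longrightarrow> k \<noteq> c' \<Longrightarrow> k \<noteq> g \<Longrightarrow> \<phi> v k = 0"
          using norm_2[OF _ n2 g v(2)] v by blast
        then have "\<phi> v c = 1 \<or> \<phi> v c = 0" using root by metis
        then show False using y2c \<open>v = y2\<close> by auto
      qed
    qed
    have lt: "card (V - {y}) < card V" using root finV by (intro card_Diff1_less) auto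
    have cC: "c \<in> C - {g}" using root by simp
    have cP: "\<phi> v c \<noteq> 1" if "v \<in> V - {y}" for v using P_unique[of v y c] that root by auto
    obtain L where L: "distinct L" "set L = V - {y}" "chain_on E L"
      "Gl (map (\<lambda>v. ip (C - {g}) (\<phi> v) (\<phi> v)) L)"
      "length L \<ge> 2 \<Longrightarrow> {v\<in>V - {y}. \<phi> v c = -1} = {hd L, last L}"
      using less.hyps[OF lt emb' cC cP conjunct1[OF zc]] by blast
    have setL: "v \<in> set L \<longleftrightarrow> v \<in> V \<and> v \<noteq> y" for v by (simp add: L(2))
    have Lne: "L \<noteq> []" using setL[of z] z by force
    have norm: "ip C (\<phi> v) (\<phi> v) = ip (C - {g}) (\<phi> v) (\<phi> v) + of_bool (v = y2)" if "v \<in> V - {y}" for v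
      using g finC zg[of v] y2g that by (auto simp: ip_def sum.remove)
    have normy: "ip C (\<phi> y) (\<phi> y) = 2" using ipy[of "\<phi> y"] root by simp
    \<comment> \<open>In a chain of length \<open>1\<close> the only vertex is \<open>y2\<close>,
      \<open>z\<close> and both ends at once; otherwise \<open>y2\<close> and \<open>z\<close> are
      distinct.\<close>
    have ends: "(y2 = hd L \<and> z = last L) \<or> (y2 = last L \<and> z = hd L)"
    proof (cases "length L \<ge> 2")
      case True
      have neq: "hd L \<noteq> last L"
        using L(1) True Lne nth_eq_iff_index_eq[of L 0 "length L - 1"] by (simp add: hd_conv_nth last_conv_nth)
      have y21: "\<phi> y2 c = -1"
      proof (rule ccontr)
        assume "\<phi> y2 c \<noteq> -1"
        then have y22: "\<phi> y2 c = -2" using y2c by auto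
        have "card {v\<in>V - {y} - {y2}. E y v} = 0" using y22 zc sc2 sc3 by auto
        then have none: "{v\<in>V - {y} - {y2}. E y v} = {}" using finV by simp
        have "hd L \<in> V - {y} - {y2} \<and> E y (hd L)"
        proof -
          have h: "hd L \<in> V - {y}" "\<phi> (hd L) c = -1" using L(5)[OF True] by auto
          then have "hd L \<noteq> y2" using y22 by auto
          then show ?thesis using cz[of "hd L"] h by auto
        qed
        then show False using none by auto
      qed
      have zz: "z \<noteq> y2" using Ey[OF y2(1)] y21 y2g z by auto
      then have "\<phi> z c = -1" using cz[of z] z by auto
      then have "y2 \<in> {hd L, last L}" "z \<in> {hd L, last L}" using L(5)[OF True] y2 y21 z by blast+
      then show ?thesis using zz by auto
    next
      case False
      then have "length L = 1" using Lne by (cases L) (auto simp: not_le)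
      then obtain w where "L = [w]" by (auto simp: length_Suc_conv)
      then show ?thesis using setL[of y2] setL[of z] y2 z by simp
    qed
    have Nez: "E y v \<longleftrightarrow> v = z" if "v \<in> set L" for v using zc z that setL by blast
    have Ng: "{v\<in>V. \<phi> v g = -1} = {y, y2}" using root(1,5) y2(1) y2g zg by force
    have yL: "y \<notin> set L" by (simp add: setL)
    from ends show ?thesis
    proof
      assume e: "y2 = hd L \<and> z = last L"
      obtain a as where as: "map (\<lambda>v. ip (C - {g}) (\<phi> v) (\<phi> v)) L = a # as" using Lne by (cases L) auto
      obtain M where M: "L = y2 # M" using e Lne by (cases L) auto
      have "map (\<lambda>v. ip C (\<phi> v) (\<phi> v)) M = map (\<lambda>v. ip (C - {g}) (\<phi> v) (\<phi> v)) M"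
      proof (rule map_cong[OF HOL.refl])
        fix v assume v: "v \<in> set M"
        have "v \<noteq> y2" using L(1) v unfolding M by auto
        moreover have "v \<in> V - {y}" using setL[of v] v unfolding M by simp
        ultimately show "ip C (\<phi> v) (\<phi> v) = ip (C - {g}) (\<phi> v) (\<phi> v)" using norm[of v] by simp
      qed
      moreover have "a = ip (C - {g}) (\<phi> y2) (\<phi> y2)" "as = map (\<lambda>v. ip (C - {g}) (\<phi> v) (\<phi> v)) M"
        using as unfolding M by simp_all
      ultimately have "map (\<lambda>v. ip C (\<phi> v) (\<phi> v)) (L @ [y]) = (a + 1) # as @ [2]"
        using norm[OF y2(1)] normy unfolding M by simp
      then have "Gl (map (\<lambda>v. ip C (\<phi> v) (\<phi> v)) (L @ [y]))" using Gl_right L(4) as by auto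
      moreover have "chain_on E (L @ [y])" using chain_on_snoc[OF L(3,1)] E_sym E_irr Nez e by blast
      moreover have "distinct (L @ [y])" "set (L @ [y]) = V" using L(1) yL setL root(1) by auto
      moreover have "{v\<in>V. \<phi> v g = -1} = {hd (L @ [y]), last (L @ [y])}" using Ng M by auto
      ultimately show ?thesis by blast
    next
      assume e: "y2 = last L \<and> z = hd L"
      obtain M where M: "L = M @ [y2]" using e Lne append_butlast_last_id by metis
      have "map (\<lambda>v. ip C (\<phi> v) (\<phi> v)) M = map (\<lambda>v. ip (C - {g}) (\<phi> v) (\<phi> v)) M"
      proof (rule map_cong[OF HOL.refl])
        fix v assume v: "v \<in> set M"
        have "v \<noteq> y2" using L(1) v unfolding M by auto
        moreover have "v \<in> V - {y}" using setL[of v] v unfolding M by simp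
        ultimately show "ip C (\<phi> v) (\<phi> v) = ip (C - {g}) (\<phi> v) (\<phi> v)" using norm[of v] by simp
      qed
      moreover have "Gl (map (\<lambda>v. ip (C - {g}) (\<phi> v) (\<phi> v)) M @ [ip (C - {g}) (\<phi> y2) (\<phi> y2)])"
        using L(4) M by simp
      ultimately have "Gl (map (\<lambda>v. ip C (\<phi> v) (\<phi> v)) M @ [ip (C - {g}) (\<phi> y2) (\<phi> y2)])"
        by metis
      then have "Gl (map (\<lambda>v. ip C (\<phi> v) (\<phi> v)) (y # L))"
        using Gl_left norm[OF y2(1)] normy unfolding M by simp
      moreover have "chain_on E (y # L)" using chain_on_Cons[OF L(3,1)] E_sym E_irr Nez e by blast
      moreover have "distinct (y # L)" "set (y # L) = V" using L(1) yL setL root(1) by auto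
      moreover have "{v\<in>V. \<phi> v g = -1} = {hd (y # L), last (y # L)}" using Ng M by auto
      ultimately show ?thesis by blast
    qed
  qed
qed

section \<open>Trees with a hub: the blow-up families\<close>

text \<open>A cut of \<open>V - {x}\<close> is crossed in \<open>V\<close> starting from either
  side. If both crossings pass through \<open>x\<close>, they start at neighbours of
  \<open>x\<close> on different sides, and \<open>R'\<close> joins these directly.\<close>

lemma conn_remove:
  assumes con: "conn V R" and sym: "\<And>u v. R u v \<Longrightarrow> R v u" and x: "x \<in> V"
    and sub: "\<And>u v. u \<in> V - {x} \<Longrightarrow> v \<in> V - {x} \<Longrightarrow> R u v \<Longrightarrow> R' u v"
    and clique: "\<And>u v. u \<in> V - {x} \<Longrightarrow> v \<in> V - {x} \<Longrightarrow> u \<noteq> v \<Longrightarrow> R x u \<Longrightarrow> R x v \<Longrightarrow> R' u v"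
  shows "conn (V - {x}) R'"
  unfolding conn_def
proof (intro allI impI)
  fix S assume S: "S \<subseteq> V - {x}" "S \<noteq> {}" "S \<noteq> V - {x}"
  obtain a b where ab: "a \<in> S" "b \<in> V - S" "R a b" using connD[OF con, of S] S x by blast
  show "\<exists>u\<in>S. \<exists>v\<in>V - {x} - S. R' u v"
  proof (cases "b = x")
    case False
    then show ?thesis using ab sub[of a b] S by blast
  next
    case True
    let ?S = "V - {x} - S"
    obtain c d where cd: "c \<in> ?S" "d \<in> V - ?S" "R c d" using connD[OF con, of ?S] S x by blast
    show ?thesis
    proof (cases "d = x")
      case True
      have "R' a c" using clique[of a c] ab cd S True \<open>b = x\<close> sym by blast
      then show ?thesis using ab cd by blast
    next
      case False
      then show ?thesis using cd sub[of d c] sym S by blast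
    qed
  qed
qed

text \<open>Vectors orthogonal to \<open>f\<close> lie in a hyperplane: coordinate \<open>k\<close>
  may be dropped, because \<open>f k \<noteq> 0\<close> recovers it from the others.\<close>

lemma orth_dependence:
  fixes \<phi> :: "'a \<Rightarrow> 'b \<Rightarrow> int"
  assumes fin: "finite D" "finite W" and card: "card D \<le> card W" and f: "k \<in> D" "f k \<noteq> 0"
    and orth: "\<And>w. w \<in> W \<Longrightarrow> ip D f (\<phi> w) = 0"
  shows "\<exists>m. (\<exists>v\<in>W. m v \<noteq> 0) \<and> (\<forall>j\<in>D. (\<Sum>v\<in>W. m v * \<phi> v j) = 0)"
proof -
  have "card (D - {k}) < card W" using card_Diff1_less[OF fin(1) f(1)] card by linarith
  then obtain m where m: "\<exists>v\<in>W. m v \<noteq> 0" "\<forall>j\<in>D - {k}. (\<Sum>v\<in>W. m v * \<phi> v j) = 0"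
    using linear_dependence[of "D - {k}" W \<phi>] fin by auto
  have "0 = (\<Sum>v\<in>W. m v * ip D f (\<phi> v))" using orth by simp
  also have "\<dots> = (\<Sum>j\<in>D. \<Sum>v\<in>W. m v * (f j * \<phi> v j))"
    by (subst sum.swap) (simp add: ip_def sum_distrib_left)
  also have "\<dots> = (\<Sum>j\<in>D. f j * (\<Sum>v\<in>W. m v * \<phi> v j))"
    by (simp add: sum_distrib_left mult.left_commute)
  also have "\<dots> = f k * (\<Sum>v\<in>W. m v * \<phi> v k)"
    using fin f(1) m(2) by (simp add: sum.remove)
  finally have "(\<Sum>v\<in>W. m v * \<phi> v k) = 0" using f(2) by simp
  then show ?thesis using m by blast
qed

text \<open>The vertex \<open>x\<close> plays the role of the last \<open>(-1)\<close>-vertex of a blow-up sequence: its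
  neighbours are exactly the vertices meeting the exceptional class \<open>c\<close>.\<close>
locale hub = emb +
  fixes x c :: nat
  assumes xV: "x \<in> V" and cC: "c \<in> C" and xc: "\<phi> x c = 1"
    and hub: "\<And>z. z \<in> V - {x} \<Longrightarrow> \<phi> z c = - of_bool (E x z)"
begin

abbreviation "valx \<equiv> card {v\<in>V. E x v}"

lemma hub_adj: "z \<in> V \<Longrightarrow> E x z \<Longrightarrow> \<phi> z c = -1"
  using hub[of z] E_irr by fastforce

lemma colsum_c: "colsum c = 1 - int valx"
proof -
  have "colsum c = 1 + (\<Sum>z\<in>V - {x}. \<phi> z c)" using finV xV xc by (simp add: colsum_def sum.remove)
  also have "(\<Sum>z\<in>V - {x}. \<phi> z c) = (\<Sum>z\<in>{v\<in>V. E x v}. -1)"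
    using finV hub hub_adj E_irr by (intro sum.mono_neutral_cong_right) auto
  finally show ?thesis by simp
qed

text \<open>The lower bound \<open>-2\<close> for column sums turns into an upper bound for the
  valency of a hub.\<close>

lemma valx_le: "valx \<le> 3" using colsum_ge[OF cC] colsum_c by linarith

lemma x_other: "k \<in> C \<Longrightarrow> k \<noteq> c \<Longrightarrow> \<phi> x k = 0 \<or> \<phi> x k = -1"
  using other_entries[OF xV cC] xc by blast

text \<open>The entries of \<open>\<phi> x\<close> off column \<open>c\<close> form the vector f
  that is orthogonal to all other vertices; norm at least \<open>2\<close> makes it nonzero.\<close>

lemma f_exists: obtains k where "k \<in> C" "k \<noteq> c" "\<phi> x k = -1"
proof -
  have "ip C (\<phi> x) (\<phi> x) = 1 * 1 + int (card {k\<in>C - {c}. \<phi> x k = -1})"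
    using row_count(2)[OF finC cC, of "\<phi> x"] x_other xc by simp
  then have "card {k\<in>C - {c}. \<phi> x k = -1} \<noteq> 0" using norm_ge_2[OF xV] by linarith
  then have "{k\<in>C - {c}. \<phi> x k = -1} \<noteq> {}" using card.empty by metis
  then show thesis using that by blast
qed

lemma valx_pos: "valx > 0"
proof (rule ccontr)
  assume "\<not> valx > 0"
  then have "{v\<in>V. E x v} = {}" using finV by simp
  then have "V = {x}" using connD[OF connE, of "{x}"] xV by blast
  then have "card C = 1" using cardC by simp
  then have "C = {c}" using cC by (metis card_1_singletonE singletonD)
  then show False using f_exists by blast
qed

lemma ip_drop: "ip C y y' = y c * y' c + ip (C - {c}) y y'"
  using finC cC by (simp add: ip_def sum.remove)

lemma f_orth: "z \<in> V - {x} \<Longrightarrow> ip (C - {c}) (\<phi> x) (\<phi> z) = 0"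
  using pair[OF xV, of z] ip_drop[of "\<phi> x" "\<phi> z"] hub[of z] xc by auto

text \<open>Dropping column \<open>c\<close> is the blow-down of \<open>x\<close>: its neighbours,
  which all have entry \<open>-1\<close> there, become adjacent to each other.\<close>

lemma ip_c:
  assumes "z \<in> V - {x}" "w \<in> V - {x}" "z \<noteq> w"
  shows "ip (C - {c}) (\<phi> z) (\<phi> w) = - of_bool (E z w) - of_bool (E x z \<and> E x w)"
  using pair[of z w] ip_drop[of "\<phi> z" "\<phi> w"] hub[of z] hub[of w] assms by auto

lemma no_tri: "E x a \<Longrightarrow> E x b \<Longrightarrow> a \<in> V \<Longrightarrow> b \<in> V \<Longrightarrow> \<not> E a b"
  using tree_no_triangle[OF tree, of a x b] E_sym xV by blast

lemma con_c: "conn (V - {x}) (\<lambda>u v. ip (C - {c}) (\<phi> u) (\<phi> v) < 0)"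
proof (rule conn_remove[OF connE _ xV])
  fix u v assume uv: "u \<in> V - {x}" "v \<in> V - {x}"
  show "ip (C - {c}) (\<phi> u) (\<phi> v) < 0" if "E u v"
    using ip_c[OF uv] that E_irr by (cases "u = v") auto
  show "ip (C - {c}) (\<phi> u) (\<phi> v) < 0" if "u \<noteq> v" "E x u" "E x v"
    using ip_c[OF uv] that by auto
qed (use E_sym in blast)

lemma off_c: "z \<in> V - {x} \<Longrightarrow> w \<in> V - {x} \<Longrightarrow> z \<noteq> w \<Longrightarrow> ip (C - {c}) (\<phi> z) (\<phi> w) \<le> 0"
  using ip_c by auto

lemma sum_drop: "(\<Sum>k\<in>C. y k) = y c + (\<Sum>k\<in>C - {c}. y k)" for y :: "nat \<Rightarrow> int"
  using finC cC by (simp add: sum.remove)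

text \<open>After the blow-down there are as many vectors as columns, but all are orthogonal to f.
  Hence they are dependent, with positive coefficients after passing to absolute values.\<close>

lemma null_c:
  obtains m where "\<And>v. v \<in> V - {x} \<Longrightarrow> m v > 0" "\<And>k. k \<in> C - {c} \<Longrightarrow> (\<Sum>v\<in>V - {x}. m v * \<phi> v k) = 0"
proof -
  obtain k where k: "k \<in> C" "k \<noteq> c" "\<phi> x k = -1" using f_exists by blast
  obtain m where m: "\<exists>v\<in>V - {x}. m v \<noteq> 0" "\<forall>j\<in>C - {c}. (\<Sum>v\<in>V - {x}. m v * \<phi> v j) = 0"
    using orth_dependence[of "C - {c}" "V - {x}" k "\<phi> x" \<phi>] finC finV cardC cC xV k f_orth by auto
  have "\<bar>m v\<bar> > 0" if "v \<in> V - {x}" for v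
    using null_full[OF _ _ off_c con_c _ m(1) that] m(2) finC finV by auto
  moreover have "(\<Sum>v\<in>V - {x}. \<bar>m v\<bar> * \<phi> v j) = 0" if "j \<in> C - {c}" for j
    by (rule null_abs[where V = "V - {x}" and C = "C - {c}"]) (use finC finV off_c m(2) that in auto)
  ultimately show thesis using that[of "\<lambda>v. \<bar>m v\<bar>"] by blast
qed

text \<open>If no row sum is positive after the blow-down, all vanish and every row becomes a root
  \<open>E_p - E_q\<close>. In the positive relation each \<open>1\<close> is cancelled by a
  \<open>-1\<close> and conversely, so in the graph where the neighbours of \<open>x\<close> form a
  clique every vertex has degree at least \<open>2\<close>. The edge count of the tree then gives
  \<open>valx * (valx - 3) \<ge> 0\<close>, hence valency \<open>3\<close> and equality everywhere:
  the tree is \<open>T_a\<close> with \<open>-4\<close> at the centre.\<close>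

lemma roots_case:
  assumes le: "\<And>v. v \<in> V - {x} \<Longrightarrow> (\<Sum>k\<in>C - {c}. \<phi> v k) \<le> 0"
  shows "valx = 3" "V - {x} = {v\<in>V. E x v}" "ip C (\<phi> x) (\<phi> x) = 4"
    "\<And>v. v \<in> V - {x} \<Longrightarrow> ip C (\<phi> v) (\<phi> v) = 3"
proof -
  obtain m where m: "\<And>v. v \<in> V - {x} \<Longrightarrow> m v > 0"
    "\<And>k. k \<in> C - {c} \<Longrightarrow> (\<Sum>v\<in>V - {x}. m v * \<phi> v k) = 0" using null_c by blast
  have z: "(\<Sum>k\<in>C - {c}. \<phi> v k) = 0" if "v \<in> V - {x}" for v
  proof (rule null_row_sums[where m = m and V = "V - {x}" and C = "C - {c}"])
    show "m v \<noteq> 0" using m(1)[OF that] by simp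
  qed (use finC finV off_c m le that in auto)
  define D where "D = C - {c}"
  have finD: "finite D" using finC by (simp add: D_def)
  have root: "\<exists>p\<in>D. \<exists>q\<in>D. p \<noteq> q \<and> \<phi> v p = 1 \<and> \<phi> v q = -1 \<and> (\<forall>k\<in>D. k \<noteq> p \<longrightarrow> k \<noteq> q \<longrightarrow> \<phi> v k = 0)"
    if v: "v \<in> V - {x}" for v
  proof -
    have vV: "v \<in> V" using v by simp
    obtain i where i: "i \<in> C" "\<phi> v i = 1 \<or> \<phi> v i = -2" "\<And>k. k \<in> C \<Longrightarrow> k \<noteq> i \<Longrightarrow> \<phi> v k = 0 \<or> \<phi> v k = -1"
      using lead[OF vV] by blast
    have ic: "i \<noteq> c" using hub[OF v] i(2) by (auto simp: of_bool_def split: if_splits)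
    then have iD: "i \<in> D" using i(1) by (simp add: D_def)
    let ?J = "{k\<in>D - {i}. \<phi> v k = -1}"
    have "0 = \<phi> v i - int (card ?J)"
      using row_count(1)[OF finD iD, of "\<phi> v"] i(3) z[OF v] by (simp add: D_def)
    then have "\<phi> v i = 1" using i(2) by linarith
    then have "card ?J = 1" using \<open>0 = \<phi> v i - int (card ?J)\<close> by linarith
    then obtain q where "?J = {q}" by (metis card_1_singletonE)
    then have "q \<in> ?J" and J: "\<And>k. k \<in> ?J \<Longrightarrow> k = q" by blast+
    then have q: "q \<in> D" "q \<noteq> i" "\<phi> v q = -1" by blast+
    have "\<phi> v k = 0" if "k \<in> D" "k \<noteq> i" "k \<noteq> q" for k
      using i(3)[of k] J[of k] that by (auto simp: D_def)
    then show ?thesis using \<open>\<phi> v i = 1\<close> iD q by metis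
  qed
  define p where "p v = (SOME p. p \<in> D \<and> (\<exists>q\<in>D. p \<noteq> q \<and> \<phi> v p = 1 \<and> \<phi> v q = -1 \<and> (\<forall>k\<in>D. k \<noteq> p \<longrightarrow> k \<noteq> q \<longrightarrow> \<phi> v k = 0)))" for v
  define q where "q v = (SOME q. q \<in> D \<and> p v \<noteq> q \<and> \<phi> v (p v) = 1 \<and> \<phi> v q = -1 \<and> (\<forall>k\<in>D. k \<noteq> p v \<longrightarrow> k \<noteq> q \<longrightarrow> \<phi> v k = 0))" for v
  have p: "p v \<in> D \<and> (\<exists>q\<in>D. p v \<noteq> q \<and> \<phi> v (p v) = 1 \<and> \<phi> v q = -1 \<and> (\<forall>k\<in>D. k \<noteq> p v \<longrightarrow> k \<noteq> q \<longrightarrow> \<phi> v k = 0))"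
    if "v \<in> V - {x}" for v
    unfolding p_def by (rule someI_ex) (use root[OF that] in blast)
  have q: "q v \<in> D \<and> p v \<noteq> q v \<and> \<phi> v (p v) = 1 \<and> \<phi> v (q v) = -1 \<and> (\<forall>k\<in>D. k \<noteq> p v \<longrightarrow> k \<noteq> q v \<longrightarrow> \<phi> v k = 0)"
    if "v \<in> V - {x}" for v
    unfolding q_def by (rule someI_ex) (use p[OF that] in blast)
  have ipD: "ip D (\<phi> v) y = y (p v) - y (q v)" if "v \<in> V - {x}" for v y
  proof -
    have "ip D (\<phi> v) y = (\<Sum>k\<in>{p v, q v}. \<phi> v k * y k)"
      unfolding ip_def using p[OF that] q[OF that] finD by (intro sum.mono_neutral_right) auto
    then show ?thesis using q[OF that] by simp
  qed
  \<comment> \<open>Opposite roots have product \<open>-2\<close>, which would need an edge between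
    two neighbours of \<open>x\<close>, that is, a triangle.\<close>
  have nonopp: "\<not> (p w = q v \<and> q w = p v)" if "v \<in> V - {x}" "w \<in> V - {x}" for v w
  proof
    assume pq: "p w = q v \<and> q w = p v"
    then have "v \<noteq> w" using q[OF that(1)] by auto
    have "ip D (\<phi> v) (\<phi> w) = -2" using ipD[OF that(1), of "\<phi> w"] q[OF that(2)] pq by auto
    then have "E v w \<and> E x v \<and> E x w" using ip_c[OF that \<open>v \<noteq> w\<close>] unfolding D_def by (auto simp: of_bool_def split: if_splits)
    then show False using no_tri that by auto
  qed
  \<comment> \<open>Otherwise no row is negative in column \<open>p v\<close>, while row
    \<open>v\<close> contributes a positive amount to the relation there.\<close>
  have succ: "\<exists>w\<in>V - {x}. q w = p v" if v: "v \<in> V - {x}" for v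
  proof (rule ccontr)
    assume no: "\<not> ?thesis"
    have "0 < (\<Sum>w\<in>V - {x}. m w * \<phi> w (p v))"
    proof (rule sum_pos2[of _ v])
      show "0 \<le> m w * \<phi> w (p v)" if "w \<in> V - {x}" for w
      proof -
        have "\<phi> w (p v) \<ge> 0" using q[OF that] p[OF v] no that by (metis order_refl zero_le_one)
        then show ?thesis using m(1)[OF that] by simp
      qed
    qed (use finV v m(1)[OF v] q[OF v] in auto)
    then show False using m(2)[of "p v"] p[OF v] unfolding D_def by auto
  qed
  have pred: "\<exists>w\<in>V - {x}. p w = q v" if v: "v \<in> V - {x}" for v
  proof (rule ccontr)
    assume no: "\<not> ?thesis"
    have "0 < (\<Sum>w\<in>V - {x}. - (m w * \<phi> w (q v)))"
    proof (rule sum_pos2[of _ v])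
      show "0 \<le> - (m w * \<phi> w (q v))" if "w \<in> V - {x}" for w
      proof -
        have "\<phi> w (q v) \<le> 0" using q[OF that] q[OF v] no that by (metis order_refl neg_le_0_iff_le zero_le_one)
        then show ?thesis using m(1)[OF that] by (simp add: mult_nonneg_nonpos)
      qed
    qed (use finV v m(1)[OF v] q[OF v] in auto)
    then show False using m(2)[of "q v"] q[OF v] unfolding D_def by (auto simp: sum_negf)
  qed
  let ?R = "\<lambda>v w. E v w \<or> (v \<noteq> w \<and> E x v \<and> E x w)"
  have Rdeg: "2 \<le> card {w\<in>V - {x}. ?R v w}" if v: "v \<in> V - {x}" for v
  proof -
    obtain w1 w2 where w: "w1 \<in> V - {x}" "q w1 = p v" "w2 \<in> V - {x}" "p w2 = q v"
      using succ[OF v] pred[OF v] by blast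
    have ne: "v \<noteq> w1" "v \<noteq> w2" using q[OF v] w by auto
    have "ip D (\<phi> v) (\<phi> w1) < 0"
    proof -
      have "\<phi> w1 (q v) \<ge> 0" using q[OF w(1)] w q[OF v] by (metis order_refl zero_le_one)
      moreover have "\<phi> w1 (p v) = -1" using q[OF w(1)] w by auto
      ultimately show ?thesis using ipD[OF v, of "\<phi> w1"] by simp
    qed
    then have R1: "?R v w1" using ip_c[OF v w(1)] ne unfolding D_def by (auto simp: of_bool_def split: if_splits)
    have "ip D (\<phi> v) (\<phi> w2) < 0"
    proof -
      have "\<phi> w2 (p v) \<le> 0" using q[OF w(3)] w q[OF v] p[OF v] by (metis neg_le_0_iff_le order_refl zero_le_one)
      moreover have "\<phi> w2 (q v) = 1" using q[OF w(3)] w by auto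
      ultimately show ?thesis using ipD[OF v, of "\<phi> w2"] by simp
    qed
    then have R2: "?R v w2" using ip_c[OF v w(3)] ne unfolding D_def by (auto simp: of_bool_def split: if_splits)
    have "w1 \<noteq> w2" using nonopp[OF v w(1)] w by auto
    then have "card {w1, w2} = 2" by simp
    moreover have "{w1, w2} \<subseteq> {w\<in>V - {x}. ?R v w}" using w R1 R2 by auto
    ultimately show ?thesis using card_mono[of "{w\<in>V - {x}. ?R v w}" "{w1, w2}"] finV by simp
  qed
  \<comment> \<open>A neighbour of \<open>x\<close> loses its edge to \<open>x\<close> and gains
    edges to the other \<open>valx - 1\<close> neighbours.\<close>
  have deg: "int (card {w\<in>V - {x}. ?R v w}) = int (card {w\<in>V. E v w}) + (if E x v then int valx - 2 else 0)"
    if v: "v \<in> V - {x}" for v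
  proof (cases "E x v")
    case True
    have "{w\<in>V - {x}. ?R v w} = ({w\<in>V. E v w} - {x}) \<union> ({w\<in>V. E x w} - {v})"
      using True v E_irr by auto
    moreover have "({w\<in>V. E v w} - {x}) \<inter> ({w\<in>V. E x w} - {v}) = {}" using no_tri True v by auto
    ultimately have "card {w\<in>V - {x}. ?R v w} = card ({w\<in>V. E v w} - {x}) + card ({w\<in>V. E x w} - {v})"
      using finV by (simp add: card_Un_disjoint)
    moreover have "card {w\<in>V. E v w} = Suc (card ({w\<in>V. E v w} - {x}))"
      using finV True E_sym xV by (intro card.remove) auto
    moreover have "valx = Suc (card ({w\<in>V. E x w} - {v}))"
      using finV True v by (intro card.remove) auto
    ultimately show ?thesis using True by simp
  next
    case False
    have "{w\<in>V - {x}. ?R v w} = {w\<in>V. E v w}" using False E_sym by auto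
    then show ?thesis using False by simp
  qed
  have total: "(\<Sum>v\<in>V - {x}. int (card {w\<in>V - {x}. ?R v w})) = 2 * int (card (V - {x})) + int valx * int valx - 3 * int valx"
  proof -
    have "(\<Sum>v\<in>V - {x}. int (card {w\<in>V - {x}. ?R v w}))
        = (\<Sum>v\<in>V - {x}. int (card {w\<in>V. E v w})) + (\<Sum>v\<in>V - {x}. if E x v then int valx - 2 else 0)"
      using deg by (simp add: sum.distrib)
    also have "(\<Sum>v\<in>V - {x}. if E x v then int valx - 2 else 0) = (\<Sum>v\<in>{v\<in>V. E x v}. int valx - 2)"
      using finV E_irr by (intro sum.mono_neutral_cong_right) auto
    also have "\<dots> = int valx * (int valx - 2)" by simp
    also have "(\<Sum>v\<in>V - {x}. int (card {w\<in>V. E v w})) = (\<Sum>v\<in>V. int (card {w\<in>V. E v w})) - int valx"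
      using finV xV by (simp add: sum.remove)
    also have "(\<Sum>v\<in>V. int (card {w\<in>V. E v w})) = 2 * int (card V) - 2"
    proof -
      have "(\<Sum>v\<in>V. card {w\<in>V. E v w}) + 2 = 2 * card V" using tree by (simp add: tree_def)
      then have "int (\<Sum>v\<in>V. card {w\<in>V. E v w}) + 2 = 2 * int (card V)" by linarith
      then show ?thesis by simp
    qed
    finally have "(\<Sum>v\<in>V - {x}. int (card {w\<in>V - {x}. ?R v w}))
      = 2 * int (card V) - 2 - int valx + int valx * (int valx - 2)" .
    moreover have "int (card V) = int (card (V - {x})) + 1"
      using card.remove[OF finV xV] by linarith
    ultimately show ?thesis unfolding right_diff_distrib by linarith
  qed
  have ge: "2 * int (card (V - {x})) \<le> (\<Sum>v\<in>V - {x}. int (card {w\<in>V - {x}. ?R v w}))"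
    using sum_mono[of "V - {x}" "\<lambda>_. 2::int" "\<lambda>v. int (card {w\<in>V - {x}. ?R v w})"] Rdeg by fastforce
  have "int valx * int valx - 3 * int valx \<ge> 0" using ge total by linarith
  then have "int valx * (int valx - 3) \<ge> 0" by (simp add: algebra_simps)
  then show v3: "valx = 3" using valx_pos valx_le by (simp add: zero_le_mult_iff)
  have "(\<Sum>v\<in>V - {x}. int (card {w\<in>V - {x}. ?R v w}) - 2) = 0"
    using total v3 by (simp add: sum_subtractf)
  then have eq2: "card {w\<in>V - {x}. ?R v w} = 2" if "v \<in> V - {x}" for v
    using that Rdeg finV by (subst (asm) sum_nonneg_eq_0_iff) fastforce+
  have closed: "{w\<in>V - {x}. ?R v w} = {w\<in>V. E x w} - {v}" if "v \<in> V" "E x v" for v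
  proof (rule card_subset_eq[symmetric])
    show "finite {w\<in>V - {x}. ?R v w}" using finV by simp
    show "{w\<in>V. E x w} - {v} \<subseteq> {w\<in>V - {x}. ?R v w}" using that E_irr by auto
    have "valx = Suc (card ({w\<in>V. E x w} - {v}))"
      using finV that by (intro card.remove) auto
    moreover have "v \<in> V - {x}" using that E_irr by auto
    ultimately show "card ({w\<in>V. E x w} - {v}) = card {w\<in>V - {x}. ?R v w}" using eq2 v3 by simp
  qed
  show Veq: "V - {x} = {v\<in>V. E x v}"
  proof (rule ccontr)
    assume ne: "\<not> ?thesis"
    have "{v\<in>V. E x v} \<noteq> {}" using valx_pos card_gt_0_iff by blast
    moreover have "{v\<in>V. E x v} \<subseteq> V - {x}" using E_irr by auto
    ultimately obtain a b where ab: "a \<in> {v\<in>V. E x v}" "b \<in> V - {x} - {v\<in>V. E x v}" "ip (C - {c}) (\<phi> a) (\<phi> b) < 0"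
      using connD[OF con_c, of "{v\<in>V. E x v}"] ne by blast
    moreover have "a \<noteq> x" "a \<noteq> b" using ab E_irr by auto
    ultimately have "?R a b" using ip_c[of a b] by (auto simp: of_bool_def split: if_splits)
    then show False using closed[of a] ab by blast
  qed
  show "ip C (\<phi> v) (\<phi> v) = 3" if v: "v \<in> V - {x}" for v
  proof -
    have "E x v" using v Veq by blast
    then have "ip C (\<phi> v) (\<phi> v) = 1 + ip D (\<phi> v) (\<phi> v)"
      using ip_drop[of "\<phi> v" "\<phi> v"] hub[OF v] by (simp add: D_def)
    also have "ip D (\<phi> v) (\<phi> v) = 2" unfolding ipD[OF v] using q[OF v] by simp
    finally show ?thesis by simp
  qed
  show "ip C (\<phi> x) (\<phi> x) = 4"
  proof -
    obtain k where k: "k \<in> D" "\<phi> x k = -1" using f_exists unfolding D_def by blast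
    have inj: "inj_on p (V - {x})"
    proof (rule inj_onI)
      fix a b assume a: "a \<in> V - {x}" and b: "b \<in> V - {x}" and e: "p a = p b"
      have "p a \<in> C" using p[OF a] by (simp add: D_def)
      moreover have "\<phi> a (p a) = 1" "\<phi> b (p a) = 1" using q[OF a] q[OF b] e by auto
      ultimately show "a = b" using P_unique a b by blast
    qed
    have cV: "card (V - {x}) = 3" using v3 Veq by simp
    have cD: "card D = 3" using cV cardC card.remove[OF finV xV] card.remove[OF finC cC] unfolding D_def by linarith
    have pD: "p ` (V - {x}) = D"
      using p inj cV cD finD by (intro card_subset_eq) (auto simp: card_image)
    \<comment> \<open>Orthogonality to a root makes f equal at its two ends, hence constant on the
      cycle formed by the three roots. So f has three entries \<open>-1\<close>, and
      \<open>x\<close> has norm \<open>4\<close>.\<close>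
    have fq: "\<phi> x (q v) = \<phi> x (p v)" if "v \<in> V - {x}" for v
      using f_orth[OF that] ipD[OF that, of "\<phi> x"] by (simp add: D_def ip_commute)
    obtain v1 where v1: "v1 \<in> V - {x}" "p v1 = k" using pD k by blast
    obtain v2 where v2: "v2 \<in> V - {x}" "p v2 = q v1" using pred[OF v1(1)] by blast
    have d: "q v2 \<noteq> p v1" "q v2 \<noteq> q v1" "q v1 \<noteq> p v1"
      using nonopp[OF v1(1) v2(1)] v2 q[OF v2(1)] q[OF v1(1)] by auto
    have all: "{p v1, q v1, q v2} = D"
      using d cD finD q[OF v1(1)] p[OF v1(1)] q[OF v2(1)] by (intro card_subset_eq) auto
    have "\<phi> x k' = -1" if "k' \<in> D" for k'
      using that k v1 v2 fq[OF v1(1)] fq[OF v2(1)] unfolding all[symmetric] by auto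
    then have "{k\<in>C - {c}. \<phi> x k = -1} = D" by (auto simp: D_def)
    then show ?thesis using row_count(2)[OF finC cC, of "\<phi> x"] x_other xc cD by simp
  qed
qed

end

section \<open>Hubs with a neighbour of norm 2\<close>

context hub begin

text \<open>Row sums are at most \<open>0\<close>, so one becomes positive only by losing an entry
  \<open>-1\<close> in column \<open>c\<close> from a row of sum \<open>0\<close>. Such a row is
  \<open>E_p - E_c\<close> and adjacent to \<open>x\<close>.\<close>

lemma root_vertex:
  assumes u: "u \<in> V - {x}" "(\<Sum>k\<in>C - {c}. \<phi> u k) > 0"
  obtains p where "p \<in> C" "p \<noteq> c" "\<phi> u p = 1" "\<phi> u c = -1" "E x u" "ip C (\<phi> u) (\<phi> u) = 2"
    "\<And>y. ip C (\<phi> u) y = y p - y c"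
proof -
  have uV: "u \<in> V" using u by simp
  have c: "\<phi> u c = -1" "E x u"
    using hub[OF u(1)] sum_drop[of "\<phi> u"] sum_le_0[OF uV] u(2) by (auto simp: of_bool_def split: if_splits)
  then have "(\<Sum>k\<in>C. \<phi> u k) = 0" using sum_drop[of "\<phi> u"] sum_le_0[OF uV] u(2) by linarith
  then have n2: "ip C (\<phi> u) (\<phi> u) = 2" using norm_sum[OF uV] by simp
  obtain p where p: "p \<in> C" "p \<noteq> c" "\<phi> u p = 1" "\<And>k. k \<in> C \<Longrightarrow> k \<noteq> p \<Longrightarrow> k \<noteq> c \<Longrightarrow> \<phi> u k = 0"
    using norm_2[OF uV n2 cC c(1)] by blast
  have "ip C (\<phi> u) y = y p - y c" for y
  proof -
    have "ip C (\<phi> u) y = (\<Sum>k\<in>{p, c}. \<phi> u k * y k)"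
      unfolding ip_def using p cC finC by (intro sum.mono_neutral_right) auto
    then show ?thesis using p c by simp
  qed
  then show thesis using that p c n2 by blast
qed

lemma colsum_other:
  assumes "valx = 3" "k \<in> C" "k \<noteq> c" shows "colsum k = 0 \<or> colsum k = -1"
proof -
  obtain e where e: "e \<in> C" "\<And>k. k \<in> C \<Longrightarrow> k \<noteq> e \<Longrightarrow> colsum k = 0 \<or> colsum k = -1"
    using exceptional by metis
  have "e = c" using e(2)[OF cC] colsum_c assms(1) by auto
  then show ?thesis using e(2) assms by auto
qed

text \<open>A column has at most one entry \<open>1\<close>, so outside \<open>A\<close> all entries
  are nonpositive; their sum is at least \<open>0\<close>, because \<open>A\<close> already uses up
  the allowed \<open>-1\<close>.\<close>

lemma column_rest:
  assumes k: "k \<in> C" "colsum k \<ge> -1" and A: "A \<subseteq> V" "(\<Sum>v\<in>A. \<phi> v k) = -1" "a \<in> A" "\<phi> a k = 1"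
    and z: "z \<in> V - A"
  shows "\<phi> z k = 0"
proof -
  have le: "\<phi> v k \<le> 0" if "v \<in> V - A" for v
  proof -
    have "\<phi> v k \<noteq> 1" using P_unique[of v a k] that k A by auto
    then show ?thesis using entries[of v k] that k by auto
  qed
  have "colsum k = (\<Sum>v\<in>V - A. \<phi> v k) + (\<Sum>v\<in>A. \<phi> v k)"
    unfolding colsum_def by (rule sum.subset_diff[OF A(1) finV])
  then have "(\<Sum>v\<in>V - A. - \<phi> v k) \<le> 0" using k A by (simp add: sum_negf)
  moreover have "(\<Sum>v\<in>V - A. - \<phi> v k) \<ge> 0" using le by (intro sum_nonneg) auto
  ultimately have "(\<Sum>v\<in>V - A. - \<phi> v k) = 0" by linarith
  then show ?thesis using z le finV by (subst (asm) sum_nonneg_eq_0_iff) auto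
qed

text \<open>At valency \<open>3\<close> column \<open>c\<close> is exceptional, so all other columns
  have sum \<open>0\<close> or \<open>-1\<close>. This confines column \<open>p\<close> to the three
  neighbours of \<open>x\<close>, and after deleting \<open>x\<close>, \<open>u\<close>,
  \<open>c\<close>, \<open>p\<close> the Perron-type argument applies again. If no row sum is
  positive, \<open>l2\<close> and \<open>l3\<close> have become opposite roots (\<open>T_b\<close>).
  Otherwise one of them is \<open>E_a - E_c - E_p\<close>, which forces the entry \<open>-2\<close>
  in the other, and one more deletion shows that the latter has only the entries \<open>-2\<close>,
  \<open>-1\<close>, \<open>-1\<close> (\<open>T_c\<close>).\<close>

lemma triple_case:
  assumes v3: "valx = 3" and u: "u \<in> V - {x}" "(\<Sum>k\<in>C - {c}. \<phi> u k) > 0"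
  shows "\<exists>l l'. distinct [x, u, l, l'] \<and> V = {x, u, l, l'} \<and> {v\<in>V. E x v} = {u, l, l'} \<and> ip C (\<phi> u) (\<phi> u) = 2 \<and>
    (ip C (\<phi> l) (\<phi> l) = 4 \<and> ip C (\<phi> l') (\<phi> l') = 4 \<and> ip C (\<phi> x) (\<phi> x) = 3 \<or>
     ip C (\<phi> l) (\<phi> l) = 3 \<and> ip C (\<phi> l') (\<phi> l') = 6 \<and> ip C (\<phi> x) (\<phi> x) = 2)"
proof -
  obtain p where p: "p \<in> C" "p \<noteq> c" "\<phi> u p = 1" "\<phi> u c = -1" "E x u" "ip C (\<phi> u) (\<phi> u) = 2"
    "\<And>y. ip C (\<phi> u) y = y p - y c" using root_vertex[OF u] by blast
  have uN: "u \<in> {v\<in>V. E x v}" using p u by simp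
  have "card ({v\<in>V. E x v} - {u}) = 2" using v3 uN finV by simp
  then obtain l2 l3 where l: "{v\<in>V. E x v} - {u} = {l2, l3}" "l2 \<noteq> l3" by (auto simp: card_2_iff)
  have N: "{v\<in>V. E x v} = {u, l2, l3}" using l uN by blast
  have lV: "l2 \<in> V" "l3 \<in> V" "E x l2" "E x l3" "l2 \<noteq> u" "l3 \<noteq> u" using l(1) by blast+
  have lx: "l2 \<noteq> x" "l3 \<noteq> x" "u \<noteq> x" using lV p E_irr by metis+
  have lc: "\<phi> l2 c = -1" "\<phi> l3 c = -1" using hub_adj lV by auto
  have lp: "\<phi> l p = -1" if "l \<in> {l2, l3}" for l
    using pair[of u l] p(7)[of "\<phi> l"] no_tri[of u l] that lV lc p(5) u by auto
  have xp: "\<phi> x p = 0" using pair[of u x] p(7)[of "\<phi> x"] p(5) u xV xc E_sym by auto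
  have zp: "\<phi> z p = 0" if "z \<in> V - {u, l2, l3}" for z
  proof (rule column_rest[OF p(1) _ _ _ _ p(3) that])
    show "- 1 \<le> colsum p" using colsum_other[OF v3 p(1,2)] by auto
    show "(\<Sum>v\<in>{u, l2, l3}. \<phi> v p) = -1" using lp p(3) lV l(2) by auto
  qed (use lV u in auto)
  have zc: "\<phi> z c = 0" if "z \<in> V - {x, u, l2, l3}" for z using hub[of z] that N by auto
  define W where "W = V - {x} - {u}"
  define D where "D = C - {c} - {p}"
  have finD: "finite D" and finW: "finite W" using finC finV by (auto simp: D_def W_def)
  have cardWD: "card D = card W"
    using cardC finC finV cC p xV u by (simp add: D_def W_def)
  have ipD: "ip (C - {c}) y y' = y p * y' p + ip D y y'" for y y'
    using finC p unfolding D_def ip_def by (intro sum.remove) auto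
  have sumD: "(\<Sum>k\<in>C. y k) = y c + y p + (\<Sum>k\<in>D. y k)" for y :: "nat \<Rightarrow> int"
    using sum_drop[of y] finC p sum.remove[of "C - {c}" p y] by (simp add: D_def)
  have ple: "\<phi> z p \<le> 0" if "z \<in> W" for z using zp[of z] lp[of z] that by (cases "z \<in> {l2, l3}") (auto simp: W_def)
  have offle: "ip D (\<phi> z) (\<phi> w) \<le> ip (C - {c}) (\<phi> z) (\<phi> w)" if "z \<in> W" "w \<in> W" for z w
    using ipD[of "\<phi> z" "\<phi> w"] ple[OF that(1)] ple[OF that(2)] mult_nonpos_nonpos[of "\<phi> z p" "\<phi> w p"] by linarith
  have offD: "ip D (\<phi> z) (\<phi> w) \<le> 0" if "z \<in> W" "w \<in> W" "z \<noteq> w" for z w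
    using offle[OF that(1,2)] off_c[of z w] that by (auto simp: W_def)
  \<comment> \<open>The two rows are orthogonal and share the entry \<open>-1\<close> in both
    deleted columns.\<close>
  have l23: "ip D (\<phi> l2) (\<phi> l3) = -2"
    using ip_c[of l2 l3] ipD[of "\<phi> l2" "\<phi> l3"] lp lV lx l(2) no_tri[of l2 l3] by auto
  have Ru: "z \<in> {l2, l3}" if "z \<in> V - {x} - {u}" "ip (C - {c}) (\<phi> u) (\<phi> z) < 0" for z
  proof (rule ccontr)
    assume z: "z \<notin> {l2, l3}"
    then have "ip C (\<phi> u) (\<phi> z) = 0" "\<phi> z c = 0" using p(7) zp[of z] zc[of z] that by auto
    then show False using ip_drop[of "\<phi> u" "\<phi> z"] that by simp
  qed
  have conD: "conn W (\<lambda>z w. ip D (\<phi> z) (\<phi> w) < 0)"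
    unfolding W_def
  proof (rule conn_remove[OF con_c _ u(1)])
    fix z w assume zw: "z \<in> V - {x} - {u}" "w \<in> V - {x} - {u}"
    show "ip D (\<phi> z) (\<phi> w) < 0" if "ip (C - {c}) (\<phi> z) (\<phi> w) < 0"
      using offle[of z w] zw that by (simp add: W_def)
    show "ip D (\<phi> z) (\<phi> w) < 0" if "z \<noteq> w" "ip (C - {c}) (\<phi> u) (\<phi> z) < 0" "ip (C - {c}) (\<phi> u) (\<phi> w) < 0"
      using Ru[OF zw(1) that(2)] Ru[OF zw(2) that(3)] that(1) l23 ip_commute[of D "\<phi> l2"] by auto
  qed (simp add: ip_commute)
  obtain k where k: "k \<in> C" "k \<noteq> c" "\<phi> x k = -1" using f_exists by blast
  have kD: "k \<in> D" using k xp by (auto simp: D_def)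
  have orthD: "ip D (\<phi> x) (\<phi> z) = 0" if "z \<in> W" for z
    using f_orth[of z] ipD[of "\<phi> x" "\<phi> z"] xp that by (simp add: W_def)
  have fset: "{j\<in>C - {c}. \<phi> x j = -1} = {j\<in>D. \<phi> x j = -1}" using xp by (auto simp: D_def)
  have normx: "ip C (\<phi> x) (\<phi> x) = 1 + int (card {j\<in>D. \<phi> x j = -1})"
    using row_count(2)[OF finC cC, of "\<phi> x"] x_other xc fset by simp
  obtain m where m: "\<exists>v\<in>W. m v \<noteq> 0" "\<forall>j\<in>D. (\<Sum>v\<in>W. m v * \<phi> v j) = 0"
    using orth_dependence[of D W k "\<phi> x" \<phi>] finD finW cardWD kD k orthD by auto
  have m0: "m v \<noteq> 0" if "v \<in> W" for v
    using null_full[OF finW finD offD conD _ m(1) that] m(2) by auto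
  have Wl: "l2 \<in> W" "l3 \<in> W" using lV lx by (auto simp: W_def)
  have sumW: "(\<Sum>j\<in>D. \<phi> z j) \<le> 0" if "z \<in> W - {l2, l3}" for z
    using sumD[of "\<phi> z"] zc[of z] zp[of z] sum_le_0[of z] that by (auto simp: W_def)
  show ?thesis
  proof (cases "\<forall>z\<in>W. (\<Sum>j\<in>D. \<phi> z j) \<le> 0")
    case True
    have z0: "(\<Sum>j\<in>D. \<phi> z j) = 0" if "z \<in> W" for z
      by (rule null_row_sums[where m = m and V = W and C = D])
        (use finD finW offD m(2) True that m0[OF that] in auto)
    have n4: "ip C (\<phi> l) (\<phi> l) = 4" if "l \<in> {l2, l3}" for l
      using norm_sum[of l] sumD[of "\<phi> l"] z0[of l] lc lp[OF that] that Wl lV by auto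
    have nD: "ip D (\<phi> l) (\<phi> l) = 2" if "l \<in> {l2, l3}" for l
      using n4[OF that] ip_drop[of "\<phi> l" "\<phi> l"] ipD[of "\<phi> l" "\<phi> l"] lc lp[OF that] that by auto
    \<comment> \<open>Norms \<open>2\<close> and \<open>2\<close> with product \<open>-2\<close> are
      the equality case of Cauchy-Schwarz, so the vectors are opposite.\<close>
    have "(\<Sum>j\<in>D. (\<phi> l2 j + \<phi> l3 j) * (\<phi> l2 j + \<phi> l3 j)) = 0"
      using nD[of l2] nD[of l3] l23 by (simp add: ip_def algebra_simps sum.distrib sum_distrib_left[symmetric])
    then have opp: "\<phi> l3 j = - \<phi> l2 j" if "j \<in> D" for j
      using that finD by (subst (asm) sum_nonneg_eq_0_iff) (auto simp: eq_neg_iff_add_eq_0 add.commute)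
    \<comment> \<open>A further row would have nonpositive product with both of two opposite
      vectors, hence be orthogonal to both, against connectedness.\<close>
    have "W = {l2, l3}"
    proof (rule ccontr)
      assume "W \<noteq> {l2, l3}"
      then obtain a z where az: "a \<in> {l2, l3}" "z \<in> W - {l2, l3}" "ip D (\<phi> a) (\<phi> z) < 0"
        using connD[OF conD, of "{l2, l3}"] Wl by blast
      have "ip D (\<phi> l3) (\<phi> z) = - ip D (\<phi> l2) (\<phi> z)"
        using opp by (simp add: ip_def sum_negf[symmetric])
      then show False using offD[of l2 z] offD[of l3 z] az Wl by auto
    qed
    then have V: "V = {x, u, l2, l3}" using xV u by (auto simp: W_def)
    have "card D = 2" using cardWD \<open>W = {l2, l3}\<close> l(2) by simp
    then obtain a b where ab: "D = {a, b}" "a \<noteq> b" by (auto simp: card_2_iff)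
    have s: "\<phi> l2 a + \<phi> l2 b = 0" using z0[OF Wl(1)] ab by simp
    have n: "\<phi> l2 a * \<phi> l2 a + \<phi> l2 b * \<phi> l2 b = 2" using nD[of l2] ab by (simp add: ip_def)
    have o: "\<phi> x a * \<phi> l2 a + \<phi> x b * \<phi> l2 b = 0" using orthD[OF Wl(1)] ab by (simp add: ip_def)
    have b: "\<phi> l2 b = - \<phi> l2 a" using s by simp
    have "\<phi> l2 a \<noteq> 0" using n b by auto
    then have "\<phi> x a = \<phi> x b" using o unfolding b by simp
    then have "{j\<in>D. \<phi> x j = -1} = D" using kD k ab by auto
    then have "ip C (\<phi> x) (\<phi> x) = 3" using normx \<open>card D = 2\<close> by simp
    moreover have "distinct [x, u, l2, l3]" using lx lV(5,6) l(2) by simp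
    moreover have "ip C (\<phi> l2) (\<phi> l2) = 4" "ip C (\<phi> l3) (\<phi> l3) = 4" using n4 by blast+
    ultimately show ?thesis using V N p(6) by blast
  next
    case False
    then obtain l where l0: "l \<in> W" "(\<Sum>j\<in>D. \<phi> l j) > 0" by (auto simp: not_le)
    then have ll: "l \<in> {l2, l3}" using sumW by force
    then obtain l' where l': "{l, l'} = {l2, l3}" "l \<noteq> l'" using l(2) by blast
    have l'l: "l' \<in> {l2, l3}" using l' by blast
    have lV': "l \<in> V" "l' \<in> V" "E x l" "E x l'" using lV ll l'l by auto
    have lcp: "\<phi> l c = -1" "\<phi> l p = -1" "\<phi> l' c = -1" "\<phi> l' p = -1" using lc lp ll l'l by auto
    obtain a where a: "a \<in> C" "\<phi> l a = 1 \<or> \<phi> l a = -2" "\<And>k. k \<in> C \<Longrightarrow> k \<noteq> a \<Longrightarrow> \<phi> l k = 0 \<or> \<phi> l k = -1"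
      using lead[OF lV'(1)] by blast
    have acp: "a \<noteq> c" "a \<noteq> p" using a(2) lcp by auto
    then have aD: "a \<in> D" using a(1) by (simp add: D_def)
    let ?J = "{k\<in>C - {a}. \<phi> l k = -1}"
    have J: "{c, p} \<subseteq> ?J" using lcp cC p acp by auto
    have fJ: "finite ?J" using finC by simp
    have cJ: "card ?J \<ge> 2" using card_mono[OF fJ J] p(2) by simp
    have "ip C (\<phi> l) (\<phi> l) \<le> 3"
      using norm_sum[OF lV'(1)] sumD[of "\<phi> l"] lcp l0(2) by simp
    moreover have nl: "ip C (\<phi> l) (\<phi> l) = \<phi> l a * \<phi> l a + int (card ?J)"
      by (rule row_count(2)[OF finC a(1,3)])
    ultimately have la: "\<phi> l a = 1" using a(2) cJ by auto
    then have "card ?J = 2" and nl3: "ip C (\<phi> l) (\<phi> l) = 3"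
      using nl cJ \<open>ip C (\<phi> l) (\<phi> l) \<le> 3\<close> by auto
    then have Jeq: "?J = {c, p}" using card_subset_eq[OF fJ J] p(2) by simp
    have l_0: "\<phi> l k = 0" if "k \<in> C - {a, c, p}" for k
    proof -
      have "k \<notin> ?J" using Jeq that by blast
      then show ?thesis using a(3)[of k] that by auto
    qed
    have ipl: "ip C (\<phi> l) y = y a - y c - y p" for y
    proof -
      have "ip C (\<phi> l) y = (\<Sum>k\<in>{a, c, p}. \<phi> l k * y k)"
        unfolding ip_def using l_0 a(1) cC p finC by (intro sum.mono_neutral_right) auto
      then show ?thesis using la lcp acp p(2) by simp
    qed
    \<comment> \<open>As \<open>\<phi> l\<close> is \<open>E_a - E_c - E_p\<close>, orthogonality
      reads \<open>\<phi> l' a = \<phi> l' c + \<phi> l' p\<close>, which is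
      \<open>-2\<close>.\<close>
    have "ip C (\<phi> l) (\<phi> l') = 0" using pair[of l l'] lV' l' no_tri by auto
    then have l'a: "\<phi> l' a = -2" using ipl[of "\<phi> l'"] lcp by simp
    have za: "\<phi> z a = 0" if "z \<in> V - {l, l'}" for z
    proof (rule column_rest[OF a(1) _ _ _ _ la that])
      show "- 1 \<le> colsum a" using colsum_other[OF v3 a(1) acp(1)] by auto
      show "(\<Sum>v\<in>{l, l'}. \<phi> v a) = -1" using la l'a l'(2) by simp
    qed (use lV' in auto)
    have lx': "l \<noteq> x" "l' \<noteq> x" "l \<noteq> u" "l' \<noteq> u" using lx lV ll l'l by auto
    have Wl': "l' \<in> W" using lV' lx' by (simp add: W_def)
    define W2 where "W2 = W - {l}"
    define D2 where "D2 = D - {a}"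
    have fin2: "finite D2" "finite W2" using finD finW by (auto simp: D2_def W2_def)
    have card2: "card D2 = card W2" using cardWD finD finW aD l0 by (simp add: D2_def W2_def)
    have ip2: "ip D y y' = y a * y' a + ip D2 y y'" for y y'
      using finD aD unfolding D2_def ip_def by (intro sum.remove) auto
    have za2: "\<phi> z a = 0" if "z \<in> W2" "z \<noteq> l'" for z using za that by (auto simp: W2_def W_def)
    have eq2: "ip D2 (\<phi> z) (\<phi> w) = ip D (\<phi> z) (\<phi> w)" if "z \<in> W2" "w \<in> W2" "z \<noteq> w" for z w
      using ip2[of "\<phi> z" "\<phi> w"] za2 that by (cases "z = l'") auto
    have off2: "ip D2 (\<phi> z) (\<phi> w) \<le> 0" if "z \<in> W2" "w \<in> W2" "z \<noteq> w" for z w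
      using eq2[OF that] offD[of z w] that by (simp add: W2_def)
    have ale: "\<phi> z a \<le> 0" if "z \<in> W2" for z using za2[OF that] l'a by (cases "z = l'") auto
    have con2: "conn W2 (\<lambda>z w. ip D2 (\<phi> z) (\<phi> w) < 0)"
      unfolding W2_def
    proof (rule conn_remove[OF conD _ l0(1)])
      fix z w assume zw: "z \<in> W - {l}" "w \<in> W - {l}"
      show "ip D2 (\<phi> z) (\<phi> w) < 0" if "ip D (\<phi> z) (\<phi> w) < 0"
        using ip2[of "\<phi> z" "\<phi> w"] ale[of z] ale[of w] mult_nonpos_nonpos[of "\<phi> z a" "\<phi> w a"] zw that
        by (simp add: W2_def)
      have Rl: "y = l'" if "y \<in> W - {l}" "ip D (\<phi> l) (\<phi> y) < 0" for y
      proof -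
        have "ip D (\<phi> l) (\<phi> y) = \<phi> y a"
        proof -
          have "ip D (\<phi> l) (\<phi> y) = (\<Sum>k\<in>{a}. \<phi> l k * \<phi> y k)"
            unfolding ip_def using l_0 aD finD by (intro sum.mono_neutral_right) (auto simp: D_def)
          then show ?thesis using la by simp
        qed
        then show ?thesis using za2[of y] that by (auto simp: W2_def)
      qed
      show "ip D2 (\<phi> z) (\<phi> w) < 0" if "z \<noteq> w" "ip D (\<phi> l) (\<phi> z) < 0" "ip D (\<phi> l) (\<phi> w) < 0"
        using Rl[OF zw(1) that(2)] Rl[OF zw(2) that(3)] that(1) by simp
    qed (simp add: ip_commute)
    have xa: "\<phi> x a = 0" using za[of x] xV lx' by auto
    have kD2: "k \<in> D2" using kD k xa by (auto simp: D2_def)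
    have orth2: "ip D2 (\<phi> x) (\<phi> z) = 0" if "z \<in> W2" for z
      using orthD[of z] ip2[of "\<phi> x" "\<phi> z"] xa that by (simp add: W2_def)
    obtain m2 where m2: "\<exists>v\<in>W2. m2 v \<noteq> 0" "\<forall>j\<in>D2. (\<Sum>v\<in>W2. m2 v * \<phi> v j) = 0"
      using orth_dependence[of D2 W2 k "\<phi> x" \<phi>] fin2 card2 kD2 k orth2 by auto
    have Wl2: "l' \<in> W2" using Wl' l' by (auto simp: W2_def)
    have m2l: "m2 l' \<noteq> 0"
      using null_full[OF fin2(2,1) off2 con2 _ m2(1) Wl2] m2(2) by auto
    let ?J' = "{k\<in>C - {a}. \<phi> l' k = -1}"
    have oth': "\<phi> l' k = 0 \<or> \<phi> l' k = -1" if "k \<in> C" "k \<noteq> a" for k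
      using other_entries[OF lV'(2) a(1) _ that] l'a by blast
    have s': "(\<Sum>k\<in>C. \<phi> l' k) = -2 - int (card ?J')"
      using row_count(1)[OF finC a(1), of "\<phi> l'"] oth' l'a by simp
    have J': "{c, p} \<subseteq> ?J'" using lcp cC p acp by auto
    have fJ': "finite ?J'" using finC by simp
    have cJ': "card ?J' \<ge> 2" using card_mono[OF fJ' J'] p(2) by simp
    have sum2: "(\<Sum>j\<in>D. y j) = y a + (\<Sum>j\<in>D2. y j)" for y :: "nat \<Rightarrow> int"
      using finD aD by (simp add: D2_def sum.remove)
    have sl': "(\<Sum>j\<in>D2. \<phi> l' j) = 2 - int (card ?J')"
      using s' sumD[of "\<phi> l'"] sum2[of "\<phi> l'"] lcp l'a by simp
    have le2: "(\<Sum>j\<in>D2. \<phi> z j) \<le> 0" if "z \<in> W2" for z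
    proof (cases "z = l'")
      case False
      then have "z \<in> W - {l2, l3}" using that l' by (auto simp: W2_def)
      then show ?thesis using sumW[of z] sum2[of "\<phi> z"] za2[OF that False] by simp
    qed (use sl' cJ' in simp)
    have "(\<Sum>j\<in>D2. \<phi> l' j) = 0"
      by (rule null_row_sums[where m = m2 and V = W2 and C = D2])
        (use fin2 off2 m2(2) le2 Wl2 m2l in auto)
    then have cJ2: "card ?J' = 2" using sl' by simp
    then have J'eq: "?J' = {c, p}" using card_subset_eq[OF fJ' J'] p(2) by simp
    have l'0: "\<phi> l' k = 0" if "k \<in> D2" for k
    proof -
      have "k \<notin> ?J'" using J'eq that by (auto simp: D2_def D_def)
      then show ?thesis using oth'[of k] that by (auto simp: D2_def D_def)
    qed
    have n6: "ip C (\<phi> l') (\<phi> l') = 6"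
      using norm_sum[OF lV'(2)] s' cJ2 by simp
    have W2eq: "W2 = {l'}"
    proof (rule ccontr)
      assume "W2 \<noteq> {l'}"
      then obtain z where "z \<in> W2 - {l'}" "ip D2 (\<phi> l') (\<phi> z) < 0"
        using connD[OF con2, of "{l'}"] Wl2 by blast
      then show False using l'0 by (simp add: ip_def)
    qed
    then have V: "V = {x, u, l, l'}" using xV u l0 by (auto simp: W_def W2_def)
    have "card D2 = 1" using card2 W2eq by simp
    then have "D2 = {k}" using kD2 by (metis card_1_singletonE singletonD)
    moreover have "{j\<in>D. \<phi> x j = -1} = {j\<in>D2. \<phi> x j = -1}" using xa by (auto simp: D2_def)
    ultimately have "{j\<in>D. \<phi> x j = -1} = {k}" using k by auto
    then have "ip C (\<phi> x) (\<phi> x) = 2" using normx by simp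
    moreover have "{v\<in>V. E x v} = {u, l, l'}" using N l' by simp
    moreover have "distinct [x, u, l, l']" using lx lx' l'(2) by simp
    ultimately show ?thesis using V p(6) nl3 n6 by blast
  qed
qed

text \<open>Inverse of a blow-up. The edge \<open>x u\<close> is contracted, column \<open>c\<close>
  disappears, and \<open>x\<close> trades its entry \<open>1\<close> in column \<open>c\<close> for
  one in column \<open>p\<close> of \<open>u = E_p - E_c\<close>, which keeps its norm. Valency at
  most \<open>2\<close> means that besides \<open>x\<close> and \<open>u\<close> at most one row has
  an entry in column \<open>c\<close>, so no product among the other rows changes.\<close>

lemma merge_hub:
  assumes u: "u \<in> V - {x}" "(\<Sum>k\<in>C - {c}. \<phi> u k) > 0" and v2: "valx \<le> 2"
    and E': "E' = (\<lambda>z w. E z w \<or> (z = x \<and> E u w \<and> w \<noteq> x) \<or> (w = x \<and> E u z \<and> z \<noteq> x))"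
  obtains p \<phi>' where "hub (V - {u}) (C - {c}) E' \<phi>' x p" "E x u"
    "ip C (\<phi> u) (\<phi> u) = 2" "ip C (\<phi> x) (\<phi> x) = ip (C - {c}) (\<phi>' x) (\<phi>' x)"
    "\<And>z. z \<in> V - {u, x} \<Longrightarrow> ip C (\<phi> z) (\<phi> z) = ip (C - {c}) (\<phi>' z) (\<phi>' z) + of_bool (E x z)"
proof -
  obtain p where p: "p \<in> C" "p \<noteq> c" "\<phi> u p = 1" "\<phi> u c = -1" "E x u" "ip C (\<phi> u) (\<phi> u) = 2"
    "\<And>y. ip C (\<phi> u) y = y p - y c" using root_vertex[OF u] by blast
  define \<phi>' where "\<phi>' = \<phi>(x := (\<phi> x)(p := 1))"
  have uV: "u \<in> V" "u \<noteq> x" using u by auto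
  have xp: "\<phi> x p = 0" using pair[of u x] p(7)[of "\<phi> x"] p(5) uV xV xc E_sym by auto
  have uniq: "z = w" if "z \<in> V - {u}" "w \<in> V - {u}" "E x z" "E x w" for z w
  proof (rule ccontr)
    assume "z \<noteq> w"
    then have "card {u, z, w} = 3" using that by auto
    moreover have "{u, z, w} \<subseteq> {v\<in>V. E x v}" using that p uV by auto
    ultimately show False using card_mono[of "{v\<in>V. E x v}" "{u, z, w}"] finV v2 by auto
  qed
  have pz: "\<phi> z p = - of_bool (E u z \<or> E x z)" if "z \<in> V - {u, x}" for z
  proof -
    have "- of_bool (E u z) = \<phi> z p - \<phi> z c" using pair[of u z] p(7)[of "\<phi> z"] that uV by auto
    moreover have "\<not> (E u z \<and> E x z)" using no_tri[of u z] p(5) uV that by auto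
    ultimately show ?thesis using hub[of z] that by (auto simp: of_bool_def split: if_splits)
  qed
  have zz: "\<phi>' z = \<phi> z" if "z \<noteq> x" for z using that by (simp add: \<phi>'_def)
  have ipx: "ip (C - {c}) (\<phi>' x) y = ip C (\<phi> x) y - y c + y p" for y
  proof -
    have "ip (C - {c}) (\<phi>' x) y = y p + (\<Sum>k\<in>C - {c} - {p}. \<phi> x k * y k)"
      using finC p by (simp add: ip_def \<phi>'_def sum.remove)
    moreover have "ip (C - {c}) (\<phi> x) y = \<phi> x p * y p + (\<Sum>k\<in>C - {c} - {p}. \<phi> x k * y k)"
      using finC p unfolding ip_def by (intro sum.remove) auto
    ultimately show ?thesis using ip_drop[of "\<phi> x" y] xc xp by simp
  qed
  have normx: "ip C (\<phi> x) (\<phi> x) = ip (C - {c}) (\<phi>' x) (\<phi>' x)"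
  proof -
    have "ip C (\<phi> x) (\<phi>' x) = ip C (\<phi> x) (\<phi> x)"
      unfolding ip_def using xp by (intro sum.cong) (auto simp: \<phi>'_def)
    then show ?thesis using ipx[of "\<phi>' x"] p xc by (simp add: \<phi>'_def)
  qed
  have norm: "ip C (\<phi> z) (\<phi> z) = ip (C - {c}) (\<phi>' z) (\<phi>' z) + of_bool (E x z)" if "z \<in> V - {u, x}" for z
    using ip_drop[of "\<phi> z" "\<phi> z"] hub[of z] zz that by auto
  have "emb (V - {u}) (C - {c}) E' \<phi>'"
  proof
    show "tree (V - {u}) E'"
      by (rule tree_contract[OF tree uV(1) xV]) (use p E_sym E_irr uV in \<open>auto simp: E'\<close>)
    show "finite (C - {c})" using finC by simp
    show "card (C - {c}) = card (V - {u})" using cardC finC finV cC uV by simp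
    fix z assume z: "z \<in> V - {u}"
    show "(\<Sum>k\<in>C - {c}. \<phi>' z k * (\<phi>' z k + 1)) = 2"
    proof (cases "z = x")
      case True
      have "(\<Sum>k\<in>C - {c}. \<phi>' x k * (\<phi>' x k + 1)) = 2 + (\<Sum>k\<in>C - {c} - {p}. \<phi> x k * (\<phi> x k + 1))"
        using finC p by (simp add: \<phi>'_def sum.remove)
      moreover have "(\<Sum>k\<in>C - {c}. \<phi> x k * (\<phi> x k + 1)) = 0 + (\<Sum>k\<in>C - {c} - {p}. \<phi> x k * (\<phi> x k + 1))"
        using finC p xp by (simp add: sum.remove)
      ultimately show ?thesis using row[OF xV] sum_drop[of "\<lambda>k. \<phi> x k * (\<phi> x k + 1)"] xc True by simp
    next
      case False
      then have "\<phi> z c * (\<phi> z c + 1) = 0" using hub[of z] z by (cases "E x z") auto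
      then have "(\<Sum>k\<in>C - {c}. \<phi> z k * (\<phi> z k + 1)) = 2"
        using row[of z] sum_drop[of "\<lambda>k. \<phi> z k * (\<phi> z k + 1)"] DiffD1[OF z] by linarith
      then show ?thesis using zz[OF False] by simp
    qed
    show "ip (C - {c}) (\<phi>' z) (\<phi>' z) \<noteq> 1"
    proof (cases "z = x")
      case True then show ?thesis using normx norm_ne_1[OF xV] by simp
    next
      case False
      then have zV: "z \<in> V - {u, x}" using z by auto
      show ?thesis
      proof (cases "E x z")
        case True
        have c1: "\<phi> z c = -1" "\<phi> z p = -1" using hub_adj[of z] pz[OF zV] True z by auto
        \<comment> \<open>The row has entries \<open>-1\<close> in both \<open>c\<close> and
          \<open>p\<close>, too many for norm \<open>2\<close>; so its norm does not drop to
          \<open>1\<close>.\<close>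
        have "ip C (\<phi> z) (\<phi> z) \<noteq> 2"
        proof
          assume n2: "ip C (\<phi> z) (\<phi> z) = 2"
          obtain a where "a \<in> C" "a \<noteq> c" "\<phi> z a = 1" "\<And>k. k \<in> C \<Longrightarrow> k \<noteq> a \<Longrightarrow> k \<noteq> c \<Longrightarrow> \<phi> z k = 0"
            using norm_2[OF _ n2 cC c1(1)] z by blast
          then have "\<phi> z p \<in> {0, 1}" using p by (metis insertCI)
          then show False using c1 by auto
        qed
        then show ?thesis using norm[OF zV] True by auto
      next
        case False
        then show ?thesis using norm[OF zV] norm_ne_1[of z] z by simp
      qed
    qed
    fix w assume w: "w \<in> V - {u}" "z \<noteq> w"
    have x_case: "ip (C - {c}) (\<phi>' x) (\<phi>' y) = - of_bool (E' x y)" if y: "y \<in> V - {u, x}" for y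
    proof -
      have "ip (C - {c}) (\<phi>' x) (\<phi>' y) = \<phi> y p"
        using ipx[of "\<phi> y"] pair[OF xV, of y] hub[of y] y zz by auto
      then show ?thesis using pz[OF y] y by (auto simp: E')
    qed
    consider "z = x" | "w = x" | "z \<noteq> x" "w \<noteq> x" by blast
    then show "ip (C - {c}) (\<phi>' z) (\<phi>' w) = - of_bool (E' z w)"
    proof cases
      case 1 then show ?thesis using x_case[of w] w by auto
    next
      case 2
      have "E' z w = E' w z" using E_sym by (auto simp: E')
      then show ?thesis using 2 x_case[of z] z w by (auto simp: ip_commute)
    next
      case 3
      have "\<not> (E x z \<and> E x w)" using uniq[of z w] z w by auto
      then have "\<phi> z c * \<phi> w c = 0" using hub[of z] hub[of w] z w 3 by auto
      then show ?thesis using ip_drop[of "\<phi> z" "\<phi> w"] pair[of z w] z w 3 zz by (auto simp: E')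
    qed
  qed
  then have "hub (V - {u}) (C - {c}) E' \<phi>' x p"
  proof (rule hub.intro)
    show "hub_axioms (V - {u}) (C - {c}) E' \<phi>' x p"
    proof
      show "x \<in> V - {u}" using xV uV by simp
      show "p \<in> C - {c}" using p by simp
      show "\<phi>' x p = 1" by (simp add: \<phi>'_def)
      show "\<phi>' z p = - of_bool (E' x z)" if "z \<in> V - {u} - {x}" for z
        using pz[of z] zz[of z] that by (auto simp: E')
    qed
  qed
  then show thesis using that[of \<phi>' p] p normx norm by blast
qed

end

section \<open>From hubs to blow-up sequences\<close>

definition base_trees :: "(ptree \<times> int) set" where
  "base_trees = {(T_a, -4), (T_b, -3), (T_c, -2)}"

text \<open>Isomorphism onto a decorated tree on an arbitrary set of naturals, such as remains after
  removing vertices.\<close>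

definition ptree_at :: "ptree \<Rightarrow> nat set \<Rightarrow> (nat \<Rightarrow> nat \<Rightarrow> bool) \<Rightarrow> (nat \<Rightarrow> int) \<Rightarrow> bool" where
  "ptree_at F V E d \<longleftrightarrow> (\<exists>f. bij_betw f {..<nv F} V \<and>
     (\<forall>i<nv F. \<forall>j<nv F. E (f i) (f j) = adj F i j) \<and> (\<forall>i<nv F. d (f i) = dec F i))"

lemma star3_single:
  "star3 c [d1] [d2] [d3] = mk_tree [c, d1, d2, d3] [(0, 1), (0, 2), (0, 3)]"
  by (simp add: star3_def leg_edges_def numeral_2_eq_2 numeral_3_eq_3)

lemma less_4_iff: "(i::nat) < 4 \<longleftrightarrow> i = 0 \<or> i = 1 \<or> i = 2 \<or> i = 3"
  by auto

text \<open>The bound \<open>-2\<close> for all but the last vertex shows that an edge blow-up does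
  not create a second \<open>(-1)\<close>-vertex, and it yields minimality of the final
  tree.\<close>

definition reach_inv :: "ptree \<Rightarrow> nat \<Rightarrow> bool" where
  "reach_inv T u \<longleftrightarrow> u < nv T \<and> (\<forall>i j. adj T i j \<longrightarrow> i < nv T \<and> j < nv T \<and> i \<noteq> j \<and> adj T j i) \<and>
     dec T u = -1 \<and> (\<forall>i<nv T. i \<noteq> u \<longrightarrow> dec T i \<le> -2)"

lemma reach_inv:
  assumes "(T0, r) \<in> base_trees" "blowup_reach T0 0 T u" shows "reach_inv T u"
  using assms(2)
proof induction
  case refl
  have "reach_inv (star3 (-1) [a] [b] [c]) 0" if "a \<le> -2" "b \<le> -2" "c \<le> -2" for a b c
    using that unfolding reach_inv_def star3_single mk_tree_def by (auto simp: less_Suc_eq nth_Cons split: nat.splits)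
  then show ?case using assms(1) by (auto simp: base_trees_def T_a_def T_b_def T_c_def)
next
  case (vert T u)
  then show ?case unfolding reach_inv_def blowup_vertex_def by (auto simp: less_Suc_eq)
next
  case (edge T u w)
  then have "dec T w \<le> -2" unfolding reach_inv_def by blast
  then have "1 + dec T w \<le> 0" by simp
  with edge show ?case unfolding reach_inv_def blowup_edge_def by (auto simp: less_Suc_eq)
qed

text \<open>The vertex \<open>x\<close> carries its final decoration \<open>r\<close> throughout, as
  the norm of a hub is constant under \<open>merge_hub\<close>; in the blow-up sequence itself it
  has decoration \<open>-1\<close>.\<close>

definition abc :: "nat set \<Rightarrow> (nat \<Rightarrow> nat \<Rightarrow> bool) \<Rightarrow> (nat \<Rightarrow> int) \<Rightarrow> nat \<Rightarrow> bool" where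
  "abc V E d x \<longleftrightarrow> (\<exists>T0 r T u f. (T0, r) \<in> base_trees \<and> blowup_reach T0 0 T u \<and>
     bij_betw f {..<nv T} V \<and> f u = x \<and> (\<forall>i<nv T. \<forall>j<nv T. E (f i) (f j) = adj T i j) \<and>
     (\<forall>i<nv T. i \<noteq> u \<longrightarrow> d (f i) = dec T i) \<and> d x = r)"

lemma abc_ptree_at:
  assumes "abc V E d x" shows "\<exists>F\<in>A_set \<union> B_set \<union> C_set. ptree_at F V E d"
proof -
  obtain T0 r T u f where a: "(T0, r) \<in> base_trees" "blowup_reach T0 0 T u"
    "bij_betw f {..<nv T} V" "f u = x" "\<forall>i<nv T. \<forall>j<nv T. E (f i) (f j) = adj T i j"
    "\<forall>i<nv T. i \<noteq> u \<longrightarrow> d (f i) = dec T i" "d x = r" using assms unfolding abc_def by blast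
  have "set_dec T u r \<in> A_set \<union> B_set \<union> C_set"
    using a(1,2) unfolding base_trees_def A_set_def B_set_def C_set_def by blast
  moreover have "ptree_at (set_dec T u r) V E d"
    unfolding ptree_at_def using a(3-7) by (intro exI[of _ f]) (auto simp: set_dec_def)
  ultimately show ?thesis by blast
qed

text \<open>The name \<open>x\<close> always belongs to the current \<open>(-1)\<close>-vertex: the
  new index \<open>n\<close> takes it over, and the former \<open>(-1)\<close>-vertex
  \<open>u\<close> gets the new name \<open>y\<close>.\<close>

lemma bij_betw_blowup:
  assumes f: "bij_betw f {..<n} V" and u: "u < n" "f u = x" "y \<notin> V"
  shows "bij_betw (f(u := y, n := x)) {..<Suc n} (insert y V)"
proof -
  have inj: "inj_on f {..<n}" and im: "f ` {..<n} = V" using f by (auto simp: bij_betw_def)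
  have V: "V - {x} = f ` ({..<n} - {u})"
    using inj im u inj_on_image_set_diff[OF inj, of "{..<n}" "{u}"] by simp
  let ?g = "f(u := y, n := x)"
  have 1: "bij_betw ?g ({..<n} - {u}) (V - {x})"
    unfolding V by (rule bij_betwI') (use inj in \<open>auto simp: inj_on_def\<close>)
  have 2: "bij_betw ?g {u} {y}" using u by auto
  have 3: "bij_betw ?g {n} {x}" by auto
  have 4: "bij_betw ?g (({..<n} - {u}) \<union> {u}) ((V - {x}) \<union> {y})"
    by (rule bij_betw_combine[OF 1 2]) (use u in auto)
  have "bij_betw ?g (({..<n} - {u}) \<union> {u} \<union> {n}) ((V - {x}) \<union> {y} \<union> {x})"
    by (rule bij_betw_combine[OF 4 3]) (use u im in auto)
  moreover have "({..<n} - {u}) \<union> {u} \<union> {n} = {..<Suc n}" using u by auto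
  moreover have "(V - {x}) \<union> {y} \<union> {x} = insert y V" using u im by auto
  ultimately show ?thesis by simp
qed

text \<open>\<open>W\<close> collects the former neighbours that stay attached to \<open>x\<close>:
  none if a vertex was blown up, one if an edge was.\<close>

lemma abc_step:
  assumes abc: "abc V' E' d' x" and y: "y \<notin> V'" and xV: "x \<in> V'"
    and W: "W \<subseteq> {z\<in>V'. z \<noteq> x \<and> E' x z}" "W = {} \<or> (\<exists>w. W = {w})"
    and sym: "\<And>z w. E z w \<Longrightarrow> E w z" "\<And>z. \<not> E z z"
    and E: "E x y" "\<And>z. z \<in> V' - {x} \<Longrightarrow> E x z = (z \<in> W)"
      "\<And>z. z \<in> V' - {x} \<Longrightarrow> E y z = (E' x z \<and> z \<notin> W)"
      "\<And>z w. z \<in> V' - {x} \<Longrightarrow> w \<in> V' - {x} \<Longrightarrow> E z w = E' z w"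
    and d: "d y = -2" "d x = d' x" "\<And>z. z \<in> V' - {x} \<Longrightarrow> d z = d' z - of_bool (z \<in> W)"
  shows "abc (insert y V') E d x"
proof -
  obtain T0 r T u f where a: "(T0, r) \<in> base_trees" "blowup_reach T0 0 T u"
    "bij_betw f {..<nv T} V'" "f u = x" and adj': "\<And>i j. i < nv T \<Longrightarrow> j < nv T \<Longrightarrow> E' (f i) (f j) = adj T i j"
    and dec': "\<And>i. i < nv T \<Longrightarrow> i \<noteq> u \<Longrightarrow> d' (f i) = dec T i" "d' x = r" using abc unfolding abc_def by blast
  have inv: "u < nv T" "\<And>i j. adj T i j \<Longrightarrow> i < nv T \<and> j < nv T \<and> i \<noteq> j \<and> adj T j i" "dec T u = -1"
    using reach_inv[OF a(1,2)] by (auto simp: reach_inv_def)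
  let ?n = "nv T"
  let ?f = "f(u := y, ?n := x)"
  have bij: "bij_betw ?f {..<Suc ?n} (insert y V')" by (rule bij_betw_blowup[OF a(3) inv(1) a(4) y])
  have fV: "f i \<in> V' - {x}" if "i < ?n" "i \<noteq> u" for i
    using a(3,4) that inv(1) by (auto simp: bij_betw_def inj_on_def)
  have fi: "?f i = f i" if "i < ?n" "i \<noteq> u" for i using that by auto
  have Eyx: "E y x" using E(1) sym by blast
  have cases3: "P" if "i < Suc ?n" "i = ?n \<Longrightarrow> P" "i = u \<Longrightarrow> P" "i < ?n \<Longrightarrow> i \<noteq> u \<Longrightarrow> P" for i P
    using that by (cases "i = ?n") auto
  have nadj: "\<not> adj T ?n j" "\<not> adj T j ?n" "\<not> adj T j j" for j using inv(2) by blast+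
  have un: "u \<noteq> ?n" using inv(1) by simp
  show ?thesis
    using W(2)
  proof
    assume W0: "W = {}"
    let ?T = "blowup_vertex T u"
    have r: "blowup_reach T0 0 ?T ?n" by (rule blowup_reach.vert[OF a(2)])
    have "E (?f i) (?f j) = adj ?T i j" if i: "i < Suc ?n" and j: "j < Suc ?n" for i j
    proof (rule cases3[OF i]; rule cases3[OF j])
      assume "i < ?n" "i \<noteq> u" "j < ?n" "j \<noteq> u"
      then show ?thesis using E(4)[OF fV fV, of i j] adj'[of i j] un by (auto simp: blowup_vertex_def)
    next
      assume ij: "i = ?n" "j < ?n" "j \<noteq> u"
      then show ?thesis using E(2)[OF fV, of j] W0 nadj by (auto simp: blowup_vertex_def)
    next
      assume ij: "j = ?n" "i < ?n" "i \<noteq> u"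
      then show ?thesis using E(2)[OF fV, of i] W0 nadj sym(1) by (auto simp: blowup_vertex_def)
    next
      assume ij: "i = u" "j < ?n" "j \<noteq> u"
      then show ?thesis using E(3)[OF fV, of j] adj'[of u j] W0 un inv(1) a(4) by (auto simp: blowup_vertex_def)
    next
      assume ij: "j = u" "i < ?n" "i \<noteq> u"
      have "E (f i) y = E y (f i)" using sym(1) by blast
      then show ?thesis using ij E(3)[OF fV, of i] adj'[of u i] inv(2)[of u i] inv(2)[of i u] W0 un inv(1) a(4)
        by (auto simp: blowup_vertex_def)
    qed (use un E(1) Eyx sym(2) nadj inv(2) in \<open>auto simp: blowup_vertex_def\<close>)
    moreover have "d (?f i) = dec ?T i" if i: "i < Suc ?n" "i \<noteq> ?n" for i
      using i d(1) d(3)[OF fV, of i] dec'(1)[of i] W0 inv(3) un by (auto simp: blowup_vertex_def less_Suc_eq)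
    ultimately show ?thesis unfolding abc_def using a(1) r bij d(2) dec'(2)
      by (intro exI[of _ T0] exI[of _ r] exI[of _ ?T] exI[of _ ?n] exI[of _ ?f]) (auto simp: blowup_vertex_def)
  next
    assume "\<exists>w. W = {w}"
    then obtain w where Ww: "W = {w}" by blast
    then have w: "w \<in> V'" "w \<noteq> x" "E' x w" using W(1) by auto
    then have "w \<in> f ` {..<?n}" using a(3) by (simp add: bij_betw_def)
    then obtain k where k: "k < ?n" "f k = w" by auto
    have ku: "k \<noteq> u" using k w a(4) by auto
    have uk: "adj T u k" using adj'[OF inv(1) k(1)] k a(4) w by simp
    have fk: "f i = w \<longleftrightarrow> i = k" if "i < ?n" for i
      using that k a(3) by (auto simp: bij_betw_def inj_on_def)
    let ?T = "blowup_edge T u k"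
    have r: "blowup_reach T0 0 ?T ?n" by (rule blowup_reach.edge[OF a(2) k(1) uk])
    have "E (?f i) (?f j) = adj ?T i j" if i: "i < Suc ?n" and j: "j < Suc ?n" for i j
    proof (rule cases3[OF i]; rule cases3[OF j])
      assume "i < ?n" "i \<noteq> u" "j < ?n" "j \<noteq> u"
      then show ?thesis using E(4)[OF fV fV, of i j] adj'[of i j] un by (auto simp: blowup_edge_def)
    next
      assume ij: "i = ?n" "j < ?n" "j \<noteq> u"
      then show ?thesis using E(2)[OF fV, of j] Ww fk[of j] nadj k un by (auto simp: blowup_edge_def)
    next
      assume ij: "j = ?n" "i < ?n" "i \<noteq> u"
      have "E (f i) x = E x (f i)" using sym(1) by blast
      then show ?thesis using ij E(2)[OF fV, of i] Ww fk[of i] nadj k un by (auto simp: blowup_edge_def)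
    next
      assume ij: "i = u" "j < ?n" "j \<noteq> u"
      then show ?thesis using E(3)[OF fV, of j] adj'[of u j] Ww fk[of j] un inv(1) a(4) ku by (auto simp: blowup_edge_def)
    next
      assume ij: "j = u" "i < ?n" "i \<noteq> u"
      have "E (f i) y = E y (f i)" using sym(1) by blast
      then show ?thesis using ij E(3)[OF fV, of i] adj'[of u i] inv(2)[of u i] inv(2)[of i u] Ww fk[of i] un inv(1) a(4) ku
        by (auto simp: blowup_edge_def)
    qed (use un E(1) Eyx sym(2) nadj inv(2) ku k in \<open>auto simp: blowup_edge_def\<close>)
    moreover have "d (?f i) = dec ?T i" if i: "i < Suc ?n" "i \<noteq> ?n" for i
      using i d(1) d(3)[OF fV, of i] dec'(1)[of i] Ww fk[of i] inv(3) un ku k by (auto simp: blowup_edge_def less_Suc_eq)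
    ultimately show ?thesis unfolding abc_def using a(1) r bij d(2) dec'(2)
      by (intro exI[of _ T0] exI[of _ r] exI[of _ ?T] exI[of _ ?n] exI[of _ ?f]) (auto simp: blowup_edge_def)
  qed
qed

lemma abc_base:
  assumes dist: "distinct [x, a, b, c]" and N: "{v\<in>{x, a, b, c}. E x v} = {a, b, c}"
    and no: "\<not> E a b" "\<not> E a c" "\<not> E b c" and sym: "\<And>z w. E z w \<Longrightarrow> E w z" "\<And>z. \<not> E z z"
    and base: "(star3 (-1) [d a] [d b] [d c], d x) \<in> base_trees"
  shows "abc {x, a, b, c} E d x"
proof -
  let ?T = "star3 (-1) [d a] [d b] [d c]" and ?f = "\<lambda>i. [x, a, b, c] ! i"
  have T: "nv ?T = 4" "adj ?T = (\<lambda>i j. (i, j) \<in> {(0,1),(0,2),(0,3)} \<or> (j, i) \<in> {(0,1),(0,2),(0,3)})"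
    "dec ?T = (\<lambda>i. [-1, d a, d b, d c] ! i)"
    by (auto simp: star3_single mk_tree_def)
  have Ex: "E x a" "E x b" "E x c" using N by blast+
  have Ey: "E a x" "E b x" "E c x" "\<not> E b a" "\<not> E c a" "\<not> E c b" using Ex no sym by blast+
  have "bij_betw ?f {..<4} {x, a, b, c}"
    using bij_betw_nth[OF dist, of "{..<4}" "{x, a, b, c}"] by auto
  moreover have "E (?f i) (?f j) = adj ?T i j" if "i < 4" "j < 4" for i j
    using that Ex Ey no sym(2) unfolding T(2) less_4_iff by auto
  moreover have "d (?f i) = dec ?T i" if "i < 4" "i \<noteq> 0" for i
    using that unfolding T(3) less_4_iff by auto
  ultimately show ?thesis unfolding abc_def using base T(1) blowup_reach.refl[of ?T 0]
    by (intro exI[of _ ?T] exI[of _ "d x"] exI[of _ 0] exI[of _ ?f]) auto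
qed

text \<open>Blow down while some row sum off column \<open>c\<close> is positive and the hub has
  valency at most \<open>2\<close>; where this stops, \<open>roots_case\<close> and
  \<open>triple_case\<close> identify \<open>T_a\<close>, \<open>T_b\<close> or
  \<open>T_c\<close>.\<close>

lemma hub_abc:
  assumes "hub V C E \<phi> x c"
  shows "abc V E (\<lambda>v. - ip C (\<phi> v) (\<phi> v)) x"
  using assms
proof (induction "card V" arbitrary: V C E \<phi> c rule: less_induct)
  case less
  interpret hub V C E \<phi> x c by fact
  let ?d = "\<lambda>v. - ip C (\<phi> v) (\<phi> v)"
  show ?case
  proof (cases "\<forall>v\<in>V - {x}. (\<Sum>k\<in>C - {c}. \<phi> v k) \<le> 0")
    case True
    then have r: "valx = 3" "V - {x} = {v\<in>V. E x v}" "ip C (\<phi> x) (\<phi> x) = 4"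
      "\<And>v. v \<in> V - {x} \<Longrightarrow> ip C (\<phi> v) (\<phi> v) = 3" using roots_case by blast+
    then have "card (V - {x}) = 3" by simp
    then obtain a b c' where abc': "V - {x} = {a, b, c'}" "a \<noteq> b" "b \<noteq> c'" "a \<noteq> c'"
      by (auto simp: card_3_iff)
    have V: "V = {x, a, b, c'}" using abc' xV by blast
    have in3: "a \<in> V - {x}" "b \<in> V - {x}" "c' \<in> V - {x}" using abc' by blast+
    have "abc {x, a, b, c'} E ?d x"
    proof (rule abc_base)
      show "distinct [x, a, b, c']" using abc' in3 by auto
      show "{v \<in> {x, a, b, c'}. E x v} = {a, b, c'}" using r(2) abc' V by simp
      have "E x a" "E x b" "E x c'" using in3 r(2) by blast+
      then show "\<not> E a b" "\<not> E a c'" "\<not> E b c'" using no_tri in3 by auto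
      show "(star3 (- 1) [?d a] [?d b] [?d c'], ?d x) \<in> base_trees"
        using r(3) r(4)[OF in3(1)] r(4)[OF in3(2)] r(4)[OF in3(3)] by (simp add: base_trees_def T_a_def)
    qed (use E_sym E_irr in auto)
    then show ?thesis using V by simp
  next
    case False
    then obtain u where u: "u \<in> V - {x}" "(\<Sum>k\<in>C - {c}. \<phi> u k) > 0" by (auto simp: not_le)
    show ?thesis
    proof (cases "valx = 3")
      case True
      obtain l l' where l: "distinct [x, u, l, l']" "V = {x, u, l, l'}" "{v\<in>V. E x v} = {u, l, l'}"
        "ip C (\<phi> u) (\<phi> u) = 2"
        "ip C (\<phi> l) (\<phi> l) = 4 \<and> ip C (\<phi> l') (\<phi> l') = 4 \<and> ip C (\<phi> x) (\<phi> x) = 3 \<or>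
         ip C (\<phi> l) (\<phi> l) = 3 \<and> ip C (\<phi> l') (\<phi> l') = 6 \<and> ip C (\<phi> x) (\<phi> x) = 2"
        using triple_case[OF True u] by blast
      have Ex: "E x u" "E x l" "E x l'" using l(3) by blast+
      have in4: "u \<in> V" "l \<in> V" "l' \<in> V" using l(2) by blast+
      have no: "\<not> E u l" "\<not> E u l'" "\<not> E l l'" "\<not> E l u" "\<not> E l' u" "\<not> E l' l"
        using no_tri Ex in4 by blast+
      from l(5) show ?thesis
      proof
        assume n: "ip C (\<phi> l) (\<phi> l) = 4 \<and> ip C (\<phi> l') (\<phi> l') = 4 \<and> ip C (\<phi> x) (\<phi> x) = 3"
        have V: "V = {x, l, l', u}" using l(2) by blast
        have "abc {x, l, l', u} E ?d x"
          by (rule abc_base) (use l(1,3,4) V n no E_sym E_irr in \<open>auto simp: base_trees_def T_b_def\<close>)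
        then show ?thesis using V by simp
      next
        assume n: "ip C (\<phi> l) (\<phi> l) = 3 \<and> ip C (\<phi> l') (\<phi> l') = 6 \<and> ip C (\<phi> x) (\<phi> x) = 2"
        have V: "V = {x, u, l', l}" using l(2) by blast
        have "abc {x, u, l', l} E ?d x"
          by (rule abc_base) (use l(1,3,4) V n no E_sym E_irr in \<open>auto simp: base_trees_def T_c_def\<close>)
        then show ?thesis using V by simp
      qed
    next
      case False
      then have v2: "valx \<le> 2" using valx_le by simp
      define E' where "E' = (\<lambda>z w. E z w \<or> (z = x \<and> E u w \<and> w \<noteq> x) \<or> (w = x \<and> E u z \<and> z \<noteq> x))"
      obtain p \<phi>' where m: "hub (V - {u}) (C - {c}) E' \<phi>' x p" "E x u"
        "ip C (\<phi> u) (\<phi> u) = 2" "ip C (\<phi> x) (\<phi> x) = ip (C - {c}) (\<phi>' x) (\<phi>' x)"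
        "\<And>z. z \<in> V - {u, x} \<Longrightarrow> ip C (\<phi> z) (\<phi> z) = ip (C - {c}) (\<phi>' z) (\<phi>' z) + of_bool (E x z)"
        using merge_hub[OF u v2 E'_def] by metis
      have uV: "u \<in> V" "u \<noteq> x" using u by auto
      have "card (V - {u}) < card V" using card_Diff1_less[OF finV uV(1)] .
      then have IH: "abc (V - {u}) E' (\<lambda>v. - ip (C - {c}) (\<phi>' v) (\<phi>' v)) x"
        using less.hyps m(1) by blast
      let ?W = "{z\<in>V - {u, x}. E x z}"
      have "abc (insert u (V - {u})) E ?d x"
      proof (rule abc_step[OF IH, where W = ?W])
        have "{v\<in>V. E x v} = insert u ?W" using m(2) uV E_irr by auto
        then have "card ?W \<le> 1" using v2 finV by simp
        then show "?W = {} \<or> (\<exists>w. ?W = {w})"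
        proof (cases "?W = {}")
          case False
          then have "card ?W > 0" using finV by (subst card_gt_0_iff) simp
          then have "card ?W = 1" using \<open>card ?W \<le> 1\<close> by linarith
          then show ?thesis by (metis card_1_singletonE)
        qed simp
        fix z assume z: "z \<in> V - {u} - {x}"
        show "E u z = (E' x z \<and> z \<notin> ?W)"
          using no_tri[OF m(2), of z] uV z by (auto simp: E'_def)
        show "E x z = (z \<in> ?W)" using z by auto
        show "?d z = - ip (C - {c}) (\<phi>' z) (\<phi>' z) - of_bool (z \<in> ?W)"
          using m(5)[of z] z by auto
        fix w assume "w \<in> V - {u} - {x}"
        then show "E z w = E' z w" using z by (auto simp: E'_def)
      qed (use m uV xV E_sym E_irr in \<open>auto simp: E'_def\<close>)
      then show ?thesis using uV by (simp add: insert_absorb)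
    qed
  qed
qed

section \<open>Embeddings without entries -2\<close>

text \<open>An embedding without entries \<open>-2\<close>, with the columns named after the vertices:
  column \<open>k\<close> has \<open>1\<close> in row \<open>k\<close> and \<open>-1\<close> exactly in the rows of \<open>N k\<close>.\<close>
definition cc :: "(nat \<Rightarrow> nat set) \<Rightarrow> nat \<Rightarrow> nat \<Rightarrow> int" where
  "cc N v k = (if v = k then 1 else - of_bool (v \<in> N k))"

lemma cc_same [simp]: "cc N k k = 1" by (simp add: cc_def)

lemma cc_neq: "v \<noteq> k \<Longrightarrow> cc N v k = - of_bool (v \<in> N k)" by (simp add: cc_def)

lemma cc_row:
  assumes "finite V" "v \<in> V" shows "(\<Sum>k\<in>V. cc N v k * (cc N v k + 1)) = 2"
proof -
  have "(\<Sum>k\<in>V. cc N v k * (cc N v k + 1)) = (\<Sum>k\<in>{v}. cc N v k * (cc N v k + 1))"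
    using assms by (intro sum.mono_neutral_right) (auto simp: cc_def)
  then show ?thesis by (simp add: cc_def)
qed

lemma cc_norm:
  assumes "finite V" "v \<in> V" "v \<notin> N v"
  shows "ip V (cc N v) (cc N v) = 1 + int (card {k\<in>V. v \<in> N k})"
    and "(\<Sum>k\<in>V. cc N v k) = 1 - int (card {k\<in>V. v \<in> N k})"
proof -
  have eq: "{k\<in>V - {v}. cc N v k = -1} = {k\<in>V. v \<in> N k}" using assms(3) by (auto simp: cc_def)
  have o: "\<And>k. k \<in> V \<Longrightarrow> k \<noteq> v \<Longrightarrow> cc N v k = 0 \<or> cc N v k = -1" by (auto simp: cc_def)
  show "ip V (cc N v) (cc N v) = 1 + int (card {k\<in>V. v \<in> N k})"
    and "(\<Sum>k\<in>V. cc N v k) = 1 - int (card {k\<in>V. v \<in> N k})"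
    using row_count[OF assms(1,2), of "cc N v", OF o] unfolding eq by (auto simp: cc_def)
qed

lemma cc_ip:
  assumes "finite V" "u \<in> V" "v \<in> V" "u \<noteq> v" "u \<notin> N u" "v \<notin> N v"
  shows "ip V (cc N u) (cc N v) = int (card {k\<in>V. u \<in> N k \<and> v \<in> N k}) - of_bool (u \<in> N v) - of_bool (v \<in> N u)"
proof -
  let ?V = "V - {u} - {v}"
  have "ip V (cc N u) (cc N v) = cc N v u + cc N u v + (\<Sum>k\<in>?V. cc N u k * cc N v k)"
    using assms by (simp add: ip_def sum.remove[of V u] sum.remove[of "V - {u}" v])
  also have "(\<Sum>k\<in>?V. cc N u k * cc N v k) = (\<Sum>k\<in>{k\<in>V. u \<in> N k \<and> v \<in> N k}. 1)"
    using assms by (intro sum.mono_neutral_cong_right) (auto simp: cc_def)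
  finally show ?thesis using assms cc_neq[of u v N] cc_neq[of v u N] by simp
qed

locale dfree = emb V V E "cc N" for V E N +
  assumes NV: "k \<in> V \<Longrightarrow> N k \<subseteq> V - {k}"
begin

abbreviation "J v \<equiv> {k\<in>V. v \<in> N k}"

lemma finN: "k \<in> V \<Longrightarrow> finite (N k)" using NV finV by (meson finite_Diff finite_subset)
lemma N_irr: "k \<in> V \<Longrightarrow> k \<notin> N k" using NV by blast

text \<open>Since the left-hand side is nonnegative, every column shared by two rows has to be paid
  for by an entry of one row in the column of the other.\<close>

lemma E_card: "u \<in> V \<Longrightarrow> v \<in> V \<Longrightarrow> u \<noteq> v \<Longrightarrow>
    of_bool (E u v) = of_bool (u \<in> N v) + of_bool (v \<in> N u) - int (card (J u \<inter> J v))"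
  using pair[of u v] cc_ip[OF finV, of u v N] N_irr by (simp add: Int_def conj_ac)

lemma norm_J: "v \<in> V \<Longrightarrow> ip V (cc N v) (cc N v) = 1 + int (card (J v))"
  using cc_norm(1)[OF finV] N_irr by blast

lemma J_pos: "v \<in> V \<Longrightarrow> card (J v) \<ge> 1"
  using norm_ge_2[of v] norm_J[of v] by linarith

lemma colsum_N: assumes "k \<in> V" shows "colsum k = 1 - int (card (N k))"
proof -
  have "colsum k = cc N k k + (\<Sum>v\<in>V - {k}. cc N v k)" using finV assms by (simp add: colsum_def sum.remove)
  also have "(\<Sum>v\<in>V - {k}. cc N v k) = (\<Sum>v\<in>N k. -1)"
    using finV NV[OF assms] by (intro sum.mono_neutral_cong_right) (auto simp: cc_def)
  finally show ?thesis by simp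
qed

text \<open>The exceptional column sum is \<open>1\<close> or \<open>-2\<close>, so that column has
  \<open>0\<close> or \<open>3\<close> entries \<open>-1\<close>. Zero is impossible: dropping the
  column would leave nonpositive row sums, with a negative one in row \<open>e\<close>.\<close>

lemma centre:
  obtains e where "e \<in> V" "card (N e) = 3" "\<And>k. k \<in> V \<Longrightarrow> k \<noteq> e \<Longrightarrow> card (N k) = 1 \<or> card (N k) = 2"
proof -
  obtain e where e: "e \<in> V" "colsum e = 1 \<or> colsum e = -2"
    "\<And>k. k \<in> V \<Longrightarrow> k \<noteq> e \<Longrightarrow> colsum k = 0 \<or> colsum k = -1" using exceptional by blast
  have "card (N e) \<noteq> 0"
  proof
    assume "card (N e) = 0"
    then have Ne: "N e = {}" using finN[OF e(1)] by simp
    have s: "(\<Sum>k\<in>V - {e}. cc N v k) = (1 - int (card (J v))) - cc N v e" if "v \<in> V" for v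
      using cc_norm(2)[of V v N, OF finV that N_irr[OF that]] finV e(1) by (simp add: sum.remove)
    have "(\<Sum>k\<in>V - {e}. cc N e k) = 0"
    proof (rule drop_column[OF e(1) _ _ e(1)])
      show "0 \<le> cc N u e * cc N v e" if "u \<in> V" "v \<in> V" "u \<noteq> v" for u v
        using that Ne by (auto simp: cc_def)
      show "(\<Sum>k\<in>V - {e}. cc N v k) \<le> 0" if "v \<in> V" for v
        using s[OF that] J_pos[OF that] Ne by (simp add: cc_def)
    qed
    then show False using s[OF e(1)] J_pos[OF e(1)] by (simp add: cc_def)
  qed
  then have "card (N e) = 3" using e(2) colsum_N[OF e(1)] by auto
  moreover have "card (N k) = 1 \<or> card (N k) = 2" if "k \<in> V" "k \<noteq> e" for k
    using e(3)[OF that] colsum_N[OF that(1)] by auto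
  ultimately show thesis using that e(1) by blast
qed

text \<open>The product of row \<open>v\<close> with the sum of all rows, computed once by adjacency
  and once by columns; adjunction eliminates the norm.\<close>

lemma valency:
  assumes v: "v \<in> V"
  shows "int (card {w\<in>V. E v w}) = 2 - (\<Sum>k\<in>V. (2 - int (card (N k))) * cc N v k)"
proof -
  have "(\<Sum>u\<in>V. ip V (cc N v) (cc N u)) = ip V (cc N v) (cc N v) + (\<Sum>u\<in>V - {v}. ip V (cc N v) (cc N u))"
    using finV v by (simp add: sum.remove)
  also have "(\<Sum>u\<in>V - {v}. ip V (cc N v) (cc N u)) = (\<Sum>u\<in>V - {v}. - of_bool (E v u))"
    using pair v by (intro sum.cong) auto
  also have "\<dots> = (\<Sum>u\<in>{w\<in>V. E v w}. -1)"
    using finV E_irr by (intro sum.mono_neutral_cong_right) auto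
  finally have 1: "(\<Sum>u\<in>V. ip V (cc N v) (cc N u)) = ip V (cc N v) (cc N v) - int (card {w\<in>V. E v w})" by simp
  have "(\<Sum>u\<in>V. ip V (cc N v) (cc N u)) = (\<Sum>k\<in>V. cc N v k * colsum k)"
    unfolding ip_def colsum_def by (subst sum.swap) (simp add: sum_distrib_left)
  also have "\<dots> = (\<Sum>k\<in>V. cc N v k * (1 - int (card (N k))))"
    using colsum_N by (intro sum.cong) auto
  also have "\<dots> = (\<Sum>k\<in>V. (2 - int (card (N k))) * cc N v k) - (\<Sum>k\<in>V. cc N v k)"
    by (simp add: sum_subtractf[symmetric] algebra_simps)
  finally show ?thesis using 1 norm_sum[OF v] by linarith
qed

lemma hub_N:
  assumes "x \<in> V" "N x = {v\<in>V. E x v}" shows "hub V V E (cc N) x x"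
  using assms by unfold_locales (auto simp: cc_def)

end

text \<open>The leading entries \<open>1\<close> lie in distinct columns, and there are as many
  columns as rows; so each column can be renamed after its row.\<close>

lemma emb_dfree:
  assumes "emb V C E \<phi>" and noD: "\<And>v k. v \<in> V \<Longrightarrow> k \<in> C \<Longrightarrow> \<phi> v k \<noteq> -2"
  shows "\<exists>N. dfree V E N \<and> (\<forall>v\<in>V. ip V (cc N v) (cc N v) = ip C (\<phi> v) (\<phi> v))"
proof -
  interpret emb V C E \<phi> by fact
  have ex: "\<exists>i. i \<in> C \<and> \<phi> v i = 1" if v: "v \<in> V" for v
  proof -
    obtain i where "i \<in> C" "\<phi> v i = 1 \<or> \<phi> v i = -2" using lead[OF v] by metis
    then show ?thesis using noD[OF v] by blast
  qed
  define l where "l v = (SOME i. i \<in> C \<and> \<phi> v i = 1)" for v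
  have l: "l v \<in> C" "\<phi> v (l v) = 1" if "v \<in> V" for v
    using someI_ex[OF ex[OF that]] unfolding l_def by blast+
  have inj: "inj_on l V" using l P_unique by (intro inj_onI) metis
  have im: "l ` V = C" using inj l(1) cardC finC by (intro card_subset_eq) (auto simp: card_image)
  define N where "N k = {z\<in>V. \<phi> z (l k) = -1}" for k
  have eq: "\<phi> v (l k) = cc N v k" if "v \<in> V" "k \<in> V" for v k
  proof (cases "v = k")
    case False
    then have "l k \<noteq> l v" using inj that by (auto simp: inj_on_def)
    then have "\<phi> v (l k) = 0 \<or> \<phi> v (l k) = -1"
      using other_entries[OF that(1) l(1)[OF that(1)] _ l(1)[OF that(2)]] l(2)[OF that(1)] by blast
    then show ?thesis using False that by (auto simp: cc_def N_def)
  qed (use l that in \<open>simp add: cc_def\<close>)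
  have sumeq: "(\<Sum>k\<in>C. g k) = (\<Sum>k\<in>V. g (l k))" for g :: "nat \<Rightarrow> int"
    using sum.reindex[OF inj, of g] im by simp
  have ipeq: "ip V (cc N u) (cc N v) = ip C (\<phi> u) (\<phi> v)" if "u \<in> V" "v \<in> V" for u v
    unfolding ip_def sumeq by (intro sum.cong) (use eq that in auto)
  have "dfree V E N"
  proof (intro dfree.intro dfree_axioms.intro)
    show "emb V V E (cc N)"
    proof
      show "(\<Sum>k\<in>V. cc N v k * (cc N v k + 1)) = 2" if "v \<in> V" for v by (rule cc_row[OF finV that])
    qed (use tree finV pair norm_ne_1 ipeq in auto)
    show "N k \<subseteq> V - {k}" if "k \<in> V" for k using l(2)[OF that] by (auto simp: N_def)
  qed
  then show ?thesis using ipeq by blast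
qed

text \<open>Expansion: the new vertex \<open>u\<close> (with \<open>\<phi> u = E\<^sub>u - E\<^sub>a\<close>) is inserted between \<open>a\<close> and those
  members of \<open>N' a\<close> that are adjacent to \<open>a\<close>; at most one member of \<open>N' a\<close> is left in place and
  receives an additional \<open>- E\<^sub>u\<close>.\<close>
definition expansion where
  "expansion V' E' N' a u W V E N \<longleftrightarrow> u \<notin> V' \<and> V = insert u V' \<and> a \<in> V' \<and> W \<subseteq> N' a \<and>
     (W = {} \<or> (\<exists>w. W = {w})) \<and> (\<forall>b\<in>N' a - W. E' a b) \<and>
     N u = N' a \<and> N a = insert u W \<and> (\<forall>k\<in>V' - {a}. N k = N' k) \<and>
     (\<forall>z\<in>V'. E u z = (z = a \<or> z \<in> N' a - W)) \<and>
     (\<forall>z\<in>V'. \<forall>w\<in>V'. E z w = (E' z w \<and> \<not> (z = a \<and> w \<in> N' a - W) \<and> \<not> (w = a \<and> z \<in> N' a - W)))"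

text \<open>Column \<open>u\<close> inherits the old column \<open>a\<close>, and the new column
  \<open>a\<close> holds \<open>u\<close> and \<open>W\<close>. As \<open>W\<close> has at most one
  member, the new column adds no product among old rows other than those with
  \<open>a\<close>.\<close>

lemma expansion_ip:
  assumes fin: "finite V'" and V: "V = insert u V'" and u: "u \<notin> V'" and a: "a \<in> V'"
    and N': "\<And>k. k \<in> V' \<Longrightarrow> N' k \<subseteq> V' - {k}" and W: "W \<subseteq> N' a" "W = {} \<or> (\<exists>w. W = {w})"
    and N: "N u = N' a" "N a = insert u W" "\<And>k. k \<in> V' - {a} \<Longrightarrow> N k = N' k"
  shows "\<And>z w. z \<in> V' \<Longrightarrow> w \<in> V' \<Longrightarrow> z \<noteq> w \<Longrightarrow> ip V (cc N z) (cc N w) =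
      ip V' (cc N' z) (cc N' w) + of_bool (z = a \<and> w \<in> N' a - W) + of_bool (w = a \<and> z \<in> N' a - W)"
    and "\<And>z. z \<in> V' \<Longrightarrow> ip V (cc N z) (cc N z) = ip V' (cc N' z) (cc N' z) + of_bool (z \<in> W)"
    and "\<And>z. z \<in> V' \<Longrightarrow> ip V (cc N u) (cc N z) = - of_bool (z = a \<or> z \<in> N' a - W)"
    and "ip V (cc N u) (cc N u) = 2"
proof -
  have aN: "a \<notin> N' a" and uN: "\<And>k. k \<in> V' \<Longrightarrow> u \<notin> N' k" using N' a u by blast+
  have ua: "u \<noteq> a" using u a by blast
  have split: "ip V x y = x u * y u + x a * y a + ip (V' - {a}) x y" for x y
    using fin V u a by (simp add: ip_def sum.remove)
  have split': "ip V' x y = x a * y a + ip (V' - {a}) x y" for x y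
    using fin a by (simp add: ip_def sum.remove)
  have rest: "ip (V' - {a}) (cc N z) (cc N w) = ip (V' - {a}) (cc N' z) (cc N' w)" for z w
    unfolding ip_def by (rule sum.cong[OF HOL.refl]) (use N(3) in \<open>simp add: cc_def\<close>)
  show "ip V (cc N z) (cc N w) =
      ip V' (cc N' z) (cc N' w) + of_bool (z = a \<and> w \<in> N' a - W) + of_bool (w = a \<and> z \<in> N' a - W)"
    if z: "z \<in> V'" and w: "w \<in> V'" and ne: "z \<noteq> w" for z w
  proof -
    have "z \<noteq> u" "w \<noteq> u" using z w u by auto
    then show ?thesis
      unfolding split split' rest using z w ne aN ua W N(1,2) by (auto simp: cc_def)
  qed
  show "ip V (cc N z) (cc N z) = ip V' (cc N' z) (cc N' z) + of_bool (z \<in> W)" if z: "z \<in> V'" for z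
  proof -
    have "z \<noteq> u" using z u by auto
    then show ?thesis
      unfolding split split' rest using z aN ua W N(1,2) by (auto simp: cc_def)
  qed
  have u0: "cc N u k = 0" if "k \<in> V' - {a}" for k using that N(3)[OF that] uN[of k] u by (auto simp: cc_def)
  have ipu: "ip V (cc N u) y = y u - y a" for y
  proof -
    have "ip (V' - {a}) (cc N u) y = 0" unfolding ip_def using u0 by (simp add: sum.neutral)
    then show ?thesis unfolding split using N(1,2) ua by (simp add: cc_def)
  qed
  show "ip V (cc N u) (cc N z) = - of_bool (z = a \<or> z \<in> N' a - W)" if z: "z \<in> V'" for z
  proof -
    have "z \<noteq> u" using z u by auto
    then show ?thesis unfolding ipu using aN ua W N(1,2) by (auto simp: cc_def)
  qed
  show "ip V (cc N u) (cc N u) = 2" unfolding ipu using N(1,2) ua uN[OF a] by (simp add: cc_def)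
qed

context dfree begin

text \<open>Inverse of \<open>expansion\<close>: \<open>u = E_u - E_a\<close> is contracted into
  \<open>a\<close> and the old column \<open>a\<close> is dropped. Two common members of
  \<open>N u\<close> and \<open>N a\<close> would share the dropped column and change their product,
  hence the bound \<open>1\<close>; a single common member has norm at least \<open>3\<close>, so
  its norm may drop.\<close>

lemma merge:
  assumes u: "u \<in> V" and a: "a \<in> V" and Ju: "J u = {a}" and c1: "card (N u \<inter> N a) \<le> 1"
  obtains E' N' where "dfree (V - {u}) E' N'" "expansion (V - {u}) E' N' a u (N u \<inter> N a) V E N"
proof -
  let ?V = "V - {u}" and ?W = "N u \<inter> N a"
  have uNk: "u \<in> N k \<longleftrightarrow> k = a" if "k \<in> V" for k using Ju that by blast
  have ua: "u \<noteq> a" using uNk[OF a] N_irr[OF a] by blast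
  have ipu: "ip V (cc N u) y = y u - y a" for y
  proof -
    have "ip V (cc N u) y = (\<Sum>k\<in>{u, a}. cc N u k * y k)"
      unfolding ip_def using u a finV uNk by (intro sum.mono_neutral_right) (auto simp: cc_def)
    then show ?thesis using ua uNk[OF a] by (simp add: cc_def)
  qed
  have Eu: "- of_bool (E u z) = cc N z u - cc N z a" if "z \<in> V" "z \<noteq> u" for z
    using pair[of u z] ipu[of "cc N z"] that u by auto
  have Eua: "E u a" "a \<notin> N u" using Eu[OF a] ua by (auto simp: cc_def of_bool_def split: if_splits)
  have Euz: "E u z = (z \<in> N u - ?W)" "z \<in> N a \<Longrightarrow> z \<in> N u" if "z \<in> V - {u, a}" for z
    using Eu[of z] that by (auto simp: cc_def of_bool_def split: if_splits)
  have Na: "N a = insert u ?W" using Euz(2) NV[OF a] uNk[OF a] by blast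
  define N' where "N' = N(a := N u)"
  define E' where "E' = (\<lambda>z w. E z w \<or> (z = a \<and> E u w \<and> w \<noteq> a) \<or> (w = a \<and> E u z \<and> z \<noteq> a))"
  have N'V: "N' k \<subseteq> ?V - {k}" if "k \<in> ?V" for k
    using NV[of k] NV[OF u] uNk[of k] Eua that u by (auto simp: N'_def)
  have W: "?W \<subseteq> N' a" "?W = {} \<or> (\<exists>w. ?W = {w})"
  proof -
    show "?W = {} \<or> (\<exists>w. ?W = {w})"
      using c1 finN[OF u] by (metis One_nat_def card_0_eq card_1_singletonE finite_Int le_SucE le_zero_eq)
  qed (auto simp: N'_def)
  have Vins: "V = insert u ?V" using u by blast
  have av: "a \<in> ?V" using a ua by blast
  have Nfacts: "N u = N' a" "N a = insert u ?W" "\<And>k. k \<in> ?V - {a} \<Longrightarrow> N k = N' k"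
    using Na by (auto simp: N'_def)
  have fin': "finite ?V" using finV by simp
  note ex = expansion_ip[OF fin' Vins _ av N'V W Nfacts]
  have no_tri: "\<not> (E u z \<and> E a z)" if "z \<in> V" for z
    using tree_no_triangle[OF tree a u that] Eua(1) E_sym by blast
  have "emb ?V ?V E' (cc N')"
  proof
    show "tree ?V E'"
      by (rule tree_contract[OF tree u a Eua(1)]) (use E_sym E_irr in \<open>auto simp: E'_def\<close>)
    show "finite ?V" using finV by simp
    fix z assume z: "z \<in> ?V"
    show "(\<Sum>k\<in>?V. cc N' z k * (cc N' z k + 1)) = 2" by (rule cc_row[OF fin' z])
    have n: "ip V (cc N z) (cc N z) = ip ?V (cc N' z) (cc N' z) + of_bool (z \<in> ?W)" by (rule ex(2)) (use z in auto)
    show "ip ?V (cc N' z) (cc N' z) \<noteq> 1"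
    proof (cases "z \<in> ?W")
      case True
      then have "{u, a} \<subseteq> J z" using u a by auto
      then have "2 \<le> card (J z)" using card_mono[of "J z" "{u, a}"] finV ua by simp
      then show ?thesis using n norm_J[of z] True z by simp
    next
      case False
      then have "of_bool (z \<in> ?W) = (0::int)" by simp
      then show ?thesis using n norm_ne_1[of z] z by (metis DiffD1 add.right_neutral)
    qed
    fix w assume w: "w \<in> ?V" and ne: "z \<noteq> w"
    have p: "ip V (cc N z) (cc N w) =
      ip ?V (cc N' z) (cc N' w) + of_bool (z = a \<and> w \<in> N' a - ?W) + of_bool (w = a \<and> z \<in> N' a - ?W)"
      by (rule ex(1)) (use z w ne in auto)
    have "ip V (cc N z) (cc N w) = - of_bool (E z w)" using pair[of z w] z w ne by auto
    moreover have "w \<in> N' a - ?W \<longleftrightarrow> E u w" if "z = a" using Euz(1)[of w] w ne that by (auto simp: N'_def)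
    moreover have "z \<in> N' a - ?W \<longleftrightarrow> E u z" if "w = a" using Euz(1)[of z] z ne that by (auto simp: N'_def)
    moreover have "\<not> (E u w \<and> E z w)" if "z = a" using no_tri[of w] w that by blast
    moreover have "\<not> (E u z \<and> E z w)" if "w = a" using no_tri[of z] z that E_sym by blast
    ultimately show "ip ?V (cc N' z) (cc N' w) = - of_bool (E' z w)"
      using p ne by (cases "z = a"; cases "w = a") (auto simp: E'_def of_bool_def split: if_splits)
  qed auto
  then have d: "dfree ?V E' N'" using N'V by (intro dfree.intro dfree_axioms.intro)
  have "expansion ?V E' N' a u ?W V E N"
    unfolding expansion_def
  proof (intro conjI ballI)
    show "E' a b" if "b \<in> N' a - ?W" for b
    proof -
      have "b \<in> V - {u, a}" using that NV[OF u] Eua by (auto simp: N'_def)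
      then show ?thesis using Euz(1)[of b] that by (auto simp: E'_def N'_def)
    qed
    show "E u z = (z = a \<or> z \<in> N' a - ?W)" if "z \<in> ?V" for z
      using Euz(1)[of z] Eua(1) that by (auto simp: N'_def)
    show "E z w = (E' z w \<and> \<not> (z = a \<and> w \<in> N' a - ?W) \<and> \<not> (w = a \<and> z \<in> N' a - ?W))"
      if "z \<in> ?V" "w \<in> ?V" for z w
      using Euz(1)[of w] Euz(1)[of z] no_tri[of w] no_tri[of z] that E_irr E_sym
      by (auto simp: E'_def N'_def)
  qed (use W Nfacts Vins av in auto)
  then show thesis using that d by blast
qed

end

section \<open>The families W, N and M\<close>

text \<open>Legs are listed from the centre outwards; \<open>p\<close> is the vertex before the first one.\<close>
fun chainN :: "(nat \<Rightarrow> nat set) \<Rightarrow> nat \<Rightarrow> nat list \<Rightarrow> nat \<Rightarrow> bool" where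
  "chainN N p [] t = True"
| "chainN N p (v # L) t = (N v = {p, t} \<and> chainN N v L t)"

fun path_edges :: "nat \<Rightarrow> nat list \<Rightarrow> (nat \<times> nat) set" where
  "path_edges p [] = {}"
| "path_edges p (v # L) = insert (p, v) (path_edges v L)"

lemma chainN_append: "chainN N p (xs @ ys) t \<longleftrightarrow> chainN N p xs t \<and> chainN N (last (p # xs)) ys t"
  by (induction xs arbitrary: p) auto

lemma chainN_cong: "(\<And>k. k \<in> set L \<Longrightarrow> N k = N' k) \<Longrightarrow> chainN N p L t = chainN N' p L t"
  by (induction L arbitrary: p) auto

lemma chainN_mem: "chainN N p (xs @ a # ys) t \<Longrightarrow> N a = {last (p # xs), t}"
  by (simp add: chainN_append)

lemma chainN_insert:
  assumes "chainN N' p (xs @ a # ys) t" "\<And>k. k \<in> set xs \<union> set ys \<Longrightarrow> N k = N' k" "N u = N' a" "N a = {u, t}"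
  shows "chainN N p (xs @ u # a # ys) t"
  using assms chainN_cong[of xs N N'] chainN_cong[of ys N N'] by (simp add: chainN_append)

lemma path_edges_append: "path_edges p (xs @ ys) = path_edges p xs \<union> path_edges (last (p # xs)) ys"
  by (induction xs arbitrary: p) auto

lemma path_edges_mem: "(z, w) \<in> path_edges p L \<Longrightarrow> z \<in> set (p # L) \<and> w \<in> set L"
  by (induction L arbitrary: p) auto

definition star_on :: "nat set \<Rightarrow> (nat \<Rightarrow> nat \<Rightarrow> bool) \<Rightarrow> nat \<Rightarrow> nat list \<Rightarrow> nat list \<Rightarrow> nat list \<Rightarrow> bool" where
  "star_on V E x A B C \<longleftrightarrow> distinct (x # A @ B @ C) \<and> V = set (x # A @ B @ C) \<and>
     (\<forall>z\<in>V. \<forall>w\<in>V. E z w = ((z, w) \<in> path_edges x A \<union> path_edges x B \<union> path_edges x C \<or>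
        (w, z) \<in> path_edges x A \<union> path_edges x B \<union> path_edges x C))"

lemma star_on_rotate: "star_on V E x A B C \<Longrightarrow> star_on V E x B C A"
  unfolding star_on_def by auto

lemma star_on_swap: "star_on V E x A B C \<Longrightarrow> star_on V E x A C B"
  unfolding star_on_def by auto

lemma star_on_nbr:
  assumes "star_on V E x (xs @ a # ys) B C" "b \<in> V"
  shows "E a b \<longleftrightarrow> b = last (x # xs) \<or> (ys \<noteq> [] \<and> b = hd ys)"
proof -
  let ?p = "last (x # xs)"
  have d: "distinct (x # (xs @ a # ys) @ B @ C)" and V: "V = set (x # (xs @ a # ys) @ B @ C)"
    using assms(1) by (auto simp: star_on_def)
  have aV: "a \<in> V" using V by simp
  have E: "E a b = ((a, b) \<in> path_edges x (xs @ a # ys) \<union> path_edges x B \<union> path_edges x C \<or>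
     (b, a) \<in> path_edges x (xs @ a # ys) \<union> path_edges x B \<union> path_edges x C)"
    using assms(1)[unfolded star_on_def, THEN conjunct2, THEN conjunct2] aV assms(2) by blast
  have 1: "(a, b) \<notin> path_edges x B" "(b, a) \<notin> path_edges x B" "(a, b) \<notin> path_edges x C" "(b, a) \<notin> path_edges x C"
    "(a, b) \<notin> path_edges x xs" "(b, a) \<notin> path_edges x xs" "(b, a) \<notin> path_edges a ys"
    using d path_edges_mem by fastforce+
  have p: "?p \<noteq> a" using d by (cases xs rule: rev_cases) auto
  have 2: "(a, b) \<in> path_edges a ys \<longleftrightarrow> ys \<noteq> [] \<and> b = hd ys"
  proof (cases ys)
    case (Cons y zs)
    then have "(a, b) \<notin> path_edges y zs" using d path_edges_mem[of a b y zs] by auto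
    then show ?thesis using Cons by auto
  qed simp
  show ?thesis unfolding E using 1 2 p by (auto simp: path_edges_append)
qed

lemma star_on_nonadj:
  assumes "star_on V E x A B C" "a \<in> set A" "b \<in> set B" shows "\<not> E a b"
proof -
  obtain xs ys where A: "A = xs @ a # ys" using assms(2) by (meson split_list)
  have d: "distinct (x # A @ B @ C)" and V: "V = set (x # A @ B @ C)"
    using assms(1) by (auto simp: star_on_def)
  have "b \<in> V" using V assms(3) by simp
  have "b \<notin> set (x # A)" using d assms(3) by auto
  moreover have "last (x # xs) \<in> set (x # A)" using A by (cases xs rule: rev_cases) auto
  moreover have "ys \<noteq> [] \<Longrightarrow> hd ys \<in> set (x # A)" using A by auto
  ultimately show ?thesis using star_on_nbr[OF assms(1)[unfolded A] \<open>b \<in> V\<close>] by metis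
qed

lemma star_on_centre:
  assumes "star_on V E x A B C" "A \<noteq> []" "B \<noteq> []" "C \<noteq> []" "b \<in> V"
  shows "E x b \<longleftrightarrow> b \<in> {hd A, hd B, hd C}"
proof -
  obtain a1 A' b1 B' c1 C' where L: "A = a1 # A'" "B = b1 # B'" "C = c1 # C'"
    using assms(2-4) by (auto simp: neq_Nil_conv)
  have d: "distinct (x # A @ B @ C)" and V: "V = set (x # A @ B @ C)"
    using assms(1) by (auto simp: star_on_def)
  have xV: "x \<in> V" using V by simp
  have E: "E x b = ((x, b) \<in> path_edges x A \<union> path_edges x B \<union> path_edges x C \<or>
     (b, x) \<in> path_edges x A \<union> path_edges x B \<union> path_edges x C)"
    using assms(1)[unfolded star_on_def, THEN conjunct2, THEN conjunct2] xV assms(5) by blast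
  have 1: "(b, x) \<notin> path_edges x A" "(b, x) \<notin> path_edges x B" "(b, x) \<notin> path_edges x C"
    "(x, b) \<notin> path_edges a1 A'" "(x, b) \<notin> path_edges b1 B'" "(x, b) \<notin> path_edges c1 C'"
    using d L path_edges_mem by fastforce+
  show ?thesis unfolding E using 1 L by auto
qed

lemma star_on_insert:
  assumes s: "star_on V' E' x (xs @ a # ys) B C" and u: "u \<notin> V'" and V: "V = insert u V'"
    and sym: "\<And>z w. E z w \<Longrightarrow> E w z" "\<And>z. \<not> E z z"
    and Eu: "\<And>z. z \<in> V' \<Longrightarrow> E u z = (z = a \<or> z = last (x # xs))"
    and EV: "\<And>z w. z \<in> V' \<Longrightarrow> w \<in> V' \<Longrightarrow> E z w = (E' z w \<and> \<not> (z = a \<and> w = last (x # xs)) \<and> \<not> (w = a \<and> z = last (x # xs)))"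
  shows "star_on V E x (xs @ u # a # ys) B C"
proof -
  let ?p = "last (x # xs)"
  let ?S' = "path_edges x (xs @ a # ys) \<union> path_edges x B \<union> path_edges x C"
  let ?S = "path_edges x (xs @ u # a # ys) \<union> path_edges x B \<union> path_edges x C"
  have d: "distinct (x # (xs @ a # ys) @ B @ C)" and V': "V' = set (x # (xs @ a # ys) @ B @ C)"
    and E': "\<And>z w. z \<in> V' \<Longrightarrow> w \<in> V' \<Longrightarrow> E' z w = ((z, w) \<in> ?S' \<or> (w, z) \<in> ?S')"
    using s unfolding star_on_def by blast+
  let ?R = "path_edges x xs \<union> path_edges a ys \<union> path_edges x B \<union> path_edges x C"
  have S': "?S' = insert (?p, a) ?R" and S: "?S = insert (?p, u) (insert (u, a) ?R)"
    by (auto simp: path_edges_append)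
  have pm: "?p \<in> set (x # xs)" by (cases xs rule: rev_cases) auto
  have R: "(z, w) \<in> ?R \<Longrightarrow> z \<in> V' \<and> w \<in> V'" for z w using path_edges_mem V' by fastforce
  have nR: "(?p, a) \<notin> ?R" "(a, ?p) \<notin> ?R"
    using path_edges_mem[of ?p a] path_edges_mem[of a ?p] d pm by fastforce+
  have pV: "?p \<in> V'" "a \<in> V'" using V' pm by auto
  have "E z w = ((z, w) \<in> ?S \<or> (w, z) \<in> ?S)" if z: "z \<in> V" and w: "w \<in> V" for z w
  proof -
    consider "z \<in> V'" "w \<in> V'" | "z = u" "w \<in> V'" | "z \<in> V'" "w = u" | "z = u" "w = u"
      using z w V by blast
    then show ?thesis
    proof cases
      case 1
      then have "z \<noteq> u" "w \<noteq> u" using u by auto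
      then show ?thesis using EV[OF 1] E'[OF 1] nR pV unfolding S S' by blast
    next
      case 2
      then have "w \<noteq> u" using u by auto
      then show ?thesis using Eu[OF 2(2)] 2 R[of u w] R[of w u] u unfolding S by blast
    next
      case 3
      then have "z \<noteq> u" using u by auto
      moreover have "E z u = E u z" using sym(1) by blast
      ultimately show ?thesis using Eu[OF 3(1)] 3 R[of u z] R[of z u] u unfolding S by blast
    next
      case 4
      then show ?thesis using sym(2) R[of u u] u pV unfolding S by blast
    qed
  qed
  moreover have "distinct (x # (xs @ u # a # ys) @ B @ C)" using d u V' by auto
  moreover have "V = set (x # (xs @ u # a # ys) @ B @ C)" using V V' by auto
  ultimately show ?thesis unfolding star_on_def by blast
qed

lemma star_on_new_centre:
  assumes s: "star_on V' E' x [al] [be] C" and u: "u \<notin> V'" and V: "V = insert u V'"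
    and sym: "\<And>z w. E z w \<Longrightarrow> E w z" "\<And>z. \<not> E z z"
    and Eu: "\<And>z. z \<in> V' \<Longrightarrow> E u z = (z \<in> {x, al, be})"
    and EV: "\<And>z w. z \<in> V' \<Longrightarrow> w \<in> V' \<Longrightarrow> E z w = (E' z w \<and> \<not> (z = x \<and> w \<in> {al, be}) \<and> \<not> (w = x \<and> z \<in> {al, be}))"
  shows "star_on V E u [al] [be] (x # C)"
proof -
  let ?S' = "path_edges x [al] \<union> path_edges x [be] \<union> path_edges x C"
  let ?S = "path_edges u [al] \<union> path_edges u [be] \<union> path_edges u (x # C)"
  have d: "distinct (x # [al] @ [be] @ C)" and V': "V' = set (x # [al] @ [be] @ C)"
    and E': "\<And>z w. z \<in> V' \<Longrightarrow> w \<in> V' \<Longrightarrow> E' z w = ((z, w) \<in> ?S' \<or> (w, z) \<in> ?S')"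
    using s unfolding star_on_def by blast+
  let ?R = "path_edges x C"
  have S': "?S' = {(x, al), (x, be)} \<union> ?R" and S: "?S = {(u, al), (u, be), (u, x)} \<union> ?R"
    by auto
  have R: "(z, w) \<in> ?R \<Longrightarrow> z \<in> set (x # C) \<and> w \<in> set C" for z w using path_edges_mem by blast
  have ne: "al \<noteq> x" "be \<noteq> x" "al \<notin> set C" "be \<notin> set C" "x \<notin> set C" using d by auto
  have "E z w = ((z, w) \<in> ?S \<or> (w, z) \<in> ?S)" if z: "z \<in> V" and w: "w \<in> V" for z w
  proof -
    consider "z \<in> V'" "w \<in> V'" | "z = u" "w \<in> V'" | "z \<in> V'" "w = u" | "z = u" "w = u"
      using z w V by blast
    then show ?thesis
    proof cases
      case 1
      then have "z \<noteq> u" "w \<noteq> u" using u by auto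
      then show ?thesis using EV[OF 1] E'[OF 1] R[of z w] R[of w z] ne unfolding S S' by auto
    next
      case 2
      then have "w \<noteq> u" using u by auto
      then show ?thesis using Eu[OF 2(2)] 2 R[of u w] R[of w u] u V' unfolding S by auto
    next
      case 3
      then have "z \<noteq> u" using u by auto
      moreover have "E z u = E u z" using sym(1) by blast
      ultimately show ?thesis using Eu[OF 3(1)] 3 R[of u z] R[of z u] u V' unfolding S by auto
    next
      case 4
      then show ?thesis using sym(2) R[of u u] u V' unfolding S by auto
    qed
  qed
  moreover have "distinct (u # [al] @ [be] @ x # C)" using d u V' by auto
  moreover have "V = set (u # [al] @ [be] @ x # C)" using V V' by auto
  ultimately show ?thesis unfolding star_on_def by blast
qed

text \<open>Each column of a leg contains the predecessor of its vertex and a target common to the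
  whole leg, namely the end of the cyclically next leg.\<close>

definition W_str where
  "W_str V E N x A B C \<longleftrightarrow> A \<noteq> [] \<and> B \<noteq> [] \<and> C \<noteq> [] \<and> star_on V E x A B C \<and> N x = {last A, last B, last C} \<and>
     chainN N x A (last B) \<and> chainN N x B (last C) \<and> chainN N x C (last A)"

text \<open>The leg of \<open>al\<close> has length one, and the third leg changes its target from
  \<open>last B\<close> to \<open>al\<close> after \<open>C1\<close>. An empty \<open>C2\<close>
  gives the trees \<open>Delta 0 q r\<close>.\<close>

definition N_str where
  "N_str V E N x al B C1 C2 \<longleftrightarrow> B \<noteq> [] \<and> C1 \<noteq> [] \<and> star_on V E x [al] B (C1 @ C2) \<and>
     N x = {al, last B, last (C1 @ C2)} \<and> N al = {last B, last C1} \<and>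
     chainN N x B (last (C1 @ C2)) \<and> chainN N x C1 (last B) \<and> chainN N (last C1) C2 al"

text \<open>Two legs have length one, and the third runs through the targets
  \<open>last (C1 @ C2)\<close>, \<open>be\<close>, \<open>al\<close>. The cases
  \<open>C1 = []\<close> and \<open>C2 = []\<close> are \<open>r = 0\<close> and
  \<open>p = 0\<close> in \<open>Lambda p q r\<close>.\<close>

definition M_str where
  "M_str V E N x al be C0 C1 C2 \<longleftrightarrow> C0 \<noteq> [] \<and> C1 @ C2 \<noteq> [] \<and> star_on V E x [al] [be] (C0 @ C1 @ C2) \<and>
     N x = {al, be, last (C1 @ C2)} \<and> N al = {be, last (C0 @ C1)} \<and> N be = {last (C1 @ C2), last C0} \<and>
     chainN N x C0 (last (C1 @ C2)) \<and> chainN N (last C0) C1 be \<and> chainN N (last (C0 @ C1)) C2 al"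

definition WNM where
  "WNM V E N \<longleftrightarrow> (\<exists>x A B C. W_str V E N x A B C) \<or> (\<exists>x al B C1 C2. N_str V E N x al B C1 C2) \<or>
     (\<exists>x al be C0 C1 C2. M_str V E N x al be C0 C1 C2)"

lemma W_str_rotate: "W_str V E N x A B C \<Longrightarrow> W_str V E N x B C A"
  unfolding W_str_def using star_on_rotate by auto

lemma N_str_swap: "N_str V E N x al B C [] \<Longrightarrow> N_str V E N x al C B []"
  unfolding N_str_def using star_on_swap by auto

locale expand =
  fixes V' E' N' a u W V and E :: "nat \<Rightarrow> nat \<Rightarrow> bool" and N
  assumes ex: "expansion V' E' N' a u W V E N"
    and sym: "\<And>z w. E z w \<Longrightarrow> E w z" and irr: "\<And>z. \<not> E z z"
begin

lemma exD:
  "u \<notin> V'" "V = insert u V'" "a \<in> V'" "W \<subseteq> N' a" "W = {} \<or> (\<exists>w. W = {w})" "\<And>b. b \<in> N' a - W \<Longrightarrow> E' a b"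
  "N u = N' a" "N a = insert u W" "\<And>k. k \<in> V' \<Longrightarrow> k \<noteq> a \<Longrightarrow> N k = N' k"
  "\<And>z. z \<in> V' \<Longrightarrow> E u z = (z = a \<or> z \<in> N' a - W)"
  "\<And>z w. z \<in> V' \<Longrightarrow> w \<in> V' \<Longrightarrow> E z w = (E' z w \<and> \<not> (z = a \<and> w \<in> N' a - W) \<and> \<not> (w = a \<and> z \<in> N' a - W))"
proof -
  note e = ex[unfolded expansion_def]
  show "u \<notin> V'" "V = insert u V'" "a \<in> V'" "W \<subseteq> N' a" "W = {} \<or> (\<exists>w. W = {w})" "N u = N' a" "N a = insert u W"
    using e by - ((elim conjE, assumption)+)
  have "\<forall>b\<in>N' a - W. E' a b" "\<forall>k\<in>V' - {a}. N k = N' k" "\<forall>z\<in>V'. E u z = (z = a \<or> z \<in> N' a - W)"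
    "\<forall>z\<in>V'. \<forall>w\<in>V'. E z w = (E' z w \<and> \<not> (z = a \<and> w \<in> N' a - W) \<and> \<not> (w = a \<and> z \<in> N' a - W))"
    using e by - ((elim conjE, assumption)+)
  then show "\<And>b. b \<in> N' a - W \<Longrightarrow> E' a b" "\<And>k. k \<in> V' \<Longrightarrow> k \<noteq> a \<Longrightarrow> N k = N' k"
    "\<And>z. z \<in> V' \<Longrightarrow> E u z = (z = a \<or> z \<in> N' a - W)"
    "\<And>z w. z \<in> V' \<Longrightarrow> w \<in> V' \<Longrightarrow> E z w = (E' z w \<and> \<not> (z = a \<and> w \<in> N' a - W) \<and> \<not> (w = a \<and> z \<in> N' a - W))"
    by simp_all
qed

text \<open>Keeping the target in column \<open>a\<close> while the predecessor moves to column
  \<open>u\<close> lengthens the leg by one vertex with the same target.\<close>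

lemma leg_insert:
  assumes s: "star_on V' E' x (xs @ a # ys) B C" and Na: "N' a = {last (x # xs), t}" and W: "W = {t}" "last (x # xs) \<noteq> t"
  shows "star_on V E x (xs @ u # a # ys) B C" and "N a = {u, t}"
proof -
  have "N' a - W = {last (x # xs)}" using Na W by auto
  then show "star_on V E x (xs @ u # a # ys) B C"
    using exD(10,11) by (intro star_on_insert[OF s exD(1,2) sym irr]) auto
  show "N a = {u, t}" using exD(8) W by auto
qed

text \<open>Members of \<open>N' a\<close> outside \<open>W\<close> are adjacent to
  \<open>a\<close>; so a nonadjacent target stays in \<open>W\<close>, and only one expansion at
  \<open>a\<close> is possible.\<close>

lemma forced:
  assumes s: "star_on V' E' x (xs @ a # ys) B C" and Na: "N' a = {last (x # xs), t}" and t: "\<not> E' a t"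
  shows "W = {t}" and "last (x # xs) \<noteq> t"
proof -
  have "t \<in> W" using exD(6)[of t] Na t by blast
  then show "W = {t}" using exD(5) by blast
  have "last (x # xs) \<in> V'" using s unfolding star_on_def by (cases xs rule: rev_cases) auto
  then have "E' a (last (x # xs))" using star_on_nbr[OF s] by blast
  then show "last (x # xs) \<noteq> t" using t by auto
qed

lemma W_leg_str:
  assumes w: "W_str V' E' N' x A B C" and A: "A = xs @ a # ys"
  shows "W_str V E N x (xs @ u # a # ys) B C"
proof -
  have s: "star_on V' E' x (xs @ a # ys) B C" and ne: "B \<noteq> []" "C \<noteq> []"
    and Nx: "N' x = {last A, last B, last C}"
    and ch: "chainN N' x (xs @ a # ys) (last B)" "chainN N' x B (last C)" "chainN N' x C (last A)"
    using w unfolding W_str_def A by auto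
  have d: "distinct (x # (xs @ a # ys) @ B @ C)" and V': "V' = set (x # (xs @ a # ys) @ B @ C)"
    using s by (auto simp: star_on_def)
  have Na: "N' a = {last (x # xs), last B}" by (rule chainN_mem[OF ch(1)])
  have "\<not> E' a (last B)" using star_on_nonadj[OF s] ne by auto
  note f = forced[OF s Na this]
  note l = leg_insert[OF s Na f]
  have other: "N k = N' k" if "k \<in> set (x # xs @ ys @ B @ C)" for k
    by (rule exD(9)) (use that d V' in auto)
  show ?thesis
    unfolding W_str_def
  proof (intro conjI)
    show "chainN N x (xs @ u # a # ys) (last B)"
      by (rule chainN_insert[OF ch(1) _ exD(7) l(2)]) (use other in auto)
    show "chainN N x B (last C)" "chainN N x C (last (xs @ u # a # ys))"
      using ch(2,3) chainN_cong[of B N N'] chainN_cong[of C N N'] other A by auto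
    show "N x = {last (xs @ u # a # ys), last B, last C}" using other[of x] Nx A by simp
  qed (use l ne in auto)
qed

lemma W_leg: "W_str V' E' N' x A B C \<Longrightarrow> a \<in> set A \<Longrightarrow> WNM V E N"
  using W_leg_str split_list unfolding WNM_def by metis

lemma single_leg: "L \<noteq> [] \<Longrightarrow> distinct L \<Longrightarrow> last L = hd L \<Longrightarrow> L = [last L]"
  by (cases L) (auto split: if_splits)

text \<open>An end released from \<open>W\<close> is adjacent to the centre, so its leg has length
  one.\<close>

lemma centre_single:
  assumes s: "star_on V' E' a A B C" and ne: "A \<noteq> []" "B \<noteq> []" "C \<noteq> []" and l: "last A \<in> N' a - W"
  shows "A = [last A]"
proof -
  have d: "distinct (a # A @ B @ C)" and V: "V' = set (a # A @ B @ C)" using s by (auto simp: star_on_def)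
  have "last A \<in> V'" "E' a (last A)" using V ne exD(6)[OF l] by auto
  then have "last A \<in> {hd A, hd B, hd C}" using star_on_centre[OF s ne] by blast
  moreover have "last A \<in> set A" "hd B \<in> set B" "hd C \<in> set C" using ne by auto
  ultimately have "last A = hd A" using d by auto
  then show ?thesis using single_leg[OF ne(1)] d by simp
qed

lemma centre_hub:
  assumes s: "star_on V' E' a A B C" and ne: "A = [l1]" "B = [l2]" "C = [l3]" and N: "N' a = {l1, l2, l3}"
  shows "N' a = {z\<in>V'. E' a z}"
proof -
  have V: "V' = set (a # A @ B @ C)" using s by (auto simp: star_on_def)
  show ?thesis using star_on_centre[OF s] ne N V by auto
qed

text \<open>The new vertex takes over the two one-vertex legs and thereby the branching; the old
  centre becomes the first vertex of the third leg.\<close>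

lemma new_centre:
  assumes s: "star_on V' E' a [al] [be] C" "C \<noteq> []" and N: "N' a = {al, be, last C}" and W: "W = {last C}"
  shows "star_on V E u [al] [be] (a # C)" and "N u = {al, be, last C}" and "N a = {u, last C}"
proof -
  have "last C \<notin> {al, be}" using s unfolding star_on_def by auto
  then have "N' a - W = {al, be}" using N W by auto
  then show "star_on V E u [al] [be] (a # C)"
    using exD(10,11) by (intro star_on_new_centre[OF s(1) exD(1,2) sym irr]) auto
  show "N u = {al, be, last C}" "N a = {u, last C}" using exD(7,8) N W by auto
qed

text \<open>Expansion at the centre releases two ends, so two legs have length one. The outcome is
  of type M, with the old centre as \<open>C0\<close> and the third leg as
  \<open>C2\<close>.\<close>

lemma W_centre_str:
  assumes w: "W_str V' E' N' a A B C" and W: "W = {last C}"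
  shows "M_str V E N u (last A) (last B) [a] [] C"
proof -
  have s: "star_on V' E' a A B C" and ne: "A \<noteq> []" "B \<noteq> []" "C \<noteq> []" and Na: "N' a = {last A, last B, last C}"
    and ch: "chainN N' a A (last B)" "chainN N' a B (last C)" "chainN N' a C (last A)"
    using w unfolding W_str_def by auto
  have d: "distinct (a # A @ B @ C)" and V': "V' = set (a # A @ B @ C)" using s by (auto simp: star_on_def)
  have lm: "last A \<in> set A" "last B \<in> set B" "last C \<in> set C" using ne by auto
  have "last A \<in> N' a - W" "last B \<in> N' a - W" using Na W d lm by auto
  then have A: "A = [last A]" and B: "B = [last B]"
    using centre_single[OF s ne] centre_single[OF star_on_rotate[OF s] ne(2,3,1)] by blast+
  define al be where "al = last A" and "be = last B"
  have AB: "A = [al]" "B = [be]" using A B by (simp_all add: al_def be_def)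
  note nc = new_centre[OF s[unfolded AB] ne(3) Na[unfolded AB, simplified] W]
  have other: "N k = N' k" if "k \<in> set (A @ B @ C)" for k by (rule exD(9)) (use that d V' in auto)
  have "M_str V E N u al be [a] [] C"
    unfolding M_str_def using nc ne ch other[of al] other[of be] AB chainN_cong[of C N N'] other by auto
  then show ?thesis by (simp add: al_def be_def)
qed

lemma W_centre: "W_str V' E' N' a A B C \<Longrightarrow> W = {last C} \<Longrightarrow> WNM V E N"
  using W_centre_str unfolding WNM_def by blast

lemma N_part_B_str:
  assumes w: "N_str V' E' N' x al B C1 C2" and B: "B = xs @ a # ys"
  shows "N_str V E N x al (xs @ u # a # ys) C1 C2"
proof -
  let ?C = "C1 @ C2"
  have s: "star_on V' E' x (xs @ a # ys) ?C [al]" and ne: "C1 \<noteq> []"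
    and Nx: "N' x = {al, last B, last ?C}" and Nal: "N' al = {last B, last C1}"
    and ch: "chainN N' x (xs @ a # ys) (last ?C)" "chainN N' x C1 (last B)" "chainN N' (last C1) C2 al"
    using w star_on_rotate unfolding N_str_def B by auto
  have d: "distinct (x # (xs @ a # ys) @ ?C @ [al])" and V': "V' = set (x # (xs @ a # ys) @ ?C @ [al])"
    using s by (auto simp: star_on_def)
  have Na: "N' a = {last (x # xs), last ?C}" by (rule chainN_mem[OF ch(1)])
  have "last ?C \<in> set ?C" using ne by (intro last_in_set) simp
  then have "\<not> E' a (last ?C)" using star_on_nonadj[OF s, of a "last ?C"] by simp
  note f = forced[OF s Na this]
  note l = leg_insert[OF s Na f]
  have other: "N k = N' k" if "k \<in> set (x # xs @ ys @ ?C @ [al])" for k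
    by (rule exD(9)) (use that d V' in auto)
  show ?thesis
    unfolding N_str_def
  proof (intro conjI)
    show "star_on V E x [al] (xs @ u # a # ys) ?C" by (rule star_on_rotate[OF star_on_rotate[OF l(1)]])
    show "chainN N x (xs @ u # a # ys) (last ?C)"
      by (rule chainN_insert[OF ch(1) _ exD(7) l(2)]) (use other in auto)
    show "chainN N x C1 (last (xs @ u # a # ys))" "chainN N (last C1) C2 al"
      using ch(2,3) chainN_cong[of C1 N N'] chainN_cong[of C2 N N'] other B by auto
    show "N x = {al, last (xs @ u # a # ys), last ?C}" using other[of x] Nx B by simp
    show "N al = {last (xs @ u # a # ys), last C1}" using other[of al] Nal B by simp
  qed (use ne in auto)
qed

lemma N_part_B: "N_str V' E' N' x al B C1 C2 \<Longrightarrow> a \<in> set B \<Longrightarrow> WNM V E N"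
  using N_part_B_str split_list unfolding WNM_def by metis

lemma N_part_C1_str:
  assumes w: "N_str V' E' N' x al B C1 C2" and C1: "C1 = xs @ a # ys"
  shows "N_str V E N x al B (xs @ u # a # ys) C2"
proof -
  have s0: "star_on V' E' x [al] B ((xs @ a # ys) @ C2)" and ne: "B \<noteq> []"
    and Nx: "N' x = {al, last B, last ((xs @ a # ys) @ C2)}" and Nal: "N' al = {last B, last (xs @ a # ys)}"
    and ch: "chainN N' x (xs @ a # ys) (last B)" "chainN N' x B (last ((xs @ a # ys) @ C2))" "chainN N' (last (xs @ a # ys)) C2 al"
    using w unfolding N_str_def C1 by - ((elim conjE, assumption)+)
  have s: "star_on V' E' x (xs @ a # (ys @ C2)) B [al]"
    using star_on_swap[OF star_on_rotate[OF star_on_rotate[OF s0]]] by simp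
  have d: "distinct (x # (xs @ a # (ys @ C2)) @ B @ [al])" and V': "V' = set (x # (xs @ a # (ys @ C2)) @ B @ [al])"
    using s by (auto simp: star_on_def)
  have Na: "N' a = {last (x # xs), last B}" by (rule chainN_mem[OF ch(1)])
  have "\<not> E' a (last B)" using star_on_nonadj[OF s, of a "last B"] ne by simp
  note f = forced[OF s Na this]
  note l = leg_insert[OF s Na f]
  have other: "N k = N' k" if "k \<in> set (x # xs @ ys @ C2 @ B @ [al])" for k
    by (rule exD(9)) (use that d V' in auto)
  let ?C1 = "xs @ u # a # ys"
  have last: "last ?C1 = last C1" "last (?C1 @ C2) = last (C1 @ C2)" by (simp_all add: C1)
  note Nx = Nx[folded C1] and Nal = Nal[folded C1] and ch = ch[folded C1]
  show ?thesis
    unfolding N_str_def last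
  proof (intro conjI)
    show "star_on V E x [al] B (?C1 @ C2)" using star_on_swap[OF star_on_rotate[OF star_on_rotate[OF l(1)]]] by simp
    show "chainN N x ?C1 (last B)"
      by (rule chainN_insert[OF ch(1)[unfolded C1] _ exD(7) l(2)]) (use other in auto)
    show "chainN N x B (last (C1 @ C2))" "chainN N (last C1) C2 al"
      using ch(2,3) chainN_cong[of B N N'] chainN_cong[of C2 N N'] other by auto
    show "N x = {al, last B, last (C1 @ C2)}" using other[of x] Nx by simp
    show "N al = {last B, last C1}" using other[of al] Nal by simp
  qed (use ne in auto)
qed

lemma N_part_C1: "N_str V' E' N' x al B C1 C2 \<Longrightarrow> a \<in> set C1 \<Longrightarrow> WNM V E N"
  using N_part_C1_str split_list unfolding WNM_def by metis

lemma N_part_C2_str: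
  assumes w: "N_str V' E' N' x al B C1 C2" and C2: "C2 = xs @ a # ys"
  shows "N_str V E N x al B C1 (xs @ u # a # ys)"
proof -
  have s: "star_on V' E' x ((C1 @ xs) @ a # ys) [al] B" and ne: "B \<noteq> []" "C1 \<noteq> []"
    and Nx: "N' x = {al, last B, last (C1 @ C2)}" and Nal: "N' al = {last B, last C1}"
    and ch: "chainN N' (last C1) (xs @ a # ys) al" "chainN N' x B (last (C1 @ C2))" "chainN N' x C1 (last B)"
    using w star_on_rotate unfolding N_str_def C2 by (auto simp del: last_append)
  have d: "distinct (x # ((C1 @ xs) @ a # ys) @ [al] @ B)" and V': "V' = set (x # ((C1 @ xs) @ a # ys) @ [al] @ B)"
    using s by (auto simp: star_on_def)
  have "N' a = {last (last C1 # xs), al}" by (rule chainN_mem[OF ch(1)])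
  then have Na: "N' a = {last (x # C1 @ xs), al}" using ne by simp
  have "\<not> E' a al" using star_on_nonadj[OF s, of a al] by simp
  note f = forced[OF s Na this]
  note l = leg_insert[OF s Na f]
  have other: "N k = N' k" if "k \<in> set (x # C1 @ xs @ ys @ B @ [al])" for k
    by (rule exD(9)) (use that d V' in auto)
  let ?C2 = "xs @ u # a # ys"
  have last: "last (C1 @ ?C2) = last (C1 @ C2)" by (simp add: C2)
  show ?thesis
    unfolding N_str_def last
  proof (intro conjI)
    show "star_on V E x [al] B (C1 @ ?C2)" using star_on_rotate[OF l(1)] by simp
    show "chainN N (last C1) ?C2 al"
      by (rule chainN_insert[OF ch(1) _ exD(7) l(2)]) (use other in auto)
    show "chainN N x B (last (C1 @ C2))" "chainN N x C1 (last B)"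
      using ch(2,3) chainN_cong[of B N N'] chainN_cong[of C1 N N'] other by auto
    show "N x = {al, last B, last (C1 @ C2)}" using other[of x] Nx by simp
    show "N al = {last B, last C1}" using other[of al] Nal by simp
  qed (use ne in auto)
qed

lemma N_part_C2: "N_str V' E' N' x al B C1 C2 \<Longrightarrow> a \<in> set C2 \<Longrightarrow> WNM V E N"
  using N_part_C2_str split_list unfolding WNM_def by metis

text \<open>Both members of \<open>N' a\<close> are nonadjacent to \<open>a\<close>, but
  \<open>W\<close> has room for only one: no expansion exists at this vertex.\<close>

lemma N_al:
  assumes w: "N_str V' E' N' x a B C1 C2" shows False
proof -
  have s: "star_on V' E' x [a] B (C1 @ C2)" and ne: "B \<noteq> []" "C1 \<noteq> []" and Na: "N' a = {last B, last C1}"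
    using w unfolding N_str_def by auto
  have m: "last B \<in> set B" "last C1 \<in> set (C1 @ C2)" using ne by auto
  have "\<not> E' a (last B)" using star_on_nonadj[OF s, of a "last B"] m by simp
  moreover have "\<not> E' a (last C1)" using star_on_nonadj[OF star_on_swap[OF s], of a "last C1"] m by simp
  moreover have "last B \<noteq> last C1" using s m unfolding star_on_def by auto
  moreover have "last B \<in> W" "last C1 \<in> W"
    using calculation exD(6)[of "last B"] exD(6)[of "last C1"] Na by auto
  ultimately show False using exD(5) by auto
qed

lemma N_centre_str:
  assumes w: "N_str V' E' N' a al B C1 C2" and W: "W = {last (C1 @ C2)}"
  shows "M_str V E N u al (last B) [a] C1 C2"
proof -
  let ?C = "C1 @ C2"
  have s: "star_on V' E' a [al] B ?C" and ne: "B \<noteq> []" "C1 \<noteq> []" and Na: "N' a = {al, last B, last ?C}"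
    and Nal: "N' al = {last B, last C1}"
    and ch: "chainN N' a B (last ?C)" "chainN N' a C1 (last B)" "chainN N' (last C1) C2 al"
    using w unfolding N_str_def by (auto simp del: last_append)
  have neC: "?C \<noteq> []" using ne by simp
  have d: "distinct (a # [al] @ B @ ?C)" and V': "V' = set (a # [al] @ B @ ?C)" using s by (auto simp: star_on_def)
  have lm: "last B \<in> set B" "last ?C \<in> set ?C" using ne(1) last_in_set[OF neC] by auto
  have "last B \<in> N' a - W" using Na W d lm by (auto simp del: last_append)
  then have B: "B = [last B]"
    using centre_single[OF star_on_rotate[OF s] ne(1) neC] by blast
  define be where "be = last B"
  have AB: "B = [be]" using B by (simp add: be_def)
  note nc = new_centre[OF s[unfolded AB] neC _ W]
  have Na': "N' a = {al, be, last ?C}" using Na AB by (simp del: last_append)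
  have other: "N k = N' k" if "k \<in> set ([al] @ B @ ?C)" for k by (rule exD(9)) (use that d V' in auto)
  have "M_str V E N u al be [a] C1 C2"
    unfolding M_str_def
  proof (intro conjI)
    show "star_on V E u [al] [be] ([a] @ C1 @ C2)" using nc(1)[OF Na'] by simp
    show "N u = {al, be, last ?C}" by (rule nc(2)[OF Na'])
    show "N al = {be, last ([a] @ C1)}" using Nal other[of al] AB ne by simp
    show "N be = {last ?C, last [a]}" using ch(1) other[of be] AB by (auto simp del: last_append)
    show "chainN N u [a] (last ?C)" using nc(3)[OF Na'] by (simp del: last_append)
    show "chainN N (last [a]) C1 be" using ch(2) chainN_cong[of C1 N N'] other AB by auto
    show "chainN N (last ([a] @ C1)) C2 al" using ch(3) chainN_cong[of C2 N N'] other ne by auto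
  qed (use ne in auto)
  then show ?thesis by (simp add: be_def)
qed

lemma N_centre: "N_str V' E' N' a al B C1 C2 \<Longrightarrow> W = {last (C1 @ C2)} \<Longrightarrow> WNM V E N"
  using N_centre_str unfolding WNM_def by blast

text \<open>On this part of the leg the target can be adjacent to \<open>a\<close>, so
  \<open>W\<close> being the target is an assumption here instead of a consequence of
  \<open>forced\<close>.\<close>

lemma M_part_C0_str:
  assumes w: "M_str V' E' N' x al be C0 C1 C2" and C0: "C0 = xs @ a # ys"
    and t: "W = {last (C1 @ C2)}" "last (x # xs) \<noteq> last (C1 @ C2)"
  shows "M_str V E N x al be (xs @ u # a # ys) C1 C2"
proof -
  let ?C = "C0 @ C1 @ C2"
  have s: "star_on V' E' x ?C [al] [be]" and ne: "C0 \<noteq> []" "C1 @ C2 \<noteq> []"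
    and Nx: "N' x = {al, be, last (C1 @ C2)}" and Nal: "N' al = {be, last (C0 @ C1)}"
    and Nbe: "N' be = {last (C1 @ C2), last C0}"
    and ch: "chainN N' x C0 (last (C1 @ C2))" "chainN N' (last C0) C1 be" "chainN N' (last (C0 @ C1)) C2 al"
    using w star_on_rotate unfolding M_str_def by (auto simp del: last_append)
  have d: "distinct (x # ?C @ [al] @ [be])" and V': "V' = set (x # ?C @ [al] @ [be])"
    using s by (auto simp: star_on_def)
  have other: "N k = N' k" if "k \<in> set (x # ?C @ [al] @ [be])" "k \<noteq> a" for k
    by (rule exD(9)) (use that d V' in auto)
  have a: "a \<in> set ?C" using C0 by simp
  have xa: "x \<noteq> a" "al \<noteq> a" "be \<noteq> a" using a d by auto
  have s': "star_on V' E' x (xs @ a # (ys @ C1 @ C2)) [al] [be]" using s C0 by simp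
  have Na: "N' a = {last (x # xs), last (C1 @ C2)}" by (rule chainN_mem[OF ch(1)[unfolded C0]])
  note l = leg_insert[OF s' Na t]
  let ?C0 = "xs @ u # a # ys"
  have last: "last ?C0 = last C0" "last (?C0 @ C1) = last (C0 @ C1)" by (simp_all add: C0)
  have ax: "a \<notin> set xs \<union> set ys \<union> set C1 \<union> set C2" using d C0 by auto
  show ?thesis
    unfolding M_str_def last
  proof (intro conjI)
    show "star_on V E x [al] [be] (?C0 @ C1 @ C2)" using star_on_rotate[OF l(1)] by simp
    show "chainN N x ?C0 (last (C1 @ C2))"
      by (rule chainN_insert[OF ch(1)[unfolded C0] _ exD(7) l(2)]) (use other ax C0 in auto)
    have o: "N k = N' k" if "k \<in> set C1 \<union> set C2" for k by (rule other) (use that ax in auto)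
    have "chainN N p C1 t = chainN N' p C1 t" for p t by (rule chainN_cong) (use o in blast)
    moreover have "chainN N p C2 t = chainN N' p C2 t" for p t by (rule chainN_cong) (use o in blast)
    ultimately show "chainN N (last C0) C1 be" "chainN N (last (C0 @ C1)) C2 al" using ch by auto
  qed (use ne other xa Nx Nal Nbe in \<open>auto simp del: last_append\<close>)
qed

lemma M_part_C0:
  assumes "M_str V' E' N' x al be C0 C1 C2" "C0 = xs @ a # ys" "W = {last (C1 @ C2)}" "last (x # xs) \<noteq> last (C1 @ C2)"
  shows "WNM V E N"
  using M_part_C0_str[OF assms] unfolding WNM_def by blast

lemma M_part:
  assumes w: "M_str V' E' N' x al be C0 C1 C2" and a12: "a \<in> set (C1 @ C2)"
  shows "WNM V E N"
proof -
  let ?C = "C0 @ C1 @ C2"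
  have s: "star_on V' E' x ?C [al] [be]" and ne: "C0 \<noteq> []" "C1 @ C2 \<noteq> []"
    and Nx: "N' x = {al, be, last (C1 @ C2)}" and Nal: "N' al = {be, last (C0 @ C1)}"
    and Nbe: "N' be = {last (C1 @ C2), last C0}"
    and ch: "chainN N' x C0 (last (C1 @ C2))" "chainN N' (last C0) C1 be" "chainN N' (last (C0 @ C1)) C2 al"
    using w star_on_rotate unfolding M_str_def by (auto simp del: last_append)
  have d: "distinct (x # ?C @ [al] @ [be])" and V': "V' = set (x # ?C @ [al] @ [be])"
    using s by (auto simp: star_on_def)
  have other: "N k = N' k" if "k \<in> set (x # ?C @ [al] @ [be])" "k \<noteq> a" for k
    by (rule exD(9)) (use that d V' in auto)
  have a: "a \<in> set ?C" using a12 by simp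
  have xa: "x \<noteq> a" "al \<noteq> a" "be \<noteq> a" using a d by auto
  have na: "\<not> E' a al" "\<not> E' a be"
    using star_on_nonadj[OF s a, of al] star_on_nonadj[OF star_on_swap[OF s] a, of be] by simp_all
  consider "a \<in> set C1" | "a \<in> set C2" using a12 by auto
  then show ?thesis
  proof cases
    case 1
    then obtain xs ys where C1: "C1 = xs @ a # ys" by (meson split_list)
    have s': "star_on V' E' x ((C0 @ xs) @ a # (ys @ C2)) [al] [be]" using s C1 by simp
    have "N' a = {last (last C0 # xs), be}" by (rule chainN_mem[OF ch(2)[unfolded C1]])
    then have Na: "N' a = {last (x # C0 @ xs), be}" using ne by simp
    note l = leg_insert[OF s' Na forced[OF s' Na na(2)]]
    let ?C1 = "xs @ u # a # ys"
    have last: "last (C0 @ ?C1) = last (C0 @ C1)" "last (?C1 @ C2) = last (C1 @ C2)" by (simp_all add: C1)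
    have ax: "a \<notin> set xs \<union> set ys \<union> set C0 \<union> set C2" using d C1 by auto
    have "M_str V E N x al be C0 ?C1 C2"
      unfolding M_str_def last
    proof (intro conjI)
      show "star_on V E x [al] [be] (C0 @ ?C1 @ C2)" using star_on_rotate[OF l(1)] by simp
      show "chainN N (last C0) ?C1 be"
        by (rule chainN_insert[OF ch(2)[unfolded C1] _ exD(7) l(2)]) (use other ax C1 in auto)
      have o: "N k = N' k" if "k \<in> set C0 \<union> set C2" for k by (rule other) (use that ax in auto)
      have "chainN N p C0 t = chainN N' p C0 t" for p t by (rule chainN_cong) (use o in blast)
      moreover have "chainN N p C2 t = chainN N' p C2 t" for p t by (rule chainN_cong) (use o in blast)
      ultimately show "chainN N x C0 (last (C1 @ C2))" "chainN N (last (C0 @ C1)) C2 al" using ch by auto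
    qed (use ne other xa Nx Nal Nbe in \<open>auto simp del: last_append\<close>)
    then show ?thesis unfolding WNM_def by blast
  next
    case 2
    then obtain xs ys where C2: "C2 = xs @ a # ys" by (meson split_list)
    have s': "star_on V' E' x ((C0 @ C1 @ xs) @ a # ys) [al] [be]" using s C2 by simp
    have "N' a = {last (last (C0 @ C1) # xs), al}" by (rule chainN_mem[OF ch(3)[unfolded C2]])
    then have Na: "N' a = {last (x # C0 @ C1 @ xs), al}" using ne by (cases xs rule: rev_cases) auto
    note l = leg_insert[OF s' Na forced[OF s' Na na(1)]]
    let ?C2 = "xs @ u # a # ys"
    have last: "last (C1 @ ?C2) = last (C1 @ C2)" by (simp add: C2)
    have ax: "a \<notin> set xs \<union> set ys \<union> set C0 \<union> set C1" using d C2 by auto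
    have "M_str V E N x al be C0 C1 ?C2"
      unfolding M_str_def last
    proof (intro conjI)
      show "star_on V E x [al] [be] (C0 @ C1 @ ?C2)" using star_on_rotate[OF l(1)] by simp
      show "chainN N (last (C0 @ C1)) ?C2 al"
        by (rule chainN_insert[OF ch(3)[unfolded C2] _ exD(7) l(2)]) (use other ax C2 in auto)
      have o: "N k = N' k" if "k \<in> set C0 \<union> set C1" for k by (rule other) (use that ax in auto)
      have "chainN N p C0 t = chainN N' p C0 t" for p t by (rule chainN_cong) (use o in blast)
      moreover have "chainN N p C1 t = chainN N' p C1 t" for p t by (rule chainN_cong) (use o in blast)
      ultimately show "chainN N x C0 (last (C1 @ C2))" "chainN N (last C0) C1 be" using ch by auto
    qed (use ne other xa Nx Nal Nbe in \<open>auto simp del: last_append\<close>)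
    then show ?thesis unfolding WNM_def by blast
  qed
qed

text \<open>As for \<open>N_al\<close>: two nonadjacent members of one column cannot both stay in
  \<open>W\<close>.\<close>

lemma M_ends:
  assumes w: "M_str V' E' N' x al be C0 C1 C2" shows "a \<noteq> al" "a \<noteq> be"
proof -
  let ?C = "C0 @ C1 @ C2"
  have s: "star_on V' E' x [al] [be] ?C" and ne: "C0 \<noteq> []" "C1 @ C2 \<noteq> []"
    and Nal: "N' al = {be, last (C0 @ C1)}" and Nbe: "N' be = {last (C1 @ C2), last C0}"
    using w unfolding M_str_def by (auto simp del: last_append)
  have d: "distinct (x # [al] @ [be] @ ?C)" using s by (auto simp: star_on_def)
  have m1: "last (C0 @ C1) \<in> set ?C" using last_in_set[of "C0 @ C1"] ne by (auto simp del: last_append)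
  have m2: "last C0 \<in> set C0" using ne by simp
  have m3: "last (C1 @ C2) \<in> set (C1 @ C2)" by (rule last_in_set[OF ne(2)])
  have al: "\<not> E' al be" "\<not> E' al (last (C0 @ C1))"
    using star_on_nonadj[OF s, of al be] star_on_nonadj[OF star_on_swap[OF s], of al "last (C0 @ C1)"] m1
    by (simp_all del: last_append)
  have be: "\<not> E' be (last (C1 @ C2))" "\<not> E' be (last C0)"
    using star_on_nonadj[OF star_on_rotate[OF s], of be] m2 m3 by auto
  have ne1: "be \<noteq> last (C0 @ C1)" using d m1 by (auto simp del: last_append)
  have ne2: "last (C1 @ C2) \<noteq> last C0" using d m2 m3 by (auto simp del: last_append)
  show "a \<noteq> al"
  proof
    assume "a = al"
    then have "be \<in> W" "last (C0 @ C1) \<in> W" using exD(6)[of be] exD(6)[of "last (C0 @ C1)"] Nal al by auto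
    then show False using exD(5) ne1 by auto
  qed
  show "a \<noteq> be"
  proof
    assume "a = be"
    then have "last (C1 @ C2) \<in> W" "last C0 \<in> W" using exD(6)[of "last (C1 @ C2)"] exD(6)[of "last C0"] Nbe be by auto
    then show False using exD(5) ne2 by auto
  qed
qed

text \<open>The third leg has at least two vertices, so its end is not adjacent to the centre and
  has to lie in \<open>W\<close>.\<close>

lemma M_centre:
  assumes w: "M_str V' E' N' a al be C0 C1 C2" shows "WNM V E N"
proof -
  let ?C = "C0 @ C1 @ C2"
  have s: "star_on V' E' a [al] [be] ?C" and ne: "C0 \<noteq> []" "C1 @ C2 \<noteq> []"
    and Na: "N' a = {al, be, last (C1 @ C2)}" and Nal: "N' al = {be, last (C0 @ C1)}"
    and Nbe: "N' be = {last (C1 @ C2), last C0}"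
    and ch: "chainN N' a C0 (last (C1 @ C2))" "chainN N' (last C0) C1 be" "chainN N' (last (C0 @ C1)) C2 al"
    using w unfolding M_str_def by (auto simp del: last_append)
  have d: "distinct (a # [al] @ [be] @ ?C)" and V': "V' = set (a # [al] @ [be] @ ?C)" using s by (auto simp: star_on_def)
  have lC: "last ?C = last (C1 @ C2)" using ne by simp
  have neC: "?C \<noteq> []" using ne by simp
  have "last ?C \<in> W"
  proof (rule ccontr)
    assume "last ?C \<notin> W"
    then have "last ?C \<in> N' a - W" using Na lC by (simp del: last_append)
    then have "?C = [last ?C]"
      using centre_single[OF star_on_rotate[OF star_on_rotate[OF s]] neC] by blast
    then have "length ?C = 1" by (metis One_nat_def length_Cons list.size(3))
    then show False using ne by (cases C0; cases C1; cases C2) auto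
  qed
  then have W: "W = {last ?C}" using exD(5) by blast
  have Na': "N' a = {al, be, last ?C}" unfolding lC by (rule Na)
  note nc = new_centre[OF s neC Na' W]
  have other: "N k = N' k" if "k \<in> set ([al] @ [be] @ ?C)" for k by (rule exD(9)) (use that d V' in auto)
  have "M_str V E N u al be (a # C0) C1 C2"
    unfolding M_str_def
  proof (intro conjI)
    show "star_on V E u [al] [be] ((a # C0) @ C1 @ C2)" using nc(1) by simp
    show "N u = {al, be, last (C1 @ C2)}" using nc(2) unfolding lC .
    show "N al = {be, last ((a # C0) @ C1)}" using Nal other[of al] ne by auto
    show "N be = {last (C1 @ C2), last (a # C0)}" using Nbe other[of be] ne by auto
    show "chainN N u (a # C0) (last (C1 @ C2))"
      using nc(3) ch(1) chainN_cong[of C0 N N'] other unfolding lC by auto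
    show "chainN N (last (a # C0)) C1 be" using ch(2) chainN_cong[of C1 N N'] other ne by auto
    show "chainN N (last ((a # C0) @ C1)) C2 al" using ch(3) chainN_cong[of C2 N N'] other ne by auto
  qed (use ne in auto)
  then show ?thesis unfolding WNM_def by blast
qed

text \<open>The second alternative covers the expansions that may leave the three families: there
  \<open>a\<close> is a hub, and it stays one by \<open>expansion_hub\<close>. Its clause about
  \<open>W\<close> excludes mutual pairs, which is what the induction in \<open>mutual\<close>
  relies on.\<close>

lemma WNM_expand:
  assumes "WNM V' E' N'"
  shows "WNM V E N \<or> N' a = {z\<in>V'. E' a z} \<and> \<not> (\<exists>w\<in>W. a \<in> N' w)"
proof -
  consider (W) x A B C where "W_str V' E' N' x A B C" | (N) x al B C1 C2 where "N_str V' E' N' x al B C1 C2"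
    | (M) x al be C0 C1 C2 where "M_str V' E' N' x al be C0 C1 C2" using assms unfolding WNM_def by blast
  then show ?thesis
  proof cases
    case W
    note W2 = W_str_rotate[OF W] and W3 = W_str_rotate[OF W_str_rotate[OF W]]
    have s: "star_on V' E' x A B C" and ne: "A \<noteq> []" "B \<noteq> []" "C \<noteq> []" and Nx: "N' x = {last A, last B, last C}"
      using W unfolding W_str_def by auto
    have "V' = set (x # A @ B @ C)" using s by (simp add: star_on_def)
    then consider "a \<in> set A" | "a \<in> set B" | "a \<in> set C" | "a = x" using exD(3) by auto
    then show ?thesis
    proof cases
      case 4
      show ?thesis
      proof (cases "W = {}")
        case True
        then have "last A \<in> N' a - W" "last B \<in> N' a - W" "last C \<in> N' a - W" using Nx 4 by auto
        then have "A = [last A]" "B = [last B]" "C = [last C]"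
          using centre_single[OF s[folded 4] ne] centre_single[OF star_on_rotate[OF s[folded 4]] ne(2,3,1)]
            centre_single[OF star_on_rotate[OF star_on_rotate[OF s[folded 4]]] ne(3,1,2)] by blast+
        then have "N' a = {z\<in>V'. E' a z}" using centre_hub[OF s[folded 4]] Nx 4 by blast
        then show ?thesis using True by blast
      next
        case False
        then obtain w where w: "W = {w}" using exD(5) by blast
        then have "w \<in> N' x" using exD(4) 4 by simp
        then have "W = {last A} \<or> W = {last B} \<or> W = {last C}" using Nx w by simp
        then have "WNM V E N"
          by (elim disjE) (erule W_centre[OF W2[folded 4]] W_centre[OF W3[folded 4]] W_centre[OF W[folded 4]])+
        then show ?thesis by blast
      qed
    qed (use W_leg W W2 W3 in blast)+
  next
    case N
    let ?C = "C1 @ C2"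
    have s: "star_on V' E' x [al] B ?C" and ne: "B \<noteq> []" "C1 \<noteq> []" and Nx: "N' x = {al, last B, last ?C}"
      and Nal: "N' al = {last B, last C1}"
      using N unfolding N_str_def by (auto simp del: last_append)
    have neC: "?C \<noteq> []" using ne by simp
    have V': "V' = set (x # [al] @ B @ ?C)" and d: "distinct (x # [al] @ B @ ?C)" using s by (auto simp: star_on_def)
    then consider "a = al" | "a \<in> set B" | "a \<in> set C1" | "a \<in> set C2" | "a = x" using exD(3) by auto
    then show ?thesis
    proof cases
      case 5
      note s' = s[folded 5]
      have lB: "B = [last B]" if "last B \<notin> W"
        using centre_single[OF star_on_rotate[OF s'] ne(1) neC] Nx 5 that by blast
      have lC: "?C = [last ?C]" if "last ?C \<notin> W"
        using centre_single[OF star_on_rotate[OF star_on_rotate[OF s']] neC] Nx 5 that ne(1) by blast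
      have "W = {} \<or> W = {al} \<or> W = {last B} \<or> W = {last ?C}"
        using exD(5) exD(4)[folded 5] Nx by (elim disjE exE) (auto simp: 5 simp del: last_append)
      then show ?thesis
      proof (elim disjE)
        assume "W = {last ?C}" then show ?thesis using N_centre N 5 by blast
      next
        assume WB: "W = {last B}"
        have lm: "last B \<in> set B" "last ?C \<in> set ?C" using ne(1) last_in_set[OF neC] by auto
        then have "last ?C \<notin> W" using d WB by (auto simp del: last_append)
        then have "length ?C = 1" using lC by (metis One_nat_def length_Cons list.size(3))
        then have C2: "C2 = []" using ne(2) by (cases C1) auto
        then have "N_str V' E' N' a al C1 B []" using N N_str_swap 5 by blast
        then show ?thesis using N_centre[of al C1 B "[]"] WB by simp
      next
        assume W: "W = {al}"
        have lm: "last B \<in> set B" "last ?C \<in> set ?C" using ne(1) last_in_set[OF neC] by auto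
        then have "last B \<notin> W" "last ?C \<notin> W" using d W by (auto simp del: last_append)
        then have "N' a = {z\<in>V'. E' a z}" using centre_hub[OF s' _ lB lC] Nx 5 by blast
        moreover have "a \<notin> N' al" using Nal 5 d ne by auto
        ultimately show ?thesis using W by blast
      next
        assume W: "W = {}"
        then have "N' a = {z\<in>V'. E' a z}" using centre_hub[OF s' _ lB lC] Nx 5 by blast
        then show ?thesis using W by blast
      qed
    qed (use N_al N_part_B N_part_C1 N_part_C2 N in blast)+
  next
    case M
    let ?C = "C0 @ C1 @ C2"
    have s: "star_on V' E' x ?C [al] [be]" and ne: "C0 \<noteq> []" "C1 @ C2 \<noteq> []"
      and Nx: "N' x = {al, be, last (C1 @ C2)}"
      and ch: "chainN N' x C0 (last (C1 @ C2))" "chainN N' (last C0) C1 be" "chainN N' (last (C0 @ C1)) C2 al"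
      using M star_on_rotate unfolding M_str_def by (auto simp del: last_append)
    have V': "V' = set (x # ?C @ [al] @ [be])" and d: "distinct (x # ?C @ [al] @ [be])" using s by (auto simp: star_on_def)
    have tm: "last (C1 @ C2) \<in> set (C1 @ C2)" by (rule last_in_set[OF ne(2)])
    consider "a = x" | "a = al" | "a = be" | "a \<in> set C1 \<union> set C2" | "a \<in> set C0" using exD(3) V' by auto
    then show ?thesis
    proof cases
      case 1 then show ?thesis using M_centre M by blast
    next
      case 4
      then have "WNM V E N" using M_part[OF M] by simp
      then show ?thesis by blast
    next
      case 5
      then obtain xs ys where C0: "C0 = xs @ a # ys" by (meson split_list)
      have s': "star_on V' E' x (xs @ a # (ys @ C1 @ C2)) [al] [be]" using s C0 by simp
      let ?t = "last (C1 @ C2)" and ?p = "last (x # xs)"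
      have Na: "N' a = {?p, ?t}" by (rule chainN_mem[OF ch(1)[unfolded C0]])
      have pm: "?p \<in> set (x # xs)" by (cases xs rule: rev_cases) auto
      have pt: "?p \<noteq> ?t" using pm tm d C0 by auto
      show ?thesis
      proof (cases "W = {?t}")
        case True
        have "WNM V E N" by (rule M_part_C0[OF M C0 True pt])
        then show ?thesis by blast
      next
        case False
        \<comment> \<open>A released target is adjacent to \<open>a\<close>; so \<open>a\<close>
          ends \<open>C0\<close>, the rest of the leg is a single vertex, and column
          \<open>a\<close> consists of the two neighbours of \<open>a\<close>.\<close>
        then have tW: "?t \<notin> W" using exD(5) by blast
        then have "E' a ?t" using exD(6) Na by blast
        have pV: "?p \<in> V'" "?t \<in> V'" using pm tm V' C0 by auto
        have "?t = hd (ys @ C1 @ C2)"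
          using star_on_nbr[OF s' pV(2)] \<open>E' a ?t\<close> pt by auto
        then have "ys = []" using tm d C0 ne by (cases ys) auto
        have "N' a = {z\<in>V'. E' a z}"
          using star_on_nbr[OF s'] \<open>?t = hd (ys @ C1 @ C2)\<close> Na pV ne(2) by auto
        moreover have "a \<notin> N' w" if "w \<in> W" for w
        proof -
          have "w = ?p" using that tW exD(4) Na by blast
          moreover have "a \<notin> N' ?p"
          proof (cases xs rule: rev_cases)
            case Nil
            then show ?thesis using Nx d C0 tm by (auto simp del: last_append)
          next
            case (snoc zs z)
            then have "N' z = {last (x # zs), ?t}" using chainN_mem[of N' x zs z "a # ys"] ch(1) C0 by auto
            moreover have "last (x # zs) \<in> set (x # zs)" by (cases zs rule: rev_cases) auto
            ultimately show ?thesis using snoc d C0 tm by (auto simp del: last_append)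
          qed
          ultimately show ?thesis by simp
        qed
        ultimately show ?thesis by blast
      qed
    qed (use M_ends[OF M] in blast)+
  qed
qed

end

section \<open>Classification of embeddings without entries -2\<close>

definition hub_at where "hub_at V E N x \<longleftrightarrow> x \<in> V \<and> N x = {v\<in>V. E x v}"

lemma emb_cong:
  assumes "emb V C E \<phi>" "\<And>v k. v \<in> V \<Longrightarrow> k \<in> C \<Longrightarrow> \<phi>' v k = \<phi> v k" shows "emb V C E \<phi>'"
proof -
  interpret emb V C E \<phi> by fact
  have "ip C (\<phi>' u) (\<phi>' v) = ip C (\<phi> u) (\<phi> v)" if "u \<in> V" "v \<in> V" for u v
    unfolding ip_def using assms(2) that by simp
  moreover have "(\<Sum>k\<in>C. \<phi>' v k * (\<phi>' v k + 1)) = 2" if "v \<in> V" for v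
    using row[OF that] assms(2)[OF that] by simp
  ultimately show ?thesis using tree finC cardC pair norm_ne_1 by unfold_locales auto
qed

context dfree begin

lemma root_N:
  assumes u: "u \<in> V" and a: "a \<in> V" and Ju: "J u = {a}"
  shows "N a = insert u (N u \<inter> N a)" "a \<notin> N u" "E u a"
proof -
  have uNk: "u \<in> N k \<longleftrightarrow> k = a" if "k \<in> V" for k using Ju that by blast
  have ua: "u \<noteq> a" using uNk[OF a] N_irr[OF a] by blast
  have Ju': "J u \<inter> J z = (if z \<in> N a then {a} else {})" for z using Ju a by auto
  have 1: "of_bool (E u a) = (1::int) + of_bool (a \<in> N u)"
    using E_card[OF u a ua] Ju' uNk[OF a] N_irr[OF a] by simp
  then show "a \<notin> N u" "E u a" by (auto simp: of_bool_def split: if_splits)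
  have "z \<in> N u" if "z \<in> N a" "z \<noteq> u" for z
  proof -
    have z: "z \<in> V" "z \<noteq> a" using that NV[OF a] by auto
    have "u \<notin> N z" using uNk[OF z(1)] z by simp
    then show ?thesis using E_card[OF u z(1)] that Ju'[of z] by (auto simp: of_bool_def split: if_splits)
  qed
  then show "N a = insert u (N u \<inter> N a)" using uNk[OF a] by blast
qed

lemma J_finite: "finite (J v)" using finV by simp

lemma adj_N: "E u v \<Longrightarrow> u \<in> V \<Longrightarrow> v \<in> V \<Longrightarrow> u \<in> N v \<or> v \<in> N u"
  using E_card[of u v] E_irr by (cases "u = v") (auto simp: of_bool_def split: if_splits)

end

text \<open>The new column \<open>a\<close> is \<open>insert u W\<close>, and these are precisely
  the vertices that the expansion leaves adjacent to \<open>a\<close>.\<close>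

lemma expansion_hub:
  assumes ex: "expand V' E' N' a u W V E N" and h: "N' a = {z\<in>V'. E' a z}"
  shows "hub_at V E N a"
proof -
  interpret expand V' E' N' a u W V E N by fact
  have "E a u" using exD(3,10) sym by blast
  moreover have "E a z \<longleftrightarrow> z \<in> W" if "z \<in> V'" for z
    using exD(11)[OF exD(3) that] that h exD(4) irr by blast
  moreover have "W \<subseteq> V'" using h exD(4) by blast
  ultimately show ?thesis unfolding hub_at_def exD(8) using exD(2,3) by blast
qed

lemma set_eq_4:
  assumes "N \<subseteq> {x, a, b, c}" "S \<subseteq> {x, a, b, c}"
    "x \<in> N \<longleftrightarrow> x \<in> S" "a \<in> N \<longleftrightarrow> a \<in> S" "b \<in> N \<longleftrightarrow> b \<in> S" "c \<in> N \<longleftrightarrow> c \<in> S"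
  shows "N = S"
proof (rule set_eqI)
  fix z show "z \<in> N \<longleftrightarrow> z \<in> S" using assms by (cases "z \<in> {x, a, b, c}") auto
qed

lemma star_on_triple:
  assumes d: "distinct [x, a, b, c]" and V: "V = {x, a, b, c}" and E: "E x a" "E x b" "E x c"
    and no: "\<not> E a b" "\<not> E a c" "\<not> E b c" and sym: "\<And>z w. E z w \<Longrightarrow> E w z" "\<And>z. \<not> E z z"
  shows "star_on V E x [a] [b] [c]"
proof -
  have E': "E a x" "E b x" "E c x" "\<not> E b a" "\<not> E c a" "\<not> E c b" using E no sym(1) by blast+
  have "\<forall>z\<in>{x, a, b, c}. \<forall>w\<in>{x, a, b, c}. E z w =
     ((z, w) \<in> {(x, a), (x, b), (x, c)} \<or> (w, z) \<in> {(x, a), (x, b), (x, c)})"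
    using d E E' no sym(2) by auto
  then show ?thesis unfolding star_on_def V using d by simp
qed

text \<open>An expansion at \<open>a\<close> may separate \<open>a\<close> from the hub
  \<open>x\<close>; this lemma shows that nothing is lost, since a mutual pair already places the
  tree in the structured families. Blow down as in \<open>hub_abc\<close>: the pair survives each
  step, the base cases \<open>T_a\<close> and \<open>T_b\<close> are the smallest members of W and
  N, and \<open>T_c\<close> cannot occur without an entry \<open>-2\<close>.\<close>

lemma mutual:
  assumes "dfree V E N" "hub_at V E N x" "a \<in> N x" "x \<in> N a"
  shows "WNM V E N"
  using assms
proof (induction "card V" arbitrary: V E N a rule: less_induct)
  case less
  interpret dfree V E N by fact
  have xV: "x \<in> V" and Nx: "N x = {v\<in>V. E x v}" using less.prems(2) by (auto simp: hub_at_def)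
  interpret hub V V E "cc N" x x by (rule hub_N[OF xV Nx])
  have xJ: "x \<in> J v" if "E x v" "v \<in> V" for v using Nx xV that by blast
  show ?case
  proof (cases "\<forall>v\<in>V - {x}. (\<Sum>k\<in>V - {x}. cc N v k) \<le> 0")
    case True
    then have r: "valx = 3" "V - {x} = {v\<in>V. E x v}" "ip V (cc N x) (cc N x) = 4"
      "\<And>v. v \<in> V - {x} \<Longrightarrow> ip V (cc N v) (cc N v) = 3" using roots_case by blast+
    have "card (V - {x}) = 3" using r by simp
    then obtain p q s where pqs: "V - {x} = {p, q, s}" "p \<noteq> q" "q \<noteq> s" "p \<noteq> s"
      by (auto simp: card_3_iff)
    have V: "V = {x, p, q, s}" using pqs xV by blast
    have in3: "p \<in> V - {x}" "q \<in> V - {x}" "s \<in> V - {x}" using pqs by blast+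
    have adj: "E x p" "E x q" "E x s" using in3 r(2) by blast+
    have adj': "E p x" "E q x" "E s x" using adj E_sym by blast+
    have no: "\<not> E p q" "\<not> E q s" "\<not> E p s" "\<not> E q p" "\<not> E s q" "\<not> E s p" using no_tri adj in3 by blast+
    have cJ: "card (J v) = 2" if "v \<in> {p, q, s}" for v using r(4)[of v] norm_J[of v] pqs(1) that by auto
    have "card (J x) = 3" using r(3) norm_J[OF xV] by simp
    moreover have "J x \<subseteq> {p, q, s}" using N_irr[OF xV] pqs(1) by blast
    ultimately have Jx: "J x = {p, q, s}" using pqs by (intro card_subset_eq) auto
    have Nxx: "N x = {p, q, s}" using Nx r(2) pqs(1) by simp
    have two: "\<exists>t. J v = {x, t} \<and> t \<noteq> x \<and> t \<noteq> v" if v: "v \<in> {p, q, s}" for v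
    proof -
      have "x \<in> J v" using Nxx v xV by blast
      moreover have "card (J v - {x}) = 1" using cJ[OF v] \<open>x \<in> J v\<close> J_finite by simp
      then obtain t where "J v - {x} = {t}" by (metis card_1_singletonE)
      moreover have "v \<notin> J v" using N_irr by blast
      ultimately show ?thesis by blast
    qed
    obtain tp where tp: "J p = {x, tp}" "tp \<noteq> x" "tp \<noteq> p" using two[of p] by blast
    obtain tq where tq: "J q = {x, tq}" "tq \<noteq> x" "tq \<noteq> q" using two[of q] by blast
    obtain ts where ts: "J s = {x, ts}" "ts \<noteq> x" "ts \<noteq> s" using two[of s] by blast
    note t = tp tq ts
    have tV: "tp \<in> {q, s}" "tq \<in> {p, s}" "ts \<in> {p, q}" using t pqs(1) by blast+
    have mem: "p \<in> N k \<longleftrightarrow> k = x \<or> k = tp" "q \<in> N k \<longleftrightarrow> k = x \<or> k = tq" "s \<in> N k \<longleftrightarrow> k = x \<or> k = ts"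
      if k: "k \<in> V" for k
    proof -
      have "k \<in> J p \<longleftrightarrow> k = x \<or> k = tp" "k \<in> J q \<longleftrightarrow> k = x \<or> k = tq" "k \<in> J s \<longleftrightarrow> k = x \<or> k = ts"
        unfolding t by simp_all
      then show "p \<in> N k \<longleftrightarrow> k = x \<or> k = tp" "q \<in> N k \<longleftrightarrow> k = x \<or> k = tq" "s \<in> N k \<longleftrightarrow> k = x \<or> k = ts"
        using k by simp_all
    qed
    \<comment> \<open>Nonadjacent rows that share two columns need two entries in each other's
      columns as a balance; here there are none.\<close>
    have neq: False
      if ab: "a \<in> V - {x}" "b \<in> V - {x}" "a \<noteq> b" "\<not> E a b" and Jab: "J a = {x, t}" "J b = {x, t}"
        and t: "t \<noteq> x" "t \<noteq> a" "t \<noteq> b" for a b t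
    proof -
      have "b \<notin> J a" "a \<notin> J b" unfolding Jab using ab t by auto
      then have "a \<notin> N b" "b \<notin> N a" using ab by auto
      moreover have "card (J a \<inter> J b) = 2" unfolding Jab using t by simp
      ultimately show False using E_card[of a b] ab by simp
    qed
    have ne: "\<not> (tp = s \<and> tq = s)" "\<not> (tp = q \<and> ts = q)" "\<not> (tq = p \<and> ts = p)"
      using neq[OF in3(1,2) pqs(2) no(1), of s] neq[OF in3(1,3) pqs(4) no(3), of q] neq[OF in3(2,3) pqs(3) no(2), of p]
        tp tq ts pqs in3 by fast+
    have xN: "x \<in> N p" "x \<in> N q" "x \<in> N s" using Jx by blast+
    have star: "star_on V E x [p] [q] [s]"
      by (rule star_on_triple) (use pqs in3 adj no E_sym E_irr V in auto)
    have Nval: "N k = {x, t}"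
      if k: "k \<in> V" "x \<in> N k" and m: "p \<in> N k \<longleftrightarrow> p = t" "q \<in> N k \<longleftrightarrow> q = t" "s \<in> N k \<longleftrightarrow> s = t" "t \<in> {p, q, s}" for k t
    proof
      show "{x, t} \<subseteq> N k" using k(2) m by auto
      show "N k \<subseteq> {x, t}"
      proof
        fix z assume z: "z \<in> N k"
        then have "z \<in> {x, p, q, s}" using NV[OF k(1)] V by blast
        then show "z \<in> {x, t}" using z m by (elim insertE emptyE) simp_all
      qed
    qed
    have pV: "p \<in> V" "q \<in> V" "s \<in> V" "p \<noteq> x" "q \<noteq> x" "s \<noteq> x" using in3 by auto
    \<comment> \<open>Each leaf has one column besides \<open>x\<close>, namely that of another
      leaf; these choices form one of the two cyclic orientations.\<close>
    consider "tp = q" "tq = s" "ts = p" | "tp = s" "ts = q" "tq = p" using tV ne pqs by blast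
    then show ?thesis
    proof cases
      case 1
      have "N q = {x, p}" "N s = {x, q}" "N p = {x, s}"
        by (rule Nval; simp add: mem pV 1 xN pqs(2-4) pqs(2-4)[symmetric])+
      then have "W_str V E N x [p] [s] [q]"
        unfolding W_str_def using star_on_swap[OF star] Nxx by (simp add: insert_commute)
      then show ?thesis unfolding WNM_def by blast
    next
      case 2
      have "N s = {x, p}" "N q = {x, s}" "N p = {x, q}"
        by (rule Nval; simp add: mem pV 2 xN pqs(2-4) pqs(2-4)[symmetric])+
      then have "W_str V E N x [p] [q] [s]" unfolding W_str_def using star Nxx by simp
      then show ?thesis unfolding WNM_def by blast
    qed
  next
    case False
    then obtain u where u: "u \<in> V - {x}" "(\<Sum>k\<in>V - {x}. cc N u k) > 0" by (auto simp: not_le)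
    have uV: "u \<in> V" "u \<noteq> x" using u by auto
    have ux: "E x u" and n2: "ip V (cc N u) (cc N u) = 2" using root_vertex[OF u] by metis+
    have "card (J u) = 1" using n2 norm_J[OF uV(1)] by simp
    then have Ju: "J u = {x}" using xJ[OF ux uV(1)] by (metis card_1_singletonE singletonD)
    note rN = root_N[OF uV(1) xV Ju]
    show ?thesis
    proof (cases "valx = 3")
      case True
      obtain l l' where l: "distinct [x, u, l, l']" "V = {x, u, l, l'}" "{v\<in>V. E x v} = {u, l, l'}"
        "ip V (cc N l) (cc N l) = 4 \<and> ip V (cc N l') (cc N l') = 4 \<and> ip V (cc N x) (cc N x) = 3 \<or>
         ip V (cc N l) (cc N l) = 3 \<and> ip V (cc N l') (cc N l') = 6 \<and> ip V (cc N x) (cc N x) = 2"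
        using triple_case[OF True u] by blast
      have in4: "l \<in> V" "l' \<in> V" using l(2) by blast+
      have J3: "J v \<subseteq> V - {v}" for v using N_irr by blast
      have cV: "card V = 4" using l(1,2) by simp
      have c3: "card (J v) \<le> 3" if "v \<in> V" for v
        using card_mono[OF _ J3[of v]] finV cV that by simp
      \<comment> \<open>Norm \<open>6\<close> needs five entries \<open>-1\<close> in a row, but
        there are only three other columns.\<close>
      have "ip V (cc N l') (cc N l') \<noteq> 6" using norm_J[OF in4(2)] c3[OF in4(2)] by linarith
      then have n: "ip V (cc N l) (cc N l) = 4" "ip V (cc N l') (cc N l') = 4" "ip V (cc N x) (cc N x) = 3"
        using l(4) by blast+
      have c: "card (J l) = 3" "card (J l') = 3" "card (J x) = 2"
        using n norm_J[OF in4(1)] norm_J[OF in4(2)] norm_J[OF xV] by linarith+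
      have fl: "finite (V - {l})" "finite (V - {l'})" using finV by auto
      have cl: "card (V - {l}) = 3" "card (V - {l'}) = 3" using finV cV in4 by simp_all
      have "J l = V - {l}" "J l' = V - {l'}"
        using card_subset_eq[OF fl(1) J3] card_subset_eq[OF fl(2) J3] c cl by simp_all
      moreover have "V - {l} = {x, u, l'}" "V - {l'} = {x, u, l}" unfolding l(2) using l(1) by auto
      ultimately have Jl: "J l = {x, u, l'}" "J l' = {x, u, l}" by simp_all
      have "J x \<subseteq> {l, l'}" using J3[of x] l(2) rN(2) by blast
      then have Jx: "J x = {l, l'}" using c(3) l(1) card_subset_eq[of "{l, l'}" "J x"] by simp
      have Nxx: "N x = {u, l, l'}" using Nx l(3) by simp
      have mem: "u \<in> N k \<longleftrightarrow> k = x" "l \<in> N k \<longleftrightarrow> k \<in> {x, u, l'}" "l' \<in> N k \<longleftrightarrow> k \<in> {x, u, l}" "x \<in> N k \<longleftrightarrow> k \<in> {l, l'}"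
        if k: "k \<in> V" for k
      proof -
        have "k \<in> J u \<longleftrightarrow> k = x" "k \<in> J l \<longleftrightarrow> k \<in> {x, u, l'}" "k \<in> J l' \<longleftrightarrow> k \<in> {x, u, l}" "k \<in> J x \<longleftrightarrow> k \<in> {l, l'}"
          unfolding Ju Jl Jx by simp_all
        then show "u \<in> N k \<longleftrightarrow> k = x" "l \<in> N k \<longleftrightarrow> k \<in> {x, u, l'}" "l' \<in> N k \<longleftrightarrow> k \<in> {x, u, l}" "x \<in> N k \<longleftrightarrow> k \<in> {l, l'}"
          using k by simp_all
      qed
      have sub: "N k \<subseteq> {x, u, l, l'}" if "k \<in> V" for k using NV[OF that] l(2) by blast
      have NN1: "N u = {l, l'}"
        by (rule set_eq_4[OF sub[OF uV(1)]]; insert l(1); simp add: mem[OF uV(1)])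
      have NN2: "N l = {x, l'}"
        by (rule set_eq_4[OF sub[OF in4(1)]]; insert l(1); simp add: mem[OF in4(1)])
      have NN3: "N l' = {x, l}"
        by (rule set_eq_4[OF sub[OF in4(2)]]; insert l(1); simp add: mem[OF in4(2)])
      note NN = NN1 NN2 NN3
      have adj: "E x u" "E x l" "E x l'" using l(3) by blast+
      have adj': "E u x" "E l x" "E l' x" using adj E_sym by blast+
      have no: "\<not> E u l" "\<not> E u l'" "\<not> E l l'" "\<not> E l u" "\<not> E l' u" "\<not> E l' l"
        using no_tri adj uV in4 by blast+
      have "star_on V E x [u] [l] ([l'] @ [])"
        using star_on_triple[OF l(1,2) adj no(1,2,3)] E_sym E_irr by simp
      then have "N_str V E N x u [l] [l'] []" unfolding N_str_def using NN Nxx by auto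
      then show ?thesis unfolding WNM_def by blast
    next
      case False
      then have v2: "valx \<le> 2" using valx_le by simp
      have "u \<in> N x" "finite (N x)" using rN(1) finN[OF xV] by auto
      then have "card (N x - {u}) \<le> 1" using v2 Nx by simp
      moreover have "N u \<inter> N x \<subseteq> N x - {u}" using N_irr[OF uV(1)] by blast
      ultimately have c1: "card (N u \<inter> N x) \<le> 1"
        using card_mono[of "N x - {u}" "N u \<inter> N x"] finN[OF xV] by simp
      obtain E' N' where m: "dfree (V - {u}) E' N'" "expansion (V - {u}) E' N' x u (N u \<inter> N x) V E N"
        using merge[OF uV(1) xV Ju c1] by blast
      let ?W = "N u \<inter> N x"
      have exx: "expand (V - {u}) E' N' x u ?W V E N" using m(2) E_sym E_irr by unfold_locales auto
      interpret ex: expand "V - {u}" E' N' x u ?W V E N by (rule exx)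
      have hub': "hub_at (V - {u}) E' N' x"
      proof -
        have "E' x z \<longleftrightarrow> z \<in> N' x" if z: "z \<in> V - {u}" for z
        proof (cases "z \<in> ?W")
          case True
          then have "E x z" using Nx by blast
          then show ?thesis using ex.exD(11)[OF ex.exD(3) z] True ex.exD(4) by blast
        next
          case False
          have "E x z \<longleftrightarrow> z \<in> N x" using Nx z by blast
          then have "\<not> E x z" using False z rN(1) by blast
          then show ?thesis using ex.exD(6)[of z] ex.exD(11)[OF ex.exD(3) z] False by blast
        qed
        moreover have "N' x \<subseteq> V - {u}" using ex.exD(7) NV[OF uV(1)] by blast
        ultimately show ?thesis unfolding hub_at_def using xV uV by blast
      qed
      have "a \<noteq> u" using less.prems(4) rN(2) by blast
      then have aW: "a \<in> ?W" using less.prems(3) rN(1) by blast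
      have "a \<in> V - {u}" "a \<noteq> x" using less.prems(3) NV[OF xV] \<open>a \<noteq> u\<close> by blast+
      then have xa: "x \<in> N' a" using ex.exD(9)[of a] less.prems(4) by simp
      have "a \<in> N' x" using aW ex.exD(4) by blast
      moreover have "card (V - {u}) < card V" by (rule card_Diff1_less[OF finV uV(1)])
      ultimately have "WNM (V - {u}) E' N'" using less.hyps[OF _ m(1) hub' _ xa] by blast
      then show ?thesis using ex.WNM_expand aW xa by blast
    qed
  qed
qed

text \<open>Blow-ups never raise the decoration of an old vertex, so the leaf \<open>-4\<close> of
  \<open>T_b\<close> or \<open>-6\<close> of \<open>T_c\<close> keeps a decoration of at most
  \<open>-4\<close>; for \<open>T_a\<close> the final decoration itself is
  \<open>-4\<close>.\<close>

lemma reach_big: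
  assumes "(T0, r) \<in> base_trees" "blowup_reach T0 0 T u"
  shows "r \<le> -4 \<or> (\<exists>i<nv T. i \<noteq> u \<and> dec T i \<le> -4)"
proof (cases "r \<le> -4")
  case False
  then have T0: "T0 = T_b \<or> T0 = T_c" using assms(1) by (auto simp: base_trees_def)
  from assms(2) have "\<exists>i<nv T. i \<noteq> u \<and> dec T i \<le> -4"
  proof induction
    case refl
    show ?case using T0
    proof
      assume "T0 = T_b" then show ?thesis unfolding T_b_def star3_single mk_tree_def by (intro exI[of _ 1]) auto
    next
      assume "T0 = T_c" then show ?thesis unfolding T_c_def star3_single mk_tree_def by (intro exI[of _ 2]) auto
    qed
  next
    case (vert T u)
    then obtain i where "i < nv T" "i \<noteq> u" "dec T i \<le> -4" by blast
    then show ?case by (intro exI[of _ i]) (auto simp: blowup_vertex_def)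
  next
    case (edge T u w)
    then obtain i where "i < nv T" "i \<noteq> u" "dec T i \<le> -4" by blast
    then show ?case by (intro exI[of _ i]) (auto simp: blowup_edge_def)
  qed
  then show ?thesis ..
qed simp

lemma abc_big: assumes "abc V E d x" "x \<in> V" shows "\<exists>v\<in>V. d v \<le> -4"
proof -
  obtain T0 r T u f where a: "(T0, r) \<in> base_trees" "blowup_reach T0 0 T u"
    "bij_betw f {..<nv T} V" "\<forall>i<nv T. i \<noteq> u \<longrightarrow> d (f i) = dec T i" "d x = r" using assms(1) unfolding abc_def by blast
  have "f i \<in> V" if "i < nv T" for i using a(3) that by (auto simp: bij_betw_def)
  then show ?thesis using reach_big[OF a(1,2)] a(4,5) assms(2) by force
qed

lemma WNM_big:
  assumes "WNM V E N" shows "\<exists>v a b c. distinct [a, b, c] \<and> v \<in> V \<and> {a, b, c} \<subseteq> V \<and> v \<in> N a \<and> v \<in> N b \<and> v \<in> N c"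
proof -
  have hd: "N (hd L) = {p, t}" if "chainN N p L t" "L \<noteq> []" for p L t using that by (cases L) auto
  consider (W) x A B C where "W_str V E N x A B C" | (N) x al B C1 C2 where "N_str V E N x al B C1 C2"
    | (M) x al be C0 C1 C2 where "M_str V E N x al be C0 C1 C2" using assms unfolding WNM_def by blast
  then show ?thesis
  proof cases
    case W
    then have s: "star_on V E x A B C" and ne: "A \<noteq> []" "B \<noteq> []" "C \<noteq> []"
      and ch: "chainN N x A (last B)" "chainN N x B (last C)" "chainN N x C (last A)" unfolding W_str_def by auto
    have m: "hd A \<in> set A" "hd B \<in> set B" "hd C \<in> set C" using ne by auto
    have "distinct [hd A, hd B, hd C]" "{hd A, hd B, hd C} \<subseteq> V" "x \<in> V"
      using s m unfolding star_on_def by auto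
    moreover have "x \<in> N (hd A)" "x \<in> N (hd B)" "x \<in> N (hd C)"
      using hd[OF ch(1) ne(1)] hd[OF ch(2) ne(2)] hd[OF ch(3) ne(3)] by simp_all
    ultimately show ?thesis by (intro exI conjI)
  next
    case N
    then have s: "star_on V E x [al] B (C1 @ C2)" and ne: "B \<noteq> []" "C1 \<noteq> []"
      and Nn: "N x = {al, last B, last (C1 @ C2)}" "N al = {last B, last C1}" and ch: "chainN N x C1 (last B)"
      unfolding N_str_def by (auto simp del: last_append)
    have m: "last B \<in> set B" "hd C1 \<in> set C1" using ne by auto
    have "distinct [x, al, hd C1]" "{x, al, hd C1} \<subseteq> V" "last B \<in> V"
      using s m unfolding star_on_def by auto
    moreover have "last B \<in> N x" "last B \<in> N al" "last B \<in> N (hd C1)"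
      using hd[OF ch ne(2)] Nn by simp_all
    ultimately show ?thesis by (intro exI conjI)
  next
    case M
    then have s: "star_on V E x [al] [be] (C0 @ C1 @ C2)" and ne: "C0 \<noteq> []" "C1 @ C2 \<noteq> []"
      and Nn: "N x = {al, be, last (C1 @ C2)}" "N be = {last (C1 @ C2), last C0}" and ch: "chainN N x C0 (last (C1 @ C2))"
      unfolding M_str_def by (auto simp del: last_append)
    have m: "hd C0 \<in> set C0" "last (C1 @ C2) \<in> set (C1 @ C2)" using ne(1) last_in_set[OF ne(2)] by auto
    have "distinct [x, be, hd C0]" "{x, be, hd C0} \<subseteq> V" "last (C1 @ C2) \<in> V"
      using s m unfolding star_on_def by (auto simp del: last_append)
    moreover have "last (C1 @ C2) \<in> N x" "last (C1 @ C2) \<in> N be" "last (C1 @ C2) \<in> N (hd C0)"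
      using hd[OF ch ne(1)] Nn by (simp_all del: last_append)
    ultimately show ?thesis by (intro exI conjI)
  qed
qed

context dfree begin

text \<open>A norm of at least \<open>4\<close> occurs in every classified configuration; this
  yields the contradiction in \<open>one_PN\<close>, where all norms are \<open>3\<close>.\<close>

lemma classified_big:
  assumes "(\<exists>x. hub_at V E N x) \<or> WNM V E N" shows "\<exists>v\<in>V. 3 \<le> card (J v)"
  using assms
proof
  assume "\<exists>x. hub_at V E N x"
  then obtain x where x: "x \<in> V" "N x = {v\<in>V. E x v}" unfolding hub_at_def by blast
  obtain v where "v \<in> V" "- ip V (cc N v) (cc N v) \<le> -4"
    using abc_big[OF hub_abc[OF hub_N[OF x]] x(1)] by blast
  then show ?thesis using norm_J[of v] by (intro bexI[of _ v]) auto
next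
  assume "WNM V E N"
  from WNM_big[OF this] obtain v a b c where v: "distinct [a, b, c]" "v \<in> V" "{a, b, c} \<subseteq> V"
    "v \<in> N a" "v \<in> N b" "v \<in> N c" by (elim exE conjE)
  then have c: "card {a, b, c} = 3" and s: "{a, b, c} \<subseteq> J v" by auto
  show ?thesis using card_mono[OF J_finite s] c v(2) by auto
qed

text \<open>A hub \<open>x\<close> different from \<open>a\<close> is destroyed only if it lies in
  \<open>N' a - W\<close>, because then the new vertex is put between \<open>x\<close> and
  \<open>a\<close>; but then the two form a mutual pair.\<close>

lemma expansion_step:
  assumes m: "dfree V' E' N'" "expansion V' E' N' a u W V E N"
    and IH: "(\<exists>x. hub_at V' E' N' x) \<or> WNM V' E' N'"
  shows "(\<exists>x. hub_at V E N x) \<or> WNM V E N"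
proof -
  have exx: "expand V' E' N' a u W V E N" using m(2) E_sym E_irr by unfold_locales auto
  interpret ex: expand V' E' N' a u W V E N by (rule exx)
  have W: ?thesis if "WNM V' E' N'" using ex.WNM_expand[OF that] expansion_hub[OF exx] by blast
  from IH show ?thesis
  proof
    assume "\<exists>x. hub_at V' E' N' x"
    then obtain x where h: "hub_at V' E' N' x" by blast
    then have x: "x \<in> V'" "N' x = {z\<in>V'. E' x z}" by (auto simp: hub_at_def)
    show ?thesis
    proof (cases "x = a")
      case True then show ?thesis using expansion_hub[OF exx] x by blast
    next
      case xa: False
      show ?thesis
      proof (cases "x \<in> N' a - W")
        case True
        interpret d: dfree V' E' N' by fact
        have "E' a x" using ex.exD(6) True by blast
        then have "a \<in> N' x" using x d.E_sym ex.exD(3) by blast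
        then show ?thesis using W mutual[OF m(1) h] True by blast
      next
        case False
        have "\<not> E x u" using ex.exD(10)[OF x(1)] False xa E_sym by blast
        moreover have "E x z \<longleftrightarrow> E' x z" if "z \<in> V'" for z using ex.exD(11)[OF x(1) that] xa False by blast
        ultimately have "hub_at V E N x" unfolding hub_at_def using x ex.exD(2) ex.exD(9)[OF x(1) xa] by blast
        then show ?thesis by blast
      qed
    qed
  qed (rule W)
qed

lemma sum_J_N: "(\<Sum>v\<in>V. card (J v)) = (\<Sum>k\<in>V. card (N k))"
proof -
  have "(\<Sum>v\<in>V. card (J v)) = (\<Sum>v\<in>V. \<Sum>k\<in>V. of_bool (v \<in> N k))"
    using finV by (simp add: Int_def)
  also have "\<dots> = (\<Sum>k\<in>V. \<Sum>v\<in>V. of_bool (v \<in> N k))" by (rule sum.swap)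
  also have "\<dots> = (\<Sum>k\<in>V. card (N k))"
  proof (rule sum.cong[OF HOL.refl])
    fix k assume k: "k \<in> V"
    then have "{v\<in>V. v \<in> N k} = N k" using NV[OF k] by blast
    then show "(\<Sum>v\<in>V. of_bool (v \<in> N k)) = card (N k)" using finV by (simp add: Int_def)
  qed
  finally show ?thesis .
qed

end

section \<open>Configurations that admit no merge\<close>

locale dfree_e = dfree +
  fixes e assumes eV: "e \<in> V" and Ne: "card (N e) = 3"
    and Nk: "\<And>k. k \<in> V \<Longrightarrow> k \<noteq> e \<Longrightarrow> card (N k) = 1 \<or> card (N k) = 2"
begin

abbreviation "PN \<equiv> {k\<in>V. card (N k) = 1}"

text \<open>Double count of the entries \<open>-1\<close>: by rows they give the norms, by columns
  the sizes, and compared with size two the column of \<open>e\<close> has one entry too many while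
  those in \<open>PN\<close> have one too few.\<close>

lemma excess: "(\<Sum>v\<in>V. int (card (J v)) - 2) = 1 - int (card PN)"
proof -
  have "(\<Sum>v\<in>V. int (card (J v)) - 2) = (\<Sum>k\<in>V. int (card (N k)) - 2)"
    using sum_J_N by (simp add: sum_subtractf flip: of_nat_sum)
  also have "\<dots> = (int (card (N e)) - 2) + (\<Sum>k\<in>V - {e}. int (card (N k)) - 2)"
    using finV eV by (simp add: sum.remove)
  also have "(\<Sum>k\<in>V - {e}. int (card (N k)) - 2) = (\<Sum>k\<in>PN. -1)"
    using finV Ne by (intro sum.mono_neutral_cong_right) (use Nk in force)+
  finally show ?thesis using Ne by simp
qed

lemma val: assumes "v \<in> V" shows "int (card {w\<in>V. E v w}) = 2 + cc N v e - (\<Sum>k\<in>PN. cc N v k)"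
proof -
  have "(\<Sum>k\<in>V. (2 - int (card (N k))) * cc N v k)
      = (2 - int (card (N e))) * cc N v e + (\<Sum>k\<in>V - {e}. (2 - int (card (N k))) * cc N v k)"
    using finV eV by (simp add: sum.remove)
  also have "(\<Sum>k\<in>V - {e}. (2 - int (card (N k))) * cc N v k) = (\<Sum>k\<in>PN. cc N v k)"
    using finV Ne by (intro sum.mono_neutral_cong_right) (use Nk in force)+
  finally show ?thesis using valency[OF assms] Ne by simp
qed

text \<open>With every column except that of \<open>e\<close> of size two, valencies are read off
  from column \<open>e\<close>: the tree has three legs, centre \<open>e\<close>, and its ends are
  the members of \<open>N e\<close>.\<close>

lemma val0: assumes "PN = {}"
  shows "card {w\<in>V. E e w} = 3" "\<And>l. l \<in> N e \<Longrightarrow> card {w\<in>V. E l w} = 1"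
    "\<And>v. v \<in> V \<Longrightarrow> v \<noteq> e \<Longrightarrow> v \<notin> N e \<Longrightarrow> card {w\<in>V. E v w} = 2"
proof -
  have v: "int (card {w\<in>V. E v w}) = 2 + cc N v e" if "v \<in> V" for v
    using val[OF that] unfolding assms by simp
  show "card {w\<in>V. E e w} = 3" using v[OF eV] by simp
  show "card {w\<in>V. E l w} = 1" if "l \<in> N e" for l
  proof -
    have "l \<in> V" "l \<noteq> e" using that NV[OF eV] by auto
    then show ?thesis using v[of l] cc_neq[of l e N] that by simp
  qed
  show "card {w\<in>V. E v w} = 2" if "v \<in> V" "v \<noteq> e" "v \<notin> N e" for v
    using v[OF that(1)] cc_neq[of v e N] that by simp
qed

lemma hub_e: assumes "PN = {}" "\<And>l. l \<in> N e \<Longrightarrow> E e l" shows "hub_at V E N e"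
proof -
  have "N e \<subseteq> {w\<in>V. E e w}" using NV[OF eV] assms(2) by blast
  then have "N e = {w\<in>V. E e w}" using val0(1)[OF assms(1)] Ne finV by (intro card_subset_eq) auto
  then show ?thesis using eV by (simp add: hub_at_def)
qed

end

lemma star_on_5:
  assumes d: "distinct [x, a, b, z, c]" and V: "V = {x, a, b, z, c}" and E: "E x a" "E x b" "E x z" "E z c"
    and no: "\<not> E a b" "\<not> E a z" "\<not> E a c" "\<not> E b z" "\<not> E b c" "\<not> E x c"
    and sym: "\<And>z w. E z w \<Longrightarrow> E w z" "\<And>z. \<not> E z z"
  shows "star_on V E x [a] [b] [z, c]"
proof -
  have E': "E a x" "E b x" "E z x" "E c z" using E sym(1) by blast+
  have no': "\<not> E b a" "\<not> E z a" "\<not> E c a" "\<not> E z b" "\<not> E c b" "\<not> E c x" using no sym(1) by blast+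
  have "\<forall>v\<in>{x, a, b, z, c}. \<forall>w\<in>{x, a, b, z, c}. E v w =
     ((v, w) \<in> {(x, a), (x, b), (x, z), (z, c)} \<or> (w, v) \<in> {(x, a), (x, b), (x, z), (z, c)})"
    using d E E' no no' sym(2) by auto
  moreover have "path_edges x [a] \<union> path_edges x [b] \<union> path_edges x [z, c] = {(x, a), (x, b), (x, z), (z, c)}"
    by auto
  ultimately show ?thesis unfolding star_on_def V using d by simp
qed

context dfree_e begin

text \<open>A norm-2 row with blocked merge has a partner \<open>a\<close> with at least three
  entries in its column, so \<open>a = e\<close>. The two blocking rows share the columns
  \<open>e\<close> and \<open>u\<close> and therefore lie in each other's column.\<close>

lemma leaf_nonmergeable:
  assumes nm: "\<forall>u\<in>V. \<forall>a\<in>V. J u = {a} \<longrightarrow> 2 \<le> card (N u \<inter> N a)"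
    and u: "u \<in> V" "card (J u) = 1"
  obtains w1 w2 where "J u = {e}" "distinct [e, u, w1, w2]" "N e = {u, w1, w2}" "N u = {w1, w2}"
    "{e, u, w2} \<subseteq> J w1" "{e, u, w1} \<subseteq> J w2"
proof -
  obtain a where Ju: "J u = {a}" using u(2) by (metis card_1_singletonE)
  then have a: "a \<in> V" by blast
  note rN = root_N[OF u(1) a Ju]
  have un: "u \<notin> N u" by (rule N_irr[OF u(1)])
  have "card (N a) = Suc (card (N u \<inter> N a))"
    using rN(1) un finN[OF u(1)] by (metis IntD1 card_insert_disjoint finite_Int)
  then have "card (N a) \<ge> 3" using nm u(1) a Ju by auto
  then have ae: "a = e" using Nk[OF a] by auto
  have c2: "card (N u \<inter> N e) = 2" using \<open>card (N a) = Suc _\<close> Ne ae by simp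
  then obtain w1 w2 where w: "N u \<inter> N e = {w1, w2}" "w1 \<noteq> w2" by (auto simp: card_2_iff)
  have Nee: "N e = {u, w1, w2}" using rN(1) w(1) ae by simp
  have ue: "u \<noteq> e" using Nee N_irr[OF eV] by blast
  have "N u \<inter> N e = N u"
    by (rule card_subset_eq[OF finN[OF u(1)]]) (use c2 Nk[OF u(1) ue] card_mono[OF finN[OF u(1)], of "N u \<inter> N e"] in auto)
  then have Nu: "N u = {w1, w2}" using w(1) by simp
  have wu: "w1 \<noteq> u" "w2 \<noteq> u" using un Nu by auto
  have we: "w1 \<noteq> e" "w2 \<noteq> e" using Nee N_irr[OF eV] by auto
  have wV: "w1 \<in> V" "w2 \<in> V" using Nee NV[OF eV] by auto
  have J1: "{e, u} \<subseteq> J w1" "{e, u} \<subseteq> J w2" using Nee Nu eV u(1) by auto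
  then have "{e, u} \<subseteq> J w1 \<inter> J w2" by blast
  then have "card {e, u} \<le> card (J w1 \<inter> J w2)" by (intro card_mono) (use finV in auto)
  then have "2 \<le> card (J w1 \<inter> J w2)" using ue by simp
  then have "w1 \<in> N w2" "w2 \<in> N w1"
    using E_card[OF wV w(2)] by (auto simp: of_bool_def split: if_splits)
  then have "{e, u, w2} \<subseteq> J w1" "{e, u, w1} \<subseteq> J w2" using J1 wV by auto
  then show thesis using that[of w1 w2] Ju ae Nee Nu ue wu we w(2) by auto
qed

text \<open>The blocked row contributes \<open>-1\<close> to \<open>excess\<close> and the two
  blocking rows at least \<open>1\<close> each. Hence \<open>PN\<close> is empty, all remaining rows
  have norm \<open>3\<close>, and the valencies make \<open>e\<close> a hub.\<close>

lemma base_root: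
  assumes nm: "\<forall>u\<in>V. \<forall>a\<in>V. J u = {a} \<longrightarrow> 2 \<le> card (N u \<inter> N a)"
    and u: "u \<in> V" "card (J u) = 1"
  shows "hub_at V E N e"
proof -
  obtain w1 w2 where w: "J u = {e}" "distinct [e, u, w1, w2]" "N e = {u, w1, w2}" "N u = {w1, w2}"
    "{e, u, w2} \<subseteq> J w1" "{e, u, w1} \<subseteq> J w2" using leaf_nonmergeable[OF nm u] by blast
  have wV: "w1 \<in> V" "w2 \<in> V" using w(3) NV[OF eV] by auto
  have c3: "card (J w1) \<ge> 3" "card (J w2) \<ge> 3"
    using card_mono[OF J_finite w(5)] card_mono[OF J_finite w(6)] w(2) by auto
  have c2: "card (J v) \<ge> 2" if "v \<in> V" "v \<noteq> u" for v
  proof (rule ccontr)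
    assume "\<not> ?thesis"
    then have "card (J v) = 1" using J_pos[OF that(1)] by linarith
    then have "J v = {e}" using leaf_nonmergeable[OF nm that(1)] by metis
    then have "v \<in> N e" by blast
    then have "v = w1 \<or> v = w2" using w(3) that by blast
    then show False using c3 \<open>card (J v) = 1\<close> by auto
  qed
  \<comment> \<open>The deviations of the norms from \<open>3\<close> that are forced so
    far.\<close>
  define h :: "nat \<Rightarrow> int" where "h v = (if v = u then -1 else if v = w1 \<or> v = w2 then 1 else 0)" for v
  have h0: "0 \<le> int (card (J v)) - 2 - h v" if "v \<in> V" for v
    using c3 c2[OF that] u(2) by (auto simp: h_def)
  have sumh: "(\<Sum>v\<in>V. h v) = 1"
  proof -
    have "(\<Sum>v\<in>V. h v) = (\<Sum>v\<in>{u, w1, w2}. h v)"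
      using finV u wV by (intro sum.mono_neutral_right) (auto simp: h_def)
    then show ?thesis using w(2) by (simp add: h_def)
  qed
  have tot: "(\<Sum>v\<in>V. int (card (J v)) - 2 - h v) = - int (card PN)"
    using excess sumh by (simp add: sum_subtractf)
  have "0 \<le> (\<Sum>v\<in>V. int (card (J v)) - 2 - h v)" by (rule sum_nonneg) (rule h0)
  then have cPN: "card PN = 0" using tot by linarith
  then have PN: "PN = {}" using finV by simp
  have "(\<Sum>v\<in>V. int (card (J v)) - 2 - h v) = 0" using tot cPN by simp
  then have z: "int (card (J v)) - 2 - h v = 0" if "v \<in> V" for v
    using that h0 finV by (subst (asm) sum_nonneg_eq_0_iff) auto
  have "card (J w1) = 3" "card (J w2) = 3" using z[OF wV(1)] z[OF wV(2)] w(2) by (auto simp: h_def)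
  then have Jw: "J w1 = {e, u, w2}" "J w2 = {e, u, w1}"
    using card_subset_eq[OF J_finite w(5)] card_subset_eq[OF J_finite w(6)] w(2) by auto
  have eu: "e \<notin> N u" and ee: "e \<notin> N e" using w(2,4) N_irr[OF eV] by auto
  have i1: "J e \<inter> J w1 = (if e \<in> N w2 then {w2} else {})"
    unfolding Jw(1) using eu ee wV by auto
  have i2: "J e \<inter> J w2 = (if e \<in> N w1 then {w1} else {})"
    unfolding Jw(2) using eu ee wV by auto
  have "of_bool (E e w1) = (1::int) + of_bool (e \<in> N w1) - of_bool (e \<in> N w2)"
    using E_card[OF eV wV(1)] i1 w(2,3) by auto
  moreover have "of_bool (E e w2) = (1::int) + of_bool (e \<in> N w2) - of_bool (e \<in> N w1)"
    using E_card[OF eV wV(2)] i2 w(2,3) by auto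
  ultimately have "E e w1" "E e w2" by (auto simp: of_bool_def split: if_splits)
  moreover have "E e u" using root_N(3)[OF u(1) eV w(1)] E_sym by blast
  ultimately have "E e l" if "l \<in> N e" for l using that w(3) by auto
  then show ?thesis using hub_e[OF PN] by blast
qed

text \<open>All norms are \<open>3\<close> here. If \<open>i\<close> is adjacent to the single
  member \<open>w\<close> of its column, dropping column \<open>i\<close> keeps the products
  nonpositive, but only row \<open>w\<close> has row sum \<open>0\<close>, and a relation cannot be
  supported on one nonzero row. Otherwise \<open>i\<close> is a leaf that can be removed with its
  column, and by induction the smaller configuration has a row with three entries
  \<open>-1\<close>.\<close>

lemma one_PN:
  assumes ge2: "\<And>v. v \<in> V \<Longrightarrow> 2 \<le> card (J v)" and PN1: "card PN = 1"
    and IH: "\<And>V' E' N'. card V' < card V \<Longrightarrow> dfree V' E' N' \<Longrightarrow> (\<exists>x. hub_at V' E' N' x) \<or> WNM V' E' N'"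
  shows False
proof -
  have "(\<Sum>v\<in>V. int (card (J v)) - 2) = 0" using excess PN1 by simp
  moreover have "\<forall>v\<in>V. 0 \<le> int (card (J v)) - 2" using ge2 by force
  ultimately have "\<forall>v\<in>V. int (card (J v)) - 2 = 0" using finV by (subst (asm) sum_nonneg_eq_0_iff) auto
  then have c2: "card (J v) = 2" if "v \<in> V" for v using that by auto
  obtain i where i: "PN = {i}" using PN1 by (metis card_1_singletonE)
  then have iV: "i \<in> V" and ci: "card (N i) = 1" by blast+
  have ie: "i \<noteq> e" using ci Ne by auto
  obtain w where w: "N i = {w}" using ci by (metis card_1_singletonE)
  have wV: "w \<in> V" "w \<noteq> i" using NV[OF iV] w by auto
  have cci: "cc N v i = 0" if "v \<in> V" "v \<noteq> i" "v \<noteq> w" for v using that w by (simp add: cc_def)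
  have ccw: "cc N w i = -1" using w wV by (simp add: cc_def)
  have ipD: "ip V y y' = y i * y' i + ip (V - {i}) y y'" for y y'
    using finV iV by (simp add: ip_def sum.remove)
  have prod: "cc N a i * cc N b i = 0" if "a \<in> V" "b \<in> V" "a \<noteq> b" "{a, b} \<noteq> {i, w}" for a b
    using cci[of a] cci[of b] that by auto
  show False
  proof (cases "E i w")
    case True
    then have Ewi: "E w i" using E_sym by blast
    have off: "ip (V - {i}) (cc N a) (cc N b) \<le> 0" if ab: "a \<in> V" "b \<in> V" "a \<noteq> b" for a b
    proof (cases "{a, b} = {i, w}")
      case True
      then have "(a = i \<and> b = w) \<or> (a = w \<and> b = i)" using ab by (auto simp: doubleton_eq_iff)
      then show ?thesis using ipD[of "cc N a" "cc N b"] pair[OF ab] ccw \<open>E i w\<close> Ewi by auto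
    next
      case False
      then have "ip (V - {i}) (cc N a) (cc N b) = - of_bool (E a b)"
        using ipD[of "cc N a" "cc N b"] prod[OF ab False] pair[OF ab] by linarith
      then show ?thesis by simp
    qed
    have s: "(\<Sum>k\<in>V - {i}. cc N v k) = -1 - cc N v i" if "v \<in> V" for v
      using cc_norm(2)[of V v N, OF finV that N_irr[OF that]] c2[OF that] finV iV by (simp add: sum.remove)
    have le: "(\<Sum>k\<in>V - {i}. cc N v k) \<le> 0" if "v \<in> V" for v
      using s[OF that] cci[OF that] ccw by (cases "v = i"; cases "v = w") auto
    have "card (V - {i}) < card V" by (rule card_Diff1_less[OF finV iV])
    then obtain m where m: "\<exists>v\<in>V. m v \<noteq> 0" "\<forall>k\<in>V - {i}. (\<Sum>v\<in>V. m v * cc N v k) = 0"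
      using linear_dependence[of "V - {i}" V "cc N"] finV by auto
    have only: "v = w" if "v \<in> V" "m v \<noteq> 0" for v
    proof -
      have "(\<Sum>k\<in>V - {i}. cc N v k) = 0"
        by (rule null_row_sums[where m = m and V = V and C = "V - {i}"]) (use finV off m(2) le that in auto)
      then show ?thesis using s[OF that(1)] cci[OF that(1)] by (cases "v = i"; cases "v = w") auto
    qed
    then have mw: "m w \<noteq> 0" using m(1) by auto
    have "(\<Sum>v\<in>V. m v * cc N v w) = (\<Sum>v\<in>{w}. m v * cc N v w)"
      using finV wV only by (intro sum.mono_neutral_right) auto
    then show False using m(2) wV mw by auto
  next
    case False
    have "int (card {v\<in>V. E i v}) = 1 + cc N i e" using val[OF iV] unfolding i by simp
    then have v1: "card {v\<in>V. E i v} \<le> 1" using cc_neq[OF ie, of N] by (simp add: of_bool_def split: if_splits)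
    have "{i} \<noteq> V" using wV by auto
    then obtain z where z: "z \<in> V" "E i z" using connD[OF connE, of "{i}"] iV by blast
    then have "z \<in> {v\<in>V. E i v}" by simp
    then have nb: "y = z" if "y \<in> V" "E i y" for y
      using v1 finV that card_le_Suc0_iff_eq[of "{v\<in>V. E i v}"] by auto
    have e1: "emb (V - {i}) (V - {i}) E (cc N)"
    proof (rule emb_remove_leaf[OF emb_axioms iV z nb iV])
      show "cc N a i * cc N b i = 0" if "a \<in> V - {i}" "b \<in> V - {i}" "a \<noteq> b" for a b
        using prod[of a b] that by auto
      show "cc N v i = 0 \<or> cc N v i = -1" if "v \<in> V - {i}" for v
        using cci[of v] ccw that by (cases "v = w") auto
      show "ip V (cc N v) (cc N v) \<noteq> 2" if "v \<in> V - {i}" for v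
        using norm_J[of v] c2[of v] that by simp
    qed
    define N' where "N' k = N k - {i}" for k
    have "dfree (V - {i}) E N'"
    proof (intro dfree.intro dfree_axioms.intro)
      show "emb (V - {i}) (V - {i}) E (cc N')"
        by (rule emb_cong[OF e1]) (auto simp: cc_def N'_def)
      show "N' k \<subseteq> V - {i} - {k}" if "k \<in> V - {i}" for k using NV[of k] that by (auto simp: N'_def)
    qed
    then interpret d: dfree "V - {i}" E N' .
    have "(\<exists>x. hub_at (V - {i}) E N' x) \<or> WNM (V - {i}) E N'"
      by (rule IH[OF card_Diff1_less[OF finV iV] d.dfree_axioms])
    then obtain v where v: "v \<in> V - {i}" "3 \<le> card {k\<in>V - {i}. v \<in> N' k}" using d.classified_big by blast
    have "{k\<in>V - {i}. v \<in> N' k} \<subseteq> J v" by (auto simp: N'_def)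
    then have "card {k\<in>V - {i}. v \<in> N' k} \<le> card (J v)" by (rule card_mono[OF J_finite])
    then show False using v c2[of v] by simp
  qed
qed

end

locale dfree_e0 = dfree_e +
  assumes PN0: "PN = {}"
begin

lemma N2: "k \<in> V \<Longrightarrow> k \<noteq> e \<Longrightarrow> card (N k) = 2" using Nk[of k] PN0 by blast

lemma leaf: assumes "l \<in> N e" "E e l" "z \<in> V" "E l z" shows "z = e"
proof -
  have "l \<in> V" using NV[OF eV] assms by blast
  have "card {w\<in>V. E l w} = 1" by (rule val0(2)[OF PN0 assms(1)])
  then obtain y where y: "{w\<in>V. E l w} = {y}" by (metis card_1_singletonE)
  have "e \<in> {w\<in>V. E l w}" "z \<in> {w\<in>V. E l w}" using assms eV E_sym by auto
  then show ?thesis unfolding y by simp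
qed

text \<open>Two adjacent vertices of valency one would form a whole component, without
  \<open>e\<close>.\<close>

lemma leaves_nonadj: assumes "l \<in> N e" "l' \<in> N e" shows "\<not> E l l'"
proof
  assume E: "E l l'"
  have lV: "l \<in> V" "l' \<in> V" "l \<noteq> e" "l' \<noteq> e" using NV[OF eV] assms by auto
  obtain y where y: "{w\<in>V. E l w} = {y}" using val0(2)[OF PN0 assms(1)] by (metis card_1_singletonE)
  obtain y' where y': "{w\<in>V. E l' w} = {y'}" using val0(2)[OF PN0 assms(2)] by (metis card_1_singletonE)
  have "l' \<in> {w\<in>V. E l w}" "l \<in> {w\<in>V. E l' w}" using E E_sym lV by auto
  then have n: "{w\<in>V. E l w} = {l'}" "{w\<in>V. E l' w} = {l}" using y y' by auto
  have "{l, l'} \<subseteq> V" "{l, l'} \<noteq> {}" using lV by auto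
  moreover have "{l, l'} \<noteq> V" using eV lV(3,4) by blast
  ultimately obtain a b where "a \<in> {l, l'}" "b \<in> V - {l, l'}" "E a b" using connD[OF connE, of "{l, l'}"] by blast
  then have "b \<in> {w\<in>V. E a w}" by blast
  moreover have "{w\<in>V. E a w} \<subseteq> {l, l'}" using \<open>a \<in> {l, l'}\<close> n by (elim insertE emptyE) simp_all
  ultimately show False using \<open>b \<in> V - {l, l'}\<close> by blast
qed

lemma arcs:
  assumes "l \<in> N e" "l' \<in> N e" "l \<noteq> l'"
  shows "of_bool (l' \<in> J l) + of_bool (l \<in> J l') = int (card (J l \<inter> J l'))"
proof -
  have "l \<in> V" "l' \<in> V" using NV[OF eV] assms by auto
  then show ?thesis using E_card[of l l'] leaves_nonadj[OF assms(1,2)] assms(3) by simp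
qed

lemma centre_adj:
  assumes "l \<in> N e" "J l = {e, b}"
  shows "of_bool (E e l) = 1 + of_bool (e \<in> N l) - (of_bool (e \<in> N b)::int)"
proof -
  have l: "l \<in> V" "l \<noteq> e" "b \<in> V" using NV[OF eV] assms by auto
  have "J e \<inter> J l = (if e \<in> N b then {b} else {})"
    unfolding assms(2) using N_irr[OF eV] l by auto
  then show ?thesis using E_card[OF eV l(1)] l assms(1) by auto
qed

text \<open>The three equations of \<open>centre_adj\<close> sum to \<open>3\<close>, since their
  other terms cancel cyclically; so all three ends are adjacent to the centre.\<close>

lemma all_leaves_3:
  assumes d: "distinct [l1, l2, l3]" "N e = {l1, l2, l3}"
    and J: "J l1 = {e, l2}" "J l2 = {e, l3}" "J l3 = {e, l1}"
  shows "hub_at V E N e"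
proof -
  have "E e l1" "E e l2" "E e l3"
    using centre_adj[OF _ J(1)] centre_adj[OF _ J(2)] centre_adj[OF _ J(3)] d(2)
    by (auto simp: of_bool_def split: if_splits)
  then have "E e l" if "l \<in> N e" for l using that d(2) by auto
  then show ?thesis using hub_e[OF PN0] by blast
qed

text \<open>The surplus entry sits in the end \<open>l1\<close>. Counting common columns determines
  the columns one after another, and the configuration closes up on five vertices: it is
  \<open>Delta 1 0 0\<close>, the smallest case of \<open>N_str\<close> with nonempty
  \<open>C2\<close>.\<close>

lemma one_leaf_4:
  assumes d: "distinct [l1, l2, l3]" and Nee: "N e = {l1, l2, l3}"
    and c3: "card (J l1) = 3" and c2: "\<And>v. v \<in> V \<Longrightarrow> v \<noteq> l1 \<Longrightarrow> card (J v) = 2"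
    and J2: "J l2 = {e, l3}" and J3: "J l3 = {e, b3}" "b3 \<noteq> l2"
  shows "WNM V E N"
proof -
  have lN: "l1 \<in> N e" "l2 \<in> N e" "l3 \<in> N e" using Nee by auto
  have lV: "l1 \<in> V" "l2 \<in> V" "l3 \<in> V" and le: "l1 \<noteq> e" "l2 \<noteq> e" "l3 \<noteq> e" using lN NV[OF eV] by auto
  have dd: "l1 \<noteq> l2" "l1 \<noteq> l3" "l2 \<noteq> l3" using d by auto
  have eJ: "e \<in> J v \<longleftrightarrow> v \<in> {l1, l2, l3}" for v using Nee eV by auto
  have J12: "l2 \<in> J l1" "l3 \<notin> J l1"
  proof -
    have "J l1 \<inter> J l2 = (if l3 \<in> J l1 then {e, l3} else {e})" unfolding J2 using eJ[of l1] by auto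
    moreover have "l1 \<notin> J l2" unfolding J2 using dd le by auto
    moreover have "int (card (if b then {e, l3} else {e})) = 1 + of_bool b" for b using le by simp
    ultimately have "int (card (J l1 \<inter> J l2)) = 1 + of_bool (l3 \<in> J l1)" "of_bool (l1 \<in> J l2) = (0::int)" by simp_all
    then have "of_bool (l2 \<in> J l1) = (1::int) + of_bool (l3 \<in> J l1)"
      using arcs[OF lN(1,2) dd(1)] by linarith
    then show "l2 \<in> J l1" "l3 \<notin> J l1" by (auto simp: of_bool_def split: if_splits)
  qed
  have b3: "b3 = l1"
  proof (rule ccontr)
    assume b: "b3 \<noteq> l1"
    then have "l1 \<notin> J l3" unfolding J3 using le by auto
    then have "int (card (J l1 \<inter> J l3)) = 0" using arcs[OF lN(1,3) dd(2)] J12(2) by auto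
    then have "J l1 \<inter> J l3 = {}" using J_finite by simp
    then show False using eJ[of l1] eJ[of l3] by auto
  qed
  have J3': "J l3 = {e, l1}" using J3 b3 by simp
  have "{e, l2} \<subseteq> J l1" using eJ[of l1] J12 by auto
  then have "card (J l1 - {e, l2}) = 1" using c3 le J_finite by (simp add: card_Diff_subset)
  then obtain c where c: "J l1 - {e, l2} = {c}" by (metis card_1_singletonE)
  then have J1: "J l1 = {e, l2, c}" using \<open>{e, l2} \<subseteq> J l1\<close> by auto
  have "c \<in> J l1" using c by blast
  then have cV: "c \<in> V" "l1 \<in> N c" by blast+
  have cne: "c \<noteq> e" "c \<noteq> l2" "c \<noteq> l3" "c \<noteq> l1" using c J12 N_irr[OF lV(1)] \<open>c \<in> J l1\<close> by auto
  \<comment> \<open>The entries of row \<open>e\<close> as bits; adjacency of \<open>e\<close> to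
    the three ends becomes a system of inequalities between them.\<close>
  define f where "f v = (of_bool (e \<in> N v) :: int)" for v
  have f01: "f v = 0 \<or> f v = 1" for v by (simp add: f_def)
  have E2: "of_bool (E e l2) = 1 + f l2 - f l3" using centre_adj[OF lN(2) J2] by (simp add: f_def)
  have E3: "of_bool (E e l3) = 1 + f l3 - f l1" using centre_adj[OF lN(3) J3'] by (simp add: f_def)
  have E1: "of_bool (E e l1) = 1 + f l1 - f l2 - f c"
  proof -
    have "J e \<inter> J l1 = (if e \<in> N l2 then {l2} else {}) \<union> (if e \<in> N c then {c} else {})"
      unfolding J1 using N_irr[OF eV] lV cV by auto
    then have "int (card (J e \<inter> J l1)) = f l2 + f c" using cne by (auto simp: f_def)
    then show ?thesis using E_card[OF eV lV(1)] le lN(1) by (simp add: f_def)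
  qed
  have ob: "of_bool (E e v) \<le> (1::int)" "(0::int) \<le> of_bool (E e v)" for v by auto
  have Je: "card (J e) = 2" by (rule c2[OF eV]) (use le in auto)
  have fJ: "f v = 1 \<longleftrightarrow> v \<in> J e" if "v \<in> V" for v using that by (simp add: f_def)
  have le1: "f l2 \<le> f l3" "f l3 \<le> f l1" "f l1 \<le> f l2 + f c"
    using E1 E2 E3 ob(1)[of l1] ob(1)[of l2] ob(1)[of l3] by linarith+
  have f2: "f l2 = 0"
  proof (rule ccontr)
    assume "f l2 \<noteq> 0"
    then have "f l2 = 1" "f l3 = 1" "f l1 = 1" using f01[of l2] f01[of l3] f01[of l1] le1 by linarith+
    then have "{l1, l2, l3} \<subseteq> J e" using fJ lV by auto
    then have "card {l1, l2, l3} \<le> card (J e)" by (rule card_mono[OF J_finite])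
    then show False using Je dd by simp
  qed
  have l1N2: "l1 \<in> N l2" and l2N3: "l2 \<in> N l3" and l3N1: "l3 \<in> N l1" using J12(1) J2 J3' by blast+
  have "card (N l2 - {l1}) = 1" using N2[OF lV(2) le(2)] l1N2 finN[OF lV(2)] by simp
  then obtain z where z: "N l2 - {l1} = {z}" by (metis card_1_singletonE)
  then have Nl2: "N l2 = {l1, z}" "z \<noteq> l1" "z \<in> N l2" using l1N2 by auto
  have zV: "z \<in> V" "z \<noteq> l2" using Nl2(3) NV[OF lV(2)] by auto
  have ze: "z \<noteq> e" using f2 Nl2 by (auto simp: f_def)
  have zl3: "z \<noteq> l3"
  proof
    assume "z = l3"
    then have "l2 \<in> J l3" using Nl2 lV by blast
    then show False unfolding J3' using dd le by auto
  qed
  have zJe: "e \<notin> J z" using eJ[of z] Nl2(2) zV(2) zl3 by blast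
  have El2: "E e l2"
    using E2 f2 f01[of l3] f01[of l1] le1 E1 f01[of c] Je
  proof -
    have "f l3 = 0"
    proof (rule ccontr)
      assume "f l3 \<noteq> 0"
      then have f: "f l3 = 1" "f l1 = 1" "f c = 1" using f01[of l3] f01[of l1] f01[of c] le1 f2 by linarith+
      then have "{l1, l3, c} \<subseteq> J e" using fJ lV cV by auto
      then have "card {l1, l3, c} \<le> card (J e)" by (rule card_mono[OF J_finite])
      then show False using Je dd cne by simp
    qed
    then show ?thesis using E2 f2 by (simp add: of_bool_def split: if_splits)
  qed
  have f3: "f l3 = 0" using E2 f2 El2 by simp
  have "\<not> E l2 z" using leaf[OF lN(2) El2 zV(1)] ze by blast
  have l3z: "l3 \<in> J z"
  proof (rule ccontr)
    assume n: "l3 \<notin> J z"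
    have "J l2 \<inter> J z = {}" unfolding J2 using n zJe by blast
    moreover have "l2 \<in> J z" using Nl2 lV by blast
    moreover have "z \<notin> J l2" unfolding J2 using ze zl3 by blast
    ultimately show False using E_card[OF lV(2) zV(1)] \<open>\<not> E l2 z\<close> zV by auto
  qed
  have "f l1 = 1"
  proof (rule ccontr)
    assume "f l1 \<noteq> 1"
    then have "f l1 = 0" using f01 by blast
    then have "E e l3" using E3 f3 by (simp add: of_bool_def split: if_splits)
    then have nE: "\<not> E l3 z" using leaf[OF lN(3) _ zV(1)] ze by blast
    have zn: "z \<notin> J l3" unfolding J3' using ze Nl2(2) by blast
    have "l1 \<in> J z"
    proof (rule ccontr)
      assume "l1 \<notin> J z"
      then have "J l3 \<inter> J z = {}" unfolding J3' using zJe by blast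
      then show False using E_card[OF lV(3) zV(1)] nE zn l3z zl3 zV lV by auto
    qed
    then have "{l1, l2, l3} \<subseteq> J z" using l3z Nl2 lV by blast
    then have "card {l1, l2, l3} \<le> card (J z)" by (rule card_mono[OF J_finite])
    then show False using c2[OF zV(1) Nl2(2)] dd by simp
  qed
  then have fc: "f c = 1" using le1 f2 f01[of c] by linarith
  have "{l1, c} \<subseteq> J e" using fJ \<open>f l1 = 1\<close> fc lV cV by auto
  then have Jee: "J e = {l1, c}" by (rule card_subset_eq[OF J_finite, symmetric]) (use Je cne in simp)
  have El1: "E e l1" using E1 \<open>f l1 = 1\<close> fc f2 by (simp add: of_bool_def split: if_splits)
  have El3: "\<not> E e l3" using E3 \<open>f l1 = 1\<close> f3 by (simp add: of_bool_def split: if_splits)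
  have eN1: "e \<in> N l1" "e \<in> N c" using Jee by blast+
  have two: "N k = {a, b}" if "k \<in> V" "k \<noteq> e" "a \<in> N k" "b \<in> N k" "a \<noteq> b" for k a b
    by (rule card_subset_eq[OF finN[OF that(1)], symmetric]) (use N2[OF that(1,2)] that(3-5) in simp_all)
  have Nl1: "N l1 = {l3, e}" by (rule two[OF lV(1) le(1) l3N1 eN1(1) le(3)])
  have Nc: "N c = {l1, e}" by (rule two[OF cV(1) cne(1) cV(2) eN1(2) le(1)])
  have zN3: "z \<in> N l3" using l3z by blast
  have Nl3: "N l3 = {l2, z}" by (rule two[OF lV(3) le(3) l2N3 zN3 zV(2)[symmetric]])
  have Jz: "J z = {l2, l3}"
  proof -
    have "{l2, l3} \<subseteq> J z" using l3z Nl2 lV by blast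
    then show ?thesis
      by (rule card_subset_eq[OF J_finite, symmetric]) (use c2[OF zV(1) Nl2(2)] dd in simp)
  qed
  have Ezl3: "E z l3"
  proof -
    have "J z \<inter> J l3 = {}" unfolding Jz J3' using dd le by auto
    moreover have "l3 \<notin> N z" using J3' ze Nl2(2) zV by blast
    ultimately show ?thesis using E_card[OF zV(1) lV(3) zl3] zN3 by (simp add: of_bool_def split: if_splits)
  qed
  have Eec: "E e c"
  proof -
    have "card ({w\<in>V. E e w} - {l1, l2}) = 1"
      using val0(1)[OF PN0] El1 El2 lV dd finV by (simp add: card_Diff_subset)
    then obtain t where t: "{w\<in>V. E e w} - {l1, l2} = {t}" by (metis card_1_singletonE)
    then have tt: "t \<in> V" "E e t" "t \<noteq> l1" "t \<noteq> l2" by blast+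
    then have "t \<noteq> l3" "t \<noteq> e" using El3 E_irr by auto
    then have "t \<notin> N e" using Nee tt by blast
    then have "e \<in> N t" using adj_N[OF tt(2) eV tt(1)] by blast
    then have "t \<in> J e" using tt by blast
    then show ?thesis using Jee tt by blast
  qed
  \<comment> \<open>\<open>c\<close> and \<open>l1\<close> are nonadjacent although
    \<open>l1\<close> lies in column \<open>c\<close>, so they share a column. Among the three
    columns of row \<open>l1\<close> it can only be \<open>l2\<close>.\<close>
  have cz: "c = z"
  proof -
    have nE: "\<not> E c l1" using leaf[OF lN(1) El1 cV(1)] cne E_sym by blast
    have "c \<notin> N l1" using Nl1 cne by auto
    then have "int (card (J c \<inter> J l1)) = 1" using E_card[OF cV(1) lV(1) cne(4)] nE cV(2) by auto
    then have "J c \<inter> J l1 \<noteq> {}" by auto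
    moreover have "e \<notin> J c" using eJ[of c] cne by blast
    moreover have "c \<notin> J c" using N_irr by blast
    ultimately have "l2 \<in> J c" unfolding J1 by blast
    then show ?thesis using Nl2(1) cne by blast
  qed
  have Eez: "E e z" using Eec cz by simp
  have nb: "{w\<in>V. E z w} = {e, l3}"
  proof (rule card_subset_eq[symmetric])
    have "z \<notin> N e" using Nee Nl2(2) zV zl3 by auto
    then show "card {e, l3} = card {w\<in>V. E z w}" using val0(3)[OF PN0 zV(1) ze] le by simp
  qed (use finV eV lV Eez Ezl3 E_sym in auto)
  have nbe: "{w\<in>V. E e w} = {l1, l2, z}"
  proof (rule card_subset_eq[symmetric])
    show "card {l1, l2, z} = card {w\<in>V. E e w}" using val0(1)[OF PN0] dd Nl2(2) zV by simp
  qed (use finV lV zV El1 El2 Eez in auto)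
  have nb3: "w = z" if "w \<in> V" "E l3 w" for w
  proof -
    obtain y where y: "{w\<in>V. E l3 w} = {y}" using val0(2)[OF PN0 lN(3)] by (metis card_1_singletonE)
    have "z \<in> {w\<in>V. E l3 w}" "w \<in> {w\<in>V. E l3 w}" using that zV Ezl3 E_sym by auto
    then show ?thesis unfolding y by simp
  qed
  have V: "V = {e, l2, l1, z, l3}"
  proof (rule ccontr)
    assume ne: "V \<noteq> {e, l2, l1, z, l3}"
    have sub: "{e, l2, l1, z, l3} \<subseteq> V" using eV lV zV by simp
    obtain a b where ab: "a \<in> {e, l2, l1, z, l3}" "b \<in> V - {e, l2, l1, z, l3}" "E a b"
      using connD[OF connE sub _ ne[symmetric]] by blast
    then have bV: "b \<in> V" "b \<noteq> e" "b \<notin> {e, l3}" "b \<notin> {l1, l2, z}" "b \<noteq> z" by auto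
    have "\<not> E l1 b" "\<not> E l2 b" "\<not> E l3 b"
      using leaf[OF lN(1) El1 bV(1)] leaf[OF lN(2) El2 bV(1)] nb3[OF bV(1)] bV(2,5) by blast+
    moreover have "\<not> E z b" using bV(1,3) unfolding nb[symmetric] by simp
    moreover have "\<not> E e b" using bV(1,4) unfolding nbe[symmetric] by simp
    ultimately show False using ab(1,3) by (elim insertE emptyE) simp_all
  qed
  have ds: "distinct [e, l2, l1, z, l3]" using dd le ze zl3 zV(2) Nl2(2) by auto
  have star: "star_on V E e [l2] [l1] [z, l3]"
  proof (rule star_on_5[OF ds V El2 El1 Eez Ezl3])
    show "\<not> E l2 l1" "\<not> E l2 l3" "\<not> E l1 l3" using leaves_nonadj lN by blast+
    show "\<not> E l2 z" "\<not> E l1 z" using leaf[OF lN(1) El1 zV(1)] \<open>\<not> E l2 z\<close> ze by blast+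
  qed (use El3 E_sym E_irr in auto)
  have "N_str V E N e l2 [l1] [z] [l3]"
    unfolding N_str_def using star Nee Nl1 Nl2(1) Nl3 Nc cz by (auto simp: insert_commute)
  then show ?thesis unfolding WNM_def by blast
qed

text \<open>The excess is exactly \<open>1\<close>: one row has three entries \<open>-1\<close> and
  all others have two. If that row is an end, \<open>one_leaf_4\<close> applies; otherwise the ends
  point at each other cyclically and \<open>e\<close> is a hub.\<close>

lemma no_root:
  assumes ge2: "\<And>v. v \<in> V \<Longrightarrow> 2 \<le> card (J v)"
  shows "hub_at V E N e \<or> WNM V E N"
proof -
  have ex: "(\<Sum>v\<in>V. int (card (J v)) - 2) = 1" using excess[unfolded PN0] by simp
  have uniq: "card (J v) = 2" if h: "h \<in> V" "card (J h) \<ge> 3" and v: "v \<in> V" "v \<noteq> h" for h v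
  proof -
    have "(\<Sum>v\<in>V. int (card (J v)) - 2) = (int (card (J h)) - 2) + ((int (card (J v)) - 2)
        + (\<Sum>v\<in>V - {h} - {v}. int (card (J v)) - 2))"
      using finV h v by (simp add: sum.remove)
    moreover have "0 \<le> (\<Sum>v\<in>V - {h} - {v}. int (card (J v)) - 2)" using ge2 by (intro sum_nonneg) force
    ultimately show ?thesis using ex h(2) ge2[OF v(1)] by linarith
  qed
  have le3: "card (J h) \<le> 3" if h: "h \<in> V" for h
  proof -
    have "(\<Sum>v\<in>V. int (card (J v)) - 2) = (int (card (J h)) - 2) + (\<Sum>v\<in>V - {h}. int (card (J v)) - 2)"
      using finV h by (simp add: sum.remove)
    moreover have "0 \<le> (\<Sum>v\<in>V - {h}. int (card (J v)) - 2)" using ge2 by (intro sum_nonneg) force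
    ultimately show ?thesis using ex by linarith
  qed
  obtain l1 l2 l3 where l: "N e = {l1, l2, l3}" "l1 \<noteq> l2" "l2 \<noteq> l3" "l1 \<noteq> l3"
    using Ne by (auto simp: card_3_iff)
  have two: "\<exists>b. J l = {e, b} \<and> b \<noteq> e \<and> b \<noteq> l" if "l \<in> N e" "card (J l) = 2" for l
  proof -
    have "e \<in> J l" using that eV by blast
    then have "card (J l - {e}) = 1" using that J_finite by simp
    then obtain b where b: "J l - {e} = {b}" by (metis card_1_singletonE)
    have "l \<notin> J l" using N_irr by blast
    then show ?thesis using b \<open>e \<in> J l\<close> by blast
  qed
  have arc: "of_bool (b = l') + of_bool (b' = l) = (1::int) + of_bool (b = b')"
    if "l \<in> N e" "l' \<in> N e" "l \<noteq> l'" "J l = {e, b}" "J l' = {e, b'}" "b \<noteq> e" "b' \<noteq> e" for l l' b b'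
  proof -
    have "l \<noteq> e" "l' \<noteq> e" using that NV[OF eV] by auto
    then have m: "l' \<in> J l \<longleftrightarrow> b = l'" "l \<in> J l' \<longleftrightarrow> b' = l" unfolding that(4,5) by auto
    have "J l \<inter> J l' = (if b = b' then {e, b} else {e})" unfolding that(4,5) using that(6,7) by auto
    then have "int (card (J l \<inter> J l')) = 1 + of_bool (b = b')" using that(6) by simp
    then show ?thesis using arcs[OF that(1-3)] unfolding m by linarith
  qed
  have big: "WNM V E N"
    if h: "N e = {h, p, q}" "distinct [h, p, q]" "card (J h) = 3" for h p q
  proof -
    have pq: "p \<in> N e" "q \<in> N e" "p \<noteq> q" "p \<noteq> h" "q \<noteq> h" "h \<in> V" "p \<in> V" "q \<in> V"
      using h NV[OF eV] by auto
    have c2: "card (J v) = 2" if "v \<in> V" "v \<noteq> h" for v using uniq[OF pq(6) _ that] h(3) by simp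
    obtain bp where bp: "J p = {e, bp}" "bp \<noteq> e" "bp \<noteq> p" using two[OF pq(1) c2[OF pq(7,4)]] by blast
    obtain bq where bq: "J q = {e, bq}" "bq \<noteq> e" "bq \<noteq> q" using two[OF pq(2) c2[OF pq(8,5)]] by blast
    have "of_bool (bp = q) + of_bool (bq = p) = (1::int) + of_bool (bp = bq)"
      by (rule arc[OF pq(1-3) bp(1) bq(1) bp(2) bq(2)])
    then consider "bp = q" "bq \<noteq> p" | "bq = p" "bp \<noteq> q"
      using pq(3) by (auto simp: of_bool_def split: if_splits)
    then show ?thesis
    proof cases
      case 1
      show ?thesis by (rule one_leaf_4[OF h(2,1,3) c2 bp(1)[unfolded 1] bq(1) 1(2)])
    next
      case 2
      have h': "distinct [h, q, p]" "N e = {h, q, p}" using h by auto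
      show ?thesis by (rule one_leaf_4[OF h' h(3) c2 bq(1)[unfolded 2] bp(1) 2(2)])
    qed
  qed
  show ?thesis
  proof (cases "\<exists>l\<in>N e. card (J l) \<noteq> 2")
    case True
    then obtain h where h: "h \<in> N e" "card (J h) \<noteq> 2" by blast
    then have "h \<in> V" using NV[OF eV] by blast
    then have c: "card (J h) = 3" using le3[of h] ge2[of h] h(2) by linarith
    have "h = l1 \<or> h = l2 \<or> h = l3" using h(1) l(1) by simp
    then show ?thesis
    proof (elim disjE)
      assume "h = l1" then show ?thesis using big[of l1 l2 l3] l c by simp
    next
      assume "h = l2" then show ?thesis using big[of l2 l1 l3] l c by (simp add: insert_commute)
    next
      assume "h = l3" then show ?thesis using big[of l3 l1 l2] l c by (simp add: insert_commute)
    qed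
  next
    case False
    then have c2: "card (J l) = 2" if "l \<in> N e" for l using that by blast
    have lN: "l1 \<in> N e" "l2 \<in> N e" "l3 \<in> N e" using l(1) by auto
    obtain b1 where b1: "J l1 = {e, b1}" "b1 \<noteq> e" "b1 \<noteq> l1" using two[OF lN(1) c2[OF lN(1)]] by blast
    obtain b2 where b2: "J l2 = {e, b2}" "b2 \<noteq> e" "b2 \<noteq> l2" using two[OF lN(2) c2[OF lN(2)]] by blast
    obtain b3 where b3: "J l3 = {e, b3}" "b3 \<noteq> e" "b3 \<noteq> l3" using two[OF lN(3) c2[OF lN(3)]] by blast
    have a12: "of_bool (b1 = l2) + of_bool (b2 = l1) = (1::int) + of_bool (b1 = b2)"
      by (rule arc[OF lN(1,2) l(2) b1(1) b2(1) b1(2) b2(2)])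
    have a23: "of_bool (b2 = l3) + of_bool (b3 = l2) = (1::int) + of_bool (b2 = b3)"
      by (rule arc[OF lN(2,3) l(3) b2(1) b3(1) b2(2) b3(2)])
    have a13: "of_bool (b1 = l3) + of_bool (b3 = l1) = (1::int) + of_bool (b1 = b3)"
      by (rule arc[OF lN(1,3) l(4) b1(1) b3(1) b1(2) b3(2)])
    \<comment> \<open>Equal targets of two ends would require that these ends point at each other,
      hence have different targets; so the three arcs form a cycle.\<close>
    have "(b1 = l2 \<and> b2 = l3 \<and> b3 = l1) \<or> (b1 = l3 \<and> b3 = l2 \<and> b2 = l1)"
      using a12 a23 a13 l(2-4) by (auto simp: of_bool_def split: if_splits)
    then show ?thesis
    proof
      assume "b1 = l2 \<and> b2 = l3 \<and> b3 = l1"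
      then have "hub_at V E N e" using all_leaves_3[of l1 l2 l3] l b1(1) b2(1) b3(1) by simp
      then show ?thesis ..
    next
      assume "b1 = l3 \<and> b3 = l2 \<and> b2 = l1"
      then have "hub_at V E N e"
        using all_leaves_3[of l1 l3 l2] l b1(1) b2(1) b3(1) by (simp add: insert_commute)
      then show ?thesis ..
    qed
  qed
qed

end

text \<open>Strong induction on the number of vertices, because \<open>one_PN\<close> removes a leaf
  instead of merging and needs the induction hypothesis for that smaller configuration.\<close>

lemma dfree_classify:
  assumes "dfree V E N" shows "(\<exists>x. hub_at V E N x) \<or> WNM V E N"
  using assms
proof (induction "card V" arbitrary: V E N rule: less_induct)
  case less
  interpret dfree V E N by fact
  show ?case
  proof (cases "\<exists>u\<in>V. \<exists>a\<in>V. J u = {a} \<and> card (N u \<inter> N a) \<le> 1")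
    case True
    then obtain u a where u: "u \<in> V" "a \<in> V" "J u = {a}" "card (N u \<inter> N a) \<le> 1" by blast
    obtain E' N' where m: "dfree (V - {u}) E' N'" "expansion (V - {u}) E' N' a u (N u \<inter> N a) V E N"
      using merge[OF u] by blast
    show ?thesis
      by (rule expansion_step[OF m less.hyps[OF card_Diff1_less[OF finV u(1)] m(1)]])
  next
    case False
    then have nm: "\<forall>u\<in>V. \<forall>a\<in>V. J u = {a} \<longrightarrow> 2 \<le> card (N u \<inter> N a)"
      by (auto simp: not_le Suc_le_eq numeral_2_eq_2)
    obtain e where e: "e \<in> V" "card (N e) = 3" "\<And>k. k \<in> V \<Longrightarrow> k \<noteq> e \<Longrightarrow> card (N k) = 1 \<or> card (N k) = 2"
      using centre by blast
    then interpret dfree_e V E N e by unfold_locales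
    show ?thesis
    proof (cases "\<exists>u\<in>V. card (J u) = 1")
      case True
      then show ?thesis using base_root[OF nm] by blast
    next
      case False
      then have ge2: "2 \<le> card (J v)" if "v \<in> V" for v using J_pos[OF that] that by (metis le_neq_implies_less Suc_1 Suc_leI)
      have "0 \<le> (\<Sum>v\<in>V. int (card (J v)) - 2)" using ge2 by (intro sum_nonneg) force
      then have "card PN \<le> 1" using excess by linarith
      moreover have "card PN \<noteq> 1" using one_PN[OF ge2 _ less.hyps] by blast
      ultimately have "card PN = 0" by linarith
      then have "PN = {}" using finV by simp
      then interpret dfree_e0 V E N e by unfold_locales
      show ?thesis using no_root[OF ge2] by blast
    qed
  qed
qed

section \<open>Decorations of the trees in W, N and M\<close>

lemma ex_less_Suc_iff: "(\<exists>k<Suc n. P k) \<longleftrightarrow> P 0 \<or> (\<exists>k<n. P (Suc k))"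
  using less_Suc_eq_0_disj by auto

lemma leg_edges_iff:
  "(i, j) \<in> set (leg_edges s m) \<longleftrightarrow> (\<exists>k<m. i = (if k = 0 then 0 else s + k - 1) \<and> j = s + k)"
proof (cases m)
  case (Suc n)
  have "(i, j) \<in> set (leg_edges s m) \<longleftrightarrow> (i = 0 \<and> j = s) \<or> (\<exists>k<n. i = s + k \<and> j = s + k + 1)"
    by (auto simp: leg_edges_def Suc)
  also have "\<dots> \<longleftrightarrow> (\<exists>k<Suc n. i = (if k = 0 then 0 else s + k - 1) \<and> j = s + k)"
    by (simp add: ex_less_Suc_iff)
  finally show ?thesis by (simp add: Suc)
qed (simp add: leg_edges_def)

lemma path_edges_iff: "(z, w) \<in> path_edges p L \<longleftrightarrow> (\<exists>k<length L. z = (p # L) ! k \<and> w = L ! k)"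
  by (induction L arbitrary: p) (auto simp: ex_less_Suc_iff)

text \<open>Translates between legs as lists of vertices and the index arithmetic of
  \<open>leg_edges\<close>, where the predecessor of the first leg vertex has index \<open>0\<close>
  whatever \<open>s\<close> is.\<close>

lemma leg_path:
  assumes d: "distinct M" and M: "M ! 0 = x" and L: "\<And>k. k < length L \<Longrightarrow> M ! (s + k) = L ! k"
    and s: "0 < s" "s + length L \<le> length M" and ij: "i < length M" "j < length M"
  shows "(M ! i, M ! j) \<in> path_edges x L \<longleftrightarrow> (i, j) \<in> set (leg_edges s (length L))"
proof -
  have "M ! i = (x # L) ! k \<and> M ! j = L ! k \<longleftrightarrow> i = (if k = 0 then 0 else s + k - 1) \<and> j = s + k"
    if k: "k < length L" for k
  proof -
    let ?i = "if k = 0 then 0 else s + k - 1"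
    have lt: "?i < length M" "s + k < length M" using k s by auto
    have "(x # L) ! k = M ! ?i"
    proof (cases k)
      case (Suc n)
      then show ?thesis using L[of n] k by simp
    qed (simp add: M)
    moreover have "L ! k = M ! (s + k)" using L[OF k] by simp
    ultimately show ?thesis using nth_eq_iff_index_eq[OF d ij(1) lt(1)] nth_eq_iff_index_eq[OF d ij(2) lt(2)] by simp
  qed
  then show ?thesis unfolding path_edges_iff leg_edges_iff by blast
qed

lemma star_on_ptree_at:
  assumes s: "star_on V E x A B C"
  shows "ptree_at (star3 (d x) (map d A) (map d B) (map d C)) V E d"
proof -
  let ?M = "x # A @ B @ C"
  let ?F = "star3 (d x) (map d A) (map d B) (map d C)"
  have dist: "distinct ?M" and V: "V = set ?M"
    and E: "\<forall>z\<in>V. \<forall>w\<in>V. E z w = ((z, w) \<in> path_edges x A \<union> path_edges x B \<union> path_edges x C \<or>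
        (w, z) \<in> path_edges x A \<union> path_edges x B \<union> path_edges x C)"
    using s unfolding star_on_def by - (elim conjE, assumption)+
  have nv: "nv ?F = length ?M" by (simp add: star3_def mk_tree_def)
  have bij: "bij_betw ((!) ?M) {..<nv ?F} V"
    unfolding nv V by (rule bij_betw_nth[OF dist]) auto
  have A: "(?M ! i, ?M ! j) \<in> path_edges x A \<longleftrightarrow> (i, j) \<in> set (leg_edges 1 (length A))"
    if "i < length ?M" "j < length ?M" for i j
    by (rule leg_path[OF dist _ _ _ _ that]) (auto simp: nth_append)
  have B: "(?M ! i, ?M ! j) \<in> path_edges x B \<longleftrightarrow> (i, j) \<in> set (leg_edges (1 + length A) (length B))"
    if "i < length ?M" "j < length ?M" for i j
    by (rule leg_path[OF dist _ _ _ _ that]) (auto simp: nth_append)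
  have C: "(?M ! i, ?M ! j) \<in> path_edges x C \<longleftrightarrow> (i, j) \<in> set (leg_edges (1 + length A + length B) (length C))"
    if "i < length ?M" "j < length ?M" for i j
    by (rule leg_path[OF dist _ _ _ _ that]) (auto simp: nth_append)
  have "E (?M ! i) (?M ! j) = adj ?F i j" if ij: "i < nv ?F" "j < nv ?F" for i j
  proof -
    have ij': "i < length ?M" "j < length ?M" using ij nv by simp_all
    have "?M ! i \<in> V" "?M ! j \<in> V" using ij' unfolding V by (simp_all only: nth_mem)
    then have "E (?M ! i) (?M ! j) = ((?M ! i, ?M ! j) \<in> path_edges x A \<union> path_edges x B \<union> path_edges x C \<or>
        (?M ! j, ?M ! i) \<in> path_edges x A \<union> path_edges x B \<union> path_edges x C)" using E by blast
    also have "\<dots> = adj ?F i j"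
      unfolding Un_iff A[OF ij'] B[OF ij'] C[OF ij'] A[OF ij'(2,1)] B[OF ij'(2,1)] C[OF ij'(2,1)]
      by (simp add: star3_def mk_tree_def)
    finally show ?thesis .
  qed
  moreover have "d (?M ! i) = dec ?F i" if "i < nv ?F" for i
  proof -
    have "dec ?F i = map d ?M ! i" by (simp add: star3_def mk_tree_def)
    also have "\<dots> = d (?M ! i)" using that unfolding nv by (rule nth_map)
    finally show ?thesis by simp
  qed
  ultimately show ?thesis unfolding ptree_at_def using bij by blast
qed

text \<open>What an expansion has to preserve in the existence direction: the lattice products. The
  tree property comes from the given tree and minimality from the explicit decorations.\<close>

definition config :: "nat set \<Rightarrow> (nat \<Rightarrow> nat \<Rightarrow> bool) \<Rightarrow> (nat \<Rightarrow> nat set) \<Rightarrow> bool" where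
  "config V E N \<longleftrightarrow> finite V \<and> (\<forall>k\<in>V. N k \<subseteq> V - {k}) \<and> (\<forall>z w. E z w \<longrightarrow> E w z) \<and> (\<forall>z. \<not> E z z) \<and>
     (\<forall>u\<in>V. \<forall>v\<in>V. u \<noteq> v \<longrightarrow> ip V (cc N u) (cc N v) = - of_bool (E u v))"

lemma (in dfree) config: "config V E N"
  unfolding config_def using finV NV E_sym E_irr pair by blast

abbreviation decN :: "nat set \<Rightarrow> (nat \<Rightarrow> nat set) \<Rightarrow> nat \<Rightarrow> int" where
  "decN V N v \<equiv> - ip V (cc N v) (cc N v)"

definition cnt :: "(nat \<Rightarrow> nat set) \<Rightarrow> nat \<Rightarrow> nat list \<Rightarrow> int" where
  "cnt N v L = (\<Sum>k\<leftarrow>L. of_bool (v \<in> N k))"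

lemma decN_star:
  assumes c: "config V E N" and s: "star_on V E x A B C" and v: "v \<in> V"
  shows "decN V N v = - (1 + of_bool (v \<in> N x) + cnt N v A + cnt N v B + cnt N v C)"
proof -
  have fin: "finite V" and "v \<notin> N v" using c v unfolding config_def by auto
  have d: "distinct (x # A @ B @ C)" and V: "V = set (x # A @ B @ C)" using s unfolding star_on_def by auto
  have "int (card {k\<in>V. v \<in> N k}) = (\<Sum>k\<in>V. of_bool (v \<in> N k))" using fin by (simp add: Int_def)
  also have "\<dots> = (\<Sum>k\<leftarrow>x # A @ B @ C. of_bool (v \<in> N k))"
    unfolding V by (rule sum.distinct_set_conv_list[OF d])
  finally show ?thesis
    using cc_norm(1)[of V v N, OF fin v \<open>v \<notin> N v\<close>] by (simp add: cnt_def)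
qed

text \<open>\<open>p\<close> and every vertex of the leg but the last occur once as a predecessor,
  and the target occurs once for each vertex of the leg. This is how leg lengths enter the
  decorations of other legs.\<close>

lemma cnt_chain:
  assumes "chainN N p L t" "distinct (p # butlast L)" "t \<notin> set (p # butlast L)" "L \<noteq> []"
  shows "cnt N v L = of_bool (v \<in> set (p # butlast L)) + of_bool (v = t) * int (length L)"
  using assms
proof (induction L arbitrary: p)
  case (Cons y L)
  have Ny: "N y = {p, t}" "p \<noteq> t" using Cons.prems by auto
  show ?case
  proof (cases "L = []")
    case True
    then show ?thesis using Ny by (auto simp: cnt_def)
  next
    case False
    have "cnt N v L = of_bool (v \<in> set (y # butlast L)) + of_bool (v = t) * int (length L)"
      by (rule Cons.IH) (use Cons.prems False in auto)
    moreover have "cnt N v (y # L) = of_bool (v = p \<or> v = t) + cnt N v L" using Ny by (simp add: cnt_def)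
    ultimately show ?thesis using Cons.prems False Ny by (auto simp: algebra_simps)
  qed
qed simp

lemma map_const: "(\<And>v. v \<in> set L \<Longrightarrow> d v = c) \<Longrightarrow> map d L = replicate (length L) c"
  by (induction L) auto

lemma W_ptree_at:
  assumes c: "config V E N" and w: "W_str V E N x A B C"
  shows "ptree_at (Gamma (length C - 1) (length A - 1) (length B - 1)) V E (decN V N)"
proof -
  have s: "star_on V E x A B C" and ne: "A \<noteq> []" "B \<noteq> []" "C \<noteq> []" and Nx: "N x = {last A, last B, last C}"
    and ch: "chainN N x A (last B)" "chainN N x B (last C)" "chainN N x C (last A)"
    using w unfolding W_str_def by auto
  have d: "distinct (x # A @ B @ C)" and V: "V = set (x # A @ B @ C)" using s unfolding star_on_def by auto
  obtain as a where A: "A = as @ [a]" using ne(1) by (metis append_butlast_last_id)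
  obtain bs b where B: "B = bs @ [b]" using ne(2) by (metis append_butlast_last_id)
  obtain cs e where C: "C = cs @ [e]" using ne(3) by (metis append_butlast_last_id)
  have cA: "cnt N v A = of_bool (v \<in> set (x # as)) + of_bool (v = b) * int (length A)" for v
    using cnt_chain[OF ch(1)] d A B by auto
  have cB: "cnt N v B = of_bool (v \<in> set (x # bs)) + of_bool (v = e) * int (length B)" for v
    using cnt_chain[OF ch(2)] d B C by auto
  have cC: "cnt N v C = of_bool (v \<in> set (x # cs)) + of_bool (v = a) * int (length C)" for v
    using cnt_chain[OF ch(3)] d A C by auto
  have dec: "decN V N v = - (1 + of_bool (v \<in> {a, b, e}) + cnt N v A + cnt N v B + cnt N v C)" if "v \<in> V" for v
    using decN_star[OF c s that] Nx A B C by simp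
  have mem: "x \<in> V" "a \<in> V" "b \<in> V" "e \<in> V" and memL: "\<And>v. v \<in> set (as @ bs @ cs) \<Longrightarrow> v \<in> V"
    unfolding V by (auto simp: A B C)
  have d1: "distinct (x # as @ [a] @ bs @ [b] @ cs @ [e])" using d by (simp add: A B C)
  note d2 = d1[simplified]
  have vals: "decN V N x = -4"
      "decN V N a = - (int (length C) + 2)"
      "decN V N b = - (int (length A) + 2)"
      "decN V N e = - (int (length B) + 2)"
    unfolding mem[THEN dec] cA cB cC using d2 by (auto simp: A B C)
  have vals2: "decN V N v = -2" if "v \<in> set (as @ bs @ cs)" for v
    unfolding dec[OF memL[OF that]] cA cB cC using d2 that by (auto simp: A B C)
  have mA: "map (decN V N) A = replicate (length A - 1) (-2) @ [- (int (length C - 1) + 3)]"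
    using map_const[of as "decN V N" "-2"] vals vals2 A C by simp
  have mB: "map (decN V N) B = replicate (length B - 1) (-2) @ [- (int (length A - 1) + 3)]"
    using map_const[of bs "decN V N" "-2"] vals vals2 A B by simp
  have mC: "map (decN V N) C = replicate (length C - 1) (-2) @ [- (int (length B - 1) + 3)]"
    using map_const[of cs "decN V N" "-2"] vals vals2 B C by simp
  show ?thesis using star_on_ptree_at[OF s, of "decN V N"] unfolding mA mB mC vals(1) Gamma_def .
qed

lemma N_ptree_at:
  assumes c: "config V E N" and w: "N_str V E N x al B C1 C2"
  shows "ptree_at (Delta (length C2) (length C1 - 1) (length B - 1)) V E (decN V N)"
proof -
  let ?C = "C1 @ C2"
  have s: "star_on V E x [al] B ?C" and ne: "B \<noteq> []" "C1 \<noteq> []" and Nx: "N x = {al, last B, last ?C}"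
    and Nal: "N al = {last B, last C1}"
    and ch: "chainN N x B (last ?C)" "chainN N x C1 (last B)" "chainN N (last C1) C2 al"
    using w unfolding N_str_def by (auto simp del: last_append)
  have d: "distinct (x # [al] @ B @ ?C)" and V: "V = set (x # [al] @ B @ ?C)" using s unfolding star_on_def by auto
  obtain bs b where B: "B = bs @ [b]" using ne(1) by (metis append_butlast_last_id)
  obtain fs f where C1: "C1 = fs @ [f]" using ne(2) by (metis append_butlast_last_id)
  have dec: "decN V N v = - (1 + of_bool (v \<in> N x) + of_bool (v \<in> {b, f}) + cnt N v B + cnt N v C1 + cnt N v C2)" if "v \<in> V" for v
    using decN_star[OF c s that] Nal B C1 by (simp add: cnt_def)
  have cC1: "cnt N v C1 = of_bool (v \<in> set (x # fs)) + of_bool (v = b) * int (length C1)" for v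
    using cnt_chain[OF ch(2)] d B C1 by auto
  show ?thesis
  proof (cases "C2 = []")
    case True
    have cB: "cnt N v B = of_bool (v \<in> set (x # bs)) + of_bool (v = f) * int (length B)" for v
      using cnt_chain[OF ch(1)] d B C1 True by auto
    have mem: "x \<in> V" "al \<in> V" "b \<in> V" "f \<in> V" and memL: "\<And>v. v \<in> set (bs @ fs) \<Longrightarrow> v \<in> V"
      unfolding V by (auto simp: B C1 True)
    have d1: "distinct (x # al # bs @ [b] @ fs @ [f])" using d by (simp add: B C1 True)
    note d2 = d1[simplified]
    have vals: "decN V N x = -3"
      "decN V N al = -2"
      "decN V N b = - (int (length C1) + 3)"
      "decN V N f = - (int (length B) + 3)"
      unfolding mem[THEN dec] cB cC1 using d2 by (auto simp: B C1 True Nx cnt_def)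
    have vals2: "decN V N v = -2" if "v \<in> set (bs @ fs)" for v
      unfolding dec[OF memL[OF that]] cB cC1 using d2 that by (auto simp: B C1 True Nx cnt_def)
    have mB: "map (decN V N) B = replicate (length B - 1) (-2) @ [- (int (length C1 - 1) + 4)]"
      using map_const[of bs "decN V N" "-2"] vals vals2 B C1 by simp
    have mC: "map (decN V N) C1 = replicate (length C1 - 1) (-2) @ [- (int (length B - 1) + 4)]"
      using map_const[of fs "decN V N" "-2"] vals vals2 B C1 by simp
    have "star_on V E x [al] C1 B" using star_on_swap[OF s] True by simp
    from star_on_ptree_at[OF this, of "decN V N"] show ?thesis
      unfolding mB mC vals(1) using vals(2) True by (simp add: Delta_def)
  next
    case False
    obtain gs g where C2: "C2 = gs @ [g]" using False by (metis append_butlast_last_id)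
    have cB: "cnt N v B = of_bool (v \<in> set (x # bs)) + of_bool (v = g) * int (length B)" for v
      using cnt_chain[OF ch(1)] d B C1 C2 by auto
    have cC2: "cnt N v C2 = of_bool (v \<in> set (f # gs)) + of_bool (v = al) * int (length C2)" for v
      using cnt_chain[OF ch(3)] d C1 C2 by auto
    have mem: "x \<in> V" "al \<in> V" "b \<in> V" "f \<in> V" "g \<in> V" and memL: "\<And>v. v \<in> set (bs @ fs @ gs) \<Longrightarrow> v \<in> V"
      unfolding V by (auto simp: B C1 C2)
    have d1: "distinct (x # al # bs @ [b] @ fs @ [f] @ gs @ [g])" using d by (simp add: B C1 C2)
    note d2 = d1[simplified]
    have vals: "decN V N x = -3"
      "decN V N al = - (int (length C2) + 2)"
      "decN V N b = - (int (length C1) + 3)"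
      "decN V N f = -3"
      "decN V N g = - (int (length B) + 2)"
      unfolding mem[THEN dec] cB cC1 cC2 using d2 by (auto simp: B C1 C2 Nx)
    have vals2: "decN V N v = -2" if "v \<in> set (bs @ fs @ gs)" for v
      unfolding dec[OF memL[OF that]] cB cC1 cC2 using d2 that by (auto simp: B C1 C2 Nx)
    have mB: "map (decN V N) B = replicate (length B - 1) (-2) @ [- (int (length C1 - 1) + 4)]"
      using map_const[of bs "decN V N" "-2"] vals vals2 B C1 by simp
    have mC: "map (decN V N) ?C = replicate (length C1 - 1) (-2) @ [-3] @ replicate (length C2 - 1) (-2) @ [- (int (length B - 1) + 3)]"
      using map_const[of fs "decN V N" "-2"] map_const[of gs "decN V N" "-2"] vals vals2 B C1 C2 by simp
    from star_on_ptree_at[OF s, of "decN V N"] show ?thesis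
      unfolding mB mC vals(1) using vals(2) C2 by (simp add: Delta_def)
  qed
qed

lemma M_ptree_at:
  assumes c: "config V E N" and w: "M_str V E N x al be C0 C1 C2"
  shows "ptree_at (Lambda (length C2) (length C0 - 1) (length C1)) V E (decN V N)"
proof -
  let ?C = "C0 @ C1 @ C2"
  have s: "star_on V E x [al] [be] ?C" and ne: "C0 \<noteq> []" "C1 @ C2 \<noteq> []" and Nx: "N x = {al, be, last (C1 @ C2)}"
    and Nal: "N al = {be, last (C0 @ C1)}" and Nbe: "N be = {last (C1 @ C2), last C0}"
    and ch: "chainN N x C0 (last (C1 @ C2))" "chainN N (last C0) C1 be" "chainN N (last (C0 @ C1)) C2 al"
    using w unfolding M_str_def by (auto simp del: last_append)
  have d: "distinct (x # [al] @ [be] @ ?C)" and V: "V = set (x # [al] @ [be] @ ?C)" using s unfolding star_on_def by auto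
  obtain es e where C0: "C0 = es @ [e]" using ne(1) by (metis append_butlast_last_id)
  have split: "cnt N v ?C = cnt N v C0 + cnt N v C1 + cnt N v C2" for v by (simp add: cnt_def)
  have dec: "decN V N v = - (1 + of_bool (v \<in> N x) + of_bool (v \<in> N al) + of_bool (v \<in> N be) + cnt N v C0 + cnt N v C1 + cnt N v C2)"
    if "v \<in> V" for v
    using decN_star[OF c s that] split by (simp add: cnt_def)
  consider "C1 = []" "C2 \<noteq> []" | "C1 \<noteq> []" "C2 = []" | "C1 \<noteq> []" "C2 \<noteq> []" using ne(2) by auto
  then show ?thesis
  proof cases
    case 1
    obtain gs g where C2: "C2 = gs @ [g]" using 1 by (metis append_butlast_last_id)
    have cC0: "cnt N v C0 = of_bool (v \<in> set (x # es)) + of_bool (v = g) * int (length C0)" for v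
      using cnt_chain[OF ch(1)] d C0 C2 1 by auto
    have cC2: "cnt N v C2 = of_bool (v \<in> set (e # gs)) + of_bool (v = al) * int (length C2)" for v
      using cnt_chain[OF ch(3)] d C0 C2 1 by auto
    have mem: "x \<in> V" "al \<in> V" "be \<in> V" "e \<in> V" "g \<in> V" and memL: "\<And>v. v \<in> set (es @ gs) \<Longrightarrow> v \<in> V"
      unfolding V by (auto simp: C0 C2 1)
    have d1: "distinct (x # al # be # es @ [e] @ gs @ [g])" using d by (simp add: C0 C2 1)
    note d2 = d1[simplified]
    have vals: "decN V N x = -2"
      "decN V N al = - (int (length C2) + 2)"
      "decN V N be = -3"
      "decN V N e = -4"
      "decN V N g = - (int (length C0) + 3)"
      unfolding mem[THEN dec] cC0 cC2 using d2 by (auto simp: C0 C2 1 Nx Nal Nbe cnt_def[of _ _ "[]"])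
    have vals2: "decN V N v = -2" if "v \<in> set (es @ gs)" for v
      unfolding dec[OF memL[OF that]] cC0 cC2 using d2 that by (auto simp: C0 C2 1 Nx Nal Nbe cnt_def[of _ _ "[]"])
    have mC: "map (decN V N) ?C = replicate (length C0 - 1) (-2) @ [-4] @ replicate (length C2 - 1) (-2) @ [- (int (length C0 - 1) + 4)]"
      using map_const[of es "decN V N" "-2"] map_const[of gs "decN V N" "-2"] vals vals2 C0 C2 1 by simp
    from star_on_ptree_at[OF s, of "decN V N"] show ?thesis
      unfolding mC vals(1) using vals(2,3) 1 C2 by (simp add: Lambda_def)
  next
    case 2
    obtain fs f where C1: "C1 = fs @ [f]" using 2 by (metis append_butlast_last_id)
    have cC0: "cnt N v C0 = of_bool (v \<in> set (x # es)) + of_bool (v = f) * int (length C0)" for v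
      using cnt_chain[OF ch(1)] d C0 C1 2 by auto
    have cC1: "cnt N v C1 = of_bool (v \<in> set (e # fs)) + of_bool (v = be) * int (length C1)" for v
      using cnt_chain[OF ch(2)] d C0 C1 2 by auto
    have mem: "x \<in> V" "al \<in> V" "be \<in> V" "e \<in> V" "f \<in> V" and memL: "\<And>v. v \<in> set (es @ fs) \<Longrightarrow> v \<in> V"
      unfolding V by (auto simp: C0 C1 2)
    have d1: "distinct (x # al # be # es @ [e] @ fs @ [f])" using d by (simp add: C0 C1 2)
    note d2 = d1[simplified]
    have vals: "decN V N x = -2"
      "decN V N al = -2"
      "decN V N be = - (int (length C1) + 3)"
      "decN V N e = -3"
      "decN V N f = - (int (length C0) + 4)"
      unfolding mem[THEN dec] cC0 cC1 using d2 by (auto simp: C0 C1 2 Nx Nal Nbe cnt_def[of _ _ "[]"])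
    have vals2: "decN V N v = -2" if "v \<in> set (es @ fs)" for v
      unfolding dec[OF memL[OF that]] cC0 cC1 using d2 that by (auto simp: C0 C1 2 Nx Nal Nbe cnt_def[of _ _ "[]"])
    have mC: "map (decN V N) ?C = replicate (length C0 - 1) (-2) @ [-3] @ replicate (length C1 - 1) (-2) @ [- (int (length C0 - 1) + 5)]"
      using map_const[of es "decN V N" "-2"] map_const[of fs "decN V N" "-2"] vals vals2 C0 C1 2 by simp
    from star_on_ptree_at[OF s, of "decN V N"] show ?thesis
      unfolding mC vals(1) using vals(2,3) 2 by (simp add: Lambda_def)
  next
    case 3
    obtain fs f where C1: "C1 = fs @ [f]" using 3 by (metis append_butlast_last_id)
    obtain gs g where C2: "C2 = gs @ [g]" using 3 by (metis append_butlast_last_id)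
    have cC0: "cnt N v C0 = of_bool (v \<in> set (x # es)) + of_bool (v = g) * int (length C0)" for v
      using cnt_chain[OF ch(1)] d C0 C1 C2 by auto
    have cC1: "cnt N v C1 = of_bool (v \<in> set (e # fs)) + of_bool (v = be) * int (length C1)" for v
      using cnt_chain[OF ch(2)] d C0 C1 by auto
    have cC2: "cnt N v C2 = of_bool (v \<in> set (f # gs)) + of_bool (v = al) * int (length C2)" for v
      using cnt_chain[OF ch(3)] d C1 C2 by auto
    have mem: "x \<in> V" "al \<in> V" "be \<in> V" "e \<in> V" "f \<in> V" "g \<in> V" and memL: "\<And>v. v \<in> set (es @ fs @ gs) \<Longrightarrow> v \<in> V"
      unfolding V by (auto simp: C0 C1 C2)
    have d1: "distinct (x # al # be # es @ [e] @ fs @ [f] @ gs @ [g])" using d by (simp add: C0 C1 C2)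
    note d2 = d1[simplified]
    have vals: "decN V N x = -2"
      "decN V N al = - (int (length C2) + 2)"
      "decN V N be = - (int (length C1) + 3)"
      "decN V N e = -3"
      "decN V N f = -3"
      "decN V N g = - (int (length C0) + 3)"
      unfolding mem[THEN dec] cC0 cC1 cC2 using d2 by (auto simp: C0 C1 C2 Nx Nal Nbe)
    have vals2: "decN V N v = -2" if "v \<in> set (es @ fs @ gs)" for v
      unfolding dec[OF memL[OF that]] cC0 cC1 cC2 using d2 that by (auto simp: C0 C1 C2 Nx Nal Nbe)
    have mC: "map (decN V N) ?C = replicate (length C0 - 1) (-2) @ [-3] @ replicate (length C1 - 1) (-2) @ [-3]
        @ replicate (length C2 - 1) (-2) @ [- (int (length C0 - 1) + 4)]"
      using map_const[of es "decN V N" "-2"] map_const[of fs "decN V N" "-2"] map_const[of gs "decN V N" "-2"] vals vals2 C0 C1 C2 by simp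
    from star_on_ptree_at[OF s, of "decN V N"] show ?thesis
      unfolding mC vals(1) using vals(2,3) 3 C2 by (simp add: Lambda_def Suc_le_eq)
  qed
qed

lemma WNM_ptree_at:
  assumes c: "config V E N" and w: "WNM V E N"
  shows "\<exists>F\<in>W_set \<union> N_set \<union> M_set. ptree_at F V E (decN V N)"
proof -
  consider (W) x A B C where "W_str V E N x A B C" | (N) x al B C1 C2 where "N_str V E N x al B C1 C2"
    | (M) x al be C0 C1 C2 where "M_str V E N x al be C0 C1 C2" using w unfolding WNM_def by blast
  then show ?thesis
  proof cases
    case W
    then show ?thesis using W_ptree_at[OF c] unfolding W_set_def by blast
  next
    case N
    then show ?thesis using N_ptree_at[OF c] unfolding N_set_def by blast
  next
    case M
    then have "(length C2, length C1) \<noteq> (0, 0)" unfolding M_str_def by auto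
    then have "Lambda (length C2) (length C0 - 1) (length C1) \<in> M_set" unfolding M_set_def by blast
    then show ?thesis using M_ptree_at[OF c M] by blast
  qed
qed

section \<open>Existence of embeddings\<close>

text \<open>Any number outside \<open>V'\<close> serves as the new vertex; columns and adjacency are
  then dictated by \<open>expansion\<close>, and \<open>expansion_ip\<close> shows that the two fit
  together.\<close>

lemma expansion_exists:
  assumes c: "config V' E' N'" and a: "a \<in> V'" and W: "W \<subseteq> N' a" "W = {} \<or> (\<exists>w. W = {w})"
    and adj: "\<And>b. b \<in> N' a - W \<Longrightarrow> E' a b"
  shows "\<exists>u V E N. expand V' E' N' a u W V E N \<and> config V E N"
proof -
  have fin: "finite V'" and NV': "\<And>k. k \<in> V' \<Longrightarrow> N' k \<subseteq> V' - {k}" and sym': "\<And>z w. E' z w \<Longrightarrow> E' w z"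
    and irr': "\<And>z. \<not> E' z z"
    and pair': "\<And>z w. z \<in> V' \<Longrightarrow> w \<in> V' \<Longrightarrow> z \<noteq> w \<Longrightarrow> ip V' (cc N' z) (cc N' w) = - of_bool (E' z w)"
    using c unfolding config_def by blast+
  obtain u where u: "u \<notin> V'" using fin ex_new_if_finite infinite_UNIV_nat by blast
  define R where "R = N' a - W"
  define V where "V = insert u V'"
  define N where "N = N'(u := N' a, a := insert u W)"
  define E where "E z w = (if z = u then w = a \<or> w \<in> R else if w = u then z = a \<or> z \<in> R
      else E' z w \<and> \<not> (z = a \<and> w \<in> R) \<and> \<not> (w = a \<and> z \<in> R))" for z w
  have ua: "u \<noteq> a" using u a by blast
  have uR: "u \<notin> R" using NV'[OF a] u unfolding R_def by blast
  have NN: "N u = N' a" "N a = insert u W" "\<And>k. k \<in> V' - {a} \<Longrightarrow> N k = N' k"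
    using ua u unfolding N_def by auto
  have e1: "ip V (cc N z) (cc N w) = ip V' (cc N' z) (cc N' w) + of_bool (z = a \<and> w \<in> R) + of_bool (w = a \<and> z \<in> R)"
    if "z \<in> V'" "w \<in> V'" "z \<noteq> w" for z w
    unfolding R_def by (rule expansion_ip(1)[OF fin V_def u a]) (fact NV' W NN that)+
  have e3: "ip V (cc N u) (cc N z) = - of_bool (z = a \<or> z \<in> R)" if "z \<in> V'" for z
    unfolding R_def by (rule expansion_ip(3)[OF fin V_def u a]) (fact NV' W NN that)+
  have sym: "\<And>z w. E z w \<Longrightarrow> E w z" unfolding E_def using sym' by (metis (full_types))
  have irr: "\<not> E z z" for z unfolding E_def using irr' ua uR by auto
  have "expansion V' E' N' a u W V E N"
    unfolding expansion_def R_def[symmetric]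
  proof (intro conjI)
    show "\<forall>b\<in>R. E' a b" using adj unfolding R_def by blast
    show "\<forall>k\<in>V' - {a}. N k = N' k" using NN(3) by blast
    show "\<forall>z\<in>V'. E u z = (z = a \<or> z \<in> R)" unfolding E_def by simp
    show "\<forall>z\<in>V'. \<forall>w\<in>V'. E z w = (E' z w \<and> \<not> (z = a \<and> w \<in> R) \<and> \<not> (w = a \<and> z \<in> R))"
    proof (intro ballI)
      fix z w assume "z \<in> V'" "w \<in> V'"
      then have "z \<noteq> u" "w \<noteq> u" using u by blast+
      then show "E z w = (E' z w \<and> \<not> (z = a \<and> w \<in> R) \<and> \<not> (w = a \<and> z \<in> R))" unfolding E_def by simp
    qed
  qed (fact u V_def a W NN)+
  then have "expand V' E' N' a u W V E N" using sym irr by unfold_locales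
  moreover have "config V E N"
    unfolding config_def
  proof (intro conjI ballI allI impI)
    show "finite V" using fin V_def by simp
    show "N k \<subseteq> V - {k}" if k: "k \<in> V" for k
    proof -
      consider "k = u" | "k = a" | "k \<in> V' - {a}" using k unfolding V_def by blast
      then show ?thesis
      proof cases
        case 1
        then show ?thesis using NV'[OF a] u unfolding V_def 1 NN(1) by auto
      next
        case 2
        then show ?thesis using NV'[OF a] W(1) ua unfolding V_def 2 NN(2) by auto
      next
        case 3
        then show ?thesis using NV'[of k] u unfolding V_def NN(3)[OF 3] by auto
      qed
    qed
    show "\<And>z w. E z w \<Longrightarrow> E w z" by (rule sym)
    show "\<And>z. \<not> E z z" by (rule irr)
    fix z w assume zw: "z \<in> V" "w \<in> V" "z \<noteq> w"
    have comm: "ip V (cc N z) (cc N u) = ip V (cc N u) (cc N z)" by (simp add: ip_def mult.commute)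
    consider "z = u" "w \<in> V'" "w \<noteq> u" | "w = u" "z \<in> V'" "z \<noteq> u" | "z \<in> V'" "w \<in> V'" "z \<noteq> u" "w \<noteq> u"
      using zw u V_def by blast
    then show "ip V (cc N z) (cc N w) = - of_bool (E z w)"
    proof cases
      case 1
      then show ?thesis using e3[of w] E_def[of z w] by simp
    next
      case 2
      then show ?thesis using e3[of z] E_def[of z w] comm by simp
    next
      case 3
      have aR: "a \<notin> R" using NV'[OF a] R_def by blast
      have "E' a b" "E' b a" if "b \<in> R" for b using adj that sym' R_def by blast+
      then show ?thesis using e1[OF 3(1,2) zw(3)] pair'[OF 3(1,2) zw(3)] E_def[of z w] 3 aR by auto
    qed
  qed
  ultimately show ?thesis by blast
qed

lemma hd_nbr:
  assumes "star_on V E x (a # ys) B C" shows "E a x"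
  using star_on_nbr[of V E x "[]" a ys B C x] assms by (auto simp: star_on_def)

definition W_exists where "W_exists m n k \<longleftrightarrow> (\<exists>V E N x A B C. config V E N \<and> W_str V E N x A B C \<and>
    length A = Suc m \<and> length B = Suc n \<and> length C = Suc k)"

lemma W_exists_rotate: "W_exists m n k \<Longrightarrow> W_exists n k m"
  unfolding W_exists_def using W_str_rotate by blast

text \<open>\<open>Gamma 0 0 0\<close>, with the column of each end containing the centre and the
  cyclically next end.\<close>

lemma W_exists_0: "W_exists 0 0 0"
proof -
  let ?V = "{0, 1, 2, 3 :: nat}"
  define E where "E = (\<lambda>(i::nat) (j::nat). (i = 0 \<and> j \<in> {1, 2, 3}) \<or> (j = 0 \<and> i \<in> {1, 2, 3}))"
  define N where "N = (\<lambda>_. {})(0::nat := {1, 2, 3::nat}, 1 := {0, 2}, 2 := {0, 3}, 3 := {0, 1})"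
  have "config ?V E N" unfolding config_def by (simp add: E_def N_def ip_def cc_def) auto
  moreover have "W_str ?V E N 0 [1] [2] [3]"
    unfolding W_str_def star_on_def by (auto simp: E_def N_def)
  ultimately show ?thesis unfolding W_exists_def by fastforce
qed

lemma W_exists_Suc:
  assumes "W_exists m n k" shows "W_exists (Suc m) n k"
proof -
  obtain V E N x A B C where c: "config V E N" and w: "W_str V E N x A B C"
    and l: "length A = Suc m" "length B = Suc n" "length C = Suc k" using assms unfolding W_exists_def by blast
  obtain a ys where A: "A = a # ys" using l(1) by (cases A) auto
  have s: "star_on V E x (a # ys) B C" and Na: "N a = {x, last B}" and aV: "a \<in> V"
    using w unfolding W_str_def A star_on_def by auto
  have "\<And>b. b \<in> N a - {last B} \<Longrightarrow> E a b" using Na hd_nbr[OF s] by auto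
  then obtain u V2 E2 N2 where "expand V E N a u {last B} V2 E2 N2" and c2: "config V2 E2 N2"
    using expansion_exists[OF c aV, of "{last B}"] Na by auto
  then interpret expand V E N a u "{last B}" V2 E2 N2 by simp
  have "W_str V2 E2 N2 x ([] @ u # a # ys) B C" by (rule W_leg_str[OF w]) (simp add: A)
  moreover have "length ([] @ u # a # ys) = Suc (Suc m)" using l A by simp
  ultimately show ?thesis unfolding W_exists_def using c2 l by blast
qed

text \<open>Only the first leg is ever lengthened; rotations bring each leg to the front in
  turn.\<close>

lemma W_exists_all: "W_exists m n k"
proof -
  have step: "W_exists a b c \<Longrightarrow> W_exists (j + a) b c" for a b c j by (induction j) (auto intro: W_exists_Suc)
  have "W_exists m 0 0" using step[OF W_exists_0, of m] by simp
  then have "W_exists k m 0" using step[OF W_exists_rotate[OF W_exists_rotate], of m 0 0 k] by simp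
  then show ?thesis using step[OF W_exists_rotate[OF W_exists_rotate], of k m 0 n] W_exists_rotate by simp
qed

definition N_exists where "N_exists m n k \<longleftrightarrow> (\<exists>V E N x al B C1 C2. config V E N \<and> N_str V E N x al B C1 C2 \<and>
    length B = Suc m \<and> length C1 = Suc n \<and> length C2 = k)"

lemma N_exists_0: "N_exists 0 0 0"
proof -
  let ?V = "{0, 1, 2, 3 :: nat}"
  define E where "E = (\<lambda>(i::nat) (j::nat). (i = 0 \<and> j \<in> {1, 2, 3}) \<or> (j = 0 \<and> i \<in> {1, 2, 3}))"
  define N where "N = (\<lambda>_. {})(0::nat := {1, 2, 3::nat}, 1 := {2, 3}, 2 := {0, 3}, 3 := {0, 2})"
  have "config ?V E N" unfolding config_def by (simp add: E_def N_def ip_def cc_def) auto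
  moreover have "N_str ?V E N 0 1 [2] [3] []"
    unfolding N_str_def star_on_def by (auto simp: E_def N_def)
  ultimately show ?thesis unfolding N_exists_def by fastforce
qed

text \<open>A second base case: lengthening \<open>C2\<close> acts at its first vertex, so an empty
  \<open>C2\<close> gives no start.\<close>

lemma N_exists_1: "N_exists 0 0 1"
proof -
  let ?V = "{0, 1, 2, 3, 4 :: nat}"
  define E where "E = (\<lambda>(i::nat) (j::nat). (i = 0 \<and> j \<in> {1, 2, 3}) \<or> (j = 0 \<and> i \<in> {1, 2, 3}) \<or> (i = 3 \<and> j = 4) \<or> (i = 4 \<and> j = 3))"
  define N where "N = (\<lambda>_. {})(0::nat := {1, 2, 4::nat}, 1 := {2, 3}, 2 := {0, 4}, 3 := {0, 2}, 4 := {3, 1})"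
  have "config ?V E N" unfolding config_def by (simp add: E_def N_def ip_def cc_def) auto
  moreover have "N_str ?V E N 0 1 [2] [3] [4]"
    unfolding N_str_def star_on_def by (auto simp: E_def N_def)
  ultimately show ?thesis unfolding N_exists_def by fastforce
qed

lemma N_exists_Suc_B:
  assumes "N_exists m n k" shows "N_exists (Suc m) n k"
proof -
  obtain V E N x al B C1 C2 where c: "config V E N" and w: "N_str V E N x al B C1 C2"
    and l: "length B = Suc m" "length C1 = Suc n" "length C2 = k" using assms unfolding N_exists_def by blast
  obtain a ys where B: "B = a # ys" using l(1) by (cases B) auto
  let ?t = "last (C1 @ C2)"
  have s0: "star_on V E x [al] (a # ys) (C1 @ C2)" and ch: "chainN N x (a # ys) ?t"
    using w unfolding N_str_def B by - ((elim conjE, assumption)+)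
  have s: "star_on V E x (a # ys) (C1 @ C2) [al]" by (rule star_on_rotate[OF s0])
  have Na: "N a = {x, ?t}" and aV: "a \<in> V" using ch s by (simp_all add: star_on_def)
  have "\<And>b. b \<in> N a - {?t} \<Longrightarrow> E a b" using Na hd_nbr[OF s] by (auto simp del: last_append)
  then obtain u V2 E2 N2 where "expand V E N a u {?t} V2 E2 N2" and c2: "config V2 E2 N2"
    using expansion_exists[OF c aV, of "{?t}"] Na by (auto simp del: last_append)
  then interpret expand V E N a u "{?t}" V2 E2 N2 by blast
  have "N_str V2 E2 N2 x al ([] @ u # a # ys) C1 C2" by (rule N_part_B_str[OF w]) (simp add: B)
  moreover have "length ([] @ u # a # ys) = Suc (Suc m)" using l B by simp
  ultimately show ?thesis unfolding N_exists_def using c2 l by blast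
qed

lemma N_exists_Suc_C1:
  assumes "N_exists m n k" shows "N_exists m (Suc n) k"
proof -
  obtain V E N x al B C1 C2 where c: "config V E N" and w: "N_str V E N x al B C1 C2"
    and l: "length B = Suc m" "length C1 = Suc n" "length C2 = k" using assms unfolding N_exists_def by blast
  obtain a ys where C1: "C1 = a # ys" using l(2) by (cases C1) auto
  let ?t = "last B"
  have s0: "star_on V E x [al] B ((a # ys) @ C2)" using w unfolding N_str_def C1 by - ((elim conjE, assumption)+)
  have s: "star_on V E x (a # (ys @ C2)) [al] B" using star_on_rotate[OF star_on_rotate[OF s0]] by simp
  have Na: "N a = {x, ?t}" and aV: "a \<in> V"
    using w s unfolding N_str_def C1 star_on_def by (auto simp del: last_append)
  have "\<And>b. b \<in> N a - {?t} \<Longrightarrow> E a b" using Na hd_nbr[OF s] by (auto simp del: last_append)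
  then obtain u V2 E2 N2 where "expand V E N a u {?t} V2 E2 N2" and c2: "config V2 E2 N2"
    using expansion_exists[OF c aV, of "{?t}"] Na by (auto simp del: last_append)
  then interpret expand V E N a u "{?t}" V2 E2 N2 by blast
  have "N_str V2 E2 N2 x al B ([] @ u # a # ys) C2" by (rule N_part_C1_str[OF w]) (simp add: C1)
  moreover have "length ([] @ u # a # ys) = Suc (Suc n)" using l C1 by simp
  ultimately show ?thesis unfolding N_exists_def using c2 l by blast
qed

lemma N_exists_Suc_C2:
  assumes "N_exists m n (Suc k)" shows "N_exists m n (Suc (Suc k))"
proof -
  obtain V E N x al B C1 C2 where c: "config V E N" and w: "N_str V E N x al B C1 C2"
    and l: "length B = Suc m" "length C1 = Suc n" "length C2 = Suc k" using assms unfolding N_exists_def by blast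
  obtain a ys where C2: "C2 = a # ys" using l(3) by (cases C2) auto
  have s0: "star_on V E x [al] B (C1 @ a # ys)" and ch: "chainN N (last C1) (a # ys) al" and ne: "C1 \<noteq> []"
    using w unfolding N_str_def C2 by - ((elim conjE, assumption)+)
  have s: "star_on V E x (C1 @ a # ys) [al] B" by (rule star_on_rotate[OF star_on_rotate[OF s0]])
  have Na: "N a = {last C1, al}" and aV: "a \<in> V" and pV: "last C1 \<in> V" using ch s ne by (simp_all add: star_on_def)
  have "E a (last C1)" using star_on_nbr[OF s pV] ne by simp
  then have "\<And>b. b \<in> N a - {al} \<Longrightarrow> E a b" using Na by auto
  then obtain u V2 E2 N2 where "expand V E N a u {al} V2 E2 N2" and c2: "config V2 E2 N2"
    using expansion_exists[OF c aV, of "{al}"] Na by auto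
  then interpret expand V E N a u "{al}" V2 E2 N2 by blast
  have "N_str V2 E2 N2 x al B C1 ([] @ u # a # ys)" by (rule N_part_C2_str[OF w]) (simp add: C2)
  moreover have "length ([] @ u # a # ys) = Suc (Suc k)" using l C2 by simp
  ultimately show ?thesis unfolding N_exists_def using c2 l by blast
qed

lemma N_exists_all: "N_exists m n k"
proof -
  have "N_exists 0 0 (Suc j)" for j by (induction j) (use N_exists_1 N_exists_Suc_C2 in auto)
  then have "N_exists 0 0 k" using N_exists_0 by (cases k) auto
  then have "N_exists 0 n k" by (induction n) (use N_exists_Suc_C1 in auto)
  then show ?thesis by (induction m) (use N_exists_Suc_B in auto)
qed

definition M_exists where "M_exists m n k \<longleftrightarrow> (\<exists>V E N x al be C0 C1 C2. config V E N \<and> M_str V E N x al be C0 C1 C2 \<and>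
    length C0 = Suc m \<and> length C1 = n \<and> length C2 = k)"

text \<open>Configurations of type M with one-vertex \<open>C0\<close> come from an expansion at the
  centre: of type W if \<open>C1\<close> is empty, of type N otherwise.\<close>

lemma M_exists_0_0: "M_exists 0 0 (Suc k)"
proof -
  obtain V E N x A B C where c: "config V E N" and w: "W_str V E N x A B C"
    and l: "length A = Suc 0" "length B = Suc 0" "length C = Suc k" using W_exists_all[of 0 0 k] unfolding W_exists_def by blast
  obtain a where A: "A = [a]" using l(1) by (auto simp: length_Suc_conv)
  obtain b where B: "B = [b]" using l(2) by (auto simp: length_Suc_conv)
  have s: "star_on V E x [a] [b] C" and Nx: "N x = {a, b, last C}" and xV: "x \<in> V"
    using w unfolding W_str_def A B star_on_def by auto
  have "(\<forall>z w. E z w \<longrightarrow> E w z)" using c unfolding config_def by blast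
  then have "E x a" "E x b" using hd_nbr[OF s] hd_nbr[OF star_on_rotate[OF s]] by blast+
  then have "\<And>b. b \<in> N x - {last C} \<Longrightarrow> E x b" using Nx by auto
  then obtain u V2 E2 N2 where "expand V E N x u {last C} V2 E2 N2" and c2: "config V2 E2 N2"
    using expansion_exists[OF c xV, of "{last C}"] Nx by auto
  then interpret expand V E N x u "{last C}" V2 E2 N2 by blast
  have "M_str V2 E2 N2 u (last A) (last B) [x] [] C" by (rule W_centre_str[OF w]) simp
  then show ?thesis unfolding M_exists_def using c2 l(3) by fastforce
qed

lemma M_exists_0_Suc: "M_exists 0 (Suc n) k"
proof -
  obtain V E N x al B C1 C2 where c: "config V E N" and w: "N_str V E N x al B C1 C2"
    and l: "length B = Suc 0" "length C1 = Suc n" "length C2 = k" using N_exists_all[of 0 n k] unfolding N_exists_def by blast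
  obtain b where B: "B = [b]" using l(1) by (auto simp: length_Suc_conv)
  let ?t = "last (C1 @ C2)"
  have s: "star_on V E x [al] [b] (C1 @ C2)" and Nx: "N x = {al, b, ?t}" and xV: "x \<in> V"
    using w unfolding N_str_def B star_on_def by (auto simp del: last_append)
  have "(\<forall>z w. E z w \<longrightarrow> E w z)" using c unfolding config_def by blast
  then have "E x al" "E x b" using hd_nbr[OF s] hd_nbr[OF star_on_rotate[OF s]] by blast+
  then have "\<And>b. b \<in> N x - {?t} \<Longrightarrow> E x b" using Nx by (auto simp del: last_append)
  then obtain u V2 E2 N2 where "expand V E N x u {?t} V2 E2 N2" and c2: "config V2 E2 N2"
    using expansion_exists[OF c xV, of "{?t}"] Nx by (auto simp del: last_append)
  then interpret expand V E N x u "{?t}" V2 E2 N2 by blast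
  have "M_str V2 E2 N2 u al (last B) [x] C1 C2" by (rule N_centre_str[OF w]) simp
  then show ?thesis unfolding M_exists_def using c2 l(2,3) by fastforce
qed

lemma M_exists_Suc:
  assumes "M_exists m n k" shows "M_exists (Suc m) n k"
proof -
  obtain V E N x al be C0 C1 C2 where c: "config V E N" and w: "M_str V E N x al be C0 C1 C2"
    and l: "length C0 = Suc m" "length C1 = n" "length C2 = k" using assms unfolding M_exists_def by blast
  obtain a ys where C0: "C0 = a # ys" using l(1) by (cases C0) auto
  let ?t = "last (C1 @ C2)"
  have s0: "star_on V E x [al] [be] ((a # ys) @ C1 @ C2)" and ne: "C1 @ C2 \<noteq> []"
    using w unfolding M_str_def C0 by - ((elim conjE, assumption)+)
  have s: "star_on V E x (a # (ys @ C1 @ C2)) [al] [be]" using star_on_rotate[OF star_on_rotate[OF s0]] by simp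
  have Na: "N a = {x, ?t}" and aV: "a \<in> V"
    using w s unfolding M_str_def C0 star_on_def by (auto simp del: last_append)
  have tx: "?t \<noteq> x" using s last_in_set[OF ne] unfolding star_on_def by (auto simp del: last_append)
  have "\<And>b. b \<in> N a - {?t} \<Longrightarrow> E a b" using Na hd_nbr[OF s] by (auto simp del: last_append)
  then obtain u V2 E2 N2 where "expand V E N a u {?t} V2 E2 N2" and c2: "config V2 E2 N2"
    using expansion_exists[OF c aV, of "{?t}"] Na by (auto simp del: last_append)
  then interpret expand V E N a u "{?t}" V2 E2 N2 by blast
  have "M_str V2 E2 N2 x al be ([] @ u # a # ys) C1 C2"
    by (rule M_part_C0_str[OF w]) (use tx C0 in \<open>simp_all del: last_append\<close>)
  moreover have "length ([] @ u # a # ys) = Suc (Suc m)" using l C0 by simp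
  ultimately show ?thesis unfolding M_exists_def using c2 l by blast
qed

lemma M_exists_all:
  assumes "(n, k) \<noteq> (0, 0)" shows "M_exists m n k"
proof -
  have "M_exists 0 n k" using assms M_exists_0_0 M_exists_0_Suc by (cases n; cases k) auto
  then show ?thesis by (induction m) (use M_exists_Suc in auto)
qed

lemma WNM_config:
  assumes "F \<in> W_set \<union> N_set \<union> M_set"
  shows "\<exists>V E N. config V E N \<and> ptree_at F V E (decN V N)"
  using assms
proof (elim UnE)
  assume "F \<in> W_set"
  then obtain p q r where F: "F = Gamma p q r" unfolding W_set_def by blast
  obtain V E N x A B C where c: "config V E N" and w: "W_str V E N x A B C"
    and l: "length A = Suc q" "length B = Suc r" "length C = Suc p" using W_exists_all[of q r p] unfolding W_exists_def by blast
  show ?thesis using W_ptree_at[OF c w] c F l by auto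
next
  assume "F \<in> N_set"
  then obtain p q r where F: "F = Delta p q r" unfolding N_set_def by blast
  obtain V E N x al B C1 C2 where c: "config V E N" and w: "N_str V E N x al B C1 C2"
    and l: "length B = Suc r" "length C1 = Suc q" "length C2 = p" using N_exists_all[of r q p] unfolding N_exists_def by blast
  show ?thesis using N_ptree_at[OF c w] c F l by auto
next
  assume "F \<in> M_set"
  then obtain p q r where F: "F = Lambda p q r" and ne: "(r, p) \<noteq> (0, 0)" unfolding M_set_def by blast
  obtain V E N x al be C0 C1 C2 where c: "config V E N" and w: "M_str V E N x al be C0 C1 C2"
    and l: "length C0 = Suc q" "length C1 = r" "length C2 = p" using M_exists_all[OF ne, of q] unfolding M_exists_def by blast
  show ?thesis using M_ptree_at[OF c w] c F l by auto
qed

section \<open>From configurations to symplectic embeddings\<close>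

lemma symplectic_embedding_iff:
  "symplectic_embedding T \<phi> \<longleftrightarrow>
     (\<forall>u<nv T. \<forall>v<nv T. u \<noteq> v \<longrightarrow> ip {..<nv T} (\<phi> u) (\<phi> v) = - of_bool (adj T u v)) \<and>
     (\<forall>v<nv T. ip {..<nv T} (\<phi> v) (\<phi> v) = - dec T v) \<and>
     (\<forall>v<nv T. (\<Sum>k<nv T. \<phi> v k * (\<phi> v k + 1)) = 2)"
proof -
  have row: "Qn (nv T) x Kn + Qn (nv T) x x = -2 \<longleftrightarrow> (\<Sum>k<nv T. x k * (x k + 1)) = 2" for x
    by (auto simp: Qn_def Kn_def sum.distrib distrib_left)
  have Q: "Qn (nv T) x y = - ip {..<nv T} x y" for x y by (simp add: Qn_def ip_def)
  have "(- ip {..<nv T} (\<phi> u) (\<phi> v) = (if adj T u v then 1 else 0)) = (ip {..<nv T} (\<phi> u) (\<phi> v) = - of_bool (adj T u v))"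
    "(- ip {..<nv T} (\<phi> v) (\<phi> v) = dec T v) = (ip {..<nv T} (\<phi> v) (\<phi> v) = - dec T v)" for u v by auto
  then show ?thesis unfolding symplectic_embedding_def row unfolding Q by simp
qed

lemma symplectic_embedding_iso:
  assumes "symplectic_embedding F \<phi>" "ptree_iso F T" shows "\<exists>\<psi>. symplectic_embedding T \<psi>"
proof -
  obtain f where n: "nv F = nv T" and f: "bij_betw f {..<nv T} {..<nv T}"
    and a: "\<And>i j. i < nv T \<Longrightarrow> j < nv T \<Longrightarrow> adj T (f i) (f j) = adj F i j"
    and d: "\<And>i. i < nv T \<Longrightarrow> dec T (f i) = dec F i"
    using assms(2) unfolding ptree_iso_def by auto
  define g where "g = the_inv_into {..<nv T} f"
  have g: "g i < nv T" "f (g i) = i" if "i < nv T" for i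
    using that bij_betw_the_inv_into[OF f] f_the_inv_into_f_bij_betw[OF f] unfolding g_def
    by (auto dest: bij_betwE)
  have "adj T u v = adj F (g u) (g v)" "dec T u = dec F (g u)" "u \<noteq> v \<Longrightarrow> g u \<noteq> g v" if "u < nv T" "v < nv T" for u v
    using a[of "g u" "g v"] d[of "g u"] g[OF that(1)] g[OF that(2)] by auto
  then have "symplectic_embedding T (\<lambda>i. \<phi> (g i))"
    using assms(1) g unfolding symplectic_embedding_iff n by (auto; metis)
  then show ?thesis by blast
qed

lemma config_embedding:
  assumes c: "config V E N" and F: "ptree_at F V E (decN V N)"
  shows "\<exists>\<phi>. symplectic_embedding F \<phi>"
proof -
  obtain f where f: "bij_betw f {..<nv F} V"
    and a: "\<And>i j. i < nv F \<Longrightarrow> j < nv F \<Longrightarrow> E (f i) (f j) = adj F i j"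
    and d: "\<And>i. i < nv F \<Longrightarrow> decN V N (f i) = dec F i"
    using F unfolding ptree_at_def by blast
  have fin: "finite V" and pair: "\<And>z w. z \<in> V \<Longrightarrow> w \<in> V \<Longrightarrow> z \<noteq> w \<Longrightarrow> ip V (cc N z) (cc N w) = - of_bool (E z w)"
    using c unfolding config_def by blast+
  have fV: "f i \<in> V" if "i < nv F" for i using that f by (auto dest: bij_betwE)
  have inj: "f i \<noteq> f j" if "i < nv F" "j < nv F" "i \<noteq> j" for i j
    using that f unfolding bij_betw_def by (auto dest: inj_onD)
  define \<phi> where "\<phi> i k = cc N (f i) (f k)" for i k
  have ip: "ip {..<nv F} (\<phi> i) (\<phi> j) = ip V (cc N (f i)) (cc N (f j))" for i j
    unfolding ip_def \<phi>_def by (rule sum.reindex_bij_betw[OF f])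
  have row: "(\<Sum>k<nv F. \<phi> i k * (\<phi> i k + 1)) = (\<Sum>k\<in>V. cc N (f i) k * (cc N (f i) k + 1))" for i
    unfolding \<phi>_def by (rule sum.reindex_bij_betw[OF f])
  have "symplectic_embedding F \<phi>"
    unfolding symplectic_embedding_iff ip row
  proof (intro conjI allI impI)
    show "ip V (cc N (f u)) (cc N (f v)) = - of_bool (adj F u v)" if "u < nv F" "v < nv F" "u \<noteq> v" for u v
      using pair[OF fV[OF that(1)] fV[OF that(2)] inj[OF that]] a that by simp
    show "ip V (cc N (f v)) (cc N (f v)) = - dec F v" if "v < nv F" for v using d[OF that] by simp
    show "(\<Sum>k\<in>V. cc N (f v) k * (cc N (f v) k + 1)) = 2" if "v < nv F" for v by (rule cc_row[OF fin fV[OF that]])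
  qed
  then show ?thesis by blast
qed

text \<open>Along the blow-ups the \<open>(-1)\<close>-vertex \<open>u\<close> is \<open>E\<^sub>c\<close>, and the final change of its decoration
  subtracts \<open>\<Sum>k\<in>F. E\<^sub>k\<close>, which is orthogonal to all vertices.\<close>
definition abc_lattice :: "ptree \<Rightarrow> nat \<Rightarrow> int \<Rightarrow> (nat \<Rightarrow> nat \<Rightarrow> int) \<Rightarrow> nat set \<Rightarrow> nat \<Rightarrow> bool" where
  "abc_lattice T u r \<psi> F c \<longleftrightarrow> c < nv T \<and> F \<subseteq> {..<nv T} - {c} \<and> 1 + int (card F) = - r \<and>
     (\<forall>k<nv T. \<psi> u k = of_bool (k = c)) \<and> (\<forall>v<nv T. v \<noteq> u \<longrightarrow> (\<Sum>k\<in>F. \<psi> v k) = 0) \<and>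
     (\<forall>v<nv T. \<forall>w<nv T. v \<noteq> w \<longrightarrow> ip {..<nv T} (\<psi> v) (\<psi> w) = - of_bool (adj T v w)) \<and>
     (\<forall>v<nv T. ip {..<nv T} (\<psi> v) (\<psi> v) = - dec T v) \<and>
     (\<forall>v<nv T. (\<Sum>k<nv T. \<psi> v k * (\<psi> v k + 1)) = 2)"

lemma all_less_4: "(\<forall>v<0 + Suc 0 + Suc 0 + Suc 0 + Suc 0. P v) \<longleftrightarrow> P 0 \<and> P (Suc 0) \<and> P (Suc (Suc 0)) \<and> P (Suc (Suc (Suc 0)))"
  by (auto simp: less_Suc_eq)

lemma ip_4: "ip {..<0 + Suc 0 + Suc 0 + Suc 0 + Suc 0} x y =
    x 0 * y 0 + x (Suc 0) * y (Suc 0) + x (Suc (Suc 0)) * y (Suc (Suc 0)) + x (Suc (Suc (Suc 0))) * y (Suc (Suc (Suc 0)))"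
  by (simp add: ip_def)

text \<open>The matrices are those found in the classification: a cycle of three roots for
  \<open>T_a\<close>, a pair of opposite roots for \<open>T_b\<close>, a row with entry
  \<open>-2\<close> for \<open>T_c\<close>, each with \<open>-1\<close> in the columns forced there.
  The sets \<open>{1, 2, 3}\<close>, \<open>{1, 2}\<close>, \<open>{3}\<close> are the supports of
  f.\<close>

lemma abc_lattice_base:
  assumes "(T0, r) \<in> base_trees" shows "\<exists>\<psi> F c. abc_lattice T0 0 r \<psi> F c"
proof -
  have a: "abc_lattice T_a 0 (-4) (\<lambda>v k. [[1, 0, 0, 0], [-1, 1, -1, 0], [-1, 0, 1, -1], [-1, -1, 0, 1]] ! v ! k) {1, 2, 3} 0"
    unfolding abc_lattice_def T_a_def star3_single mk_tree_def by (simp only: all_less_4 ip_4 list.size ptree.simps) simp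
  have b: "abc_lattice T_b 0 (-3) (\<lambda>v k. [[1, 0, 0, 0], [-1, 1, -1, -1], [-1, -1, 1, -1], [-1, 0, 0, 1]] ! v ! k) {1, 2} 0"
    unfolding abc_lattice_def T_b_def star3_single mk_tree_def by (simp only: all_less_4 ip_4 list.size ptree.simps) simp
  have c: "abc_lattice T_c 0 (-2) (\<lambda>v k. [[1, 0, 0, 0], [-1, 1, 0, 0], [-1, -1, -2, 0], [-1, -1, 1, 0]] ! v ! k) {3} 0"
    unfolding abc_lattice_def T_c_def star3_single mk_tree_def by (simp only: all_less_4 ip_4 list.size ptree.simps) simp
  show ?thesis using assms a b c unfolding base_trees_def by blast
qed

text \<open>\<open>A\<close> is \<open>{u}\<close> or the pair of ends of the blown-up edge. The new
  basis vector is the new \<open>(-1)\<close>-vertex; subtracting it from the members of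
  \<open>A\<close> raises their mutual product by \<open>1\<close> and thus removes their
  edge.\<close>

lemma abc_lattice_step:
  fixes T u r
  assumes L: "abc_lattice T u r \<psi> F c" and inv: "reach_inv T u" and A: "u \<in> A" "A \<subseteq> {..<nv T}"
    and T': "nv T' = Suc (nv T)"
    and adj: "\<forall>v<nv T. \<forall>w<nv T. v \<noteq> w \<longrightarrow> adj T' v w = (adj T v w \<and> \<not> (v \<in> A \<and> w \<in> A))"
      "\<forall>v<nv T. adj T' v (nv T) = (v \<in> A) \<and> adj T' (nv T) v = (v \<in> A)"
    and AA: "\<forall>v\<in>A. \<forall>w\<in>A. v \<noteq> w \<longrightarrow> adj T v w"
    and dec: "\<forall>v<nv T. dec T' v = dec T v - of_bool (v \<in> A)" "dec T' (nv T) = -1"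
  shows "\<exists>\<psi> c. abc_lattice T' (nv T) r \<psi> F c"
proof -
  let ?n = "nv T"
  define \<psi>' where "\<psi>' v = (if v = ?n then (\<lambda>k. of_bool (k = ?n)) else (\<psi> v)(?n := - of_bool (v \<in> A)))" for v
  have c: "c < ?n" and F: "F \<subseteq> {..<?n} - {c}" and r: "1 + int (card F) = - r" and \<psi>u: "\<forall>k<?n. \<psi> u k = of_bool (k = c)"
    and orth: "\<forall>v<?n. v \<noteq> u \<longrightarrow> (\<Sum>k\<in>F. \<psi> v k) = 0"
    and pair: "\<forall>v<?n. \<forall>w<?n. v \<noteq> w \<longrightarrow> ip {..<?n} (\<psi> v) (\<psi> w) = - of_bool (adj T v w)"
    and norm: "\<forall>v<?n. ip {..<?n} (\<psi> v) (\<psi> v) = - dec T v" and row: "\<forall>v<?n. (\<Sum>k<?n. \<psi> v k * (\<psi> v k + 1)) = 2"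
    using L unfolding abc_lattice_def by - ((elim conjE, assumption)+)
  have old: "\<psi>' v k = \<psi> v k" if "v < ?n" "k < ?n" for v k using that unfolding \<psi>'_def by auto
  have new: "\<psi>' v ?n = - of_bool (v \<in> A)" if "v < ?n" for v using that unfolding \<psi>'_def by auto
  have top: "\<psi>' ?n k = of_bool (k = ?n)" for k unfolding \<psi>'_def by auto
  have ipn: "ip {..<Suc ?n} (\<psi>' v) (\<psi>' w) = ip {..<?n} (\<psi> v) (\<psi> w) + of_bool (v \<in> A \<and> w \<in> A)"
    if "v < ?n" "w < ?n" for v w
    using that by (simp add: ip_def old new)
  have ipt: "ip {..<Suc ?n} (\<psi>' ?n) (\<psi>' w) = - of_bool (w \<in> A)" "ip {..<Suc ?n} (\<psi>' w) (\<psi>' ?n) = - of_bool (w \<in> A)"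
    if "w < ?n" for w
    using that by (simp_all add: ip_def top new)
  \<comment> \<open>The former \<open>(-1)\<close>-vertex is \<open>E_c\<close> with
    \<open>c\<close> outside \<open>F\<close>, so it joins the vertices orthogonal to the sum over
    \<open>F\<close>.\<close>
  have orth': "(\<Sum>k\<in>F. \<psi> v k) = 0" if "v < ?n" for v
  proof (cases "v = u")
    case True
    have "(\<Sum>k\<in>F. \<psi> u k) = (\<Sum>k\<in>F. 0)" using F \<psi>u by (intro sum.cong) auto
    then show ?thesis using True by simp
  qed (use orth that in blast)
  have "abc_lattice T' ?n r \<psi>' F ?n"
    unfolding abc_lattice_def T'
  proof (intro conjI allI impI)
    show "F \<subseteq> {..<Suc ?n} - {?n}" using F by auto
    show "(\<Sum>k\<in>F. \<psi>' v k) = 0" if "v < Suc ?n" "v \<noteq> ?n" for v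
    proof -
      have v: "v < ?n" using that by simp
      have "(\<Sum>k\<in>F. \<psi>' v k) = (\<Sum>k\<in>F. \<psi> v k)" using F old[OF v] by (intro sum.cong) auto
      then show ?thesis using orth'[OF v] by simp
    qed
    show "ip {..<Suc ?n} (\<psi>' v) (\<psi>' w) = - of_bool (adj T' v w)" if "v < Suc ?n" "w < Suc ?n" "v \<noteq> w" for v w
    proof -
      note vw = that
      consider "v = ?n" "w < ?n" | "w = ?n" "v < ?n" | "v < ?n" "w < ?n" using vw by linarith
      then show ?thesis
      proof cases
        case 3
        then show ?thesis using ipn[OF 3] pair adj(1) AA vw(3) by auto
      qed (use ipt adj(2) in auto)
    qed
    show "ip {..<Suc ?n} (\<psi>' v) (\<psi>' v) = - dec T' v" if "v < Suc ?n" for v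
    proof (cases "v = ?n")
      case True
      then show ?thesis using dec(2) by (simp add: ip_def top)
    next
      case False
      then have v: "v < ?n" using that by simp
      then show ?thesis using ipn[OF v v] norm dec(1) by simp
    qed
    show "(\<Sum>k<Suc ?n. \<psi>' v k * (\<psi>' v k + 1)) = 2" if "v < Suc ?n" for v
    proof (cases "v = ?n")
      case True
      then show ?thesis by (simp add: top)
    next
      case False
      then have v: "v < ?n" using that by simp
      have "(\<Sum>k<Suc ?n. \<psi>' v k * (\<psi>' v k + 1)) = (\<Sum>k<?n. \<psi> v k * (\<psi> v k + 1))"
        using v by (simp add: old new)
      then show ?thesis using row v by simp
    qed
  qed (use r top in auto)
  then show ?thesis by blast
qed

lemma abc_lattice_reach:
  assumes "(T0, r) \<in> base_trees" "blowup_reach T0 0 T u"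
  shows "\<exists>\<psi> F c. abc_lattice T u r \<psi> F c"
  using assms(2)
proof induction
  case refl
  then show ?case by (rule abc_lattice_base[OF assms(1)])
next
  case (vert T u)
  then obtain \<psi> F c where L: "abc_lattice T u r \<psi> F c" by blast
  have inv: "reach_inv T u" by (rule reach_inv[OF assms(1) vert(1)])
  have "\<exists>\<psi> c. abc_lattice (blowup_vertex T u) (nv T) r \<psi> F c"
    by (rule abc_lattice_step[OF L inv, of "{u}"]) (use inv in \<open>auto simp: blowup_vertex_def reach_inv_def\<close>)
  then show ?case by blast
next
  case (edge T u w)
  then obtain \<psi> F c where L: "abc_lattice T u r \<psi> F c" by blast
  have inv: "reach_inv T u" by (rule reach_inv[OF assms(1) edge(1)])
  have uw: "u < nv T" "u \<noteq> w" "adj T w u" using inv edge(3) unfolding reach_inv_def by blast+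
  have "\<exists>\<psi> c. abc_lattice (blowup_edge T u w) (nv T) r \<psi> F c"
    by (rule abc_lattice_step[OF L inv, of "{u, w}"]) (use inv uw edge in \<open>auto simp: blowup_edge_def reach_inv_def\<close>)
  then show ?case by blast
qed

lemma abc_embedding:
  assumes "(T0, r) \<in> base_trees" "blowup_reach T0 0 T u"
  shows "\<exists>\<phi>. symplectic_embedding (set_dec T u r) \<phi>"
proof -
  let ?n = "nv T"
  obtain \<psi> F c where L: "abc_lattice T u r \<psi> F c" using abc_lattice_reach[OF assms] by blast
  have inv: "reach_inv T u" by (rule reach_inv[OF assms])
  have c: "c < ?n" and F: "F \<subseteq> {..<?n} - {c}" and r: "1 + int (card F) = - r" and \<psi>u: "\<forall>k<?n. \<psi> u k = of_bool (k = c)"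
    and orth: "\<forall>v<?n. v \<noteq> u \<longrightarrow> (\<Sum>k\<in>F. \<psi> v k) = 0"
    and pair: "\<forall>v<?n. \<forall>w<?n. v \<noteq> w \<longrightarrow> ip {..<?n} (\<psi> v) (\<psi> w) = - of_bool (adj T v w)"
    and norm: "\<forall>v<?n. ip {..<?n} (\<psi> v) (\<psi> v) = - dec T v" and row: "\<forall>v<?n. (\<Sum>k<?n. \<psi> v k * (\<psi> v k + 1)) = 2"
    using L unfolding abc_lattice_def by - ((elim conjE, assumption)+)
  have u: "u < ?n" using inv unfolding reach_inv_def by blast
  define y where "y k = (of_bool (k = c) - of_bool (k \<in> F) :: int)" for k
  have cF: "c \<notin> F" and finF: "finite F" using F finite_subset[of F "{..<?n}"] by auto
  have ipy: "(\<Sum>k<?n. y k * g k) = g c - (\<Sum>k\<in>F. g k)" for g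
  proof -
    have "(\<Sum>k<?n. y k * g k) = (\<Sum>k<?n. of_bool (k = c) * g k) - (\<Sum>k<?n. of_bool (k \<in> F) * g k)"
      by (simp add: y_def left_diff_distrib sum_subtractf)
    also have "(\<Sum>k<?n. of_bool (k \<in> F) * g k) = (\<Sum>k\<in>F. g k)"
      by (rule sum.mono_neutral_cong_right) (use F in auto)
    also have "(\<Sum>k<?n. of_bool (k = c) * g k) = (\<Sum>k\<in>{c}. g k)"
      by (rule sum.mono_neutral_cong_right) (use c in auto)
    finally show ?thesis by simp
  qed
  have ip: "ip {..<?n} y (\<psi> v) = - of_bool (adj T u v)" if "v < ?n" "v \<noteq> u" for v
  proof -
    have "ip {..<?n} (\<psi> u) (\<psi> v) = (\<Sum>k<?n. of_bool (k = c) * \<psi> v k)" unfolding ip_def using \<psi>u by (intro sum.cong) auto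
    also have "\<dots> = (\<Sum>k\<in>{c}. \<psi> v k)" by (rule sum.mono_neutral_cong_right) (use c in auto)
    finally have "\<psi> v c = - of_bool (adj T u v)" using pair u that by simp
    then show ?thesis using ipy[of "\<psi> v"] orth that by (simp add: ip_def)
  qed
  have yF: "(\<Sum>k\<in>F. y k) = - int (card F)" "y c = 1"
  proof -
    have "(\<Sum>k\<in>F. y k) = (\<Sum>k\<in>F. -1)" using cF by (intro sum.cong) (auto simp: y_def)
    then show "(\<Sum>k\<in>F. y k) = - int (card F)" by simp
    show "y c = 1" using cF by (simp add: y_def)
  qed
  have "symplectic_embedding (set_dec T u r) (\<psi>(u := y))"
    unfolding symplectic_embedding_iff
  proof (intro conjI allI impI)
    fix v w assume vw: "v < nv (set_dec T u r)" "w < nv (set_dec T u r)" "v \<noteq> w"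
    have sym: "adj T v u = adj T u v" using inv unfolding reach_inv_def by blast
    have "ip {..<?n} ((\<psi>(u := y)) v) ((\<psi>(u := y)) w) = - of_bool (adj T v w)"
      using vw pair ip[of w] ip[of v] sym by (auto simp: set_dec_def ip_def mult.commute)
    then show "ip {..<nv (set_dec T u r)} ((\<psi>(u := y)) v) ((\<psi>(u := y)) w) = - of_bool (adj (set_dec T u r) v w)"
      by (simp add: set_dec_def)
  next
    fix v assume v: "v < nv (set_dec T u r)"
    have "ip {..<?n} y y = - r" using ipy[of y] yF r by (simp add: ip_def)
    then show "ip {..<nv (set_dec T u r)} ((\<psi>(u := y)) v) ((\<psi>(u := y)) v) = - dec (set_dec T u r) v"
      using v norm by (auto simp: set_dec_def)
    have "(\<Sum>k<?n. y k * (y k + 1)) = 2"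
      using ipy[of "\<lambda>k. y k + 1"] yF by (simp add: sum.distrib)
    then show "(\<Sum>k<nv (set_dec T u r). (\<psi>(u := y)) v k * ((\<psi>(u := y)) v k + 1)) = 2"
      using v row by (auto simp: set_dec_def)
  qed
  then show ?thesis by blast
qed

lemma ABC_embedding:
  assumes "F \<in> A_set \<union> B_set \<union> C_set"
  shows "(\<exists>\<phi>. symplectic_embedding F \<phi>) \<and> minimal F"
proof -
  obtain T0 r T u where T: "(T0, r) \<in> base_trees" "blowup_reach T0 0 T u" "F = set_dec T u r"
    using assms unfolding A_set_def B_set_def C_set_def base_trees_def by blast
  have inv: "\<And>i. i < nv T \<Longrightarrow> i \<noteq> u \<Longrightarrow> dec T i \<le> -2" using reach_inv[OF T(1,2)] unfolding reach_inv_def by blast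
  have r: "r \<noteq> -1" using T(1) by (auto simp: base_trees_def)
  have "minimal F" unfolding minimal_def
  proof (intro allI impI)
    fix v assume "v < nv F"
    then show "dec F v \<noteq> -1" using inv[of v] r unfolding T(3) set_dec_def by (cases "v = u") auto
  qed
  then show ?thesis using abc_embedding[OF T(1,2)] T(3) by blast
qed

section \<open>Continued fractions\<close>

fun cont :: "int list \<Rightarrow> int \<times> int \<Rightarrow> int \<times> int" where
  "cont [] v = v"
| "cont (a # as) v = (a * fst (cont as v) - snd (cont as v), fst (cont as v))"

lemma cont_append: "cont (as @ bs) v = cont as (cont bs v)"
  by (induction as) simp_all

text \<open>The columns of the product of the matrices \<open>[[a, -1], [1, 0]]\<close> over a list in the
  family, in terms of \<open>p\<close> and \<open>q\<close>.\<close>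
definition gmat :: "int list \<Rightarrow> int \<Rightarrow> int \<Rightarrow> bool" where
  "gmat as p q \<longleftrightarrow> (\<forall>x y. cont as (x, y) =
     (p\<^sup>2 * x - (p * (p - q) - 1) * y, (p * q - 1) * x - (q * (p - q) - 1) * y))"

lemma gmat_base: "gmat [4] 2 1" by (simp add: gmat_def)

text \<open>Raising the last entry by \<open>1\<close> amounts to replacing \<open>y\<close> by
  \<open>y - x\<close>.\<close>

lemma gmat_left:
  assumes "gmat (as @ [a]) p q" shows "gmat (2 # as @ [a + 1]) (2 * p - q) p"
  unfolding gmat_def
proof (intro allI)
  fix x y
  have "cont (as @ [a + 1]) (x, y) = cont (as @ [a]) (x, y - x)"
    by (simp add: cont_append algebra_simps)
  then show "cont (2 # as @ [a + 1]) (x, y) = ((2 * p - q)\<^sup>2 * x - ((2 * p - q) * (2 * p - q - p) - 1) * y,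
      ((2 * p - q) * p - 1) * x - (p * (2 * p - q - p) - 1) * y)"
    using assms by (simp add: gmat_def power2_eq_square algebra_simps)
qed

text \<open>Raising the first entry by \<open>1\<close> adds the second component to the first, and
  a trailing \<open>2\<close> replaces \<open>(x, y)\<close> by
  \<open>(2 * x - y, x)\<close>.\<close>

lemma gmat_right:
  assumes "gmat (a # as) p q" shows "gmat ((a + 1) # as @ [2]) (p + q) q"
  unfolding gmat_def
proof (intro allI)
  fix x y
  obtain m1 m2 where m: "cont (a # as) (2 * x - y, x) = (m1, m2)" by fastforce
  have "(m1, m2) = (p\<^sup>2 * (2 * x - y) - (p * (p - q) - 1) * x, (p * q - 1) * (2 * x - y) - (q * (p - q) - 1) * x)"
    using assms unfolding gmat_def m[symmetric] by blast
  then have mm: "m1 = p\<^sup>2 * (2 * x - y) - (p * (p - q) - 1) * x" "m2 = (p * q - 1) * (2 * x - y) - (q * (p - q) - 1) * x"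
    by blast+
  have "cont ((a + 1) # as @ [2]) (x, y) = (m1 + m2, m2)"
    using m by (auto simp: cont_append algebra_simps)
  then show "cont ((a + 1) # as @ [2]) (x, y) = ((p + q)\<^sup>2 * x - ((p + q) * (p + q - q) - 1) * y,
      ((p + q) * q - 1) * x - (q * (p + q - q) - 1) * y)"
    using mm by (simp add: power2_eq_square algebra_simps)
qed

text \<open>The inequalities keep the denominators positive; they are inherited because every entry
  is at least \<open>2\<close>.\<close>

lemma hj_cont:
  assumes "as \<noteq> []" "\<forall>a\<in>set as. a \<ge> 2"
  shows "0 < snd (cont as (1, 0)) \<and> snd (cont as (1, 0)) < fst (cont as (1, 0)) \<and>
    hj as = of_int (fst (cont as (1, 0))) / of_int (snd (cont as (1, 0)))"
  using assms
proof (induction as rule: hj.induct)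
  case (3 a b as)
  obtain x y where c: "cont (b # as) (1, 0) = (x, y)" by fastforce
  have c': "cont (a # b # as) (1, 0) = (a * x - y, x)" by (simp only: cont.simps(2)[of a] c fst_conv snd_conv)
  have IH: "0 < y" "y < x" "hj (b # as) = of_int x / of_int y" using "3.IH" "3.prems" c by auto
  have "a \<ge> 2" using "3.prems" by simp
  then have "2 * x \<le> a * x" using IH by (intro mult_right_mono) auto
  then have "x < a * x - y" using IH by linarith
  moreover have "hj (a # b # as) = of_int (a * x - y) / of_int x"
    using IH(1,2) unfolding hj.simps IH(3) by (simp add: field_simps)
  ultimately show ?case using IH unfolding c' by simp
qed auto

lemma hj_gt_1: "as \<noteq> [] \<Longrightarrow> \<forall>a\<in>set as. a \<ge> 2 \<Longrightarrow> hj as > 1"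
  using hj_cont[of as] by (auto simp: field_simps)

lemma hj_gmat:
  assumes "as \<noteq> []" "\<forall>a\<in>set as. a \<ge> 2" "gmat as p q"
  shows "hj as = of_int (p\<^sup>2) / of_int (p * q - 1)"
  using hj_cont[OF assms(1,2)] assms(3) by (simp add: gmat_def)

text \<open>The tail subtracts a number in \<open>[0, 1)\<close> from the first entry, which is
  therefore the ceiling of the value; the subtracted number is \<open>0\<close> exactly at the end
  of the list.\<close>

lemma hj_inj:
  assumes "as \<noteq> []" "bs \<noteq> []" "\<forall>a\<in>set as. a \<ge> 2" "\<forall>b\<in>set bs. b \<ge> 2" "hj as = hj bs"
  shows "as = bs"
  using assms
proof (induction as arbitrary: bs)
  case (Cons a as)
  obtain b cs where bs: "bs = b # cs" using Cons.prems(2) by (cases bs) auto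
  have form: "\<exists>e. hj (d # ds) = of_int d - e \<and> 0 \<le> e \<and> e < 1 \<and> (e = 0 \<longleftrightarrow> ds = []) \<and> (ds \<noteq> [] \<longrightarrow> e = 1 / hj ds)"
    if "\<forall>c\<in>set (d # ds). c \<ge> 2" for d ds
  proof (cases ds)
    case (Cons c r)
    then have "hj ds > 1" using hj_gt_1 that by auto
    then show ?thesis using Cons by (intro exI[of _ "1 / hj ds"]) auto
  qed auto
  obtain e where e: "hj (a # as) = of_int a - e" "0 \<le> e" "e < 1" "e = 0 \<longleftrightarrow> as = []" "as \<noteq> [] \<Longrightarrow> e = 1 / hj as"
    using form[OF Cons.prems(3)] by blast
  obtain e' where e': "hj (b # cs) = of_int b - e'" "0 \<le> e'" "e' < 1" "e' = 0 \<longleftrightarrow> cs = []" "cs \<noteq> [] \<Longrightarrow> e' = 1 / hj cs"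
    using form Cons.prems(4) bs by blast
  have eq: "of_int a - e = of_int b - e'" using Cons.prems(5) e(1) e'(1) bs by simp
  then have "of_int a < (of_int b + 1 :: rat)" "of_int b < (of_int a + 1 :: rat)" using e(2,3) e'(2,3) by linarith+
  then have "a < b + 1" "b < a + 1" by (metis of_int_less_iff of_int_add of_int_1)+
  then have ab: "a = b" by simp
  then have ee: "e = e'" using eq by simp
  show ?case
  proof (cases "as = []")
    case True
    then show ?thesis using ab bs e(4) e'(4) ee by simp
  next
    case False
    then have ne: "cs \<noteq> []" using e(4) e'(4) ee by simp
    then have "hj as = hj cs" using e(5) e'(5) False ee by (metis divide_divide_eq_right mult_1 div_by_1 divide_divide_eq_left' inverse_eq_divide inverse_inverse_eq)
    then show ?thesis using Cons.IH[OF False ne] Cons.prems(3,4) bs ab by simp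
  qed
qed simp

definition gpair :: "int \<Rightarrow> int \<Rightarrow> bool" where
  "gpair p q \<longleftrightarrow> p > q \<and> q > 0 \<and> coprime p q"

lemma gpair_left: "gpair p q \<longleftrightarrow> gpair (2 * p - q) p \<and> q > 0"
proof -
  have "gcd (2 * p - q) p = gcd p q" by (metis gcd.commute gcd_diff2 gcd_add_mult mult.commute gcd_neg2 uminus_add_conv_diff add.commute)
  then show ?thesis unfolding gpair_def coprime_iff_gcd_eq_1 by auto
qed

lemma gpair_right: "gpair p q \<longleftrightarrow> gpair (p + q) q \<and> p > q"
  unfolding gpair_def coprime_iff_gcd_eq_1 by auto

lemma Gl_gmat:
  assumes "Gl as" shows "as \<noteq> [] \<and> (\<forall>a\<in>set as. a \<ge> 2) \<and> (\<exists>p q. gpair p q \<and> gmat as p q)"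
  using assms
proof induction
  case Gl_base
  have "gpair 2 1" by (simp add: gpair_def)
  then show ?case using gmat_base by auto
next
  case (Gl_left as a)
  then obtain p q where pq: "gpair p q" "gmat (as @ [a]) p q" by blast
  have "gpair (2 * p - q) p" using pq(1) gpair_left[of p q] by blast
  then show ?case using Gl_left.IH gmat_left[OF pq(2)] by auto
next
  case (Gl_right a as)
  then obtain p q where pq: "gpair p q" "gmat (a # as) p q" by blast
  have "gpair (p + q) q" using pq(1) gpair_right[of p q] by blast
  then show ?case using Gl_right.IH gmat_right[OF pq(2)] by auto
qed

text \<open>Subtractive Euclidean algorithm: \<open>(p, q)\<close> arises from
  \<open>(p - q, q)\<close> if \<open>2 * q < p\<close> and from \<open>(q, 2 * q - p)\<close> if
  \<open>2 * q > p\<close>; in the case of equality coprimality leaves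
  \<open>(2, 1)\<close>.\<close>

lemma Gl_exists:
  assumes "gpair p q" shows "\<exists>as. Gl as \<and> gmat as p q"
  using assms
proof (induction "nat p" arbitrary: p q rule: less_induct)
  case less
  have pq: "p > q" "q > 0" "coprime p q" using less.prems by (auto simp: gpair_def)
  consider "2 * q = p" | "2 * q < p" | "2 * q > p" by linarith
  then show ?case
  proof cases
    case 1
    then have "coprime q q" using pq(3) by auto
    then have "q = 1" using pq(2) by simp
    then show ?thesis using 1 Gl_base gmat_base by auto
  next
    case 2
    have "gpair (p - q) q" using gpair_right[of "p - q" q] less.prems 2 by simp
    then obtain as where as: "Gl as" "gmat as (p - q) q" using less.hyps[of "p - q" q] pq by auto
    obtain a bs where "as = a # bs" using Gl_gmat[OF as(1)] by (cases as) auto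
    then show ?thesis using as Gl_right gmat_right[of a bs "p - q" q] by auto
  next
    case 3
    have "gpair q (2 * q - p)" using gpair_left[of q "2 * q - p"] less.prems 3 by simp
    then obtain as where as: "Gl as" "gmat as q (2 * q - p)" using less.hyps[of q "2 * q - p"] pq by auto
    obtain a bs where "as = bs @ [a]" using Gl_gmat[OF as(1)] by (cases as rule: rev_cases) auto
    then show ?thesis using as Gl_left gmat_left[of bs a q "2 * q - p"] by auto
  qed
qed

lemma G_set_iff: "F \<in> G_set \<longleftrightarrow> (\<exists>as. Gl as \<and> F = chain (map uminus as))"
proof
  assume "F \<in> G_set"
  then obtain p q as where F: "F = chain (map uminus as)" and pq: "gpair p q" and as: "as \<noteq> []" "\<forall>a\<in>set as. a \<ge> 2"
    "hj as = of_int (p^2) / of_int (p * q - 1)"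
    unfolding G_set_def gpair_def by blast
  obtain bs where bs: "Gl bs" "gmat bs p q" using Gl_exists[OF pq] by blast
  have b: "bs \<noteq> []" "\<forall>a\<in>set bs. a \<ge> 2" using Gl_gmat[OF bs(1)] by auto
  have "hj as = hj bs" using hj_gmat[OF b bs(2)] as(3) by simp
  then have "as = bs" by (rule hj_inj[OF as(1) b(1) as(2) b(2)])
  then show "\<exists>as. Gl as \<and> F = chain (map uminus as)" using bs(1) F by blast
next
  assume "\<exists>as. Gl as \<and> F = chain (map uminus as)"
  then obtain as where as: "Gl as" "F = chain (map uminus as)" by blast
  then obtain p q where pq: "gpair p q" "gmat as p q" and a: "as \<noteq> []" "\<forall>a\<in>set as. a \<ge> 2" using Gl_gmat by blast
  then show "F \<in> G_set" using hj_gmat[OF a pq(2)] as(2) unfolding G_set_def gpair_def by blast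
qed

section \<open>Embeddings of chains\<close>

lemma adj_chain: "adj (chain ds) i j \<longleftrightarrow> i < length ds \<and> j < length ds \<and> (j = Suc i \<or> i = Suc j)"
  unfolding chain_def mk_tree_def by auto

lemma nv_chain: "nv (chain ds) = length ds" and dec_chain: "dec (chain ds) i = ds ! i"
  by (simp_all add: chain_def mk_tree_def)

lemma chain_on_ptree_at:
  assumes "distinct L" "set L = V" "chain_on E L"
  shows "ptree_at (chain (map d L)) V E d"
  unfolding ptree_at_def nv_chain
proof (intro exI[of _ "(!) L"] conjI allI impI)
  show "bij_betw ((!) L) {..<length (map d L)} V" using assms bij_betw_nth[of L "{..<length L}" V] by simp
  show "E (L ! i) (L ! j) = adj (chain (map d L)) i j" if "i < length (map d L)" "j < length (map d L)" for i j
    using assms(3) that by (auto simp: chain_on_def adj_chain)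
qed (simp add: dec_chain)

text \<open>Column \<open>g\<close> has \<open>-1\<close> at both ends of the chain, and
  \<open>-2\<close> if the ends coincide: it is the column without entry \<open>1\<close> from which
  \<open>G_chain\<close> starts.\<close>

definition Gl_lattice :: "int list \<Rightarrow> (nat \<Rightarrow> nat \<Rightarrow> int) \<Rightarrow> nat \<Rightarrow> bool" where
  "Gl_lattice as \<psi> g \<longleftrightarrow> g < length as \<and>
     (\<forall>i<length as. \<psi> i g = - of_bool (i = 0) - of_bool (Suc i = length as)) \<and>
     (\<forall>i<length as. \<forall>j<length as. i \<noteq> j \<longrightarrow> ip {..<length as} (\<psi> i) (\<psi> j) = - of_bool (j = Suc i \<or> i = Suc j)) \<and>
     (\<forall>i<length as. ip {..<length as} (\<psi> i) (\<psi> i) = as ! i) \<and>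
     (\<forall>i<length as. (\<Sum>k<length as. \<psi> i k * (\<psi> i k + 1)) = 2)"

text \<open>Reversal exchanges the two rules of \<open>Gl\<close>, so only \<open>Gl_right\<close>
  has to be realised.\<close>

lemma Gl_lattice_rev:
  assumes "Gl_lattice as \<psi> g" shows "Gl_lattice (rev as) (\<lambda>i. \<psi> (length as - Suc i)) g"
proof -
  define n where "n = length as"
  have L: "g < n" "\<And>i. i < n \<Longrightarrow> \<psi> i g = - of_bool (i = 0) - of_bool (Suc i = n)"
    "\<And>i j. i < n \<Longrightarrow> j < n \<Longrightarrow> i \<noteq> j \<Longrightarrow> ip {..<n} (\<psi> i) (\<psi> j) = - of_bool (j = Suc i \<or> i = Suc j)"
    "\<And>i. i < n \<Longrightarrow> ip {..<n} (\<psi> i) (\<psi> i) = as ! i"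
    "\<And>i. i < n \<Longrightarrow> (\<Sum>k<n. \<psi> i k * (\<psi> i k + 1)) = 2"
    using assms unfolding Gl_lattice_def n_def by blast+
  show ?thesis
    unfolding Gl_lattice_def length_rev n_def[symmetric]
  proof (intro conjI allI impI)
    fix i assume i: "i < n"
    then have i': "n - Suc i < n" by simp
    have "(n - Suc i = 0) = (Suc i = n)" "(Suc (n - Suc i) = n) = (i = 0)" using i by auto
    then show "\<psi> (n - Suc i) g = - of_bool (i = 0) - of_bool (Suc i = n)" using L(2)[OF i'] by simp
    show "ip {..<n} (\<psi> (n - Suc i)) (\<psi> (n - Suc i)) = rev as ! i" using L(4)[OF i'] i by (simp add: rev_nth n_def)
    show "(\<Sum>k<n. \<psi> (n - Suc i) k * (\<psi> (n - Suc i) k + 1)) = 2" by (rule L(5)[OF i'])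
    fix j assume j: "j < n" "i \<noteq> j"
    have "(n - Suc j = Suc (n - Suc i) \<or> n - Suc i = Suc (n - Suc j)) = (j = Suc i \<or> i = Suc j)" using i j(1) by linarith
    then show "ip {..<n} (\<psi> (n - Suc i)) (\<psi> (n - Suc j)) = - of_bool (j = Suc i \<or> i = Suc j)"
      using L(3)[of "n - Suc i" "n - Suc j"] i j by simp
  qed (rule L(1))
qed

text \<open>The appended vertex is \<open>E_g - E_n\<close>. Column \<open>g\<close> would join it
  to both ends of the chain, and the extra \<open>- E_n\<close> in the first row cancels one of
  these contacts. Column \<open>n\<close> is the next distinguished column.\<close>

lemma Gl_lattice_right:
  assumes L: "Gl_lattice (a # as) \<psi> g" shows "\<exists>\<psi> g. Gl_lattice ((a + 1) # as @ [2]) \<psi> g"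
proof -
  define n where "n = length (a # as)"
  define \<psi>' where "\<psi>' i = (if i = n then (\<lambda>k. of_bool (k = g) - of_bool (k = n)) else (\<psi> i)(n := - of_bool (i = 0)))" for i
  have g: "g < n" and \<psi>g: "\<And>i. i < n \<Longrightarrow> \<psi> i g = - of_bool (i = 0) - of_bool (Suc i = n)"
    and pair: "\<And>i j. i < n \<Longrightarrow> j < n \<Longrightarrow> i \<noteq> j \<Longrightarrow> ip {..<n} (\<psi> i) (\<psi> j) = - of_bool (j = Suc i \<or> i = Suc j)"
    and norm: "\<And>i. i < n \<Longrightarrow> ip {..<n} (\<psi> i) (\<psi> i) = (a # as) ! i"
    and row: "\<And>i. i < n \<Longrightarrow> (\<Sum>k<n. \<psi> i k * (\<psi> i k + 1)) = 2"
    using L unfolding Gl_lattice_def n_def by blast+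
  have n0: "0 < n" by (simp add: n_def)
  have len: "length ((a + 1) # as @ [2]) = Suc n" by (simp add: n_def)
  have old: "\<psi>' i k = \<psi> i k" if "i < n" "k < n" for i k using that unfolding \<psi>'_def by auto
  have new: "\<psi>' i n = - of_bool (i = 0)" if "i < n" for i using that unfolding \<psi>'_def by auto
  have top: "\<psi>' n n = -1" "\<And>k. k < n \<Longrightarrow> \<psi>' n k = of_bool (k = g)" using g unfolding \<psi>'_def by auto
  have ipn: "ip {..<Suc n} (\<psi>' i) (\<psi>' j) = ip {..<n} (\<psi> i) (\<psi> j) + of_bool (i = 0 \<and> j = 0)" if "i < n" "j < n" for i j
    using that by (simp add: ip_def old new)
  have gsum: "(\<Sum>k<n. \<psi>' n k * h k) = h g" for h
  proof -
    have "(\<Sum>k<n. \<psi>' n k * h k) = (\<Sum>k\<in>{g}. h k)" by (rule sum.mono_neutral_cong_right) (use g top in auto)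
    then show ?thesis by simp
  qed
  have ipt: "ip {..<Suc n} (\<psi>' n) (\<psi>' j) = - of_bool (Suc j = n)" if "j < n" for j
    using gsum[of "\<psi>' j"] that by (simp add: ip_def top(1) new old[OF that g] \<psi>g)
  have "Gl_lattice ((a + 1) # as @ [2]) \<psi>' n"
    unfolding Gl_lattice_def len
  proof (intro conjI allI impI)
    show "\<psi>' i n = - of_bool (i = 0) - of_bool (Suc i = Suc n)" if "i < Suc n" for i
      using that n0 new[of i] top(1) less_Suc_eq[of i n] by force
    show "ip {..<Suc n} (\<psi>' i) (\<psi>' j) = - of_bool (j = Suc i \<or> i = Suc j)" if ij: "i < Suc n" "j < Suc n" "i \<noteq> j" for i j
    proof -
      consider "i = n" "j < n" | "j = n" "i < n" | "i < n" "j < n" using ij by linarith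
      then show ?thesis
      proof cases
        case 1
        then show ?thesis using ipt[of j] by auto
      next
        case 2
        then show ?thesis using ipt[of i] ip_commute[of _ "\<psi>' i"] by auto
      next
        case 3
        then show ?thesis using ipn[OF 3] pair[OF 3 ij(3)] ij(3) by auto
      qed
    qed
    show "ip {..<Suc n} (\<psi>' i) (\<psi>' i) = ((a + 1) # as @ [2]) ! i" if "i < Suc n" for i
    proof (cases "i = n")
      case True
      have "ip {..<Suc n} (\<psi>' n) (\<psi>' n) = 2" using gsum[of "\<psi>' n"] g by (simp add: ip_def top)
      then show ?thesis using True by (simp add: n_def nth_append)
    next
      case False
      then have i: "i < n" using that by simp
      then have "((a + 1) # as @ [2]) ! i = (a # as) ! i + of_bool (i = 0)"
        by (cases i) (auto simp: n_def nth_append)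
      then show ?thesis using ipn[OF i i] norm[OF i] by simp
    qed
    show "(\<Sum>k<Suc n. \<psi>' i k * (\<psi>' i k + 1)) = 2" if "i < Suc n" for i
    proof (cases "i = n")
      case True
      then show ?thesis using gsum[of "\<lambda>k. \<psi>' n k + 1"] g by (simp add: top)
    next
      case False
      then have i: "i < n" using that by simp
      have "(\<Sum>k<Suc n. \<psi>' i k * (\<psi>' i k + 1)) = (\<Sum>k<n. \<psi> i k * (\<psi> i k + 1))"
        using i by (cases "i = 0") (simp_all add: old new)
      then show ?thesis using row[OF i] by simp
    qed
  qed simp
  then show ?thesis by blast
qed

lemma Gl_lattice_exists: "Gl as \<Longrightarrow> \<exists>\<psi> g. Gl_lattice as \<psi> g"
proof (induction rule: Gl.induct)
  case Gl_base
  have "Gl_lattice [4] (\<lambda>_ _. -2) 0" by (simp add: Gl_lattice_def ip_def)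
  then show ?case by blast
next
  case (Gl_left as a)
  then obtain \<psi> g where "Gl_lattice (a # rev as) \<psi> g" using Gl_lattice_rev by fastforce
  then obtain \<psi> g where "Gl_lattice ((a + 1) # rev as @ [2]) \<psi> g" using Gl_lattice_right by blast
  then show ?case using Gl_lattice_rev by fastforce
next
  case (Gl_right a as)
  then show ?case using Gl_lattice_right by blast
qed

lemma G_embedding:
  assumes "F \<in> G_set" shows "(\<exists>\<phi>. symplectic_embedding F \<phi>) \<and> minimal F"
proof -
  obtain as where as: "Gl as" "F = chain (map uminus as)" using assms G_set_iff by blast
  obtain \<psi> g where L: "Gl_lattice as \<psi> g" using Gl_lattice_exists[OF as(1)] by blast
  have "symplectic_embedding F \<psi>"
    using L unfolding symplectic_embedding_iff as(2) nv_chain Gl_lattice_def by (simp add: adj_chain dec_chain)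
  moreover have "minimal F"
    unfolding minimal_def as(2) nv_chain
  proof (intro allI impI)
    fix v assume "v < length (map uminus as)"
    then have "as ! v \<in> set as" "dec (chain (map uminus as)) v = - (as ! v)" by (simp_all add: dec_chain)
    then show "dec (chain (map uminus as)) v \<noteq> -1" using Gl_gmat[OF as(1)] by force
  qed
  ultimately show ?thesis by blast
qed

section \<open>The classification\<close>

lemma minimal_star3: "minimal (star3 c A B C) \<longleftrightarrow> -1 \<notin> set (c # A @ B @ C)"
  unfolding in_set_conv_nth minimal_def star3_def mk_tree_def ptree.simps by blast

lemma WNM_embedding:
  assumes "F \<in> W_set \<union> N_set \<union> M_set" shows "(\<exists>\<phi>. symplectic_embedding F \<phi>) \<and> minimal F"
proof -
  have "minimal F"
    using assms unfolding W_set_def N_set_def M_set_def Gamma_def Delta_def Lambda_def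
    by (auto simp: minimal_star3 split: if_splits)
  moreover have "\<exists>\<phi>. symplectic_embedding F \<phi>" using WNM_config[OF assms] config_embedding by blast
  ultimately show ?thesis by blast
qed

lemma minimal_iso:
  assumes "ptree_iso F T" "minimal F" shows "minimal T"
proof -
  obtain f where f: "nv F = nv T" "bij_betw f {..<nv F} {..<nv T}" "\<And>i. i < nv F \<Longrightarrow> dec T (f i) = dec F i"
    using assms(1) unfolding ptree_iso_def by blast
  have "dec T v \<noteq> -1" if "v < nv T" for v
  proof -
    have "v \<in> f ` {..<nv F}" using that f(2) unfolding bij_betw_def by simp
    then obtain i where "i < nv F" "v = f i" by blast
    then show ?thesis using f(3) assms(2) unfolding minimal_def by simp
  qed
  then show ?thesis by (simp add: minimal_def)
qed

lemma ptree_at_iso: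
  assumes "ptree_at F {..<nv T} (adj T) (dec T)" shows "ptree_iso F T"
proof -
  obtain f where f: "bij_betw f {..<nv F} {..<nv T}" "\<forall>i<nv F. \<forall>j<nv F. adj T (f i) (f j) = adj F i j"
    "\<forall>i<nv F. dec T (f i) = dec F i"
    using assms unfolding ptree_at_def by blast
  have "nv F = nv T" using bij_betw_same_card[OF f(1)] by simp
  then show ?thesis using f unfolding ptree_iso_def by blast
qed

lemma ptree_at_cong:
  assumes "ptree_at F V E d" "\<And>v. v \<in> V \<Longrightarrow> d v = d' v" shows "ptree_at F V E d'"
  using assms unfolding ptree_at_def by (metis bij_betwE lessThan_iff)

text \<open>Reachability from vertex \<open>0\<close> crosses every cut from the side of
  \<open>0\<close>, and symmetry of adjacency gives the other direction. The degree sum counts each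
  edge as an increasing and as a decreasing pair.\<close>

lemma is_tree_tree:
  assumes "is_tree T" shows "tree {..<nv T} (adj T)"
proof -
  let ?n = "nv T"
  let ?R = "{(a, b). adj T a b}"
  have n: "?n \<ge> 1" and rng: "\<And>i j. adj T i j \<Longrightarrow> i < ?n \<and> j < ?n" and sym: "\<And>i j. adj T i j \<longleftrightarrow> adj T j i"
    and irr: "\<And>i. \<not> adj T i i" and con: "\<And>i. i < ?n \<Longrightarrow> (0, i) \<in> ?R\<^sup>*"
    and edges: "card {(i, j). i < j \<and> j < ?n \<and> adj T i j} = ?n - 1"
    using assms unfolding is_tree_def by blast+
  have step: "\<exists>u\<in>S. \<exists>v\<in>{..<?n} - S. adj T u v" if S: "0 \<in> S" "S \<subseteq> {..<?n}" "S \<noteq> {..<?n}" for S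
  proof (rule ccontr)
    assume no: "\<not> ?thesis"
    have "i \<in> S" if "(0, i) \<in> ?R\<^sup>*" for i
      using that
    proof induction
      case (step y z)
      then show ?case using no rng[of y z] by auto
    qed (rule S(1))
    then show False using con S(2,3) by auto
  qed
  have "conn {..<?n} (adj T)"
    unfolding conn_def
  proof (intro allI impI)
    fix S assume S: "S \<subseteq> {..<?n}" "S \<noteq> {}" "S \<noteq> {..<?n}"
    show "\<exists>u\<in>S. \<exists>v\<in>{..<?n} - S. adj T u v"
    proof (cases "0 \<in> S")
      case False
      then have "0 \<in> {..<?n} - S" "{..<?n} - S \<noteq> {..<?n}" using n S by auto
      then obtain u v where "u \<in> {..<?n} - S" "v \<in> {..<?n} - ({..<?n} - S)" "adj T u v" using step[of "{..<?n} - S"] by auto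
      then show ?thesis using sym by blast
    qed (use step S in blast)
  qed
  moreover have "(\<Sum>u<?n. card {v\<in>{..<?n}. adj T u v}) + 2 = 2 * card {..<?n}"
  proof -
    let ?L = "{(i, j). i < j \<and> j < ?n \<and> adj T i j}" and ?G = "{(i, j). j < i \<and> i < ?n \<and> adj T i j}"
    have finL: "finite ?L" by (rule finite_subset[of _ "{..<?n} \<times> {..<?n}"]) (use rng in auto)
    have G: "?G = prod.swap ` ?L" using sym by (auto simp: image_iff)
    have finG: "finite ?G" unfolding G using finL by simp
    have "(\<Sum>u<?n. card {v\<in>{..<?n}. adj T u v}) = card (SIGMA u:{..<?n}. {v\<in>{..<?n}. adj T u v})" by simp
    also have "(SIGMA u:{..<?n}. {v\<in>{..<?n}. adj T u v}) = ?L \<union> ?G"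
    proof (intro equalityI subsetI)
      fix e assume "e \<in> (SIGMA u:{..<?n}. {v\<in>{..<?n}. adj T u v})"
      then obtain u v where "e = (u, v)" "u < ?n" "v < ?n" "adj T u v" by auto
      moreover then have "u \<noteq> v" using irr by auto
      ultimately show "e \<in> ?L \<union> ?G" by auto
    qed (use rng in auto)
    also have "card (?L \<union> ?G) = card ?L + card ?G" using finL finG by (intro card_Un_disjoint) auto
    also have "card ?G = card ?L" unfolding G by (rule card_image) simp
    finally show ?thesis using edges n by simp
  qed
  ultimately show ?thesis using n sym irr unfolding tree_def by (auto simp: lessThan_empty_iff)
qed

context emb
begin

abbreviation "decr v \<equiv> - ip C (\<phi> v) (\<phi> v)"

text \<open>Each column has a row of its own with leading entry \<open>1\<close>. By counting, every
  row is of this kind, and a row has only one leading entry.\<close>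

lemma no_D:
  assumes P: "\<forall>g\<in>C. \<exists>v\<in>V. \<phi> v g = 1" and z: "z \<in> V" "i \<in> C" shows "\<phi> z i \<noteq> -2"
proof
  assume zi: "\<phi> z i = -2"
  obtain f where f: "\<And>g. g \<in> C \<Longrightarrow> f g \<in> V \<and> \<phi> (f g) g = 1" using P by metis
  have "inj_on f C"
  proof (rule inj_onI)
    fix g h assume gh: "g \<in> C" "h \<in> C" "f g = f h"
    show "g = h"
    proof (rule ccontr)
      assume "g \<noteq> h"
      then show False using other_entries[of "f g" g h] f[OF gh(1)] f[OF gh(2)] gh by auto
    qed
  qed
  moreover have "f ` C \<subseteq> V" using f by blast
  ultimately have "f ` C = V" using cardC finV by (metis card_image card_subset_eq)
  then obtain g where g: "g \<in> C" "z = f g" using z(1) by blast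
  then have zg: "\<phi> z g = 1" using f by blast
  then have "i \<noteq> g" using zi by auto
  with zg show False using other_entries[of z g i] zi z g by auto
qed

text \<open>Apart from the one-vertex tree some row is \<open>E_c - E_g\<close>. If all other rows
  vanish in column \<open>g\<close>, products with this row are the entries of column
  \<open>c\<close>, and the row is a hub; otherwise the column sum is \<open>-2\<close> and
  \<open>G_chain\<close> applies.\<close>

lemma classify_Pless:
  assumes g: "g \<in> C" and P: "\<And>v. v \<in> V \<Longrightarrow> \<phi> v g \<noteq> 1"
  shows "(\<exists>F\<in>G_set. ptree_at F V E decr) \<or> (\<exists>F\<in>A_set \<union> B_set \<union> C_set. ptree_at F V E decr)"
proof -
  have le: "\<phi> v g \<le> 0" if "v \<in> V" for v using P[OF that] entries[OF that g] by auto
  have chain: ?thesis if s: "colsum g = -2"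
  proof -
    obtain L where L: "distinct L" "set L = V" "chain_on E L" "Gl (map (\<lambda>v. ip C (\<phi> v) (\<phi> v)) L)"
      using G_chain[OF emb_axioms g P] s unfolding colsum_def by blast
    have "map uminus (map (\<lambda>v. ip C (\<phi> v) (\<phi> v)) L) = map decr L" by simp
    then have "chain (map decr L) \<in> G_set" using L(4) unfolding G_set_iff by metis
    then show ?thesis using chain_on_ptree_at[OF L(1-3), of decr] by blast
  qed
  consider (single) z where "V = {z}" "ip C (\<phi> z) (\<phi> z) = 4"
    | (root) y c where "y \<in> V" "c \<in> C" "c \<noteq> g" "\<phi> y c = 1" "\<phi> y g = -1"
        "\<And>k. k \<in> C \<Longrightarrow> k \<noteq> c \<Longrightarrow> k \<noteq> g \<Longrightarrow> \<phi> y k = 0"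
    by (rule Pless_cases[OF g P]) blast+
  then show ?thesis
  proof cases
    case (single z)
    obtain z' i where zi: "z' \<in> V" "i \<in> C" "\<phi> z' i = -2" using D_exists[OF g P] by metis
    have "card C = 1" using cardC single by simp
    then have "i = g" using zi(2) g by (metis card_1_singletonE singletonD)
    then have "colsum g = -2" using zi single unfolding colsum_def by simp
    then show ?thesis by (rule chain)
  next
    case (root y c)
    have split: "colsum g = -1 + (\<Sum>v\<in>V - {y}. \<phi> v g)" unfolding colsum_def using root finV by (simp add: sum.remove)
    have le': "(\<Sum>v\<in>V - {y}. \<phi> v g) \<le> 0" using le by (intro sum_nonpos) auto
    show ?thesis
    proof (cases "colsum g = -2")
      case False
      then have "(\<Sum>v\<in>V - {y}. \<phi> v g) = 0" using split le' colsum_ge[OF g] by linarith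
      then have "(\<Sum>v\<in>V - {y}. - \<phi> v g) = 0" by (simp add: sum_negf)
      then have zero: "\<forall>v\<in>V - {y}. - \<phi> v g = 0"
        using le finV by (subst (asm) sum_nonneg_eq_0_iff) auto
      have "hub V C E \<phi> y c"
      proof (intro hub.intro hub_axioms.intro)
        show "\<phi> z c = - of_bool (E y z)" if z: "z \<in> V - {y}" for z
        proof -
          have "ip C (\<phi> y) (\<phi> z) = (\<Sum>k\<in>{c}. \<phi> z k)"
            unfolding ip_def by (rule sum.mono_neutral_cong_right[OF finC]) (use root z zero in auto)
          then show ?thesis using pair[of y z] root z by simp
        qed
      qed (use emb_axioms root in auto)
      then show ?thesis using abc_ptree_at[OF hub_abc] by blast
    qed (rule chain)
  qed
qed

lemma classify: "\<exists>F\<in>G_set \<union> W_set \<union> N_set \<union> M_set \<union> A_set \<union> B_set \<union> C_set. ptree_at F V E decr"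
proof (cases "\<exists>g\<in>C. \<forall>v\<in>V. \<phi> v g \<noteq> 1")
  case True
  then show ?thesis using classify_Pless by blast
next
  case False
  then have P: "\<forall>g\<in>C. \<exists>v\<in>V. \<phi> v g = 1" by blast
  obtain N where N: "dfree V E N" "\<forall>v\<in>V. ip V (cc N v) (cc N v) = ip C (\<phi> v) (\<phi> v)"
    using emb_dfree[OF emb_axioms] no_D[OF P] by blast
  interpret d: dfree V E N by fact
  have "\<exists>F\<in>W_set \<union> N_set \<union> M_set \<union> A_set \<union> B_set \<union> C_set. ptree_at F V E (decN V N)"
    using dfree_classify[OF N(1)]
  proof
    assume "\<exists>x. hub_at V E N x"
    then obtain x where "x \<in> V" "N x = {v\<in>V. E x v}" unfolding hub_at_def by blast
    then have "hub V V E (cc N) x x" by (rule d.hub_N)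
    then show ?thesis using abc_ptree_at[OF hub_abc] by blast
  next
    assume "WNM V E N"
    then show ?thesis using WNM_ptree_at[OF d.config] by blast
  qed
  then obtain F where F: "F \<in> W_set \<union> N_set \<union> M_set \<union> A_set \<union> B_set \<union> C_set" "ptree_at F V E (decN V N)" by blast
  have "ptree_at F V E decr" by (rule ptree_at_cong[OF F(2)]) (use N(2) in auto)
  then show ?thesis using F(1) by blast
qed

end

theorem theorem1p5:
  assumes "is_tree T"
  shows "T \<in> S_set \<longleftrightarrow>
    (\<exists>F \<in> G_set \<union> W_set \<union> N_set \<union> M_set \<union> A_set \<union> B_set \<union> C_set. ptree_iso F T)"
proof
  assume "T \<in> S_set"
  then obtain \<phi> where \<phi>: "symplectic_embedding T \<phi>" and min: "minimal T"
    unfolding S_set_def symplectic_tree_def by blast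
  note e = \<phi>[unfolded symplectic_embedding_iff]
  \<comment> \<open>Minimality enters as the exclusion of norm \<open>1\<close>.\<close>
  interpret emb "{..<nv T}" "{..<nv T}" "adj T" \<phi>
    using e min is_tree_tree[OF assms] by unfold_locales (auto simp: minimal_def)
  obtain F where F: "F \<in> G_set \<union> W_set \<union> N_set \<union> M_set \<union> A_set \<union> B_set \<union> C_set" "ptree_at F {..<nv T} (adj T) decr"
    using classify by blast
  have "ptree_at F {..<nv T} (adj T) (dec T)" by (rule ptree_at_cong[OF F(2)]) (use e in auto)
  then show "\<exists>F \<in> G_set \<union> W_set \<union> N_set \<union> M_set \<union> A_set \<union> B_set \<union> C_set. ptree_iso F T"
    using F(1) ptree_at_iso by blast
next
  assume "\<exists>F \<in> G_set \<union> W_set \<union> N_set \<union> M_set \<union> A_set \<union> B_set \<union> C_set. ptree_iso F T"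
  then obtain F where F: "F \<in> G_set \<union> (W_set \<union> N_set \<union> M_set) \<union> (A_set \<union> B_set \<union> C_set)" "ptree_iso F T" by blast
  then have "\<exists>\<phi>. symplectic_embedding F \<phi>" "minimal F" using G_embedding WNM_embedding ABC_embedding by blast+
  then show "T \<in> S_set"
    using symplectic_embedding_iso F(2) minimal_iso assms unfolding S_set_def symplectic_tree_def by blast
qed

end
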